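(* Let $\varphi$ be a compactly supported smooth differential form of bidegree $(n-1,n-1)$ on the unit ball $\mathbb B_n\subset\mathbb C^n$. Let $f_L$ be the hyperbolic Gaussian analytic function of intensity $L$ and $I_L(\varphi)=\int_{Z_{f_L}}\varphi$. Then, as $L\to\infty$, the distributions of the normalised variables \[ \frac{I_L(\varphi)-\mathbb E[I_L(\varphi)]}{\sqrt{\operatorname{Var}(I_L(\varphi))}} \] tend weakly to the standard (real) Gaussian.
   Context: For real $L>0$, the hyperbolic Gaussian analytic function of intensity $L$ is the random holomorphic function \[ f_L(z)=\sum_{\alpha} a_\alpha\left(\frac{\Gamma(L+|\alpha|)}{\alpha!\,\Gamma(L)}\right)^{1/2}z^\alpha,\qquad z\in\mathbb B_n=\{z\in\mathbb C^n:|z|<1\}, \] where $\alpha$ ranges over multi-indices in $\mathbb Z_{\ge0}^n$ and the $a_\alpha$ are i.i.d. complex Gaussians of mean $0$ and variance $1$. Its covariance kernel is $K_L(z,w)=\mathbb E[f_L(z)\overline{f_L(w)}]=(1-z\cdot\bar w)^{-L}$. $Z_{f_L}$ is the zero set of $f_L$, and $[Z_{f_L}]=\frac{i}{2\pi}\partial\bar\partial\log|f_L|^2$ is its integration current. By definition $I_L(\varphi)=\int_{Z_{f_L}}\varphi=\int_{\mathbb B_n}\varphi\wedge[Z_{f_L}]$.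
   Formalization: The form φ is taken to be real and with ∂∂̄φ not identically zero; for φ equal to i times a real form the normalised variable is imaginary, and for ∂∂̄φ = 0 the variance vanishes and the normalised variable is undefined. *)

theory Defs
  imports "HOL-Probability.Probability"
begin

text \<open>
  Complex \<open>n\<close>-space is \<^typ>\<open>complex ^ 'n\<close>, with \<open>n = CARD('n)\<close>. The linear order on the index
  type only serves to order the factors of the monomials \<open>dz\<^sub>J \<and> d\<bar>z\<^sub>K\<close>.
\<close>

section \<open>Smooth functions and Wirtinger derivatives\<close>

fun times_cont_diff ::
  "nat \<Rightarrow> ('a :: real_normed_vector \<Rightarrow> 'b :: real_normed_vector) \<Rightarrow> bool" where
  "times_cont_diff 0 f \<longleftrightarrow> continuous_on UNIV f"
| "times_cont_diff (Suc k) f \<longleftrightarrow>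
     (\<forall>x. f differentiable (at x)) \<and>
     (\<forall>v. times_cont_diff k (\<lambda>x. frechet_derivative f (at x) v))"

definition smooth :: "('a :: real_normed_vector \<Rightarrow> 'b :: real_normed_vector) \<Rightarrow> bool" where
  "smooth f \<longleftrightarrow> (\<forall>k. times_cont_diff k f)"

text \<open>With \<open>z\<^sub>j = x\<^sub>j + \<i> y\<^sub>j\<close>, the real directions \<open>x\<^sub>j\<close> and \<open>y\<^sub>j\<close> are
  \<^term>\<open>axis j 1\<close> and \<^term>\<open>axis j \<i>\<close>.\<close>

definition wirtinger_d ::
  "'n :: finite \<Rightarrow> (complex ^ 'n \<Rightarrow> complex) \<Rightarrow> complex ^ 'n \<Rightarrow> complex" where
  "wirtinger_d j f z =
     (frechet_derivative f (at z) (axis j 1) - \<i> * frechet_derivative f (at z) (axis j \<i>)) / 2"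

definition wirtinger_dbar ::
  "'n :: finite \<Rightarrow> (complex ^ 'n \<Rightarrow> complex) \<Rightarrow> complex ^ 'n \<Rightarrow> complex" where
  "wirtinger_dbar j f z =
     (frechet_derivative f (at z) (axis j 1) + \<i> * frechet_derivative f (at z) (axis j \<i>)) / 2"


section \<open>Differential forms\<close>

text \<open>
  A form \<open>\<phi>\<close> stands for \<open>\<Sum>\<^sub>J\<^sub>,\<^sub>K \<phi> J K dz\<^sub>J \<and> d\<bar>z\<^sub>K\<close>, where
  \<open>dz\<^sub>J = dz\<^bsub>j\<^sub>1\<^esub> \<and> \<dots> \<and> dz\<^bsub>j\<^sub>p\<^esub>\<close> for \<open>J = {j\<^sub>1 < \<dots> < j\<^sub>p}\<close>, and similarly for \<open>d\<bar>z\<^sub>K\<close>.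
\<close>

type_synonym 'n form = "'n set \<Rightarrow> 'n set \<Rightarrow> complex ^ 'n \<Rightarrow> complex"

definition bidegree :: "nat \<Rightarrow> nat \<Rightarrow> 'n form \<Rightarrow> bool" where
  "bidegree p q \<phi> \<longleftrightarrow> (\<forall>J K. \<not> (card J = p \<and> card K = q) \<longrightarrow> \<phi> J K = (\<lambda>_. 0))"

definition smooth_form :: "('n :: finite) form \<Rightarrow> bool" where
  "smooth_form \<phi> \<longleftrightarrow> (\<forall>J K. smooth (\<phi> J K))"

definition form_support :: "('n :: finite) form \<Rightarrow> (complex ^ 'n) set" where
  "form_support \<phi> = closure {z. \<exists>J K. \<phi> J K z \<noteq> 0}"

text \<open>The sign below moves \<open>d\<bar>z\<^sub>J\<close> past \<open>dz\<^sub>K\<close> in the conjugate of a term of \<open>\<phi>\<close>.\<close>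

definition form_cnj :: "'n form \<Rightarrow> 'n form" where
  "form_cnj \<phi> = (\<lambda>K J z. (-1) ^ (card J * card K) * cnj (\<phi> J K z))"

definition real_form :: "'n form \<Rightarrow> bool" where
  "real_form \<phi> \<longleftrightarrow> form_cnj \<phi> = \<phi>"

text \<open>For \<open>j \<in> J\<close>: \<open>dz\<^sub>j \<and> dz\<^bsub>J - {j}\<^esub> = insert_sign j J dz\<^sub>J\<close>.\<close>

definition insert_sign :: "'n :: linorder \<Rightarrow> 'n set \<Rightarrow> complex" where
  "insert_sign j J = (-1) ^ card {i \<in> J. i < j}"

definition form_del :: "('n :: {finite, linorder}) form \<Rightarrow> 'n form" where
  "form_del \<phi> = (\<lambda>J K z. \<Sum>j\<in>J. insert_sign j J * wirtinger_d j (\<phi> (J - {j}) K) z)"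

text \<open>Here \<open>d\<bar>z\<^sub>k\<close> also has to be moved past \<open>dz\<^sub>J\<close>.\<close>

definition form_delbar :: "('n :: {finite, linorder}) form \<Rightarrow> 'n form" where
  "form_delbar \<phi> =
     (\<lambda>J K z. \<Sum>k\<in>K. (-1) ^ card J * insert_sign k K * wirtinger_dbar k (\<phi> J (K - {k})) z)"

text \<open>
  The complex orientation is used, and \<open>dz\<^sub>j \<and> d\<bar>z\<^sub>j = -2\<i> dx\<^sub>j \<and> dy\<^sub>j\<close>. Hence
  \<open>dz\<^sub>1 \<and> \<dots> \<and> dz\<^sub>n \<and> d\<bar>z\<^sub>1 \<and> \<dots> \<and> d\<bar>z\<^sub>n\<close> is \<open>(-1)\<close> to the power \<open>n (n - 1) / 2\<close> times
  \<open>(-2\<i>)\<close> to the power \<open>n\<close> times Lebesgue measure.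
\<close>

definition form_integral :: "(complex ^ 'n) set \<Rightarrow> ('n :: finite) form \<Rightarrow> complex" where
  "form_integral D \<psi> =
     (-1) ^ (CARD('n) * (CARD('n) - 1) div 2) * (-2 * \<i>) ^ CARD('n) *
     (LINT z:D|lborel. \<psi> UNIV UNIV z)"


section \<open>Currents on the unit ball\<close>

type_synonym 'n current = "'n form \<Rightarrow> complex"

definition fun_current :: "(complex ^ 'n \<Rightarrow> complex) \<Rightarrow> ('n :: finite) current" where
  "fun_current u \<psi> = form_integral (ball 0 1) (\<lambda>J K z. u z * \<psi> J K z)"

text \<open>
  The parameter \<open>d\<close> is the degree of the current \<open>T\<close>. The signs are those for which the
  derivatives of a current given by a smooth form agree with the derivatives of that form.
\<close>

definition current_del :: "nat \<Rightarrow> ('n :: {finite, linorder}) current \<Rightarrow> 'n current" where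
  "current_del d T \<psi> = (-1) ^ (d + 1) * T (form_del \<psi>)"

definition current_delbar :: "nat \<Rightarrow> ('n :: {finite, linorder}) current \<Rightarrow> 'n current" where
  "current_delbar d T \<psi> = (-1) ^ (d + 1) * T (form_delbar \<psi>)"

text \<open>\<open>[Z\<^sub>f] = \<i> / (2\<pi>) \<partial>\<partial>\<bar> log |f|\<^sup>2\<close>, in the sense of currents.\<close>

definition zero_current ::
  "((complex, 'n) vec \<Rightarrow> complex) \<Rightarrow> ('n :: {finite, linorder}) current" where
  "zero_current f \<phi> =
     \<i> / (2 * of_real pi) *
     current_del 1 (current_delbar 0 (fun_current (\<lambda>z. of_real (ln ((norm (f z))\<^sup>2))))) \<phi>"


section \<open>The hyperbolic Gaussian analytic function\<close>

definition std_complex_gaussian :: "'w measure \<Rightarrow> ('w \<Rightarrow> complex) \<Rightarrow> bool" where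
  "std_complex_gaussian M X \<longleftrightarrow>
     distributed M lborel X (\<lambda>z. ennreal (exp (- (norm z)\<^sup>2) / pi))"

definition hyp_coeff :: "real \<Rightarrow> ('n :: finite \<Rightarrow> nat) \<Rightarrow> real" where
  "hyp_coeff L \<alpha> =
     sqrt (Gamma (L + real (\<Sum>j\<in>UNIV. \<alpha> j)) / ((\<Prod>j\<in>UNIV. fact (\<alpha> j)) * Gamma L))"

definition hyp_gaf ::
  "(('n :: finite \<Rightarrow> nat) \<Rightarrow> 'w \<Rightarrow> complex) \<Rightarrow> real \<Rightarrow> 'w \<Rightarrow> complex ^ 'n \<Rightarrow> complex" where
  "hyp_gaf a L \<omega> z =
     (\<Sum>\<^sub>\<infinity>\<alpha>. a \<alpha> \<omega> * of_real (hyp_coeff L \<alpha>) * (\<Prod>j\<in>UNIV. (z $ j) ^ \<alpha> j))"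

text \<open>
  For a real form \<open>\<phi>\<close> the integral over the zero set is real, and \<open>Re\<close> is only the
  passage from complex to real numbers.
\<close>

definition zero_integral ::
  "(('n :: {finite, linorder} \<Rightarrow> nat) \<Rightarrow> 'w \<Rightarrow> complex) \<Rightarrow> 'n form \<Rightarrow> real \<Rightarrow> 'w \<Rightarrow> real" where
  "zero_integral a \<phi> L \<omega> = Re (zero_current (hyp_gaf a L \<omega>) \<phi>)"

end

theory Submission
  imports Defs
begin

text \<open>
  The statistic is the integral of \<open>ln |f\<^sub>L|\<^sup>2\<close> against a fixed density \<open>h\<close> with compact support in the ball,
  and \<open>h\<close> is real and not identically zero because \<open>\<partial>\<close> and \<open>\<partial>\<close>-bar anticommute. Up to a constant one may
  replace \<open>f\<^sub>L\<close> by \<open>F(z) = (1 - |z|\<^sup>2)\<close> to the power \<open>L/2\<close> times \<open>f\<^sub>L(z)\<close>, which has variance one and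
  correlations of size at most \<open>exp (- c L |z - w|\<^sup>2)\<close>.

  By Frullani's integral \<open>ln |x|\<^sup>2\<close> is, up to a constant, the integral of
  \<open>(1/(1 + t) - exp (- t |x|\<^sup>2)) dt/t\<close>, and \<open>exp (- t |x|\<^sup>2)\<close> is the mean of \<open>exp (i Re (2 \<surd>t u x))\<close> over a
  complex Gaussian \<open>u\<close>. Truncating in \<open>t\<close> and \<open>u\<close> costs an \<open>L\<^sup>2\<close> error that is small relative to the standard
  deviation, uniformly in \<open>L\<close>, and leaves a mixture \<open>W = \<integral> m(\<tau>) exp (i X\<^sub>\<tau>) d\<tau>\<close> with jointly Gaussian
  \<open>X\<^sub>\<tau>\<close>. Under the weight \<open>exp (i X\<^sub>\<tau>)\<close> the variable \<open>W\<close> has the same moments as \<open>W\<close> plus a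
  perturbation governed by the covariances with \<open>X\<^sub>\<tau>\<close>; hence \<open>\<psi>(s) = E exp (i s W)\<close> satisfies
  \<open>\<psi>' = - s Var(W) \<psi>\<close> up to an error that vanishes as the correlations become local.

  The variances of \<open>W\<close> and of the statistic are at most of order \<open>L\<close> to the power \<open>-n\<close>. For a lower bound of
  the same order, all covariances of \<open>exp (- t |F(z)|\<^sup>2)\<close> and \<open>exp (- s |F(w)|\<^sup>2)\<close> are nonnegative, so the
  statistic has a large covariance with the one obtained from a small ball where \<open>h\<close> has a sign.
\<close>

section \<open>Exponentials of a Gaussian family\<close>

text \<open>The obstacle is that the logarithm is unbounded and not smooth, so that expansions in
  polynomials of the Gaussian variables would have to be controlled to all orders. Exponentials
  \<open>iexp (X t)\<close> are bounded, and the expectation of any product of them is explicit, so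
  tilting is an exact identity. The price is a double truncation: in \<open>t\<close> because
  \<open>dt / t\<close> has infinite mass at both ends, in \<open>u\<close> because the tilting
  error contains the exponential of a bound on the covariances.

  Orders of magnitude decide the result. If kappa bounds the integrated correlation of one point
  with all others, the error in the characteristic function at \<open>s\<close> is of order
  \<open>|s|^3 kappa^2 + s^2 kappa powr (3/2)\<close>, with constants that depend on the truncation.
  Normalisation makes \<open>s\<close> of order \<open>kappa powr (-1/2)\<close>, so the error is of
  order \<open>sqrt kappa\<close>, and kappa is of order \<open>L\<close> to the power
  \<open>-n\<close>. The truncation is therefore fixed first, by its mean-square error relative to a
  variance that lies between two multiples of kappa, and only then does \<open>L\<close> tend to
  infinity.\<close>

lemma norm_exp_minus_one_le: "norm (exp z - 1) \<le> norm z * exp (norm z)" for z :: complex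
proof -
  have "norm (exp z - 1) \<le> exp \<bar>Re z\<bar> * norm z"
    using Taylor_exp[of z 0] by simp
  also have "\<dots> \<le> exp (norm z) * norm z"
    by (intro mult_right_mono) (auto intro: abs_Re_le_cmod)
  finally show ?thesis by (simp add: mult.commute)
qed

lemma norm_exp_minus_linear_le:
  "norm (exp z - 1 - z) \<le> (norm z)\<^sup>2 * exp (norm z)" for z :: complex
proof -
  have "norm (exp z - 1 - z) \<le> exp \<bar>Re z\<bar> * (norm z)\<^sup>2"
    using Taylor_exp[of z 1] by (simp add: power2_eq_square algebra_simps)
  also have "\<dots> \<le> exp (norm z) * (norm z)\<^sup>2"
    by (intro mult_right_mono) (auto intro: abs_Re_le_cmod)
  finally show ?thesis by (simp add: mult.commute)
qed

lemma abs_exp_minus_one_le: "\<bar>exp x - 1\<bar> \<le> \<bar>x\<bar> * exp \<bar>x\<bar>" for x :: real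
proof -
  have "norm (exp (complex_of_real x) - 1) = \<bar>exp x - 1\<bar>"
    by (metis exp_of_real norm_of_real of_real_1 of_real_diff)
  then show ?thesis using norm_exp_minus_one_le[of "of_real x"] by simp
qed

lemma borel_measurable_cnj [measurable]: "cnj \<in> borel_measurable borel"
  by (intro borel_measurable_continuous_onI continuous_intros)

context prob_space
begin

text \<open>Bounded \<open>U\<close> and \<open>V\<close> give a summable majorant, so the
  exponential series may be integrated term by term. This is how the tilting identity passes from
  powers to exponentials.\<close>

lemma expectation_exp_series:
  fixes U V :: "'a \<Rightarrow> complex"
  assumes [measurable]: "U \<in> borel_measurable M" "V \<in> borel_measurable M"
    and U: "\<And>x. norm (U x) \<le> A" and V: "\<And>x. norm (V x) \<le> B"
  shows "expectation (\<lambda>x. V x * exp (U x)) = (\<Sum>p. expectation (\<lambda>x. V x * U x ^ p) / fact p)"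
proof -
  have A: "0 \<le> A" "0 \<le> B" using U V norm_ge_zero order_trans by blast+
  have bd: "norm (V x * U x ^ p / fact p) \<le> B * (A ^ p / fact p)" for x p
  proof -
    have "norm (V x * U x ^ p / fact p) = norm (V x) * (norm (U x) ^ p / fact p)"
      by (simp add: norm_mult norm_divide norm_power)
    also have "\<dots> \<le> B * (A ^ p / fact p)"
      by (intro mult_mono V divide_right_mono power_mono U) (auto simp: A)
    finally show ?thesis .
  qed
  have sA: "summable (\<lambda>p. B * (A ^ p / fact p))"
    using summable_exp_generic[of A] by (intro summable_mult) (simp add: field_simps)
  have int: "integrable M (\<lambda>x. V x * U x ^ p / fact p)" for p
    by (rule integrable_const_bound[where B = "B * (A ^ p / fact p)"]) (use bd in auto)
  have "expectation (\<lambda>x. V x * exp (U x)) = expectation (\<lambda>x. \<Sum>p. V x * U x ^ p / fact p)"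
  proof (intro Bochner_Integration.integral_cong refl)
    fix x
    have "(\<lambda>p. V x * (U x ^ p /\<^sub>R fact p)) sums (V x * exp (U x))"
      by (intro sums_mult exp_converges)
    then show "V x * exp (U x) = (\<Sum>p. V x * U x ^ p / fact p)"
      by (simp add: sums_iff scaleR_conv_of_real divide_inverse mult_ac)
  qed
  also have "\<dots> = (\<Sum>p. expectation (\<lambda>x. V x * U x ^ p / fact p))"
  proof (rule integral_suminf[OF int])
    show "AE x in M. summable (\<lambda>p. norm (V x * U x ^ p / fact p))"
      by (intro AE_I2 summable_comparison_test'[OF sA, of 0]) (use bd in auto)
    show "summable (\<lambda>p. expectation (\<lambda>x. norm (V x * U x ^ p / fact p)))"
    proof (rule summable_comparison_test'[OF sA, of 0])
      fix p
      have "expectation (\<lambda>x. norm (V x * U x ^ p / fact p)) \<le> expectation (\<lambda>x. B * (A ^ p / fact p))"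
        by (intro integral_mono integrable_norm int bd) auto
      then show "norm (expectation (\<lambda>x. norm (V x * U x ^ p / fact p))) \<le> B * (A ^ p / fact p)"
        by (simp add: prob_space)
    qed
  qed
  finally show ?thesis by simp
qed

text \<open>A majorant that depends only on the label is enough, because the second factor is a
  probability space; the label space may have infinite measure.\<close>

lemma fubini_expectation:
  fixes g :: "'x \<times> 'a \<Rightarrow> 'b :: {banach, second_countable_topology}" and b :: "'x \<Rightarrow> real"
  assumes N: "sigma_finite_measure N" and g [measurable]: "g \<in> borel_measurable (N \<Otimes>\<^sub>M M)"
    and b: "integrable N b" and bd: "\<And>t \<omega>. norm (g (t, \<omega>)) \<le> b t"
  shows "integrable (N \<Otimes>\<^sub>M M) g"
    and "(\<integral>\<omega>. (\<integral>t. g (t, \<omega>) \<partial>N) \<partial>M) = (\<integral>t. (\<integral>\<omega>. g (t, \<omega>) \<partial>M) \<partial>N)"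
proof -
  interpret N: sigma_finite_measure N by fact
  interpret NM: pair_sigma_finite N M ..
  show int: "integrable (N \<Otimes>\<^sub>M M) g"
  proof (rule NM.Fubini_integrable)
    show "AE t in N. integrable M (\<lambda>\<omega>. g (t, \<omega>))"
    proof (intro AE_I2)
      fix t assume "t \<in> space N"
      then show "integrable M (\<lambda>\<omega>. g (t, \<omega>))"
        by (intro integrable_const_bound[where B = "b t"]) (use bd in auto)
    qed
    show "integrable N (\<lambda>t. \<integral>\<omega>. norm (g (t, \<omega>)) \<partial>M)"
    proof (rule Bochner_Integration.integrable_bound[OF b])
      have "norm (\<integral>\<omega>. norm (g (t, \<omega>)) \<partial>M) \<le> norm (b t)" for t
      proof -
        have "(\<integral>\<omega>. norm (g (t, \<omega>)) \<partial>M) \<le> (\<integral>\<omega>. b t \<partial>M)"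
          using bd order_trans[OF norm_ge_zero bd]
          by (intro integral_mono') auto
        then show ?thesis by (simp add: prob_space)
      qed
      then show "AE t in N. norm (\<integral>\<omega>. norm (g (t, \<omega>)) \<partial>M) \<le> norm (b t)" by simp
    qed auto
  qed auto
  show "(\<integral>\<omega>. (\<integral>t. g (t, \<omega>) \<partial>N) \<partial>M) = (\<integral>t. (\<integral>\<omega>. g (t, \<omega>) \<partial>M) \<partial>N)"
    using NM.Fubini_integral[of "\<lambda>t \<omega>. g (t, \<omega>)"] int by simp
qed

end

text \<open>
  The labels \<open>t\<close> index centred, jointly Gaussian real variables \<open>X t\<close> with covariance \<open>C\<close>;
  joint Gaussianity enters only through the characteristic function of finite combinations.
\<close>

locale gaussian_family = prob_space M + N: sigma_finite_measure N
  for M :: "'w measure" and N :: "'l measure" +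
  fixes X :: "'l \<Rightarrow> 'w \<Rightarrow> real" and C :: "'l \<Rightarrow> 'l \<Rightarrow> real"
  assumes space_N: "space N = UNIV"
    and X_measurable: "(\<lambda>(t, \<omega>). X t \<omega>) \<in> borel_measurable (N \<Otimes>\<^sub>M M)"
    and C_measurable: "(\<lambda>(s, t). C s t) \<in> borel_measurable (N \<Otimes>\<^sub>M N)"
    and C_sym: "C s t = C t s"
    and char_X: "expectation (\<lambda>\<omega>. iexp (\<Sum>(c, t)\<leftarrow>ts. c * X t \<omega>))
      = of_real (exp (- (\<Sum>(c, t)\<leftarrow>ts. \<Sum>(c', t')\<leftarrow>ts. c * c' * C t t') / 2))"
begin

sublocale NM: pair_sigma_finite N M
  by unfold_locales

sublocale NN: pair_sigma_finite N N
  by unfold_locales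

lemma X_meas [measurable (raw)]:
  assumes "f \<in> measurable K N" "g \<in> measurable K M"
  shows "(\<lambda>x. X (f x) (g x)) \<in> borel_measurable K"
  using measurable_compose[OF measurable_Pair[OF assms] X_measurable] by simp

lemma C_meas [measurable (raw)]:
  assumes "f \<in> measurable K N" "g \<in> measurable K N"
  shows "(\<lambda>x. C (f x) (g x)) \<in> borel_measurable K"
  using measurable_compose[OF measurable_Pair[OF assms] C_measurable] by simp

lemma in_space [simp]: "t \<in> space N"
  by (simp add: space_N)

lemma char_one: "expectation (\<lambda>\<omega>. iexp (X t \<omega>)) = of_real (exp (- C t t / 2))"
  using char_X[of "[(1, t)]"] by simp

lemma char_diff: "expectation (\<lambda>\<omega>. iexp (X s \<omega>) * iexp (- X t \<omega>))
    = of_real (exp (- C s s / 2) * exp (- C t t / 2) * exp (C s t))"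
  using char_X[of "[(1, s), (-1, t)]"] C_sym[of s t]
  by (simp flip: exp_add of_real_minus of_real_add of_real_diff)
     (simp add: exp_add[symmetric] algebra_simps add_divide_distrib diff_divide_distrib)

text \<open>The locale does not postulate positivity of \<open>C\<close>; it is read off from the
  bound 1 on the modulus of a characteristic function.\<close>

lemma C_nonneg: "0 \<le> C t t"
proof -
  have "norm (expectation (\<lambda>\<omega>. iexp (X t \<omega>))) \<le> expectation (\<lambda>\<omega>. norm (iexp (X t \<omega>)))"
    by (rule integral_norm_bound)
  then show ?thesis by (simp add: char_one prob_space)
qed

text \<open>The same bound applied to \<open>X s + X t\<close> and \<open>X s - X t\<close>. The
  arithmetic-mean form is the one that lets \<open>exp \<bar>C s t\<bar>\<close> be absorbed by
  \<open>exp (- C s s / 2) * exp (- C t t / 2)\<close>.\<close>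

lemma C_cauchy_schwarz: "\<bar>C s t\<bar> \<le> (C s s + C t t) / 2"
proof -
  have *: "0 \<le> C s s + 2 * c * C s t + c\<^sup>2 * C t t" for c
  proof -
    have "norm (expectation (\<lambda>\<omega>. iexp (X s \<omega> + c * X t \<omega>)))
        \<le> expectation (\<lambda>\<omega>. norm (iexp (X s \<omega> + c * X t \<omega>)))"
      by (rule integral_norm_bound)
    then show ?thesis
      using char_X[of "[(1, s), (c, t)]"] C_sym[of s t]
      by (simp add: prob_space algebra_simps power2_eq_square)
  qed
  show ?thesis using *[of 1] *[of "-1"] by (simp add: abs_if)
qed

text \<open>A complex mixture of exponentials: unlike the logarithm it is bounded, by the total mass
  of \<open>m\<close>, and its expectations reduce to those of single exponentials.\<close>

definition lin :: "('l \<Rightarrow> complex) \<Rightarrow> 'w \<Rightarrow> complex" where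
  "lin m \<omega> = (\<integral>t. m t * iexp (X t \<omega>) \<partial>N)"

lemma lin_measurable [measurable]:
  assumes [measurable]: "m \<in> borel_measurable N"
  shows "lin m \<in> borel_measurable M"
  unfolding lin_def by measurable

lemma lin_integrand:
  assumes m: "integrable N m" and \<omega>: "\<omega> \<in> space M"
  shows "integrable N (\<lambda>t. m t * iexp (X t \<omega>))"
proof -
  have [measurable]: "m \<in> borel_measurable N" using m by simp
  show ?thesis
    by (rule Bochner_Integration.integrable_bound[OF m]) (use \<omega> in \<open>auto simp: norm_mult\<close>)
qed

lemma norm_lin_le: "integrable N m \<Longrightarrow> norm (lin m \<omega>) \<le> (\<integral>t. norm (m t) \<partial>N)"
  unfolding lin_def by (rule order_trans[OF integral_norm_bound]) (simp add: norm_mult)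

lemma expectation_lin:
  assumes m: "integrable N m" and [measurable]: "V \<in> borel_measurable M"
    and V: "\<And>\<omega>. norm (V \<omega>) \<le> (B :: real)"
  shows "expectation (\<lambda>\<omega>. V \<omega> * lin m \<omega>) = (\<integral>t. m t * expectation (\<lambda>\<omega>. V \<omega> * iexp (X t \<omega>)) \<partial>N)"
proof -
  have [measurable]: "m \<in> borel_measurable N" using m by simp
  have "expectation (\<lambda>\<omega>. V \<omega> * lin m \<omega>) = (\<integral>\<omega>. (\<integral>t. m t * (V \<omega> * iexp (X t \<omega>)) \<partial>N) \<partial>M)"
    unfolding lin_def
    by (subst Bochner_Integration.integral_mult_right_zero[symmetric]) (simp add: mult_ac)
  also have "\<dots> = (\<integral>t. (\<integral>\<omega>. m t * (V \<omega> * iexp (X t \<omega>)) \<partial>M) \<partial>N)"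
    using fubini_expectation(2)[OF N.sigma_finite_measure_axioms, of "\<lambda>(t, \<omega>). m t * (V \<omega> * iexp (X t \<omega>))" "\<lambda>t. norm (m t) * B"] m V
    by (simp add: norm_mult mult_left_mono)
  finally show ?thesis by simp
qed

lemma expectation_lin': "integrable N m \<Longrightarrow>
    expectation (lin m) = (\<integral>t. m t * of_real (exp (- C t t / 2)) \<partial>N)"
  using expectation_lin[of m "\<lambda>_. 1" 1] by (simp add: char_one)

lemma lin_diff:
  assumes "integrable N m" "integrable N m'" "\<omega> \<in> space M"
  shows "lin m \<omega> - lin m' \<omega> = lin (\<lambda>t. m t - m' t) \<omega>"
  unfolding lin_def using lin_integrand assms
  by (subst Bochner_Integration.integral_diff[symmetric]) (auto simp: algebra_simps)

text \<open>The covariance of two exponentials is \<open>g s * g t * (exp (C s t) - 1)\<close> with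
  \<open>g t = exp (- C t t / 2)\<close>. Since \<open>\<bar>exp x - 1\<bar> \<le> \<bar>x\<bar> *
  exp \<bar>x\<bar>\<close> and the factors \<open>g\<close> absorb the exponential, the bound is
  linear in \<open>C\<close> and holds for labels of arbitrarily large variance. This is what makes
  the tail in the Fourier variable tractable.\<close>

lemma lin_variance_le:
  assumes m: "integrable N m"
    and C': "integrable (N \<Otimes>\<^sub>M N) (\<lambda>(s, t). norm (m s) * norm (m t) * \<bar>C s t\<bar>)"
  shows "expectation (\<lambda>\<omega>. (norm (lin m \<omega> - expectation (lin m)))\<^sup>2)
    \<le> (\<integral>s. (\<integral>t. norm (m s) * norm (m t) * \<bar>C s t\<bar> \<partial>N) \<partial>N)"
proof -
  define A where "A = (\<integral>t. norm (m t) \<partial>N)"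
  define \<mu> where "\<mu> = expectation (lin m)"
  define g where "g t = exp (- C t t / 2)" for t
  have [measurable]: "m \<in> borel_measurable N" using m by simp
  have [measurable]: "g \<in> borel_measurable N" unfolding g_def by measurable
  have g01: "0 \<le> g t" "g t \<le> 1" for t using C_nonneg[of t] by (auto simp: g_def)
  have T: "norm (lin m \<omega>) \<le> A" for \<omega> unfolding A_def by (rule norm_lin_le[OF m])
  have intT: "integrable M (lin m)" by (rule integrable_const_bound[where B = A]) (use T in auto)
  have intTT: "integrable M (\<lambda>\<omega>. lin m \<omega> * cnj (lin m \<omega>))"
    by (rule integrable_const_bound[where B = "A * A"])
       (use T in \<open>auto simp: norm_mult intro!: mult_mono order_trans[OF norm_ge_zero]\<close>)
  have mg: "integrable N (\<lambda>t. m t * of_real (g t))"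
    by (rule Bochner_Integration.integrable_bound[OF m])
       (use g01 in \<open>auto simp: norm_mult intro!: mult_left_le\<close>)
  have \<mu>: "\<mu> = (\<integral>t. m t * of_real (g t) \<partial>N)"
    unfolding \<mu>_def g_def by (rule expectation_lin'[OF m])
  have E1: "expectation (\<lambda>\<omega>. lin m \<omega> * cnj (lin m \<omega>))
      = (\<integral>s. m s * (\<integral>t. cnj (m t) * of_real (g s * g t * exp (C s t)) \<partial>N) \<partial>N)"
  proof -
    have inner: "expectation (\<lambda>\<omega>. cnj (lin m \<omega>) * iexp (X s \<omega>))
        = (\<integral>t. cnj (m t) * of_real (g s * g t * exp (C s t)) \<partial>N)" for s
    proof -
      have "expectation (\<lambda>\<omega>. cnj (lin m \<omega>) * iexp (X s \<omega>))
          = cnj (expectation (\<lambda>\<omega>. iexp (- X s \<omega>) * lin m \<omega>))"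
      proof -
        have "cnj (lin m \<omega>) * iexp (X s \<omega>) = cnj (iexp (- X s \<omega>) * lin m \<omega>)" for \<omega>
          by (simp add: exp_cnj)
        then show ?thesis by (simp only: Bochner_Integration.integral_cnj)
      qed
      also have "\<dots> = cnj (\<integral>t. m t * expectation (\<lambda>\<omega>. iexp (- X s \<omega>) * iexp (X t \<omega>)) \<partial>N)"
        by (subst expectation_lin[OF m, where B = 1]) auto
      also have "\<dots> = cnj (\<integral>t. m t * of_real (g s * g t * exp (C s t)) \<partial>N)"
      proof -
        have "expectation (\<lambda>\<omega>. iexp (- X s \<omega>) * iexp (X t \<omega>)) = of_real (g s * g t * exp (C s t))" for t
          using char_diff[of t s] by (simp only: g_def mult_ac C_sym[of t s])
        then show ?thesis by (simp only:)
      qed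
      also have "\<dots> = (\<integral>t. cnj (m t) * of_real (g s * g t * exp (C s t)) \<partial>N)"
        by (subst Bochner_Integration.integral_cnj[symmetric]) simp
      finally show ?thesis .
    qed
    have "expectation (\<lambda>\<omega>. lin m \<omega> * cnj (lin m \<omega>))
      = (\<integral>s. m s * expectation (\<lambda>\<omega>. cnj (lin m \<omega>) * iexp (X s \<omega>)) \<partial>N)"
      by (subst mult.commute, rule expectation_lin[OF m, where B = A]) (use T in auto)
    also have "\<dots> = (\<integral>s. m s * (\<integral>t. cnj (m t) * of_real (g s * g t * exp (C s t)) \<partial>N) \<partial>N)"
      by (simp only: inner)
    finally show ?thesis .
  qed
  have ptw: "norm (m s * (cnj (m t) * of_real (g s * g t * exp (C s t))) - m s * of_real (g s) * cnj (m t * of_real (g t)))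
      \<le> norm (m s) * norm (m t) * \<bar>C s t\<bar>" for s t
  proof -
    have "m s * (cnj (m t) * of_real (g s * g t * exp (C s t))) - m s * of_real (g s) * cnj (m t * of_real (g t))
      = m s * cnj (m t) * of_real (g s * g t * (exp (C s t) - 1))"
      by (simp add: algebra_simps)
    moreover have "\<bar>g s * g t * (exp (C s t) - 1)\<bar> \<le> \<bar>C s t\<bar>"
    proof -
      have "\<bar>g s * g t * (exp (C s t) - 1)\<bar> \<le> g s * g t * (\<bar>C s t\<bar> * exp \<bar>C s t\<bar>)"
        using g01 by (auto simp: abs_mult intro!: mult_left_mono abs_exp_minus_one_le)
      also have "\<dots> = \<bar>C s t\<bar> * exp (\<bar>C s t\<bar> - (C s s + C t t) / 2)"
      proof -
        have "g s * g t * exp \<bar>C s t\<bar> = exp (\<bar>C s t\<bar> - (C s s + C t t) / 2)"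
          unfolding g_def exp_add[symmetric] by (simp add: field_simps)
        then show ?thesis by (simp add: mult_ac)
      qed
      also have "\<dots> \<le> \<bar>C s t\<bar> * 1"
        using C_cauchy_schwarz[of s t] by (intro mult_left_mono) auto
      finally show ?thesis by simp
    qed
    ultimately show ?thesis by (simp add: norm_mult mult_left_mono del: of_real_mult)
  qed
  \<comment> \<open>\<open>k\<close> and \<open>l\<close> are the kernels of the second moment and
    of the squared modulus of the mean. The hypothesis dominates only their difference;
    \<open>l\<close> is a product, so integrability of \<open>k\<close> follows by addition.\<close>
  define k where "k s t = m s * (cnj (m t) * of_real (g s * g t * exp (C s t)))" for s t
  define l where "l s t = m s * of_real (g s) * cnj (m t * of_real (g t))" for s t
  have [measurable]: "(\<lambda>(s, t). k s t) \<in> borel_measurable (N \<Otimes>\<^sub>M N)"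
    "(\<lambda>(s, t). l s t) \<in> borel_measurable (N \<Otimes>\<^sub>M N)"
    unfolding k_def l_def by measurable
  have intkl: "integrable (N \<Otimes>\<^sub>M N) (\<lambda>(s, t). k s t - l s t)"
    by (rule Bochner_Integration.integrable_bound[OF C'])
       (use ptw in \<open>auto simp: k_def l_def case_prod_beta\<close>)
  have intl: "integrable (N \<Otimes>\<^sub>M N) (\<lambda>(s, t). l s t)"
  proof (rule NN.Fubini_integrable)
    show "integrable N (\<lambda>s. \<integral>t. norm (case (s, t) of (s, t) \<Rightarrow> l s t) \<partial>N)"
      using integrable_mult_left[OF integrable_norm[OF mg]] by (simp add: l_def norm_mult)
    show "AE s in N. integrable N (\<lambda>t. case (s, t) of (s, t) \<Rightarrow> l s t)"
      using integrable_mult_right[OF integrable_cnj[OF mg]] by (simp add: l_def)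
  qed measurable
  have intk: "integrable (N \<Otimes>\<^sub>M N) (\<lambda>(s, t). k s t)"
    using Bochner_Integration.integrable_add[OF intkl intl] by (simp add: split_beta')
  have "of_real (expectation (\<lambda>\<omega>. (norm (lin m \<omega> - \<mu>))\<^sup>2))
      = expectation (\<lambda>\<omega>. (lin m \<omega> - \<mu>) * cnj (lin m \<omega> - \<mu>))"
    by (subst integral_complex_of_real[symmetric]) (simp only: complex_norm_square)
  also have "\<dots> = expectation (\<lambda>\<omega>. lin m \<omega> * cnj (lin m \<omega>) - lin m \<omega> * cnj \<mu> - \<mu> * cnj (lin m \<omega>) + \<mu> * cnj \<mu>)"
    by (simp add: algebra_simps)
  also have "\<dots> = expectation (\<lambda>\<omega>. lin m \<omega> * cnj (lin m \<omega>)) - \<mu> * cnj \<mu>"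
    using intT intTT by (simp add: prob_space flip: \<mu>_def)
  also have "\<dots> = (\<integral>s. (\<integral>t. k s t \<partial>N) \<partial>N) - (\<integral>s. (\<integral>t. l s t \<partial>N) \<partial>N)"
  proof -
    have "\<mu> * cnj \<mu> = (\<integral>s. (\<integral>t. l s t \<partial>N) \<partial>N)"
      unfolding l_def \<mu> by (simp flip: Bochner_Integration.integral_cnj)
    moreover have "expectation (\<lambda>\<omega>. lin m \<omega> * cnj (lin m \<omega>)) = (\<integral>s. (\<integral>t. k s t \<partial>N) \<partial>N)"
      unfolding E1 k_def by simp
    ultimately show ?thesis by simp
  qed
  also have "\<dots> = (\<integral>(s, t). k s t - l s t \<partial>(N \<Otimes>\<^sub>M N))"
    using NN.integral_fst'[OF intk] NN.integral_fst'[OF intl] Bochner_Integration.integral_diff[OF intk intl]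
    by (simp add: split_beta')
  finally have *: "complex_of_real (expectation (\<lambda>\<omega>. (norm (lin m \<omega> - \<mu>))\<^sup>2)) = (\<integral>(s, t). k s t - l s t \<partial>(N \<Otimes>\<^sub>M N))" .
  have "expectation (\<lambda>\<omega>. (norm (lin m \<omega> - \<mu>))\<^sup>2) \<le> norm (complex_of_real (expectation (\<lambda>\<omega>. (norm (lin m \<omega> - \<mu>))\<^sup>2)))"
    by simp
  also have "\<dots> \<le> (\<integral>(s, t). norm (k s t - l s t) \<partial>(N \<Otimes>\<^sub>M N))"
    unfolding * by (rule order_trans[OF integral_norm_bound]) (simp add: split_beta')
  also have "\<dots> \<le> (\<integral>(s, t). norm (m s) * norm (m t) * \<bar>C s t\<bar> \<partial>(N \<Otimes>\<^sub>M N))"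
  proof (intro integral_mono C')
    show "integrable (N \<Otimes>\<^sub>M N) (\<lambda>(s, t). norm (k s t - l s t))"
      using integrable_norm[OF intkl] by (simp add: split_beta')
    show "(case p of (s, t) \<Rightarrow> norm (k s t - l s t)) \<le> (case p of (s, t) \<Rightarrow> norm (m s) * norm (m t) * \<bar>C s t\<bar>)" for p
      using ptw by (cases p) (simp only: k_def l_def prod.case)
  qed
  also have "\<dots> = (\<integral>s. (\<integral>t. norm (m s) * norm (m t) * \<bar>C s t\<bar> \<partial>N) \<partial>N)"
    using NN.integral_fst'[OF C'] by simp
  finally show ?thesis by (simp add: \<mu>_def)
qed

end

text \<open>For bounded \<open>u\<close> the Taylor remainder of the integrand is quadratic in
  \<open>y - r\<close>, uniformly on the space, so the derivative may be taken inside the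
  expectation by a direct estimate.\<close>

lemma (in prob_space) expectation_iexp_has_vector_derivative:
  fixes u :: "'a \<Rightarrow> real"
  assumes [measurable]: "u \<in> borel_measurable M" and u: "\<And>x. \<bar>u x\<bar> \<le> A"
  shows "((\<lambda>r. expectation (\<lambda>x. iexp (r * u x))) has_vector_derivative
    expectation (\<lambda>x. \<i> * u x * iexp (r * u x))) (at r)"
  unfolding has_vector_derivative_def
proof (rule has_derivativeI_sandwich[where e = 1 and H = "\<lambda>y. A\<^sup>2 * \<bar>y - r\<bar> * exp (\<bar>y - r\<bar> * A)"])
  show "((\<lambda>y. A\<^sup>2 * \<bar>y - r\<bar> * exp (\<bar>y - r\<bar> * A)) \<longlongrightarrow> 0) (at r)"
    by (auto intro!: tendsto_eq_intros)
  fix y assume "y \<noteq> r"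
  have A: "0 \<le> A" using u abs_ge_zero order_trans by blast
  have i1: "integrable M (\<lambda>x. iexp (z * u x))" for z
    by (rule integrable_const_bound[where B = 1]) auto
  have i2: "integrable M (\<lambda>x. \<i> * u x * iexp (r * u x))"
    by (rule integrable_const_bound[where B = A]) (use u in \<open>auto simp: norm_mult\<close>)
  have ptw: "norm (iexp (y * u x) - iexp (r * u x) - (y - r) * (\<i> * u x * iexp (r * u x)))
      \<le> A\<^sup>2 * \<bar>y - r\<bar> * exp (\<bar>y - r\<bar> * A) * \<bar>y - r\<bar>" for x
  proof -
    define z where "z = \<i> * of_real ((y - r) * u x)"
    have nz: "norm z \<le> \<bar>y - r\<bar> * A" using u[of x]
      by (simp only: z_def norm_mult norm_of_real norm_ii abs_mult mult_1 mult_left_mono abs_ge_zero)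
    have "iexp (y * u x) = iexp (r * u x) * exp z"
      unfolding z_def exp_add[symmetric] by (simp add: algebra_simps)
    then have "iexp (y * u x) - iexp (r * u x) - (y - r) * (\<i> * u x * iexp (r * u x))
        = iexp (r * u x) * (exp z - 1 - z)"
      by (simp add: z_def algebra_simps)
    then have "norm (iexp (y * u x) - iexp (r * u x) - (y - r) * (\<i> * u x * iexp (r * u x))) = norm (exp z - 1 - z)"
      by (simp add: norm_mult)
    also have "\<dots> \<le> (norm z)\<^sup>2 * exp (norm z)" by (rule norm_exp_minus_linear_le)
    also have "\<dots> \<le> (\<bar>y - r\<bar> * A)\<^sup>2 * exp (\<bar>y - r\<bar> * A)"
      using nz by (intro mult_mono power_mono) auto
    also have "\<dots> = A\<^sup>2 * \<bar>y - r\<bar> * exp (\<bar>y - r\<bar> * A) * \<bar>y - r\<bar>"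
      by (simp only: power2_eq_square mult_ac)
    finally show ?thesis .
  qed
  have const: "expectation (\<lambda>x. c) = c" for c :: real by (simp add: prob_space)
  have "expectation (\<lambda>x. iexp (y * u x)) - expectation (\<lambda>x. iexp (r * u x)) -
      (y - r) *\<^sub>R expectation (\<lambda>x. \<i> * u x * iexp (r * u x))
    = expectation (\<lambda>x. iexp (y * u x) - iexp (r * u x) - (y - r) * (\<i> * u x * iexp (r * u x)))"
    using i1[of y] i1[of r] i2 by (simp add: scaleR_conv_of_real)
  also have "norm \<dots> \<le> expectation (\<lambda>x. A\<^sup>2 * \<bar>y - r\<bar> * exp (\<bar>y - r\<bar> * A) * \<bar>y - r\<bar>)"
    by (rule order_trans[OF integral_norm_bound], rule integral_mono') (use ptw in auto)
  finally have "norm (expectation (\<lambda>x. iexp (y * u x)) - expectation (\<lambda>x. iexp (r * u x)) -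
      (y - r) *\<^sub>R expectation (\<lambda>x. \<i> * u x * iexp (r * u x)))
     \<le> A\<^sup>2 * \<bar>y - r\<bar> * exp (\<bar>y - r\<bar> * A) * \<bar>y - r\<bar>"
    unfolding const .
  then show "norm (expectation (\<lambda>x. iexp (y * u x)) - expectation (\<lambda>x. iexp (r * u x)) -
      (y - r) *\<^sub>R expectation (\<lambda>x. \<i> * u x * iexp (r * u x))) / norm (y - r)
     \<le> A\<^sup>2 * \<bar>y - r\<bar> * exp (\<bar>y - r\<bar> * A)"
    unfolding real_norm_def by (subst pos_divide_le_eq) (use \<open>y \<noteq> r\<close> in auto)
qed (auto intro: bounded_linear_scaleR_left)

text \<open>Nonnegativity of the variance of the norm is the whole argument.\<close>

lemma (in prob_space) expectation_norm_le_sqrt: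
  fixes Y :: "'a \<Rightarrow> 'b :: {banach, second_countable_topology}"
  assumes [measurable]: "Y \<in> borel_measurable M" and 2: "integrable M (\<lambda>x. (norm (Y x))\<^sup>2)"
  shows "expectation (\<lambda>x. norm (Y x)) \<le> sqrt (expectation (\<lambda>x. (norm (Y x))\<^sup>2))"
proof -
  have 1: "integrable M (\<lambda>x. norm (Y x))"
    by (rule square_integrable_imp_integrable) (use 2 in auto)
  have "0 \<le> variance (\<lambda>x. norm (Y x))" by (rule variance_positive)
  then have "(expectation (\<lambda>x. norm (Y x)))\<^sup>2 \<le> expectation (\<lambda>x. (norm (Y x))\<^sup>2)"
    using variance_eq[OF 1 2] by simp
  then show ?thesis by (rule real_le_rsqrt)
qed

context gaussian_family
begin

text \<open>
  Tilting by \<open>iexp (X \<tau>)\<close> amounts to the imaginary shift of \<open>X t\<close> by the covariance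
  \<open>C \<tau> t\<close>, which multiplies the integrand of \<^term>\<open>lin\<close> by \<open>exp (- C \<tau> t)\<close>.
\<close>

definition shifted :: "('l \<Rightarrow> complex) \<Rightarrow> 'l \<Rightarrow> 'l \<Rightarrow> complex" where
  "shifted m \<tau> t = m t * of_real (exp (- C \<tau> t))"

lemma shifted_measurable [measurable]:
  assumes [measurable]: "m \<in> borel_measurable N"
  shows "shifted m \<tau> \<in> borel_measurable N"
  unfolding shifted_def by measurable

text \<open>Induction on \<open>p\<close> with an arbitrary list of labels: each factor
  \<open>lin m\<close> is opened up as a mixture, and its label joins the list. Tilting that label
  contributes \<open>exp (- C \<tau> t)\<close>, which is exactly the factor that turns
  \<open>m\<close> into \<open>shifted m \<tau>\<close>. For \<open>p = 0\<close> the claim is a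
  computation with the quadratic form.\<close>

lemma expectation_tilted_power:
  assumes m: "integrable N m" and m\<tau>: "integrable N (shifted m \<tau>)"
  shows "expectation (\<lambda>\<omega>. iexp (X \<tau> \<omega>) * iexp (\<Sum>(c, t)\<leftarrow>ts. c * X t \<omega>) * lin m \<omega> ^ p)
    = of_real (exp (- C \<tau> \<tau> / 2 - (\<Sum>(c, t)\<leftarrow>ts. c * C \<tau> t)))
      * expectation (\<lambda>\<omega>. iexp (\<Sum>(c, t)\<leftarrow>ts. c * X t \<omega>) * lin (shifted m \<tau>) \<omega> ^ p)"
proof (induction p arbitrary: ts)
  case 0
  define S where "S = (\<Sum>(c, t)\<leftarrow>ts. \<Sum>(c', t')\<leftarrow>ts. c * c' * C t t')"
  define R where "R = (\<Sum>(c, t)\<leftarrow>ts. c * C \<tau> t)"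
  \<comment> \<open>By symmetry of \<open>C\<close> the cross terms with \<tau> occur twice; after
    halving they leave the factor \<open>exp (- R)\<close>.\<close>
  have 1: "(\<Sum>(c, t)\<leftarrow>(1, \<tau>) # ts. \<Sum>(c', t')\<leftarrow>(1, \<tau>) # ts. c * c' * C t t') = C \<tau> \<tau> + 2 * R + S"
    by (simp add: S_def R_def sum_list_addf split_beta' C_sym)
  have "expectation (\<lambda>\<omega>. iexp (X \<tau> \<omega>) * iexp (\<Sum>(c, t)\<leftarrow>ts. c * X t \<omega>))
      = expectation (\<lambda>\<omega>. iexp (\<Sum>(c, t)\<leftarrow>(1, \<tau>) # ts. c * X t \<omega>))"
    by (simp add: exp_add distrib_left)
  also have "\<dots> = of_real (exp (- (C \<tau> \<tau> + 2 * R + S) / 2))"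
    by (subst char_X) (simp only: 1)
  also have "\<dots> = of_real (exp (- C \<tau> \<tau> / 2 - R)) * of_real (exp (- S / 2))"
    unfolding of_real_mult[symmetric] exp_add[symmetric] by (simp add: field_simps)
  also have "of_real (exp (- S / 2)) = expectation (\<lambda>\<omega>. iexp (\<Sum>(c, t)\<leftarrow>ts. c * X t \<omega>))"
    by (simp only: char_X S_def)
  finally show ?case by (simp add: R_def)
next
  case (Suc p)
  define V where "V \<omega> = iexp (\<Sum>(c, t)\<leftarrow>ts. c * X t \<omega>)" for \<omega>
  define A where "A = (\<integral>t. norm (m t) \<partial>N)"
  define B where "B = (\<integral>t. norm (shifted m \<tau> t) \<partial>N)"
  have [measurable]: "m \<in> borel_measurable N" using m by simp
  have [measurable]: "(\<lambda>\<omega>. \<Sum>(c, t)\<leftarrow>ts. c * X t \<omega>) \<in> borel_measurable M"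
    by (induction ts) (auto simp: split_beta')
  have [measurable]: "V \<in> borel_measurable M" unfolding V_def by measurable
  have V: "norm (V \<omega>) = 1" for \<omega> by (simp add: V_def)
  have A: "norm (lin m \<omega>) \<le> A" for \<omega> unfolding A_def by (rule norm_lin_le[OF m])
  have B: "norm (lin (shifted m \<tau>) \<omega>) \<le> B" for \<omega> unfolding B_def by (rule norm_lin_le[OF m\<tau>])
  define R where "R = - C \<tau> \<tau> / 2 - (\<Sum>(c, t)\<leftarrow>ts. c * C \<tau> t)"
  have "expectation (\<lambda>\<omega>. iexp (X \<tau> \<omega>) * V \<omega> * lin m \<omega> ^ Suc p)
      = expectation (\<lambda>\<omega>. (iexp (X \<tau> \<omega>) * V \<omega> * lin m \<omega> ^ p) * lin m \<omega>)"
    by (simp add: mult_ac)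
  also have "\<dots> = (\<integral>t. m t * expectation (\<lambda>\<omega>. (iexp (X \<tau> \<omega>) * V \<omega> * lin m \<omega> ^ p) * iexp (X t \<omega>)) \<partial>N)"
    by (rule expectation_lin[OF m, where B = "A ^ p"])
       (use A V in \<open>auto simp: norm_mult norm_power intro!: power_mono\<close>)
  also have "\<dots> = (\<integral>t. of_real (exp R) * (shifted m \<tau> t *
      expectation (\<lambda>\<omega>. (V \<omega> * lin (shifted m \<tau>) \<omega> ^ p) * iexp (X t \<omega>))) \<partial>N)"
  proof (intro Bochner_Integration.integral_cong refl)
    fix t
    have VX: "iexp (\<Sum>(c, t)\<leftarrow>(1, t) # ts. c * X t \<omega>) = V \<omega> * iexp (X t \<omega>)" for \<omega>
      by (simp add: V_def exp_add distrib_left mult_ac)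
    have "expectation (\<lambda>\<omega>. (iexp (X \<tau> \<omega>) * V \<omega> * lin m \<omega> ^ p) * iexp (X t \<omega>))
        = expectation (\<lambda>\<omega>. iexp (X \<tau> \<omega>) * (V \<omega> * iexp (X t \<omega>)) * lin m \<omega> ^ p)"
      by (simp add: mult_ac)
    also have "\<dots> = of_real (exp (R - C \<tau> t)) *
        expectation (\<lambda>\<omega>. (V \<omega> * iexp (X t \<omega>)) * lin (shifted m \<tau>) \<omega> ^ p)"
      using Suc.IH[of "(1, t) # ts"] unfolding VX by (simp add: R_def algebra_simps)
    finally show "m t * expectation (\<lambda>\<omega>. (iexp (X \<tau> \<omega>) * V \<omega> * lin m \<omega> ^ p) * iexp (X t \<omega>))
        = of_real (exp R) * (shifted m \<tau> t *
      expectation (\<lambda>\<omega>. (V \<omega> * lin (shifted m \<tau>) \<omega> ^ p) * iexp (X t \<omega>)))"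
      by (simp add: shifted_def exp_diff exp_minus divide_inverse mult_ac)
  qed
  also have "\<dots> = of_real (exp R) * expectation (\<lambda>\<omega>. (V \<omega> * lin (shifted m \<tau>) \<omega> ^ p) * lin (shifted m \<tau>) \<omega>)"
    unfolding Bochner_Integration.integral_mult_right_zero
    by (subst expectation_lin[OF m\<tau>, where B = "B ^ p"])
       (use B V in \<open>auto simp: norm_mult norm_power intro!: power_mono\<close>)
  finally show ?case by (simp add: V_def R_def mult_ac)
qed

text \<open>The identity for powers is summed over the exponential series; \<open>lin m\<close> and
  \<open>lin (shifted m \<tau>)\<close> are bounded by the masses of their weights, so both series
  converge.\<close>

lemma expectation_tilted_exp:
  assumes m: "integrable N m" and m\<tau>: "integrable N (shifted m \<tau>)"
  shows "expectation (\<lambda>\<omega>. iexp (X \<tau> \<omega>) * exp (z * lin m \<omega>))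
    = of_real (exp (- C \<tau> \<tau> / 2)) * expectation (\<lambda>\<omega>. exp (z * lin (shifted m \<tau>) \<omega>))"
proof -
  have [measurable]: "m \<in> borel_measurable N" using m by simp
  define A where "A = (\<integral>t. norm (m t) \<partial>N)"
  define B where "B = (\<integral>t. norm (shifted m \<tau> t) \<partial>N)"
  have A: "norm (z * lin m \<omega>) \<le> norm z * A" for \<omega>
    unfolding A_def norm_mult by (intro mult_left_mono norm_lin_le[OF m]) auto
  have B: "norm (z * lin (shifted m \<tau>) \<omega>) \<le> norm z * B" for \<omega>
    unfolding B_def norm_mult by (intro mult_left_mono norm_lin_le[OF m\<tau>]) auto
  have "expectation (\<lambda>\<omega>. iexp (X \<tau> \<omega>) * exp (z * lin m \<omega>))
      = (\<Sum>p. expectation (\<lambda>\<omega>. iexp (X \<tau> \<omega>) * (z * lin m \<omega>) ^ p) / fact p)"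
    by (rule expectation_exp_series[OF _ _ A, where B = 1]) auto
  also have "\<dots> = (\<Sum>p. of_real (exp (- C \<tau> \<tau> / 2)) * (expectation (\<lambda>\<omega>. 1 * (z * lin (shifted m \<tau>) \<omega>) ^ p) / fact p))"
  proof (intro suminf_cong)
    fix p
    have "expectation (\<lambda>\<omega>. iexp (X \<tau> \<omega>) * (z * lin m \<omega>) ^ p)
        = z ^ p * expectation (\<lambda>\<omega>. iexp (X \<tau> \<omega>) * lin m \<omega> ^ p)"
      by (subst Bochner_Integration.integral_mult_right_zero[symmetric]) (simp add: power_mult_distrib mult_ac)
    also have "\<dots> = z ^ p * (of_real (exp (- C \<tau> \<tau> / 2)) * expectation (\<lambda>\<omega>. lin (shifted m \<tau>) \<omega> ^ p))"
      using expectation_tilted_power[OF m m\<tau>, of "[]" p] by simp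
    also have "\<dots> = of_real (exp (- C \<tau> \<tau> / 2)) * expectation (\<lambda>\<omega>. (z * lin (shifted m \<tau>) \<omega>) ^ p)"
      by (simp add: power_mult_distrib)
    finally show "expectation (\<lambda>\<omega>. iexp (X \<tau> \<omega>) * (z * lin m \<omega>) ^ p) / fact p
      = of_real (exp (- C \<tau> \<tau> / 2)) * (expectation (\<lambda>\<omega>. 1 * (z * lin (shifted m \<tau>) \<omega>) ^ p) / fact p)"
      by simp
  qed
  also have "\<dots> = of_real (exp (- C \<tau> \<tau> / 2)) * (\<Sum>p. expectation (\<lambda>\<omega>. 1 * (z * lin (shifted m \<tau>) \<omega>) ^ p) / fact p)"
  proof (rule suminf_mult)
    have B0: "0 \<le> norm z * B" using B norm_ge_zero order_trans by blast
    show "summable (\<lambda>p. expectation (\<lambda>\<omega>. 1 * (z * lin (shifted m \<tau>) \<omega>) ^ p) / fact p)"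
    proof (rule summable_comparison_test'[where N = 0])
      show "summable (\<lambda>p. (norm z * B) ^ p / fact p)"
        using summable_exp_generic[of "norm z * B"] by (simp add: field_simps)
      fix p
      have "norm (expectation (\<lambda>\<omega>. 1 * (z * lin (shifted m \<tau>) \<omega>) ^ p)) \<le> (\<integral>\<omega>. (norm z * B) ^ p \<partial>M)"
        by (rule order_trans[OF integral_norm_bound], rule integral_mono')
           (use B B0 in \<open>auto simp: norm_power intro!: power_mono\<close>)
      then show "norm (expectation (\<lambda>\<omega>. 1 * (z * lin (shifted m \<tau>) \<omega>) ^ p) / fact p) \<le> (norm z * B) ^ p / fact p"
        by (simp add: prob_space norm_divide divide_right_mono)
    qed
  qed
  also have "(\<Sum>p. expectation (\<lambda>\<omega>. 1 * (z * lin (shifted m \<tau>) \<omega>) ^ p) / fact p)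
      = expectation (\<lambda>\<omega>. 1 * exp (z * lin (shifted m \<tau>) \<omega>))"
    by (rule expectation_exp_series[OF _ _ B, where B = 1, symmetric]) auto
  finally show ?thesis by simp
qed

text \<open>A Stein-type argument through a differential equation. Differentiating the
  characteristic function gives the expectation of \<open>w\<close> times an exponential of
  \<open>w\<close>; writing the first factor as a mixture and tilting by each
  \<open>X \<tau>\<close> perturbs the weight \<open>m\<close> in the exponent by
  \<open>d \<tau>\<close>, of mass at most \<open>K\<close>. The linear terms of this perturbation
  add up to one variable \<open>T\<close>, whose mean is the variance of \<open>w\<close> and which
  hardly fluctuates. The first error term is the quadratic Taylor remainder, the second comes from
  the standard deviation of \<open>T\<close>.\<close>

theorem char_lin_approx:
  fixes w :: "'w \<Rightarrow> real"
  assumes m: "integrable N m"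
    and w: "\<And>\<omega>. lin m \<omega> = of_real (w \<omega>)"
    and C_le: "\<And>\<tau> t. m \<tau> \<noteq> 0 \<Longrightarrow> m t \<noteq> 0 \<Longrightarrow> \<bar>C \<tau> t\<bar> \<le> B"
    and \<kappa>: "\<And>\<tau>. m \<tau> \<noteq> 0 \<Longrightarrow> (\<integral>t. norm (m t) * \<bar>C \<tau> t\<bar> \<partial>N) \<le> \<kappa>" "0 \<le> \<kappa>"
  defines "A \<equiv> (\<integral>t. norm (m t) \<partial>N)" and "K \<equiv> exp B * \<kappa>"
  shows "norm (expectation (\<lambda>\<omega>. iexp (s * (w \<omega> - expectation w))) - of_real (exp (- s\<^sup>2 * variance w / 2)))
    \<le> \<bar>s\<bar> * (A * s\<^sup>2 * K\<^sup>2 * exp (\<bar>s\<bar> * K) + \<bar>s\<bar> * (K * sqrt (A * \<kappa>)))"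
proof -
  have [measurable]: "m \<in> borel_measurable N" using m by simp
  have A0: "0 \<le> A" unfolding A_def by simp
  have K0: "0 \<le> K" unfolding K_def using \<kappa> by simp
  define \<mu> where "\<mu> = expectation w"
  define g where "g t = exp (- C t t / 2)" for t
  have [measurable]: "g \<in> borel_measurable N" unfolding g_def by measurable
  have g01: "0 \<le> g t" "g t \<le> 1" for t using C_nonneg[of t] by (auto simp: g_def)
  have wA: "\<bar>w \<omega>\<bar> \<le> A" for \<omega>
    using norm_lin_le[OF m, of \<omega>] by (simp add: w A_def)
  have "(\<lambda>\<omega>. Re (lin m \<omega>)) \<in> borel_measurable M" by measurable
  then have [measurable]: "w \<in> borel_measurable M" by (simp add: w)
  have intw: "integrable M w" by (rule integrable_const_bound[where B = A]) (use wA in auto)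
  have lin_w: "lin m = (\<lambda>\<omega>. of_real (w \<omega>))" using w by auto
  have \<mu>_lin: "of_real \<mu> = expectation (lin m)"
    by (simp add: \<mu>_def lin_w)

  \<comment> \<open>\<open>d \<tau>\<close> is the change of the weight under tilting. Bounded
    covariances give \<open>\<bar>exp (- C \<tau> t) - 1\<bar> \<le> exp B * \<bar>C \<tau>
    t\<bar>\<close> on the support of the weight, hence the mass bound \<open>K\<close>.\<close>
  define d where "d \<tau> t = m t * of_real (exp (- C \<tau> t) - 1)" for \<tau> t
  have [measurable]: "(\<lambda>(\<tau>, t). d \<tau> t) \<in> borel_measurable (N \<Otimes>\<^sub>M N)" unfolding d_def by measurable
  have [measurable]: "d \<tau> \<in> borel_measurable N" for \<tau> unfolding d_def by measurable
  have d_le: "norm (d \<tau> t) \<le> exp B * (norm (m t) * \<bar>C \<tau> t\<bar>)" if "m \<tau> \<noteq> 0" for \<tau> t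
  proof (cases "m t = 0")
    case False
    have "\<bar>exp (- C \<tau> t) - 1\<bar> \<le> \<bar>C \<tau> t\<bar> * exp \<bar>C \<tau> t\<bar>" using abs_exp_minus_one_le[of "- C \<tau> t"] by simp
    also have "\<dots> \<le> \<bar>C \<tau> t\<bar> * exp B" using C_le[OF that False] by (intro mult_left_mono) auto
    finally have "norm (m t) * \<bar>exp (- C \<tau> t) - 1\<bar> \<le> norm (m t) * (\<bar>C \<tau> t\<bar> * exp B)"
      by (intro mult_left_mono) auto
    then show ?thesis by (simp only: d_def norm_mult norm_of_real mult_ac)
  qed (simp add: d_def)
  have d_le': "norm (d \<tau> t) \<le> exp B * B * norm (m t)" if "m \<tau> \<noteq> 0" for \<tau> t
  proof (cases "m t = 0")
    case False
    have "norm (d \<tau> t) \<le> exp B * (norm (m t) * \<bar>C \<tau> t\<bar>)" by (rule d_le[OF that])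
    also have "\<dots> \<le> exp B * (norm (m t) * B)" using C_le[OF that False] by (intro mult_left_mono) auto
    finally show ?thesis by (simp add: mult_ac)
  qed (simp add: d_def)
  have int_d: "integrable N (d \<tau>)" if "m \<tau> \<noteq> 0" for \<tau>
    by (rule Bochner_Integration.integrable_bound[of _ "\<lambda>t. exp B * B * norm (m t)"])
       (use m d_le'[OF that] in \<open>auto intro: order_trans[OF _ abs_ge_self]\<close>)
  have int_mC: "integrable N (\<lambda>t. norm (m t) * \<bar>C \<tau> t\<bar>)" if "m \<tau> \<noteq> 0" for \<tau>
  proof (rule Bochner_Integration.integrable_bound[of _ "\<lambda>t. norm (m t) * B"])
    show "AE t in N. norm (norm (m t) * \<bar>C \<tau> t\<bar>) \<le> norm (norm (m t) * B)"
    proof (intro AE_I2)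
      fix t show "norm (norm (m t) * \<bar>C \<tau> t\<bar>) \<le> norm (norm (m t) * B)"
        using C_le[OF that, of t] by (cases "m t = 0") (auto simp: abs_mult intro!: mult_left_mono)
    qed
  qed (use m in auto)
  have nd: "(\<integral>t. norm (d \<tau> t) \<partial>N) \<le> K" if "m \<tau> \<noteq> 0" for \<tau>
  proof -
    have "(\<integral>t. norm (d \<tau> t) \<partial>N) \<le> (\<integral>t. exp B * (norm (m t) * \<bar>C \<tau> t\<bar>) \<partial>N)"
      using int_d[OF that] int_mC[OF that] d_le[OF that] by (intro integral_mono) auto
    also have "\<dots> \<le> K" unfolding K_def using \<kappa>(1)[OF that] by (simp add: mult_left_mono)
    finally show ?thesis .
  qed
  have sh: "shifted m \<tau> t = m t + d \<tau> t" for \<tau> t by (simp add: shifted_def d_def algebra_simps)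
  have int_sh: "integrable N (shifted m \<tau>)" if "m \<tau> \<noteq> 0" for \<tau>
    using Bochner_Integration.integrable_add[OF m int_d[OF that]] by (simp add: sh[abs_def])
  have lin_sh: "lin (shifted m \<tau>) \<omega> = lin m \<omega> + lin (d \<tau>) \<omega>" if "m \<tau> \<noteq> 0" "\<omega> \<in> space M" for \<tau> \<omega>
    using lin_diff[OF int_sh[OF that(1)] m that(2)] by (simp add: sh algebra_simps)
  have D: "norm (lin (d \<tau>) \<omega>) \<le> K" if "m \<tau> \<noteq> 0" for \<tau> \<omega>
    using norm_lin_le[OF int_d[OF that]] nd[OF that] order_trans by blast

  \<comment> \<open>Exchanging the two label integrals collects all linear terms into a single
    mixture with weight \<open>m t * q t\<close>. Symmetry of \<open>C\<close> bounds
    \<open>q\<close> by the same \<open>K\<close>.\<close>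
  define q where "q t = (\<integral>\<tau>. m \<tau> * of_real (g \<tau>) * of_real (exp (- C \<tau> t) - 1) \<partial>N)" for t
  have [measurable]: "q \<in> borel_measurable N" unfolding q_def by measurable
  have q: "norm (q t) \<le> K" if "m t \<noteq> 0" for t
  proof -
    have "norm (q t) \<le> (\<integral>\<tau>. norm (m \<tau> * of_real (g \<tau>) * of_real (exp (- C \<tau> t) - 1)) \<partial>N)"
      unfolding q_def by (rule integral_norm_bound)
    also have "\<dots> \<le> (\<integral>\<tau>. norm (d t \<tau>) \<partial>N)"
    proof (rule integral_mono')
      show "norm (m \<tau> * of_real (g \<tau>) * of_real (exp (- C \<tau> t) - 1)) \<le> norm (d t \<tau>)" for \<tau>
      proof -
        have "norm (m \<tau> * of_real (g \<tau>) * of_real (exp (- C \<tau> t) - 1)) = g \<tau> * norm (d t \<tau>)"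
          using g01[of \<tau>] by (simp add: norm_mult d_def C_sym del: of_real_diff)
        also have "\<dots> \<le> 1 * norm (d t \<tau>)" using g01[of \<tau>] by (intro mult_right_mono) auto
        finally show ?thesis by simp
      qed
    qed (use int_d[OF that] in auto)
    also have "\<dots> \<le> K" by (rule nd[OF that])
    finally show ?thesis .
  qed
  define mq where "mq t = m t * q t" for t
  have [measurable]: "mq \<in> borel_measurable N" unfolding mq_def by measurable
  have mq: "norm (mq t) \<le> K * norm (m t)" for t
    using q[of t] by (cases "m t = 0") (auto simp: mq_def norm_mult mult_ac intro!: mult_right_mono)
  have int_mq: "integrable N mq"
    by (rule Bochner_Integration.integrable_bound[of _ "\<lambda>t. K * norm (m t)"])
       (use m mq in \<open>auto intro: order_trans[OF _ abs_ge_self]\<close>)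
  define T where "T = lin mq"
  have [measurable]: "T \<in> borel_measurable M" unfolding T_def by measurable
  have T_le: "norm (T \<omega>) \<le> K * A" for \<omega>
  proof -
    have "norm (T \<omega>) \<le> (\<integral>t. norm (mq t) \<partial>N)" unfolding T_def by (rule norm_lin_le[OF int_mq])
    also have "\<dots> \<le> (\<integral>t. K * norm (m t) \<partial>N)" using int_mq m mq by (intro integral_mono) auto
    finally show ?thesis by (simp add: A_def)
  qed
  have intT: "integrable M T" by (rule integrable_const_bound[where B = "K * A"]) (use T_le in auto)

  have E_T: "(\<integral>\<tau>. m \<tau> * of_real (g \<tau>) * expectation (\<lambda>\<omega>. V \<omega> * lin (d \<tau>) \<omega>) \<partial>N)
      = expectation (\<lambda>\<omega>. V \<omega> * T \<omega>)"
    if [measurable]: "V \<in> borel_measurable M" and V: "\<And>\<omega>. norm (V \<omega>) \<le> 1" for V :: "'w \<Rightarrow> complex"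
  proof -
    define \<phi> where "\<phi> t = expectation (\<lambda>\<omega>. V \<omega> * iexp (X t \<omega>))" for t
    have [measurable]: "\<phi> \<in> borel_measurable N" unfolding \<phi>_def by measurable
    have \<phi>: "norm (\<phi> t) \<le> 1" for t
    proof -
      have "norm (\<phi> t) \<le> (\<integral>\<omega>. 1 \<partial>M)" unfolding \<phi>_def
        by (rule order_trans[OF integral_norm_bound], rule integral_mono') (use V in \<open>auto simp: norm_mult\<close>)
      then show ?thesis by (simp add: prob_space)
    qed
    define F where "F = (\<lambda>(\<tau>, t). m \<tau> * of_real (g \<tau>) * (d \<tau> t * \<phi> t))"
    have [measurable]: "F \<in> borel_measurable (N \<Otimes>\<^sub>M N)" unfolding F_def by measurable
    have F_le: "norm (F (\<tau>, t)) \<le> norm (m \<tau>) * (exp B * \<bar>B\<bar> * norm (m t))" for \<tau> t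
    proof (cases "m \<tau> = 0")
      case False
      have "norm (F (\<tau>, t)) = norm (m \<tau>) * g \<tau> * (norm (d \<tau> t) * norm (\<phi> t))"
        using g01[of \<tau>] by (simp add: F_def norm_mult)
      also have "\<dots> \<le> norm (m \<tau>) * 1 * ((exp B * \<bar>B\<bar> * norm (m t)) * 1)"
        using g01[of \<tau>] \<phi>[of t] d_le'[OF False, of t]
        by (intro mult_mono) (auto intro!: order_trans[OF d_le'[OF False]] mult_right_mono)
      finally show ?thesis by simp
    qed (simp add: F_def)
    have int_b: "integrable (N \<Otimes>\<^sub>M N) (\<lambda>(\<tau>, t). norm (m \<tau>) * (exp B * \<bar>B\<bar> * norm (m t)))"
    proof (rule NN.Fubini_integrable)
      show "integrable N (\<lambda>s. \<integral>t. norm (case (s, t) of (\<tau>, t) \<Rightarrow> norm (m \<tau>) * (exp B * \<bar>B\<bar> * norm (m t))) \<partial>N)"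
        using m by (simp add: abs_mult)
      show "AE s in N. integrable N (\<lambda>t. case (s, t) of (\<tau>, t) \<Rightarrow> norm (m \<tau>) * (exp B * \<bar>B\<bar> * norm (m t)))"
        using m by simp
    qed measurable
    have int_F: "integrable (N \<Otimes>\<^sub>M N) F"
      by (rule Bochner_Integration.integrable_bound[OF int_b])
         (use F_le in \<open>auto intro: order_trans[OF _ abs_ge_self]\<close>)
    have "(\<integral>\<tau>. m \<tau> * of_real (g \<tau>) * expectation (\<lambda>\<omega>. V \<omega> * lin (d \<tau>) \<omega>) \<partial>N)
        = (\<integral>\<tau>. (\<integral>t. F (\<tau>, t) \<partial>N) \<partial>N)"
    proof (intro Bochner_Integration.integral_cong refl)
      fix \<tau>
      show "m \<tau> * of_real (g \<tau>) * expectation (\<lambda>\<omega>. V \<omega> * lin (d \<tau>) \<omega>) = (\<integral>t. F (\<tau>, t) \<partial>N)"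
      proof (cases "m \<tau> = 0")
        case False
        then show ?thesis
          by (subst expectation_lin[OF int_d[OF False], where B = 1]) (use V in \<open>auto simp: F_def \<phi>_def\<close>)
      qed (simp add: F_def)
    qed
    also have "\<dots> = (\<integral>t. (\<integral>\<tau>. F (\<tau>, t) \<partial>N) \<partial>N)"
      using NN.Fubini_integral[of "\<lambda>\<tau> t. F (\<tau>, t)"] int_F by simp
    also have "\<dots> = (\<integral>t. mq t * \<phi> t \<partial>N)"
    proof (intro Bochner_Integration.integral_cong refl)
      fix t
      have "F (\<tau>, t) = (m \<tau> * of_real (g \<tau>) * of_real (exp (- C \<tau> t) - 1)) * (m t * \<phi> t)" for \<tau>
        by (simp add: F_def d_def mult_ac)
      then have "(\<integral>\<tau>. F (\<tau>, t) \<partial>N) = q t * (m t * \<phi> t)"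
        by (simp only: q_def Bochner_Integration.integral_mult_left_zero)
      then show "(\<integral>\<tau>. F (\<tau>, t) \<partial>N) = mq t * \<phi> t" by (simp add: mq_def)
    qed
    also have "\<dots> = expectation (\<lambda>\<omega>. V \<omega> * T \<omega>)"
      unfolding T_def \<phi>_def by (rule expectation_lin[OF int_mq, where B = 1, symmetric]) (use V in auto)
    finally show ?thesis .
  qed

  have int_mg: "integrable N (\<lambda>t. m t * of_real (g t))"
    by (rule Bochner_Integration.integrable_bound[OF m])
       (use g01 in \<open>auto simp: norm_mult intro!: mult_left_le\<close>)
  have \<mu>_mg: "of_real \<mu> = (\<integral>t. m t * of_real (g t) \<partial>N)"
    unfolding \<mu>_lin g_def by (rule expectation_lin'[OF m])
  have bound_mg: "integrable N (\<lambda>\<tau>. m \<tau> * of_real (g \<tau>) * f \<tau>)"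
    if [measurable]: "f \<in> borel_measurable N" and f: "\<And>\<tau>. m \<tau> \<noteq> 0 \<Longrightarrow> norm (f \<tau>) \<le> b" for f :: "'l \<Rightarrow> complex" and b :: real
  proof (rule Bochner_Integration.integrable_bound[of _ "\<lambda>t. b * norm (m t)"])
    show "AE t in N. norm (m t * of_real (g t) * f t) \<le> norm (b * norm (m t))"
    proof (intro AE_I2)
      fix t show "norm (m t * of_real (g t) * f t) \<le> norm (b * norm (m t))"
      proof (cases "m t = 0")
        case False
        have "norm (m t * of_real (g t) * f t) = norm (m t) * (g t * norm (f t))"
          using g01[of t] by (simp add: norm_mult)
        also have "\<dots> \<le> norm (m t) * (1 * b)" using g01[of t] f[OF False] by (intro mult_left_mono mult_mono) auto
        also have "\<dots> \<le> norm (b * norm (m t))"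
          using mult_left_mono[OF abs_ge_self[of b] norm_ge_zero[of "m t"]] by (simp add: abs_mult mult.commute)
        finally show ?thesis .
      qed simp
    qed
  qed (use m in auto)

  \<comment> \<open>In the second moment of \<open>w\<close> one factor is written as a mixture and
    the other is tilted; since that factor occurs linearly, the identity is exact.\<close>
  have var_T: "variance w = expectation T"
  proof -
    have [simp]: "integrable M (\<lambda>\<omega>. (w \<omega>)\<^sup>2)"
      by (rule integrable_const_bound[where B = "A\<^sup>2"]) (use wA A0 in \<open>auto simp: abs_le_square_iff[symmetric]\<close>)
    have "variance w = expectation (\<lambda>\<omega>. (w \<omega>)\<^sup>2) - \<mu>\<^sup>2"
      by (simp add: variance_eq intw \<mu>_def)
    then have "complex_of_real (variance w) = of_real (expectation (\<lambda>\<omega>. (w \<omega>)\<^sup>2)) - of_real \<mu> * of_real \<mu>"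
      by (simp only: of_real_diff power2_eq_square of_real_mult)
    also have "of_real (expectation (\<lambda>\<omega>. (w \<omega>)\<^sup>2)) = expectation (\<lambda>\<omega>. lin m \<omega> * lin m \<omega>)"
      by (simp only: w power2_eq_square of_real_mult[symmetric] integral_complex_of_real)
    also have "\<dots> = (\<integral>\<tau>. m \<tau> * expectation (\<lambda>\<omega>. lin m \<omega> * iexp (X \<tau> \<omega>)) \<partial>N)"
      by (rule expectation_lin[OF m, where B = A]) (use norm_lin_le[OF m] in \<open>auto simp: A_def\<close>)
    also have "\<dots> = (\<integral>\<tau>. m \<tau> * of_real (g \<tau>) * of_real \<mu> + m \<tau> * of_real (g \<tau>) * expectation (\<lambda>\<omega>. 1 * lin (d \<tau>) \<omega>) \<partial>N)"
    proof (intro Bochner_Integration.integral_cong refl)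
      fix \<tau>
      show "m \<tau> * expectation (\<lambda>\<omega>. lin m \<omega> * iexp (X \<tau> \<omega>)) = m \<tau> * of_real (g \<tau>) * of_real \<mu> + m \<tau> * of_real (g \<tau>) * expectation (\<lambda>\<omega>. 1 * lin (d \<tau>) \<omega>)"
      proof (cases "m \<tau> = 0")
        case False
        have i: "integrable M (lin (d \<tau>))"
          by (rule integrable_const_bound[where B = K]) (use D[OF False] in auto)
        have "expectation (\<lambda>\<omega>. lin m \<omega> * iexp (X \<tau> \<omega>)) = of_real (g \<tau>) * expectation (lin (shifted m \<tau>))"
          using expectation_tilted_power[OF m int_sh[OF False], of "[]" 1] by (simp add: g_def mult_ac)
        also have "expectation (lin (shifted m \<tau>)) = expectation (\<lambda>\<omega>. lin m \<omega> + lin (d \<tau>) \<omega>)"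
          by (intro Bochner_Integration.integral_cong refl) (rule lin_sh[OF False])
        also have "\<dots> = of_real \<mu> + expectation (lin (d \<tau>))"
          using i intw by (simp add: w \<mu>_def)
        finally show ?thesis by (simp add: algebra_simps)
      qed simp
    qed
    also have "\<dots> = of_real \<mu> * of_real \<mu> + expectation (\<lambda>\<omega>. 1 * T \<omega>)"
    proof -
      have "integrable N (\<lambda>\<tau>. m \<tau> * of_real (g \<tau>) * expectation (\<lambda>\<omega>. 1 * lin (d \<tau>) \<omega>))"
      proof (rule bound_mg[of _ K])
        show "(\<lambda>\<tau>. expectation (\<lambda>\<omega>. 1 * lin (d \<tau>) \<omega>)) \<in> borel_measurable N"
          unfolding lin_def by measurable
        fix \<tau> assume "m \<tau> \<noteq> 0"
        then have "norm (expectation (\<lambda>\<omega>. 1 * lin (d \<tau>) \<omega>)) \<le> (\<integral>\<omega>. K \<partial>M)"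
          by (intro order_trans[OF integral_norm_bound] integral_mono') (use D K0 in auto)
        then show "norm (expectation (\<lambda>\<omega>. 1 * lin (d \<tau>) \<omega>)) \<le> K" by (simp add: prob_space)
      qed
      then show ?thesis
        using int_mg E_T[of "\<lambda>_. 1"] \<mu>_mg by (subst Bochner_Integration.integral_add) auto
    qed
    finally show ?thesis by simp
  qed
  then have var_cT: "of_real (variance w) = expectation T" by simp

  \<comment> \<open>\<open>T\<close> is centred at the variance of \<open>w\<close>, so the left
    side is at most the mean absolute deviation of \<open>T\<close>. That is bounded by
    \<open>lin_variance_le\<close>, with a weight of modulus at most \<open>K * norm (m t)\<close>,
    which produces \<open>K * sqrt (A * \<kappa>)\<close>.\<close>
  have T_dev: "norm (expectation (\<lambda>\<omega>. V \<omega> * T \<omega>) - of_real (variance w) * expectation V) \<le> K * sqrt (A * \<kappa>)"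
    if [measurable]: "V \<in> borel_measurable M" and V: "\<And>\<omega>. norm (V \<omega>) \<le> 1" for V :: "'w \<Rightarrow> complex"
  proof -
    have iV: "integrable M V" by (rule integrable_const_bound[where B = 1]) (use V in auto)
    have iVT: "integrable M (\<lambda>\<omega>. V \<omega> * T \<omega>)"
    proof (rule integrable_const_bound[where B = "1 * (K * A)"])
      show "AE \<omega> in M. norm (V \<omega> * T \<omega>) \<le> 1 * (K * A)"
        unfolding norm_mult by (intro AE_I2 mult_mono V T_le) auto
    qed measurable
    have iTT: "integrable M (\<lambda>\<omega>. (norm (T \<omega> - expectation T))\<^sup>2)"
    proof (rule integrable_const_bound[where B = "(K * A + norm (expectation T))\<^sup>2"])
      show "AE x in M. norm ((norm (T x - expectation T))\<^sup>2) \<le> (K * A + norm (expectation T))\<^sup>2"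
        using T_le by (intro AE_I2) (auto intro!: power_mono order_trans[OF norm_triangle_ineq4])
    qed measurable
    have "expectation (\<lambda>\<omega>. V \<omega> * T \<omega>) - of_real (variance w) * expectation V
        = expectation (\<lambda>\<omega>. V \<omega> * (T \<omega> - expectation T))"
      using iV iVT by (simp add: var_cT algebra_simps)
    also have "norm \<dots> \<le> expectation (\<lambda>\<omega>. norm (T \<omega> - expectation T))"
      by (rule order_trans[OF integral_norm_bound], rule integral_mono')
         (use V intT in \<open>auto simp: norm_mult intro!: mult_right_le_one_le mult_left_le_one_le\<close>)
    also have "\<dots> \<le> sqrt (expectation (\<lambda>\<omega>. (norm (T \<omega> - expectation T))\<^sup>2))"
      by (rule expectation_norm_le_sqrt[OF _ iTT]) measurable
    also have "\<dots> \<le> sqrt (K\<^sup>2 * (A * \<kappa>))"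
    proof (rule real_sqrt_le_mono)
      define b where "b = (\<lambda>(s, t). K\<^sup>2 * (norm (m s) * (norm (m t) * \<bar>C s t\<bar>)))"
      have [measurable]: "b \<in> borel_measurable (N \<Otimes>\<^sub>M N)" unfolding b_def by measurable
      have int_b: "integrable (N \<Otimes>\<^sub>M N) b"
      proof (rule NN.Fubini_integrable)
        show "AE s in N. integrable N (\<lambda>t. b (s, t))"
        proof (intro AE_I2)
          fix s show "integrable N (\<lambda>t. b (s, t))"
            using int_mC[of s] by (cases "m s = 0") (auto simp: b_def)
        qed
        show "integrable N (\<lambda>s. \<integral>t. norm (b (s, t)) \<partial>N)"
        proof (rule Bochner_Integration.integrable_bound[of _ "\<lambda>s. K\<^sup>2 * \<kappa> * norm (m s)"])
          show "AE s in N. norm (\<integral>t. norm (b (s, t)) \<partial>N) \<le> norm (K\<^sup>2 * \<kappa> * norm (m s))"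
          proof (intro AE_I2)
            fix s show "norm (\<integral>t. norm (b (s, t)) \<partial>N) \<le> norm (K\<^sup>2 * \<kappa> * norm (m s))"
            proof (cases "m s = 0")
              case False
              have "K\<^sup>2 * (norm (m s) * (\<integral>t. norm (m t) * \<bar>C s t\<bar> \<partial>N)) \<le> K\<^sup>2 * (norm (m s) * \<kappa>)"
                by (intro mult_left_mono \<kappa> False) auto
              then have "norm (\<integral>t. norm (b (s, t)) \<partial>N) \<le> K\<^sup>2 * (norm (m s) * \<kappa>)" by (simp add: b_def abs_mult)
              also have "\<dots> \<le> norm (K\<^sup>2 * \<kappa> * norm (m s))" using \<kappa>(2) by (simp add: abs_mult mult_ac)
              finally show ?thesis .
            qed (simp add: b_def)
          qed
        qed (use m in auto)
      qed measurable
      have b_eq: "(\<integral>t. b (s, t) \<partial>N) = K\<^sup>2 * (norm (m s) * (\<integral>t. norm (m t) * \<bar>C s t\<bar> \<partial>N))"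
        for s by (simp add: b_def)
      have le_b: "norm (mq s) * norm (mq t) * \<bar>C s t\<bar> \<le> b (s, t)" for s t
      proof -
        have "norm (mq s) * norm (mq t) * \<bar>C s t\<bar> \<le> (K * norm (m s)) * (K * norm (m t)) * \<bar>C s t\<bar>"
          using K0 by (intro mult_right_mono mult_mono mq) auto
        then show ?thesis by (simp add: b_def power2_eq_square mult_ac)
      qed
      have int_c: "integrable (N \<Otimes>\<^sub>M N) (\<lambda>(s, t). norm (mq s) * norm (mq t) * \<bar>C s t\<bar>)"
      proof (rule Bochner_Integration.integrable_bound[OF int_b])
        show "AE p in N \<Otimes>\<^sub>M N. norm (case p of (s, t) \<Rightarrow> norm (mq s) * norm (mq t) * \<bar>C s t\<bar>) \<le> norm (b p)"
        proof (intro AE_I2)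
          fix p :: "'l \<times> 'l"
          obtain s t where p: "p = (s, t)" by (cases p)
          show "norm (case p of (s, t) \<Rightarrow> norm (mq s) * norm (mq t) * \<bar>C s t\<bar>) \<le> norm (b p)"
            using le_b[of s t] unfolding p prod.case real_norm_def by (simp add: abs_mult)
        qed
      qed measurable
      have "expectation (\<lambda>\<omega>. (norm (T \<omega> - expectation T))\<^sup>2) \<le> (\<integral>s. (\<integral>t. norm (mq s) * norm (mq t) * \<bar>C s t\<bar> \<partial>N) \<partial>N)"
        unfolding T_def by (rule lin_variance_le[OF int_mq int_c])
      also have "\<dots> = (\<integral>(s, t). norm (mq s) * norm (mq t) * \<bar>C s t\<bar> \<partial>(N \<Otimes>\<^sub>M N))"
        using NN.integral_fst'[OF int_c] by simp
      also have "\<dots> \<le> (\<integral>p. b p \<partial>(N \<Otimes>\<^sub>M N))"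
        using int_c int_b le_b by (intro integral_mono) auto
      also have "\<dots> = (\<integral>s. (\<integral>t. b (s, t) \<partial>N) \<partial>N)"
        using NN.integral_fst'[OF int_b] by simp
      also have "\<dots> \<le> (\<integral>s. K\<^sup>2 * \<kappa> * norm (m s) \<partial>N)"
      proof (rule integral_mono')
        fix s show "(\<integral>t. b (s, t) \<partial>N) \<le> K\<^sup>2 * \<kappa> * norm (m s)"
        proof (cases "m s = 0")
          case False
          have "K\<^sup>2 * (norm (m s) * (\<integral>t. norm (m t) * \<bar>C s t\<bar> \<partial>N)) \<le> K\<^sup>2 * (norm (m s) * \<kappa>)"
            by (intro mult_left_mono \<kappa> False) auto
          also have "\<dots> = K\<^sup>2 * \<kappa> * norm (m s)" by (simp only: mult_ac)
          finally show ?thesis unfolding b_eq .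
        qed (simp add: b_def)
      qed (use m \<kappa> in auto)
      finally show "expectation (\<lambda>\<omega>. (norm (T \<omega> - expectation T))\<^sup>2) \<le> K\<^sup>2 * (A * \<kappa>)"
        by (simp add: A_def mult_ac)
    qed
    also have "\<dots> = K * sqrt (A * \<kappa>)" using K0 by (simp add: real_sqrt_mult)
    finally show ?thesis .
  qed

  define \<sigma> where "\<sigma> = variance w"
  define E where "E = A * s\<^sup>2 * K\<^sup>2 * exp (\<bar>s\<bar> * K) + \<bar>s\<bar> * (K * sqrt (A * \<kappa>))"
  define \<psi> where "\<psi> r = expectation (\<lambda>\<omega>. iexp (r * (w \<omega> - \<mu>)))" for r
  define \<psi>' where "\<psi>' r = expectation (\<lambda>\<omega>. \<i> * (w \<omega> - \<mu>) * iexp (r * (w \<omega> - \<mu>)))" for r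
  have \<sigma>0: "0 \<le> \<sigma>" unfolding \<sigma>_def by (rule variance_positive)
  have \<psi>_deriv: "(\<psi> has_vector_derivative \<psi>' r) (at r)" for r
    unfolding \<psi>_def \<psi>'_def
    using expectation_iexp_has_vector_derivative[of "\<lambda>\<omega>. w \<omega> - \<mu>" "A + \<bar>\<mu>\<bar>" r] wA
    by (simp add: order_trans[OF abs_triangle_ineq4])

  have ode: "norm (\<psi>' r + of_real (r * \<sigma>) * \<psi> r) \<le> E" if r: "\<bar>r\<bar> \<le> \<bar>s\<bar>" for r
  proof -
    define V where "V \<omega> = iexp (r * w \<omega>)" for \<omega>
    have [measurable]: "V \<in> borel_measurable M" unfolding V_def by measurable
    have V: "norm (V \<omega>) = 1" for \<omega> by (simp add: V_def)
    have iV: "integrable M V" by (rule integrable_const_bound[where B = 1]) (use V in auto)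
    have iVw: "integrable M (\<lambda>\<omega>. V \<omega> * w \<omega>)"
      by (rule integrable_const_bound[where B = A]) (use V wA in \<open>auto simp: norm_mult\<close>)
    \<comment> \<open>\<open>e \<tau>\<close> is the remainder after the linear term of
      \<open>exp (\<i> * r * lin (d \<tau>) \<omega>)\<close>, averaged against \<open>V\<close>; it
      is quadratic in \<open>K\<close>.\<close>
    define e where "e \<tau> = expectation (\<lambda>\<omega>. exp (\<i> * r * lin (shifted m \<tau>) \<omega>)) - expectation V
        - \<i> * r * expectation (\<lambda>\<omega>. V \<omega> * lin (d \<tau>) \<omega>)" for \<tau>
    have e: "norm (e \<tau>) \<le> s\<^sup>2 * K\<^sup>2 * exp (\<bar>s\<bar> * K)" if "m \<tau> \<noteq> 0" for \<tau>
    proof -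
      have ptw: "norm (exp (\<i> * r * lin (shifted m \<tau>) \<omega>) - V \<omega> - \<i> * r * (V \<omega> * lin (d \<tau>) \<omega>))
          \<le> s\<^sup>2 * K\<^sup>2 * exp (\<bar>s\<bar> * K)" if "\<omega> \<in> space M" for \<omega>
      proof -
        define z where "z = \<i> * r * lin (d \<tau>) \<omega>"
        have nz: "norm z \<le> \<bar>s\<bar> * K" unfolding z_def using r D[OF \<open>m \<tau> \<noteq> 0\<close>, of \<omega>]
          by (auto simp: norm_mult intro!: mult_mono)
        have "exp (\<i> * r * lin (shifted m \<tau>) \<omega>) = V \<omega> * exp z"
          unfolding V_def z_def exp_add[symmetric] lin_sh[OF \<open>m \<tau> \<noteq> 0\<close> that] w by (simp add: algebra_simps)
        then have "exp (\<i> * r * lin (shifted m \<tau>) \<omega>) - V \<omega> - \<i> * r * (V \<omega> * lin (d \<tau>) \<omega>) = V \<omega> * (exp z - 1 - z)"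
          by (simp add: z_def algebra_simps)
        then have "norm (exp (\<i> * r * lin (shifted m \<tau>) \<omega>) - V \<omega> - \<i> * r * (V \<omega> * lin (d \<tau>) \<omega>)) = norm (exp z - 1 - z)"
          by (simp add: norm_mult V)
        also have "\<dots> \<le> (norm z)\<^sup>2 * exp (norm z)" by (rule norm_exp_minus_linear_le)
        also have "\<dots> \<le> (\<bar>s\<bar> * K)\<^sup>2 * exp (\<bar>s\<bar> * K)" using nz by (intro mult_mono power_mono) auto
        finally show ?thesis by (simp add: power_mult_distrib)
      qed
      have i1: "integrable M (\<lambda>\<omega>. V \<omega> * lin (d \<tau>) \<omega>)"
        by (rule integrable_const_bound[where B = K]) (use V D[OF that] in \<open>auto simp: norm_mult\<close>)
      have i2: "integrable M (\<lambda>\<omega>. exp (\<i> * r * lin (shifted m \<tau>) \<omega>))"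
      proof (rule integrable_const_bound[where B = "exp (\<bar>r\<bar> * (\<integral>t. norm (shifted m \<tau> t) \<partial>N))"])
        show "AE \<omega> in M. norm (exp (\<i> * r * lin (shifted m \<tau>) \<omega>)) \<le> exp (\<bar>r\<bar> * (\<integral>t. norm (shifted m \<tau> t) \<partial>N))"
        proof (intro AE_I2)
          fix \<omega>
          have "norm (exp (\<i> * r * lin (shifted m \<tau>) \<omega>)) \<le> exp (norm (\<i> * r * lin (shifted m \<tau>) \<omega>))"
            by (rule norm_exp)
          also have "\<dots> \<le> exp (\<bar>r\<bar> * (\<integral>t. norm (shifted m \<tau> t) \<partial>N))"
            using norm_lin_le[OF int_sh[OF that], of \<omega>] by (auto simp: norm_mult intro!: mult_left_mono)
          finally show "norm (exp (\<i> * r * lin (shifted m \<tau>) \<omega>)) \<le> exp (\<bar>r\<bar> * (\<integral>t. norm (shifted m \<tau> t) \<partial>N))" .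
        qed
      qed measurable
      have "e \<tau> = expectation (\<lambda>\<omega>. exp (\<i> * r * lin (shifted m \<tau>) \<omega>) - V \<omega> - \<i> * r * (V \<omega> * lin (d \<tau>) \<omega>))"
        unfolding e_def using i1 i2 iV by simp
      also have "norm \<dots> \<le> (\<integral>\<omega>. s\<^sup>2 * K\<^sup>2 * exp (\<bar>s\<bar> * K) \<partial>M)"
        by (rule order_trans[OF integral_norm_bound], rule integral_mono') (use ptw in auto)
      finally show ?thesis by (simp add: prob_space)
    qed
    have [measurable]: "e \<in> borel_measurable N"
      unfolding e_def lin_def shifted_def by measurable
    have wVE: "expectation (\<lambda>\<omega>. V \<omega> * w \<omega>)
        = of_real \<mu> * expectation V + \<i> * r * expectation (\<lambda>\<omega>. V \<omega> * T \<omega>) + (\<integral>\<tau>. m \<tau> * of_real (g \<tau>) * e \<tau> \<partial>N)"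
    proof -
      have "expectation (\<lambda>\<omega>. V \<omega> * w \<omega>) = expectation (\<lambda>\<omega>. V \<omega> * lin m \<omega>)" by (simp add: w)
      also have "\<dots> = (\<integral>\<tau>. m \<tau> * expectation (\<lambda>\<omega>. V \<omega> * iexp (X \<tau> \<omega>)) \<partial>N)"
        by (rule expectation_lin[OF m, where B = 1]) (use V in auto)
      also have "\<dots> = (\<integral>\<tau>. m \<tau> * of_real (g \<tau>) * expectation V
          + \<i> * r * (m \<tau> * of_real (g \<tau>) * expectation (\<lambda>\<omega>. V \<omega> * lin (d \<tau>) \<omega>))
          + m \<tau> * of_real (g \<tau>) * e \<tau> \<partial>N)"
      proof (intro Bochner_Integration.integral_cong refl)
        fix \<tau>
        show "m \<tau> * expectation (\<lambda>\<omega>. V \<omega> * iexp (X \<tau> \<omega>)) = m \<tau> * of_real (g \<tau>) * expectation V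
          + \<i> * r * (m \<tau> * of_real (g \<tau>) * expectation (\<lambda>\<omega>. V \<omega> * lin (d \<tau>) \<omega>))
          + m \<tau> * of_real (g \<tau>) * e \<tau>"
        proof (cases "m \<tau> = 0")
          case False
          have "expectation (\<lambda>\<omega>. V \<omega> * iexp (X \<tau> \<omega>)) = of_real (g \<tau>) * expectation (\<lambda>\<omega>. exp (\<i> * r * lin (shifted m \<tau>) \<omega>))"
            using expectation_tilted_exp[OF m int_sh[OF False], of "\<i> * r"] by (simp add: g_def V_def w mult_ac)
          then show ?thesis by (simp add: e_def algebra_simps)
        qed simp
      qed
      also have "\<dots> = of_real \<mu> * expectation V + \<i> * r * expectation (\<lambda>\<omega>. V \<omega> * T \<omega>) + (\<integral>\<tau>. m \<tau> * of_real (g \<tau>) * e \<tau> \<partial>N)"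
      proof -
        have j1: "integrable N (\<lambda>\<tau>. m \<tau> * of_real (g \<tau>) * expectation (\<lambda>\<omega>. V \<omega> * lin (d \<tau>) \<omega>))"
        proof (rule bound_mg[of _ K])
          show "(\<lambda>\<tau>. expectation (\<lambda>\<omega>. V \<omega> * lin (d \<tau>) \<omega>)) \<in> borel_measurable N"
            unfolding lin_def by measurable
          fix \<tau> assume "m \<tau> \<noteq> 0"
          then have "norm (expectation (\<lambda>\<omega>. V \<omega> * lin (d \<tau>) \<omega>)) \<le> (\<integral>\<omega>. K \<partial>M)"
            by (intro order_trans[OF integral_norm_bound] integral_mono') (use D K0 in \<open>auto simp: norm_mult V\<close>)
          then show "norm (expectation (\<lambda>\<omega>. V \<omega> * lin (d \<tau>) \<omega>)) \<le> K" by (simp add: prob_space)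
        qed
        have j2: "integrable N (\<lambda>\<tau>. m \<tau> * of_real (g \<tau>) * e \<tau>)"
          by (rule bound_mg[of _ "s\<^sup>2 * K\<^sup>2 * exp (\<bar>s\<bar> * K)"]) (use e in auto)
        show ?thesis
          using int_mg j1 j2 E_T[of V] V \<mu>_mg by simp
      qed
      finally show ?thesis .
    qed
    define err where "err = (\<integral>\<tau>. m \<tau> * of_real (g \<tau>) * e \<tau> \<partial>N)"
    have err: "norm err \<le> A * s\<^sup>2 * K\<^sup>2 * exp (\<bar>s\<bar> * K)"
    proof -
      have "norm err \<le> (\<integral>\<tau>. norm (m \<tau>) * (s\<^sup>2 * K\<^sup>2 * exp (\<bar>s\<bar> * K)) \<partial>N)"
        unfolding err_def
      proof (rule order_trans[OF integral_norm_bound], rule integral_mono')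
        fix \<tau> show "norm (m \<tau> * of_real (g \<tau>) * e \<tau>) \<le> norm (m \<tau>) * (s\<^sup>2 * K\<^sup>2 * exp (\<bar>s\<bar> * K))"
        proof (cases "m \<tau> = 0")
          case False
          have "norm (m \<tau> * of_real (g \<tau>) * e \<tau>) = norm (m \<tau>) * (g \<tau> * norm (e \<tau>))"
            using g01[of \<tau>] by (simp add: norm_mult)
          also have "\<dots> \<le> norm (m \<tau>) * (1 * (s\<^sup>2 * K\<^sup>2 * exp (\<bar>s\<bar> * K)))"
            using g01[of \<tau>] by (intro mult_left_mono mult_mono e False) auto
          finally show ?thesis by simp
        qed simp
      qed (use m in auto)
      then show ?thesis by (simp add: A_def mult_ac)
    qed
    have "\<psi>' r = \<i> * iexp (- r * \<mu>) * (expectation (\<lambda>\<omega>. V \<omega> * w \<omega>) - of_real \<mu> * expectation V)"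
    proof -
      have "\<psi>' r = expectation (\<lambda>\<omega>. \<i> * iexp (- r * \<mu>) * (V \<omega> * w \<omega> - of_real \<mu> * V \<omega>))"
        unfolding \<psi>'_def V_def
        by (intro Bochner_Integration.integral_cong refl) (simp add: algebra_simps exp_diff exp_minus divide_inverse)
      then show ?thesis using iV iVw by simp
    qed
    also have "\<dots> = \<i> * iexp (- r * \<mu>) * (\<i> * r * expectation (\<lambda>\<omega>. V \<omega> * T \<omega>) + err)"
      by (simp add: wVE err_def)
    finally have 1: "\<psi>' r = \<i> * iexp (- r * \<mu>) * (\<i> * r * expectation (\<lambda>\<omega>. V \<omega> * T \<omega>) + err)" .
    have 2: "\<psi> r = iexp (- r * \<mu>) * expectation V"
    proof -
      have "\<psi> r = expectation (\<lambda>\<omega>. iexp (- r * \<mu>) * V \<omega>)"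
        unfolding \<psi>_def V_def
        by (intro Bochner_Integration.integral_cong refl) (simp add: algebra_simps exp_diff exp_minus divide_inverse)
      then show ?thesis by simp
    qed
    have "\<psi>' r + of_real (r * \<sigma>) * \<psi> r = \<i> * iexp (- r * \<mu>) *
        (\<i> * r * (expectation (\<lambda>\<omega>. V \<omega> * T \<omega>) - of_real \<sigma> * expectation V) + err)"
      unfolding 1 2 by (simp add: algebra_simps)
    also have "norm \<dots> \<le> \<bar>r\<bar> * norm (expectation (\<lambda>\<omega>. V \<omega> * T \<omega>) - of_real \<sigma> * expectation V) + norm err"
      by (simp add: norm_mult) (rule order_trans[OF norm_triangle_ineq], simp add: norm_mult)
    also have "\<dots> \<le> \<bar>s\<bar> * (K * sqrt (A * \<kappa>)) + A * s\<^sup>2 * K\<^sup>2 * exp (\<bar>s\<bar> * K)"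
      using r V T_dev[of V] err unfolding \<sigma>_def by (intro add_mono mult_mono) auto
    finally show ?thesis by (simp add: E_def)
  qed

  \<comment> \<open>The exponential is the integrating factor of
    \<open>\<psi>' = - r * \<sigma> * \<psi>\<close>. The bound on the derivative of
    \<open>G\<close> carries \<open>exp (s\<^sup>2 * \<sigma> / 2)\<close>, which cancels when
    \<open>G\<close> is turned back into \<open>\<psi>\<close>, so a large variance costs
    nothing.\<close>
  define G where "G r = \<psi> r * of_real (exp (r\<^sup>2 * \<sigma> / 2))" for r
  have G': "(G has_vector_derivative (\<psi>' r + of_real (r * \<sigma>) * \<psi> r) * of_real (exp (r\<^sup>2 * \<sigma> / 2))) (at r)" for r
  proof -
    have "((\<lambda>r. exp (r\<^sup>2 * \<sigma> / 2)) has_vector_derivative r * \<sigma> * exp (r\<^sup>2 * \<sigma> / 2)) (at r)"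
      unfolding has_real_derivative_iff_has_vector_derivative[symmetric]
      by (auto intro!: derivative_eq_intros simp: power2_eq_square)
    then have "((\<lambda>r. complex_of_real (exp (r\<^sup>2 * \<sigma> / 2))) has_vector_derivative of_real (r * \<sigma> * exp (r\<^sup>2 * \<sigma> / 2))) (at r)"
      by (rule bounded_linear.has_vector_derivative[OF bounded_linear_of_real])
    from has_vector_derivative_mult[OF \<psi>_deriv[of r] this] show ?thesis
      unfolding G_def by (simp add: algebra_simps)
  qed
  have "norm (G s - G 0) \<le> (E * exp (s\<^sup>2 * \<sigma> / 2)) * norm (s - 0)"
  proof (rule differentiable_bound[where S = "{- \<bar>s\<bar>..\<bar>s\<bar>}"])
    show "(G has_derivative (\<lambda>h. h *\<^sub>R ((\<psi>' r + of_real (r * \<sigma>) * \<psi> r) * of_real (exp (r\<^sup>2 * \<sigma> / 2))))) (at r within {- \<bar>s\<bar>..\<bar>s\<bar>})" for r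
      using G'[of r] unfolding has_vector_derivative_def by (rule has_derivative_at_withinI)
    fix r assume "r \<in> {- \<bar>s\<bar>..\<bar>s\<bar>}"
    then have r: "\<bar>r\<bar> \<le> \<bar>s\<bar>" by auto
    then have r2: "r\<^sup>2 \<le> s\<^sup>2" by (simp add: abs_le_square_iff)
    have "norm ((\<psi>' r + of_real (r * \<sigma>) * \<psi> r) * of_real (exp (r\<^sup>2 * \<sigma> / 2))) \<le> E * exp (s\<^sup>2 * \<sigma> / 2)"
      unfolding norm_mult using ode[OF r] r2 \<sigma>0 order_trans[OF norm_ge_zero ode[OF r]]
      by (intro mult_mono) (auto intro!: mult_right_mono divide_right_mono)
    then show "onorm (\<lambda>h. h *\<^sub>R ((\<psi>' r + of_real (r * \<sigma>) * \<psi> r) * of_real (exp (r\<^sup>2 * \<sigma> / 2)))) \<le> E * exp (s\<^sup>2 * \<sigma> / 2)"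
      by (simp add: onorm_scaleR_left bounded_linear_ident onorm_id)
  qed auto
  then have G_le: "norm (G s - 1) \<le> \<bar>s\<bar> * E * exp (s\<^sup>2 * \<sigma> / 2)"
    by (simp add: G_def \<psi>_def prob_space mult_ac)
  have "\<psi> s - of_real (exp (- s\<^sup>2 * \<sigma> / 2)) = (G s - 1) * of_real (exp (- s\<^sup>2 * \<sigma> / 2))"
    by (simp add: G_def algebra_simps exp_minus flip: of_real_mult)
  then have "norm (\<psi> s - of_real (exp (- s\<^sup>2 * \<sigma> / 2))) = norm (G s - 1) * exp (- s\<^sup>2 * \<sigma> / 2)"
    by (simp add: norm_mult)
  also have "\<dots> \<le> (\<bar>s\<bar> * E * exp (s\<^sup>2 * \<sigma> / 2)) * exp (- s\<^sup>2 * \<sigma> / 2)"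
    by (intro mult_right_mono G_le) auto
  also have "\<dots> = \<bar>s\<bar> * E" by (simp add: exp_minus)
  finally show ?thesis by (simp add: \<psi>_def \<sigma>_def \<mu>_def E_def)
qed

end

section \<open>Gaussian integrals on the complex plane\<close>

lemma lborel_complex:
  "(lborel :: complex measure) = distr (lborel \<Otimes>\<^sub>M lborel) borel (\<lambda>(x, y). Complex x y)"
proof (rule lborel_eqI)
  have [measurable]: "(\<lambda>(x, y). Complex x y) \<in> borel_measurable (borel \<Otimes>\<^sub>M borel)"
    unfolding Complex_eq split_beta' by measurable
  fix l u :: complex assume lu: "\<And>b. b \<in> Basis \<Longrightarrow> l \<bullet> b \<le> u \<bullet> b"
  have "l \<bullet> 1 \<le> u \<bullet> 1" "l \<bullet> \<i> \<le> u \<bullet> \<i>" by (intro lu; simp add: Basis_complex_def)+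
  then have lu': "Re l \<le> Re u" "Im l \<le> Im u" by (auto simp: inner_complex_def)
  have "emeasure (distr (lborel \<Otimes>\<^sub>M lborel) borel (\<lambda>(x, y). Complex x y)) (box l u)
    = emeasure (lborel \<Otimes>\<^sub>M lborel) ({Re l <..< Re u} \<times> {Im l <..< Im u})"
    by (subst emeasure_distr)
       (auto simp: box_def Basis_complex_def inner_complex_def space_pair_measure intro!: arg_cong2[where f = emeasure])
  also have "\<dots> = ennreal ((Re u - Re l) * (Im u - Im l))"
    using lu' by (subst lborel.emeasure_pair_measure_Times) (auto simp: ennreal_mult)
  also have "(Re u - Re l) * (Im u - Im l) = (\<Prod>b\<in>Basis. (u - l) \<bullet> b)"
    by (simp add: Basis_complex_def inner_complex_def)
  finally show "emeasure (distr (lborel \<Otimes>\<^sub>M lborel) borel (\<lambda>(x, y). Complex x y)) (box l u)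
    = (\<Prod>b\<in>Basis. (u - l) \<bullet> b)" .
qed simp

lemma has_bochner_integral_complex_prod:
  fixes f g :: "real \<Rightarrow> 'b :: {real_normed_field, banach, second_countable_topology}"
  assumes f: "has_bochner_integral lborel f A" and g: "has_bochner_integral lborel g B"
  shows "has_bochner_integral (lborel :: complex measure) (\<lambda>z. f (Re z) * g (Im z)) (A * B)"
proof -
  have [measurable]: "f \<in> borel_measurable borel" "g \<in> borel_measurable borel"
    using f g by (auto dest: borel_measurable_has_bochner_integral)
  have [measurable]: "(\<lambda>(x, y). Complex x y) \<in> borel_measurable (borel \<Otimes>\<^sub>M borel)"
    unfolding Complex_eq split_beta' by measurable
  have if': "integrable lborel f" "integrable lborel g" and ie: "integral\<^sup>L lborel f = A" "integral\<^sup>L lborel g = B"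
    using f g by (auto simp: has_bochner_integral_iff)
  have int: "integrable (lborel \<Otimes>\<^sub>M lborel) (\<lambda>(x, y). f x * g y)"
    by (rule lborel_pair.Fubini_integrable) (use if' in \<open>auto simp: norm_mult\<close>)
  have "integrable (distr (lborel \<Otimes>\<^sub>M lborel) borel (\<lambda>(x, y). Complex x y)) (\<lambda>z. f (Re z) * g (Im z))"
    using int by (subst integrable_distr_eq) (auto simp: split_beta')
  moreover have "integral\<^sup>L (distr (lborel \<Otimes>\<^sub>M lborel) borel (\<lambda>(x, y). Complex x y)) (\<lambda>z. f (Re z) * g (Im z)) = A * B"
    using lborel_pair.integral_fst'[OF int] ie by (subst integral_distr) (auto simp: split_beta')
  ultimately show ?thesis by (subst lborel_complex) (simp add: has_bochner_integral_iff)
qed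

text \<open>Completing the square makes the integrand a multiple of the normal density of mean
  \<open>p / c\<close> and variance \<open>1 / (2 * c)\<close>.\<close>

lemma gaussian_integral_real:
  fixes c p :: real
  assumes "0 < c"
  shows "has_bochner_integral lborel (\<lambda>x. exp (- c * x\<^sup>2 + 2 * p * x)) (sqrt (pi / c) * exp (p\<^sup>2 / c))"
proof -
  define \<sigma> where "\<sigma> = 1 / sqrt (2 * c)"
  have \<sigma>: "0 < \<sigma>" "\<sigma>\<^sup>2 = 1 / (2 * c)" using assms by (auto simp: \<sigma>_def power_divide)
  have "has_bochner_integral lborel (normal_density (p / c) \<sigma>) 1"
    using \<sigma> by (simp add: has_bochner_integral_iff)
  then have "has_bochner_integral lborel (\<lambda>x. (sqrt (pi / c) * exp (p\<^sup>2 / c)) * normal_density (p / c) \<sigma> x)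
      (sqrt (pi / c) * exp (p\<^sup>2 / c) * 1)"
    by (rule has_bochner_integral_mult_right)
  moreover have "(sqrt (pi / c) * exp (p\<^sup>2 / c)) * normal_density (p / c) \<sigma> x = exp (- c * x\<^sup>2 + 2 * p * x)" for x
  proof -
    have "(sqrt (pi / c) * exp (p\<^sup>2 / c)) * normal_density (p / c) \<sigma> x
        = exp (p\<^sup>2 / c) * exp (- (x - p / c)\<^sup>2 * c)"
      using assms by (simp add: normal_density_def \<sigma>(2) real_sqrt_mult real_sqrt_divide)
    also have "\<dots> = exp (- c * x\<^sup>2 + 2 * p * x)"
      unfolding exp_add[symmetric] using assms by (simp add: power2_eq_square field_simps)
    finally show ?thesis .
  qed
  ultimately show ?thesis by simp
qed

lemma gaussian_integral_complex:
  fixes c :: real and w :: complex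
  assumes "0 < c"
  shows "has_bochner_integral lborel (\<lambda>v. exp (- c * (norm v)\<^sup>2 + 2 * Re (w * v)))
    (pi / c * exp ((norm w)\<^sup>2 / c))"
proof -
  have "has_bochner_integral lborel (\<lambda>v. exp (- c * (Re v)\<^sup>2 + 2 * Re w * Re v) * exp (- c * (Im v)\<^sup>2 + 2 * (- Im w) * Im v))
      ((sqrt (pi / c) * exp ((Re w)\<^sup>2 / c)) * (sqrt (pi / c) * exp ((- Im w)\<^sup>2 / c)))"
    using assms by (intro has_bochner_integral_complex_prod gaussian_integral_real)
  moreover have "exp (- c * (Re v)\<^sup>2 + 2 * Re w * Re v) * exp (- c * (Im v)\<^sup>2 + 2 * (- Im w) * Im v)
      = exp (- c * (norm v)\<^sup>2 + 2 * Re (w * v))" for v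
    unfolding exp_add[symmetric] cmod_power2 by (simp add: algebra_simps)
  moreover have "(sqrt (pi / c) * exp ((Re w)\<^sup>2 / c)) * (sqrt (pi / c) * exp ((- Im w)\<^sup>2 / c))
      = pi / c * exp ((norm w)\<^sup>2 / c)"
  proof -
    have "(sqrt (pi / c) * exp ((Re w)\<^sup>2 / c)) * (sqrt (pi / c) * exp ((- Im w)\<^sup>2 / c))
      = (sqrt (pi / c) * sqrt (pi / c)) * (exp ((Re w)\<^sup>2 / c) * exp ((Im w)\<^sup>2 / c))"
      by (simp only: power2_minus mult_ac)
    also have "\<dots> = pi / c * exp ((norm w)\<^sup>2 / c)"
      using assms unfolding exp_add[symmetric] cmod_power2 by (simp add: add_divide_distrib)
    finally show ?thesis .
  qed
  ultimately show ?thesis by simp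
qed

text \<open>The substitution by \<open>sqrt 2\<close> reduces the density to the standard normal
  one, whose characteristic function is known.\<close>

lemma gaussian_fourier_real:
  fixes p :: real
  shows "has_bochner_integral lborel (\<lambda>x. of_real (exp (- x\<^sup>2) / sqrt pi) * iexp (p * x)) (of_real (exp (- p\<^sup>2 / 4)))"
proof -
  have 1: "(\<lambda>x. of_real (exp (- x\<^sup>2) / sqrt pi) * iexp (p * x))
      = (\<lambda>x. sqrt 2 *\<^sub>R (std_normal_density (0 + sqrt 2 * x) *\<^sub>R iexp (p / sqrt 2 * (0 + sqrt 2 * x))))"
    by (simp add: std_normal_density_def real_sqrt_mult scaleR_conv_of_real power_mult_distrib fun_eq_iff)
  have i: "integrable lborel (\<lambda>x. std_normal_density x *\<^sub>R iexp (p / sqrt 2 * x))"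
    by (rule Bochner_Integration.integrable_bound[OF integrable_normal_density[of 1 0]]) auto
  have "(\<integral>x. std_normal_density x *\<^sub>R iexp (p / sqrt 2 * x) \<partial>lborel) = char std_normal_distribution (p / sqrt 2)"
    unfolding char_def by (subst integral_density) auto
  also have "\<dots> = of_real (exp (- p\<^sup>2 / 4))"
    by (simp add: char_std_normal_distribution power_divide exp_of_real)
  finally have "has_bochner_integral lborel (\<lambda>x. std_normal_density x *\<^sub>R iexp (p / sqrt 2 * x)) (of_real (exp (- p\<^sup>2 / 4)))"
    using i by (simp add: has_bochner_integral_iff)
  from lborel_has_bochner_integral_real_affine_iff[of "sqrt 2"
      "\<lambda>x. std_normal_density x *\<^sub>R iexp (p / sqrt 2 * x)" "complex_of_real (exp (- p\<^sup>2 / 4))" 0] this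
  have "has_bochner_integral lborel (\<lambda>x. std_normal_density (0 + sqrt 2 * x) *\<^sub>R iexp (p / sqrt 2 * (0 + sqrt 2 * x)))
      (complex_of_real (exp (- p\<^sup>2 / 4)) /\<^sub>R \<bar>sqrt 2\<bar>)"
    by (simp only: real_sqrt_eq_zero_cancel_iff zero_neq_numeral not_False_eq_True simp_thms)
  then have "has_bochner_integral lborel (\<lambda>x. sqrt 2 *\<^sub>R (std_normal_density (0 + sqrt 2 * x) *\<^sub>R iexp (p / sqrt 2 * (0 + sqrt 2 * x))))
      (sqrt 2 *\<^sub>R (complex_of_real (exp (- p\<^sup>2 / 4)) /\<^sub>R \<bar>sqrt 2\<bar>))"
    by (rule has_bochner_integral_scaleR_right)
  then show ?thesis unfolding 1 by simp
qed

text \<open>Density of the standard complex Gaussian, with second absolute moment 1; its real and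
  imaginary parts have variance 1/2, which explains the quarter in
  \<open>gauss_fourier\<close>.\<close>

definition gauss :: "complex \<Rightarrow> real" where
  "gauss v = exp (- (norm v)\<^sup>2) / pi"

lemma gauss_measurable [measurable]: "gauss \<in> borel_measurable borel"
  unfolding gauss_def by measurable

lemma gauss_nonneg: "0 \<le> gauss v"
  by (simp add: gauss_def)

text \<open>With \<open>b = of_real (2 * sqrt t) * x\<close> the right side is
  \<open>exp (- t * (norm x)\<^sup>2)\<close>. This linearisation of the exponent is what the
  mixture rests on.\<close>

lemma gauss_fourier:
  "has_bochner_integral lborel (\<lambda>v. of_real (gauss v) * iexp (Re (b * v))) (of_real (exp (- (norm b)\<^sup>2 / 4)))"
proof -
  have "has_bochner_integral lborel (\<lambda>v. (of_real (exp (- (Re v)\<^sup>2) / sqrt pi) * iexp (Re b * Re v))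
        * (of_real (exp (- (Im v)\<^sup>2) / sqrt pi) * iexp (- Im b * Im v)))
      (complex_of_real (exp (- (Re b)\<^sup>2 / 4)) * of_real (exp (- (- Im b)\<^sup>2 / 4)))"
    by (intro has_bochner_integral_complex_prod gaussian_fourier_real)
  moreover have "(of_real (exp (- (Re v)\<^sup>2) / sqrt pi) * iexp (Re b * Re v))
        * (of_real (exp (- (Im v)\<^sup>2) / sqrt pi) * iexp (- Im b * Im v)) = of_real (gauss v) * iexp (Re (b * v))" for v
  proof -
    have "gauss v = (exp (- (Re v)\<^sup>2) / sqrt pi) * (exp (- (Im v)\<^sup>2) / sqrt pi)"
      unfolding gauss_def cmod_power2 minus_add_distrib exp_add times_divide_times_eq by simp
    moreover have "iexp (Re (b * v)) = iexp (Re b * Re v) * iexp (- Im b * Im v)"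
      unfolding exp_add[symmetric] by (simp add: algebra_simps)
    ultimately show ?thesis by (simp only: of_real_mult mult_ac)
  qed
  moreover have "complex_of_real (exp (- (Re b)\<^sup>2 / 4)) * of_real (exp (- (- Im b)\<^sup>2 / 4)) = of_real (exp (- (norm b)\<^sup>2 / 4))"
    unfolding of_real_mult[symmetric] exp_add[symmetric] cmod_power2 by (simp add: add_divide_distrib)
  ultimately show ?thesis by simp
qed

lemma gauss_has_integral: "has_bochner_integral lborel gauss 1"
  using has_bochner_integral_divide_zero[OF gaussian_integral_complex[of 1 0], of pi] by (simp add: gauss_def[abs_def])

text \<open>The bound \<open>norm v \<le> exp ((norm v)\<^sup>2 / 2)\<close> halves the rate of the
  Gaussian, and the integral of the resulting function is 2.\<close>

lemma nn_integral_norm_gauss: "(\<integral>\<^sup>+ v. ennreal (gauss v) * ennreal (norm v) \<partial>lborel) \<le> 2"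
proof -
  have "(\<integral>\<^sup>+ v. ennreal (gauss v) * ennreal (norm v) \<partial>lborel)
      \<le> (\<integral>\<^sup>+ v. ennreal (exp (- (1/2) * (norm v)\<^sup>2 + 2 * Re (0 * v)) / pi) \<partial>lborel)"
  proof (rule nn_integral_mono)
    fix v :: complex
    have "norm v \<le> 1 + (norm v)\<^sup>2 / 2" using zero_le_power2[of "norm v - 1"] by (simp add: power2_diff)
    also have "\<dots> \<le> exp ((norm v)\<^sup>2 / 2)" by (rule exp_ge_add_one_self)
    finally have "exp (- (norm v)\<^sup>2) * norm v \<le> exp (- (norm v)\<^sup>2) * exp ((norm v)\<^sup>2 / 2)"
      by (intro mult_left_mono) auto
    also have "\<dots> = exp (- (1/2) * (norm v)\<^sup>2)" unfolding exp_add[symmetric] by simp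
    finally show "ennreal (gauss v) * ennreal (norm v) \<le> ennreal (exp (- (1/2) * (norm v)\<^sup>2 + 2 * Re (0 * v)) / pi)"
      by (simp add: ennreal_mult[symmetric] gauss_def divide_right_mono)
  qed
  also have "\<dots> = ennreal (pi / (1/2) * exp ((norm (0::complex))\<^sup>2 / (1/2)) / pi)"
    using has_bochner_integral_divide_zero[OF gaussian_integral_complex[of "1/2" 0], of pi]
    by (subst nn_integral_eq_integral) (auto simp: has_bochner_integral_iff)
  finally show ?thesis by simp
qed

section \<open>Sums over countable index sets\<close>

abbreviation abs_summable :: "('i \<Rightarrow> complex) \<Rightarrow> bool" where
  "abs_summable f \<equiv> (\<lambda>i. norm (f i)) summable_on UNIV"

text \<open>Extension by zero along \<open>to_nat\<close>. It turns unordered sums over a countable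
  type into series over the naturals, for which measurability and termwise integration are at
  hand.\<close>

definition enum_ext :: "('i :: countable \<Rightarrow> 'b) \<Rightarrow> nat \<Rightarrow> 'b :: zero" where
  "enum_ext f n = (if n \<in> range (to_nat :: 'i \<Rightarrow> nat) then f (from_nat n) else 0)"

lemma enum_ext_to_nat [simp]: "enum_ext f (to_nat i) = f i"
  by (simp add: enum_ext_def)

lemma has_sum_enum_ext:
  fixes f :: "'i :: countable \<Rightarrow> 'b :: {comm_monoid_add, topological_space}"
  shows "(f has_sum s) UNIV \<longleftrightarrow> (enum_ext f has_sum s) UNIV"
proof -
  have "enum_ext f \<circ> to_nat = f" by (simp add: fun_eq_iff)
  then have "(f has_sum s) UNIV \<longleftrightarrow> (enum_ext f \<circ> to_nat has_sum s) (UNIV :: 'i set)" by simp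
  also have "\<dots> \<longleftrightarrow> (enum_ext f has_sum s) (range (to_nat :: 'i \<Rightarrow> nat))"
    by (rule has_sum_reindex[symmetric]) simp
  also have "\<dots> \<longleftrightarrow> (enum_ext f has_sum s) UNIV"
    by (rule has_sum_cong_neutral) (auto simp: enum_ext_def)
  finally show ?thesis .
qed

lemma norm_enum_ext: "norm (enum_ext f n) = enum_ext (\<lambda>i. norm (f i)) n"
  by (simp add: enum_ext_def)

lemma abs_summable_enum_ext:
  fixes f :: "'i :: countable \<Rightarrow> complex"
  shows "abs_summable f \<longleftrightarrow> (\<Sum>n. ennreal (norm (enum_ext f n))) \<noteq> \<top>"
proof -
  have "abs_summable f \<longleftrightarrow> (\<lambda>n. norm (enum_ext f n)) summable_on UNIV"
    unfolding summable_on_def norm_enum_ext using has_sum_enum_ext[of "\<lambda>i. norm (f i)"] by simp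
  also have "\<dots> \<longleftrightarrow> summable (\<lambda>n. norm (enum_ext f n))"
    by (rule summable_on_UNIV_nonneg_real_iff) simp
  also have "\<dots> \<longleftrightarrow> (\<Sum>n. ennreal (norm (enum_ext f n))) \<noteq> \<top>"
  proof
    assume "summable (\<lambda>n. norm (enum_ext f n))"
    from suminf_ennreal2[OF norm_ge_zero this] show "(\<Sum>n. ennreal (norm (enum_ext f n))) \<noteq> \<top>"
      by (metis ennreal_neq_top)
  next
    assume "(\<Sum>n. ennreal (norm (enum_ext f n))) \<noteq> \<top>"
    then show "summable (\<lambda>n. norm (enum_ext f n))"
      by (rule summable_suminf_not_top[OF norm_ge_zero])
  qed
  finally show ?thesis .
qed

text \<open>For complex families unordered summability is absolute summability, so the unordered sum
  is a series where the norms have a finite sum and the default value 0 elsewhere. In this form its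
  measurability in a parameter is evident.\<close>

lemma infsum_enum_ext:
  fixes f :: "'i :: countable \<Rightarrow> complex"
  shows "infsum f UNIV = (if (\<Sum>n. ennreal (norm (enum_ext f n))) \<noteq> \<top> then suminf (enum_ext f) else 0)"
proof (cases "abs_summable f")
  case True
  then have "(f has_sum infsum f UNIV) UNIV" by (simp add: abs_summable_summable)
  then have "enum_ext f sums infsum f UNIV"
    using has_sum_enum_ext has_sum_imp_sums by blast
  then show ?thesis using True abs_summable_enum_ext[of f] by (simp add: sums_iff)
next
  case False
  then have "\<not> f summable_on UNIV" by (simp add: summable_on_iff_abs_summable_on_complex)
  then show ?thesis using False abs_summable_enum_ext[of f] by (simp add: infsum_not_exists)
qed

lemma borel_measurable_infsum_complex:
  fixes f :: "'i :: countable \<Rightarrow> 'a \<Rightarrow> complex"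
  assumes [measurable]: "\<And>i. f i \<in> borel_measurable N"
  shows "(\<lambda>x. \<Sum>\<^sub>\<infinity>i. f i x) \<in> borel_measurable N"
proof -
  have [measurable]: "(\<lambda>x. enum_ext (\<lambda>i. f i x) n) \<in> borel_measurable N" for n
    unfolding enum_ext_def by (cases "n \<in> range (to_nat :: 'i \<Rightarrow> nat)") auto
  show ?thesis unfolding infsum_enum_ext by measurable
qed

section \<open>Gaussian series\<close>

locale gaussian_coefficients = prob_space M for M :: "'w measure" +
  fixes a :: "'i :: countable \<Rightarrow> 'w \<Rightarrow> complex"
  assumes indep: "indep_vars (\<lambda>_. borel) a UNIV"
    and gaussian: "std_complex_gaussian M (a i)"
begin

lemma a_measurable [measurable]: "a i \<in> borel_measurable M"
  using gaussian[of i] unfolding std_complex_gaussian_def distributed_def by simp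

lemma distributed_a: "distributed M lborel (a i) (\<lambda>v. ennreal (gauss v))"
  using gaussian[of i] unfolding std_complex_gaussian_def gauss_def
  by (simp add: divide_ennreal[symmetric] del: divide_ennreal)

lemma char_a: "expectation (\<lambda>\<omega>. iexp (Re (b * a i \<omega>))) = of_real (exp (- (norm b)\<^sup>2 / 4))"
proof -
  have "expectation (\<lambda>\<omega>. iexp (Re (b * a i \<omega>))) = (\<integral>v. gauss v *\<^sub>R iexp (Re (b * v)) \<partial>lborel)"
  proof -
    have "distr M lborel (a i) = density lborel (\<lambda>v. ennreal (gauss v))"
      using distributed_a by (simp add: distributed_def)
    then have "(\<integral>v. iexp (Re (b * v)) \<partial>distr M lborel (a i)) = (\<integral>v. gauss v *\<^sub>R iexp (Re (b * v)) \<partial>lborel)"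
      by (simp only:) (subst integral_density, auto simp: gauss_nonneg)
    then show ?thesis by (subst (asm) integral_distr) auto
  qed
  then show ?thesis
    using gauss_fourier[of b] by (simp add: has_bochner_integral_iff scaleR_conv_of_real)
qed

lemma nn_integral_a: "(\<integral>\<^sup>+ \<omega>. ennreal (norm (a i \<omega>)) \<partial>M) \<le> 2"
  using distributed_nn_integral[OF distributed_a, of "\<lambda>v. ennreal (norm v)" i] nn_integral_norm_gauss by simp

definition series :: "('i \<Rightarrow> complex) \<Rightarrow> 'w \<Rightarrow> complex" where
  "series b \<omega> = (\<Sum>\<^sub>\<infinity>i. a i \<omega> * b i)"

lemma series_measurable [measurable]: "series b \<in> borel_measurable M"
  unfolding series_def by (rule borel_measurable_infsum_complex) measurable

text \<open>The first absolute moments of the \<open>a i\<close> are at most 2, so the expected sum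
  of the norms is finite. Absolute summability of \<open>b\<close> is what makes a first-moment
  argument suffice.\<close>

lemma AE_abs_summable:
  assumes b: "abs_summable b"
  shows "AE \<omega> in M. abs_summable (\<lambda>i. a i \<omega> * b i)"
proof -
  have [measurable]: "(\<lambda>\<omega>. enum_ext (\<lambda>i. a i \<omega> * b i) n) \<in> borel_measurable M" for n
    unfolding enum_ext_def by (cases "n \<in> range (to_nat :: 'i \<Rightarrow> nat)") auto
  have "(\<integral>\<^sup>+ \<omega>. (\<Sum>n. ennreal (norm (enum_ext (\<lambda>i. a i \<omega> * b i) n))) \<partial>M)
      = (\<Sum>n. \<integral>\<^sup>+ \<omega>. ennreal (norm (enum_ext (\<lambda>i. a i \<omega> * b i) n)) \<partial>M)"
    by (rule nn_integral_suminf) measurable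
  also have "\<dots> \<le> (\<Sum>n. 2 * ennreal (norm (enum_ext b n)))"
  proof (intro suminf_le allI summableI)
    fix n
    show "(\<integral>\<^sup>+ \<omega>. ennreal (norm (enum_ext (\<lambda>i. a i \<omega> * b i) n)) \<partial>M) \<le> 2 * ennreal (norm (enum_ext b n))"
      using mult_right_mono[OF nn_integral_a, of "ennreal (norm (b (from_nat n)))"]
      by (auto simp: enum_ext_def norm_mult ennreal_mult nn_integral_multc)
  qed
  also have "\<dots> = 2 * (\<Sum>n. ennreal (norm (enum_ext b n)))" by simp
  also have "\<dots> < \<infinity>" using b unfolding abs_summable_enum_ext by (simp add: ennreal_mult_less_top less_top)
  finally have "AE \<omega> in M. (\<Sum>n. ennreal (norm (enum_ext (\<lambda>i. a i \<omega> * b i) n))) \<noteq> \<infinity>"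
    by (intro nn_integral_PInf_AE) auto
  then show ?thesis unfolding abs_summable_enum_ext by simp
qed

lemma char_series:
  assumes b: "abs_summable b"
  shows "expectation (\<lambda>\<omega>. iexp (Re (series b \<omega>))) = of_real (exp (- (\<Sum>\<^sub>\<infinity>i. (norm (b i))\<^sup>2) / 4))"
proof -
  \<comment> \<open>Initial segments of the enumeration are cofinal among the finite sets, so the
    unordered limit becomes a sequence and dominated convergence applies.\<close>
  define F where "F n = {i :: 'i. to_nat i < n}" for n
  have finF: "finite (F n)" for n
    unfolding F_def by (rule finite_imageD[of to_nat]) (auto intro: finite_subset[of _ "{..<n}"])
  have b2: "(\<lambda>i. (norm (b i))\<^sup>2) summable_on UNIV"
  proof (rule summable_on_comparison_test)
    show "(\<lambda>i. (\<Sum>\<^sub>\<infinity>j. norm (b j)) * norm (b i)) summable_on UNIV"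
      by (rule summable_on_cmult_right[OF b])
    fix i
    have "norm (b i) \<le> (\<Sum>\<^sub>\<infinity>j. norm (b j))"
      using finite_sum_le_infsum[OF b, of "{i}"] by simp
    then show "(norm (b i))\<^sup>2 \<le> (\<Sum>\<^sub>\<infinity>j. norm (b j)) * norm (b i)"
      by (simp add: power2_eq_square mult_right_mono)
  qed simp
  have sum_conv: "(\<lambda>n. sum f (F n)) \<longlonglongrightarrow> infsum f UNIV" if "f summable_on UNIV" for f :: "'i \<Rightarrow> 'b :: {banach}"
  proof -
    have "(sum f \<longlongrightarrow> infsum f UNIV) (finite_subsets_at_top UNIV)"
      using has_sum_infsum[OF that] by (simp add: has_sum_def)
    moreover have "filterlim F (finite_subsets_at_top UNIV) sequentially"
      unfolding filterlim_finite_subsets_at_top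
    proof (intro allI impI)
      fix X :: "'i set" assume X: "finite X \<and> X \<subseteq> UNIV"
      define N where "N = Suc (Max (to_nat ` X))"
      have "X \<subseteq> F n" if "n \<ge> N" for n
      proof
        fix i assume "i \<in> X"
        then have "to_nat i \<le> Max (to_nat ` X)" using X by (intro Max_ge) auto
        then show "i \<in> F n" using that by (simp add: F_def N_def)
      qed
      then show "\<forall>\<^sub>F n in sequentially. finite (F n) \<and> X \<subseteq> F n \<and> F n \<subseteq> UNIV"
        using finF by (auto simp: eventually_at_top_linorder)
    qed
    ultimately show ?thesis by (rule filterlim_compose)
  qed
  have fin: "expectation (\<lambda>\<omega>. iexp (Re (\<Sum>i\<in>F n. a i \<omega> * b i))) = of_real (exp (- (\<Sum>i\<in>F n. (norm (b i))\<^sup>2) / 4))" for n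
  proof -
    have "expectation (\<lambda>\<omega>. iexp (Re (\<Sum>i\<in>F n. a i \<omega> * b i))) = expectation (\<lambda>\<omega>. \<Prod>i\<in>F n. iexp (Re (b i * a i \<omega>)))"
      by (simp add: exp_sum finF sum_distrib_left mult.commute)
    also have "\<dots> = (\<Prod>i\<in>F n. expectation (\<lambda>\<omega>. iexp (Re (b i * a i \<omega>))))"
    proof (rule indep_vars_lebesgue_integral[OF finF])
      show "indep_vars (\<lambda>_. borel) (\<lambda>i \<omega>. iexp (Re (b i * a i \<omega>))) (F n)"
        by (rule indep_vars_compose2[OF indep_vars_subset[OF indep]]) auto
      show "integrable M (\<lambda>\<omega>. iexp (Re (b i * a i \<omega>)))" for i
        by (rule integrable_const_bound[where B = 1]) auto
    qed
    also have "\<dots> = of_real (exp (- (\<Sum>i\<in>F n. (norm (b i))\<^sup>2) / 4))"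
      by (simp only: char_a of_real_prod[symmetric] exp_sum[OF finF, symmetric] sum_divide_distrib[symmetric] sum_negf)
    finally show ?thesis .
  qed
  have "(\<lambda>n. expectation (\<lambda>\<omega>. iexp (Re (\<Sum>i\<in>F n. a i \<omega> * b i)))) \<longlonglongrightarrow> expectation (\<lambda>\<omega>. iexp (Re (series b \<omega>)))"
  proof (rule integral_dominated_convergence[where w = "\<lambda>_. 1"])
    show "AE \<omega> in M. (\<lambda>n. iexp (Re (\<Sum>i\<in>F n. a i \<omega> * b i))) \<longlonglongrightarrow> iexp (Re (series b \<omega>))"
      using AE_abs_summable[OF b]
    proof eventually_elim
      case (elim \<omega>)
      have "(\<lambda>n. \<Sum>i\<in>F n. a i \<omega> * b i) \<longlonglongrightarrow> series b \<omega>"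
        unfolding series_def by (rule sum_conv[OF abs_summable_summable[OF elim]])
      from tendsto_exp[OF tendsto_mult[OF tendsto_const tendsto_of_real[OF tendsto_Re[OF this]]]]
      show ?case .
    qed
    show "AE \<omega> in M. norm (iexp (Re (\<Sum>i\<in>F n. a i \<omega> * b i))) \<le> 1" for n
      by (simp only: norm_exp_i_times order_refl AE_I2)
    show "(\<lambda>\<omega>. iexp (Re (\<Sum>i\<in>F n. a i \<omega> * b i))) \<in> borel_measurable M" for n
      by measurable
    show "(\<lambda>\<omega>. iexp (Re (series b \<omega>))) \<in> borel_measurable M"
      by measurable
    show "integrable M (\<lambda>_. 1 :: real)"
      by simp
  qed
  moreover have "(\<lambda>n. complex_of_real (exp (- (\<Sum>i\<in>F n. (norm (b i))\<^sup>2) / 4))) \<longlonglongrightarrow> of_real (exp (- (\<Sum>\<^sub>\<infinity>i. (norm (b i))\<^sup>2) / 4))"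
    by (rule tendsto_of_real[OF tendsto_exp[OF tendsto_divide[OF tendsto_minus[OF sum_conv[OF b2]] tendsto_const]]]) simp
  ultimately show ?thesis unfolding fin using LIMSEQ_unique by blast
qed

end

section \<open>The reproducing kernel of the ball\<close>

lemma finite_multiindices: "finite {\<alpha> :: 'n :: finite \<Rightarrow> nat. (\<Sum>j\<in>UNIV. \<alpha> j) = k}"
proof (rule finite_subset)
  show "{\<alpha> :: 'n \<Rightarrow> nat. (\<Sum>j\<in>UNIV. \<alpha> j) = k} \<subseteq> PiE UNIV (\<lambda>_. {..k})"
    by (auto simp: PiE_def intro: member_le_sum)
qed (auto intro: finite_PiE)

lemma finite_multiindices_on:
  "finite {\<alpha> :: 'n :: finite \<Rightarrow> nat. (\<forall>j. j \<notin> S \<longrightarrow> \<alpha> j = 0) \<and> (\<Sum>j\<in>S. \<alpha> j) = k}"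
proof (rule finite_subset[OF _ finite_multiindices[of k]])
  have "(\<Sum>j\<in>UNIV. \<alpha> j) = (\<Sum>j\<in>S. \<alpha> j)" if "\<forall>j. j \<notin> S \<longrightarrow> \<alpha> j = 0" for \<alpha> :: "'n \<Rightarrow> nat"
    using that by (intro sum.mono_neutral_right) auto
  then show "{\<alpha>. (\<forall>j. j \<notin> S \<longrightarrow> \<alpha> j = 0) \<and> (\<Sum>j\<in>S. \<alpha> j) = k} \<subseteq> {\<alpha> :: 'n \<Rightarrow> nat. (\<Sum>j\<in>UNIV. \<alpha> j) = k}"
    by auto
qed

text \<open>Induction on \<open>S\<close>: splitting off the exponent of one variable leaves the
  binomial theorem. Requiring \<alpha> to vanish off \<open>S\<close> keeps all index sets inside
  one function type.\<close>

lemma multinomial_on: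
  fixes x :: "'n :: finite \<Rightarrow> 'a :: field_char_0"
  shows "(\<Sum>\<alpha> | (\<forall>j. j \<notin> S \<longrightarrow> \<alpha> j = 0) \<and> (\<Sum>j\<in>S. \<alpha> j) = k. \<Prod>j\<in>S. x j ^ \<alpha> j / fact (\<alpha> j))
    = (\<Sum>j\<in>S. x j) ^ k / fact k"
proof (induction S arbitrary: k rule: finite_induct[OF finite])
  case 1
  have "{\<alpha> :: 'n \<Rightarrow> nat. (\<forall>j. j \<notin> {} \<longrightarrow> \<alpha> j = 0) \<and> (\<Sum>j\<in>{}. \<alpha> j) = k} = (if k = 0 then {\<lambda>_. 0} else {})"
    by auto
  then show ?case by (simp add: power_0_left)
next
  case (2 a S)
  define A where "A S k = {\<alpha> :: 'n \<Rightarrow> nat. (\<forall>j. j \<notin> S \<longrightarrow> \<alpha> j = 0) \<and> (\<Sum>j\<in>S. \<alpha> j) = k}" for S k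
  define P where "P S \<alpha> = (\<Prod>j\<in>S. x j ^ \<alpha> j / fact (\<alpha> j))" for S and \<alpha> :: "'n \<Rightarrow> nat"
  have fin: "finite (A S k)" for S k unfolding A_def by (rule finite_multiindices_on)
  have "(\<Sum>\<alpha>\<in>A (insert a S) k. P (insert a S) \<alpha>)
      = (\<Sum>(i, \<beta>)\<in>(SIGMA i:{..k}. A S (k - i)). x a ^ i / fact i * P S \<beta>)"
  proof (rule sum.reindex_bij_witness[where i = "\<lambda>(i, \<beta>). \<beta>(a := i)" and j = "\<lambda>\<alpha>. (\<alpha> a, \<alpha>(a := 0))"])
    fix \<alpha> assume \<alpha>: "\<alpha> \<in> A (insert a S) k"
    have s: "(\<Sum>j\<in>S. (\<alpha>(a := 0)) j) = (\<Sum>j\<in>S. \<alpha> j)" using \<open>a \<notin> S\<close> by (intro sum.cong) auto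
    have p: "P S (\<alpha>(a := 0)) = P S \<alpha>" using \<open>a \<notin> S\<close> unfolding P_def by (intro prod.cong) auto
    show "(\<lambda>\<alpha>. (\<alpha> a, \<alpha>(a := 0))) \<alpha> \<in> (SIGMA i:{..k}. A S (k - i))"
      using \<alpha> \<open>a \<notin> S\<close> s by (auto simp: A_def)
    show "(case (\<lambda>\<alpha>. (\<alpha> a, \<alpha>(a := 0))) \<alpha> of (i, \<beta>) \<Rightarrow> \<beta>(a := i)) = \<alpha>" by auto
    show "(case (\<lambda>\<alpha>. (\<alpha> a, \<alpha>(a := 0))) \<alpha> of (i, \<beta>) \<Rightarrow> x a ^ i / fact i * P S \<beta>) = P (insert a S) \<alpha>"
      using p \<open>a \<notin> S\<close> by (simp add: P_def)
  next
    fix b assume b: "b \<in> (SIGMA i:{..k}. A S (k - i))"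
    obtain i \<beta> where [simp]: "b = (i, \<beta>)" by (cases b)
    have s: "(\<Sum>j\<in>S. (\<beta>(a := i)) j) = (\<Sum>j\<in>S. \<beta> j)" using \<open>a \<notin> S\<close> by (intro sum.cong) auto
    show "(case b of (i, \<beta>) \<Rightarrow> \<beta>(a := i)) \<in> A (insert a S) k"
      using b \<open>a \<notin> S\<close> s by (auto simp: A_def)
    have "\<beta> a = 0" using b \<open>a \<notin> S\<close> by (auto simp: A_def)
    then show "(\<lambda>\<alpha>. (\<alpha> a, \<alpha>(a := 0))) (case b of (i, \<beta>) \<Rightarrow> \<beta>(a := i)) = b"
      by auto
  qed
  also have "\<dots> = (\<Sum>i\<le>k. \<Sum>\<beta>\<in>A S (k - i). x a ^ i / fact i * P S \<beta>)"
    using fin by (subst sum.Sigma) auto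
  also have "\<dots> = (\<Sum>i\<le>k. x a ^ i / fact i * ((\<Sum>j\<in>S. x j) ^ (k - i) / fact (k - i)))"
    using 2(3) unfolding A_def P_def sum_distrib_left[symmetric] by simp
  also have "\<dots> = (\<Sum>i\<le>k. of_nat (k choose i) * x a ^ i * (\<Sum>j\<in>S. x j) ^ (k - i)) / fact k"
    unfolding sum_divide_distrib by (intro sum.cong) (auto simp: binomial_fact field_simps)
  also have "\<dots> = (\<Sum>j\<in>insert a S. x j) ^ k / fact k"
    using 2 by (simp add: binomial_ring)
  finally show ?case by (simp add: A_def P_def)
qed

definition hyp_weight :: "real \<Rightarrow> ('n :: finite \<Rightarrow> nat) \<Rightarrow> real" where
  "hyp_weight L \<alpha> = Gamma (L + real (\<Sum>j\<in>UNIV. \<alpha> j)) / ((\<Prod>j\<in>UNIV. fact (\<alpha> j)) * Gamma L)"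

lemma hyp_weight_nonneg: "0 < L \<Longrightarrow> 0 \<le> hyp_weight L \<alpha>"
  unfolding hyp_weight_def by (intro divide_nonneg_nonneg mult_nonneg_nonneg prod_nonneg less_imp_le[OF Gamma_real_pos])
    (auto intro!: add_pos_nonneg sum_nonneg)

lemma hyp_coeff_square: "0 < L \<Longrightarrow> (hyp_coeff L \<alpha>)\<^sup>2 = hyp_weight L \<alpha>"
  using hyp_weight_nonneg[of L \<alpha>] unfolding hyp_coeff_def hyp_weight_def by simp

text \<open>The Gamma factor depends only on the degree, so on each degree the weights are
  multinomial up to a constant. The general field allows the norms of the terms to be summed by the
  same identity.\<close>

lemma hyp_weight_sum_degree:
  fixes x :: "'n :: finite \<Rightarrow> 'a :: real_normed_field"
  assumes "0 < L"
  shows "(\<Sum>\<alpha> | (\<Sum>j\<in>UNIV. \<alpha> j) = k. of_real (hyp_weight L \<alpha>) * (\<Prod>j\<in>UNIV. x j ^ \<alpha> j))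
    = of_real (pochhammer L k / fact k) * (\<Sum>j\<in>UNIV. x j) ^ k"
proof -
  have "L \<notin> \<int>\<^sub>\<le>\<^sub>0" using assms by (auto elim!: nonpos_Ints_cases)
  then have p: "pochhammer L k = Gamma (L + real k) / Gamma L" by (rule pochhammer_Gamma)
  have "(\<Sum>\<alpha> | (\<Sum>j\<in>UNIV. \<alpha> j) = k. of_real (hyp_weight L \<alpha>) * (\<Prod>j\<in>UNIV. x j ^ \<alpha> j))
    = (\<Sum>\<alpha> | (\<Sum>j\<in>UNIV. \<alpha> j) = k. of_real (pochhammer L k) * (\<Prod>j\<in>UNIV. x j ^ \<alpha> j / fact (\<alpha> j)))"
    by (intro sum.cong) (auto simp: hyp_weight_def p prod_dividef field_simps)
  also have "\<dots> = of_real (pochhammer L k) * ((\<Sum>j\<in>UNIV. x j) ^ k / fact k)"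
    using multinomial_on[where S = UNIV and k = k and x = x] by (simp add: sum_distrib_left[symmetric])
  finally show ?thesis by simp
qed

lemma binomial_series_pochhammer:
  fixes s :: complex
  assumes "norm s < 1"
  shows "(\<lambda>k. of_real (pochhammer L k / fact k) * s ^ k) sums (1 - s) powr (- of_real L)"
proof -
  have "(\<lambda>k. ((- of_real L) gchoose k) * (- s) ^ k) sums (1 + (- s)) powr (- of_real L)"
    using assms by (intro gen_binomial_complex) simp
  moreover have "((- of_real L :: complex) gchoose k) * (- s) ^ k = of_real (pochhammer L k / fact k) * s ^ k" for k
  proof -
    have "((- of_real L :: complex) gchoose k) = (- 1) ^ k * of_real (pochhammer L k) / fact k"
      by (simp add: gbinomial_pochhammer pochhammer_of_real)
    moreover have "(- 1) ^ k * (- s) ^ k = s ^ k" by (simp flip: power_mult_distrib)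
    ultimately show ?thesis by (simp add: mult_ac)
  qed
  ultimately show ?thesis by simp
qed

lemma bij_betw_multiindices: "bij_betw snd (SIGMA k:UNIV. {\<alpha> :: 'n :: finite \<Rightarrow> nat. (\<Sum>j\<in>UNIV. \<alpha> j) = k}) UNIV"
  by (auto simp: bij_betw_def inj_on_def image_iff)

text \<open>Grouping by degree reduces the kernel to a binomial series in the sum of the
  \<open>x j\<close>. The hypothesis on the norms makes the family absolutely summable, which
  justifies the grouping; for \<open>x j = z $ j * cnj (w $ j)\<close> with points of the ball it
  holds by Cauchy-Schwarz.\<close>

lemma kernel_series:
  fixes x :: "'n :: finite \<Rightarrow> complex"
  assumes L: "0 < L" and x: "(\<Sum>j\<in>UNIV. norm (x j)) < 1"
  defines "t \<equiv> \<lambda>\<alpha>. of_real (hyp_weight L \<alpha>) * (\<Prod>j\<in>UNIV. x j ^ \<alpha> j)"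
  shows "abs_summable t" and "(t has_sum (1 - (\<Sum>j\<in>UNIV. x j)) powr (- of_real L)) UNIV"
proof -
  define A where "A k = {\<alpha> :: 'n \<Rightarrow> nat. (\<Sum>j\<in>UNIV. \<alpha> j) = k}" for k
  define s where "s = (\<Sum>j\<in>UNIV. x j)"
  define r where "r = (\<Sum>j\<in>UNIV. norm (x j))"
  have fin: "finite (A k)" for k unfolding A_def by (rule finite_multiindices)
  have r: "0 \<le> r" "r < 1" using x by (auto simp: r_def sum_nonneg)
  have s: "norm s < 1" unfolding s_def using norm_sum[of x UNIV] x by simp
  have poch: "0 \<le> pochhammer L k" for k using L by (intro pochhammer_nonneg) auto
  have nt: "norm (t \<alpha>) = hyp_weight L \<alpha> * (\<Prod>j\<in>UNIV. norm (x j) ^ \<alpha> j)" for \<alpha>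
    using hyp_weight_nonneg[OF L, of \<alpha>] by (simp add: t_def norm_mult prod_norm[symmetric] norm_power)
  have deg_norm: "(\<Sum>\<alpha>\<in>A k. norm (t \<alpha>)) = pochhammer L k / fact k * r ^ k" for k
    using hyp_weight_sum_degree[OF L, where x = "\<lambda>j. norm (x j)" and k = k] by (simp add: nt A_def r_def)
  have "summable (\<lambda>k. complex_of_real (pochhammer L k / fact k * r ^ k))"
    using sums_summable[OF binomial_series_pochhammer[of "of_real r" L]] r by simp
  then have "summable (\<lambda>k. pochhammer L k / fact k * r ^ k)"
    by (simp only: summable_complex_of_real)
  then have sr: "(\<lambda>k. pochhammer L k / fact k * r ^ k) summable_on UNIV"
    using poch r by (subst summable_on_UNIV_nonneg_real_iff) auto
  have "(\<lambda>p. norm (t (snd p))) summable_on (SIGMA k:UNIV. A k)"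
  proof -
    have "(\<lambda>\<alpha>. norm (t \<alpha>)) summable_on A k" for k using fin by (rule summable_on_finite)
    moreover have "(\<lambda>k. norm (\<Sum>\<^sub>\<infinity>\<alpha>\<in>A k. norm (t \<alpha>))) summable_on UNIV"
      using sr poch r by (simp add: fin deg_norm)
    ultimately show ?thesis
      using Infinite_Sum.abs_summable_on_Sigma_iff[where f = "\<lambda>p. t (snd p)" and A = UNIV and B = A] by simp
  qed
  then have sig: "(\<lambda>p. norm (t (snd p))) summable_on (SIGMA k:UNIV. A k)" .
  then show 1: "abs_summable t"
    using summable_on_reindex_bij_betw[OF bij_betw_multiindices, where f = "\<lambda>\<alpha>. norm (t \<alpha>)"] by (simp add: A_def)
  have "infsum t UNIV = infsum (\<lambda>p. t (snd p)) (SIGMA k:UNIV. A k)"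
    using infsum_reindex_bij_betw[OF bij_betw_multiindices, where f = t] by (simp add: A_def)
  also have "\<dots> = (\<Sum>\<^sub>\<infinity>k. \<Sum>\<^sub>\<infinity>\<alpha>\<in>A k. t \<alpha>)"
    using infsum_Sigma_banach[where f = "\<lambda>p. t (snd p)" and A = UNIV and B = A] abs_summable_summable[OF sig] by simp
  also have "\<dots> = (\<Sum>\<^sub>\<infinity>k. of_real (pochhammer L k / fact k) * s ^ k)"
    using hyp_weight_sum_degree[OF L, where x = x]
    by (simp only: infsum_finite[OF fin]) (simp only: A_def t_def s_def)
  also have "\<dots> = (1 - s) powr (- of_real L)"
  proof (rule infsumI, rule norm_summable_imp_has_sum)
    have "norm s \<le> r" unfolding s_def r_def by (rule norm_sum)
    show "summable (\<lambda>k. norm (of_real (pochhammer L k / fact k) * s ^ k))"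
    proof (rule summable_comparison_test')
      show "summable (\<lambda>k. pochhammer L k / fact k * r ^ k)" by fact
      fix k
      have "pochhammer L k / fact k * norm s ^ k \<le> pochhammer L k / fact k * r ^ k"
        using poch \<open>norm s \<le> r\<close> by (intro mult_left_mono power_mono) auto
      then show "norm (norm (complex_of_real (pochhammer L k / fact k) * s ^ k)) \<le> pochhammer L k / fact k * r ^ k"
        using poch[of k] by (simp add: norm_mult norm_power norm_divide)
    qed
    show "(\<lambda>k. of_real (pochhammer L k / fact k) * s ^ k) sums (1 - s) powr (- of_real L)"
      by (rule binomial_series_pochhammer[OF s])
  qed
  finally show "(t has_sum (1 - (\<Sum>j\<in>UNIV. x j)) powr (- of_real L)) UNIV"
    using has_sum_infsum[OF abs_summable_summable[OF 1]] by (simp add: s_def)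
qed

text \<open>Every finite set of multi-indices lies in a box, and over a box the sum is a product of
  partial geometric sums.\<close>

lemma summable_geometric_multi:
  fixes u :: "'n :: finite \<Rightarrow> real"
  assumes u: "\<And>j. 0 \<le> u j" "\<And>j. u j < 1"
  shows "(\<lambda>\<alpha>. \<Prod>j\<in>UNIV. u j ^ \<alpha> j) summable_on UNIV"
proof (rule nonneg_bdd_above_summable_on)
  show "bdd_above (sum (\<lambda>\<alpha>. \<Prod>j\<in>UNIV. u j ^ \<alpha> j) ` {F. F \<subseteq> UNIV \<and> finite F})"
  proof (rule bdd_aboveI2)
    fix F :: "('n \<Rightarrow> nat) set" assume "F \<in> {F. F \<subseteq> UNIV \<and> finite F}"
    then have F: "finite F" by simp
    define N where "N = Max (insert 0 ((\<lambda>\<alpha>. Max (range \<alpha>)) ` F))"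
    have "\<alpha> j \<le> N" if "\<alpha> \<in> F" for \<alpha> j
    proof -
      have "\<alpha> j \<le> Max (range \<alpha>)" by (intro Max_ge) auto
      also have "\<dots> \<le> N" unfolding N_def using F that by (intro Max_ge) auto
      finally show ?thesis .
    qed
    then have sub: "F \<subseteq> PiE UNIV (\<lambda>_. {..N})" by auto
    have "sum (\<lambda>\<alpha>. \<Prod>j\<in>UNIV. u j ^ \<alpha> j) F \<le> (\<Sum>\<alpha>\<in>PiE UNIV (\<lambda>_. {..N}). \<Prod>j\<in>UNIV. u j ^ \<alpha> j)"
      using u by (intro sum_mono2 sub finite_PiE) (auto intro: prod_nonneg)
    also have "\<dots> = (\<Prod>j\<in>UNIV. \<Sum>i\<le>N. u j ^ i)"
      by (subst prod_sum_PiE) auto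
    also have "\<dots> \<le> (\<Prod>j\<in>UNIV. 1 / (1 - u j))"
    proof (intro prod_mono conjI)
      fix j :: 'n
      show "0 \<le> (\<Sum>i\<le>N. u j ^ i)" using u by (intro sum_nonneg) auto
      have "(\<Sum>i\<le>N. u j ^ i) \<le> (\<Sum>i. u j ^ i)"
        using u by (intro sum_le_suminf summable_geometric) auto
      also have "\<dots> = 1 / (1 - u j)" using u[of j] by (intro suminf_geometric) auto
      finally show "(\<Sum>i\<le>N. u j ^ i) \<le> 1 / (1 - u j)" .
    qed
    finally show "sum (\<lambda>\<alpha>. \<Prod>j\<in>UNIV. u j ^ \<alpha> j) F \<le> (\<Prod>j\<in>UNIV. 1 / (1 - u j))" .
  qed
qed (use u in \<open>auto intro: prod_nonneg\<close>)

subsection \<open>Normalised evaluation vectors\<close>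

text \<open>
  Points outside the ball are sent to the origin, so that \<open>evec L z\<close> is a unit vector of
  \<open>\<ell>\<^sup>2\<close> for every \<open>z\<close>; only \<open>z\<close> in the ball matters.
\<close>

definition ball_proj :: "complex ^ 'n :: finite \<Rightarrow> complex ^ 'n" where
  "ball_proj z = (if norm z < 1 then z else 0)"

definition evec :: "real \<Rightarrow> complex ^ 'n :: finite \<Rightarrow> ('n \<Rightarrow> nat) \<Rightarrow> complex" where
  "evec L z \<alpha> = of_real ((1 - (norm (ball_proj z))\<^sup>2) powr (L / 2)) *
     (of_real (hyp_coeff L \<alpha>) * (\<Prod>j\<in>UNIV. (ball_proj z $ j) ^ \<alpha> j))"

definition hermitian :: "complex ^ 'n :: finite \<Rightarrow> complex ^ 'n \<Rightarrow> complex" where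
  "hermitian z w = (\<Sum>j\<in>UNIV. z $ j * cnj (w $ j))"

text \<open>Kept as an inner product of coefficient families: in this form it is the covariance of
  the series, and Hermitian symmetry and measurability hold at every pair of points. The closed form
  inside the ball is \<open>corr_eq\<close>.\<close>

definition corr :: "real \<Rightarrow> complex ^ 'n :: finite \<Rightarrow> complex ^ 'n \<Rightarrow> complex" where
  "corr L z w = (\<Sum>\<^sub>\<infinity>\<alpha>. evec L z \<alpha> * cnj (evec L w \<alpha>))"

lemma norm_ball_proj: "norm (ball_proj z) < 1"
  by (simp add: ball_proj_def)

lemma norm_vec_square: "(norm z)\<^sup>2 = (\<Sum>j\<in>UNIV. (norm (z $ j))\<^sup>2)" for z :: "complex ^ 'n :: finite"
  by (simp add: norm_vec_def L2_set_def sum_nonneg)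

lemma sum_norm_mult_le: "(\<Sum>j\<in>UNIV. norm (z $ j * cnj (w $ j))) \<le> norm z * norm w" for z w :: "complex ^ 'n :: finite"
  using L2_set_mult_ineq[of "\<lambda>j. norm (z $ j)" "\<lambda>j. norm (w $ j)" UNIV]
  by (simp add: norm_vec_def norm_mult)

lemma norm_hermitian_le: "norm (hermitian z w) \<le> norm z * norm w"
  unfolding hermitian_def by (rule order_trans[OF norm_sum sum_norm_mult_le])

lemma hermitian_self: "hermitian z z = of_real ((norm z)\<^sup>2)"
  unfolding hermitian_def norm_vec_square of_real_sum by (intro sum.cong refl) (rule complex_norm_square[symmetric])

lemma norm_diff_square: "(norm (z - w))\<^sup>2 = (norm z)\<^sup>2 + (norm w)\<^sup>2 - 2 * Re (hermitian z w)"
proof -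
  have "(norm (z $ j - w $ j))\<^sup>2 = (norm (z $ j))\<^sup>2 + (norm (w $ j))\<^sup>2 - 2 * Re (z $ j * cnj (w $ j))" for j
    unfolding cmod_power2 by (simp add: power2_eq_square algebra_simps)
  then show ?thesis
    unfolding norm_vec_square hermitian_def
    by (simp add: sum.distrib sum_subtractf sum_distrib_left)
qed

text \<open>The kernel only gives square summability. Scaling the point by \<open>1 / t\<close> with
  \<open>norm p < t < 1\<close> keeps it in the ball, and the compensating factor, \<open>t\<close>
  to the degree, is square summable too; so the product is summable by
  \<open>A * B \<le> A\<^sup>2 + B\<^sup>2\<close>.\<close>

lemma evec_abs_summable:
  fixes z :: "complex ^ 'n :: finite"
  assumes L: "0 < L"
  shows "abs_summable (evec L z)"
proof -
  define p where "p = ball_proj z"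
  \<comment> \<open>The square of \<open>t\<close> is the midpoint of
    \<open>(norm p)\<^sup>2\<close> and 1; thus \<open>t\<close> is positive also for
    \<open>p = 0\<close>.\<close>
  define t where "t = sqrt ((1 + (norm p)\<^sup>2) / 2)"
  have np: "norm p < 1" unfolding p_def by (rule norm_ball_proj)
  then have np2: "(norm p)\<^sup>2 < 1" by (simp add: abs_square_less_1)
  have t2: "t\<^sup>2 = (1 + (norm p)\<^sup>2) / 2" by (simp add: t_def add_nonneg_nonneg)
  have t: "0 < t" unfolding t_def by (simp add: add_pos_nonneg)
  have t1: "t\<^sup>2 < 1" "(norm p)\<^sup>2 < t\<^sup>2" using np2 by (auto simp: t2)
  have s1: "abs_summable (\<lambda>\<alpha>. of_real (hyp_weight L \<alpha>) * (\<Prod>j\<in>UNIV. (complex_of_real ((norm (p $ j))\<^sup>2 / t\<^sup>2)) ^ \<alpha> j))"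
  proof (rule kernel_series(1)[OF L])
    have "(\<Sum>j\<in>UNIV. norm (complex_of_real ((norm (p $ j))\<^sup>2 / t\<^sup>2))) = (norm p)\<^sup>2 / t\<^sup>2"
      by (simp add: norm_divide norm_power norm_vec_square sum_divide_distrib)
    also have "\<dots> < 1" using t1 t by simp
    finally show "(\<Sum>j\<in>UNIV. norm (complex_of_real ((norm (p $ j))\<^sup>2 / t\<^sup>2))) < 1" .
  qed
  have n1: "norm (of_real (hyp_weight L \<alpha>) * (\<Prod>j\<in>UNIV. (complex_of_real ((norm (p $ j))\<^sup>2 / t\<^sup>2)) ^ \<alpha> j))
      = (hyp_coeff L \<alpha> * (\<Prod>j\<in>UNIV. (norm (p $ j) / t) ^ \<alpha> j))\<^sup>2" for \<alpha>
    using hyp_weight_nonneg[OF L, of \<alpha>] t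
    by (simp add: norm_mult prod_norm[symmetric] norm_power norm_divide power_mult_distrib hyp_coeff_square[OF L]
        prod_power_distrib power_divide power_even_eq[symmetric] mult.commute flip: power_mult)
  have s2: "(\<lambda>\<alpha>. \<Prod>j\<in>(UNIV :: 'n set). (t\<^sup>2) ^ \<alpha> j) summable_on UNIV"
    using t1 by (intro summable_geometric_multi) auto
  have n2: "(\<Prod>j\<in>(UNIV :: 'n set). (t\<^sup>2) ^ \<alpha> j) = (\<Prod>j\<in>UNIV. t ^ \<alpha> j)\<^sup>2" for \<alpha>
    by (simp add: prod_power_distrib mult.commute flip: power_mult)
  have s3: "(\<lambda>\<alpha>. (hyp_coeff L \<alpha> * (\<Prod>j\<in>UNIV. (norm (p $ j) / t) ^ \<alpha> j))\<^sup>2 + (\<Prod>j\<in>UNIV. t ^ \<alpha> j)\<^sup>2) summable_on UNIV"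
    using summable_on_add[OF s1[unfolded n1] s2[unfolded n2]] .
  have s4: "(\<lambda>\<alpha>. hyp_coeff L \<alpha> * (\<Prod>j\<in>UNIV. norm (p $ j) ^ \<alpha> j)) summable_on UNIV"
  proof (rule summable_on_comparison_test[OF s3])
    fix \<alpha> :: "'n \<Rightarrow> nat"
    have h: "0 \<le> hyp_coeff L \<alpha>" using hyp_weight_nonneg[OF L, of \<alpha>] by (simp add: hyp_coeff_def hyp_weight_def)
    then show "0 \<le> hyp_coeff L \<alpha> * (\<Prod>j\<in>UNIV. norm (p $ j) ^ \<alpha> j)" by (auto intro!: mult_nonneg_nonneg prod_nonneg)
    define A where "A = hyp_coeff L \<alpha> * (\<Prod>j\<in>UNIV. (norm (p $ j) / t) ^ \<alpha> j)"
    define B where "B = (\<Prod>j\<in>(UNIV :: 'n set). t ^ \<alpha> j)"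
    have AB: "0 \<le> A" "0 \<le> B" using h t unfolding A_def B_def by (auto intro!: mult_nonneg_nonneg prod_nonneg)
    have "hyp_coeff L \<alpha> * (\<Prod>j\<in>UNIV. norm (p $ j) ^ \<alpha> j) = A * B"
      unfolding A_def B_def using t by (simp add: power_divide prod_dividef)
    also have "\<dots> \<le> A\<^sup>2 + B\<^sup>2" using AB sum_squares_bound[of A B] mult_nonneg_nonneg[OF AB] by linarith
    finally show "hyp_coeff L \<alpha> * (\<Prod>j\<in>UNIV. norm (p $ j) ^ \<alpha> j) \<le> A\<^sup>2 + B\<^sup>2" .
  qed
  have "norm (evec L z \<alpha>) = (1 - (norm p)\<^sup>2) powr (L / 2) * (hyp_coeff L \<alpha> * (\<Prod>j\<in>UNIV. norm (p $ j) ^ \<alpha> j))" for \<alpha>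
    using hyp_weight_nonneg[OF L, of \<alpha>]
    by (simp add: evec_def p_def[symmetric] norm_mult prod_norm[symmetric] norm_power hyp_coeff_def hyp_weight_def)
  then show ?thesis using summable_on_cmult_right[OF s4] by simp
qed

lemma corr_eq:
  assumes L: "0 < L" and z: "norm z < 1" and w: "norm w < 1"
  shows "corr L z w = of_real ((1 - (norm z)\<^sup>2) powr (L / 2) * (1 - (norm w)\<^sup>2) powr (L / 2)) * (1 - hermitian z w) powr (- of_real L)"
proof -
  have "(\<Sum>j\<in>UNIV. norm (z $ j * cnj (w $ j))) < 1"
    using sum_norm_mult_le[of z w] mult_strict_mono[OF z w] by simp
  from kernel_series(2)[OF L this]
  have *: "((\<lambda>\<alpha>. of_real (hyp_weight L \<alpha>) * (\<Prod>j\<in>UNIV. (z $ j * cnj (w $ j)) ^ \<alpha> j)) has_sum (1 - hermitian z w) powr (- of_real L)) UNIV"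
    by (simp add: hermitian_def)
  have "evec L z \<alpha> * cnj (evec L w \<alpha>) = of_real ((1 - (norm z)\<^sup>2) powr (L / 2) * (1 - (norm w)\<^sup>2) powr (L / 2)) *
      (of_real (hyp_weight L \<alpha>) * (\<Prod>j\<in>UNIV. (z $ j * cnj (w $ j)) ^ \<alpha> j))" for \<alpha>
    using z w by (simp add: evec_def ball_proj_def hyp_coeff_square[OF L, symmetric] power2_eq_square prod.distrib power_mult_distrib mult_ac)
  then show ?thesis unfolding corr_def using has_sum_cmult_right[OF *] by (simp add: infsumI)
qed

lemma corr_ball_proj: "corr L (ball_proj z) (ball_proj w) = corr L z w"
  by (simp add: corr_def evec_def ball_proj_def)

lemma corr_self:
  assumes L: "0 < L"
  shows "corr L z z = 1"
proof -
  define p where "p = ball_proj z"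
  have p: "norm p < 1" unfolding p_def by (rule norm_ball_proj)
  then have p2: "(norm p)\<^sup>2 < 1" by (simp add: abs_square_less_1)
  have "corr L p p = of_real ((1 - (norm p)\<^sup>2) powr (L / 2) * (1 - (norm p)\<^sup>2) powr (L / 2)) * of_real ((1 - (norm p)\<^sup>2) powr (- L))"
    using p2 powr_of_real[of "1 - (norm p)\<^sup>2" "- L"]
    by (simp add: corr_eq[OF L p p] hermitian_self del: of_real_power of_real_mult)
  also have "\<dots> = of_real ((1 - (norm p)\<^sup>2) powr (L / 2 + L / 2 - L))"
    using p2 unfolding of_real_mult[symmetric] powr_add[symmetric] by simp
  also have "\<dots> = 1" using p2 by simp
  finally show ?thesis by (simp add: p_def corr_ball_proj)
qed

text \<open>The exponent is real, so the argument of the base, and with it the choice of branch,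
  drops out of the modulus.\<close>

lemma norm_corr:
  assumes L: "0 < L" and z: "norm z < 1" and w: "norm w < 1"
  shows "(norm (corr L z w))\<^sup>2 = ((1 - (norm z)\<^sup>2) * (1 - (norm w)\<^sup>2) / (norm (1 - hermitian z w))\<^sup>2) powr L"
proof -
  have z2: "(norm z)\<^sup>2 < 1" and w2: "(norm w)\<^sup>2 < 1" using z w by (simp_all add: abs_square_less_1)
  have "norm (hermitian z w) < 1"
    using norm_hermitian_le[of z w] mult_strict_mono[OF z w] by (auto intro: le_less_trans)
  then have h: "1 - hermitian z w \<noteq> 0" by auto
  have "norm (corr L z w) = (1 - (norm z)\<^sup>2) powr (L / 2) * (1 - (norm w)\<^sup>2) powr (L / 2) * norm (1 - hermitian z w) powr (- L)"
    using norm_powr_real_powr'[of "- of_real L" "1 - hermitian z w"]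
    by (simp add: corr_eq[OF L z w] norm_mult)
  then have "(norm (corr L z w))\<^sup>2 = ((1 - (norm z)\<^sup>2) powr (L / 2))\<^sup>2 * ((1 - (norm w)\<^sup>2) powr (L / 2))\<^sup>2 * (norm (1 - hermitian z w) powr (- L))\<^sup>2"
    by (simp add: power_mult_distrib)
  also have "\<dots> = (1 - (norm z)\<^sup>2) powr L * (1 - (norm w)\<^sup>2) powr L * ((norm (1 - hermitian z w))\<^sup>2) powr (- L)"
    using z2 w2 h by (simp add: power2_eq_square powr_mult powr_add[symmetric])
  also have "\<dots> = ((1 - (norm z)\<^sup>2) * (1 - (norm w)\<^sup>2) / (norm (1 - hermitian z w))\<^sup>2) powr L"
    using z2 w2 h by (simp add: powr_mult powr_divide powr_minus_divide)
  finally show ?thesis .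
qed

text \<open>
  With \<open>d = |z - w|\<^sup>2\<close> and \<open>c = \<langle>z, w\<rangle>\<close>, the gap \<open>|1 - c|\<^sup>2 - (1 - |z|\<^sup>2) (1 - |w|\<^sup>2)\<close> equals
  \<open>d - (|z|\<^sup>2 |w|\<^sup>2 - |c|\<^sup>2)\<close>, and the bracket is at most \<open>|z|\<^sup>2 d\<close>.
\<close>

lemma hyp_gap:
  "(norm (1 - hermitian z w))\<^sup>2 - (1 - (norm z)\<^sup>2) * (1 - (norm w)\<^sup>2)
    = (norm (z - w))\<^sup>2 - ((norm z)\<^sup>2 * (norm w)\<^sup>2 - (norm (hermitian z w))\<^sup>2)"
  unfolding norm_diff_square cmod_power2 by (simp add: power2_eq_square algebra_simps)

lemma hyp_gap_ge:
  "(1 - (norm z)\<^sup>2) * (norm (z - w))\<^sup>2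
    \<le> (norm (1 - hermitian z w))\<^sup>2 - (1 - (norm z)\<^sup>2) * (1 - (norm w)\<^sup>2)"
proof -
  \<comment> \<open>The two sides of the claim differ by exactly this square.\<close>
  have "0 \<le> (norm (of_real ((norm z)\<^sup>2) - hermitian z w))\<^sup>2" by simp
  then show ?thesis
    unfolding hyp_gap norm_diff_square cmod_power2 by (simp add: power2_eq_square algebra_simps)
qed

lemma hyp_gap_le:
  "(norm (1 - hermitian z w))\<^sup>2 - (1 - (norm z)\<^sup>2) * (1 - (norm w)\<^sup>2) \<le> (norm (z - w))\<^sup>2"
proof -
  have "(norm (hermitian z w))\<^sup>2 \<le> (norm z * norm w)\<^sup>2"
    by (intro power_mono norm_hermitian_le) auto
  then show ?thesis unfolding hyp_gap by (simp add: power_mult_distrib)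
qed

text \<open>The squared modulus is \<open>(P / Q) powr L\<close>. The gap bound with
  \<open>Q \<le> 4\<close> gives \<open>(1 - r\<^sup>2) * d / 4 \<le> 1 - P / Q\<close>, and
  \<open>1 - x \<le> exp (- x)\<close> does the rest; taking the root turns 4 into 8.\<close>

lemma norm_corr_le:
  assumes L: "0 < L" and z: "norm z \<le> r" and w: "norm w \<le> r" and r: "r < 1"
  shows "norm (corr L z w) \<le> exp (- (L * (1 - r\<^sup>2) / 8) * (norm (z - w))\<^sup>2)"
proof -
  have r0: "0 \<le> r" using z norm_ge_zero order_trans by blast
  have z1: "norm z < 1" and w1: "norm w < 1" using z w r by auto
  have z2: "(norm z)\<^sup>2 \<le> r\<^sup>2" using z by (intro power_mono) auto
  have r2: "r\<^sup>2 < 1" using r r0 by (simp add: abs_square_less_1)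
  have z3: "(norm z)\<^sup>2 < 1" and w3: "(norm w)\<^sup>2 < 1" using z1 w1 by (simp_all add: abs_square_less_1)
  define P where "P = (1 - (norm z)\<^sup>2) * (1 - (norm w)\<^sup>2)"
  define Q where "Q = (norm (1 - hermitian z w))\<^sup>2"
  define d where "d = (norm (z - w))\<^sup>2"
  have h: "norm (hermitian z w) < 1"
    using norm_hermitian_le[of z w] mult_strict_mono[OF z1 w1] by (auto intro: le_less_trans)
  then have Q0: "0 < Q" unfolding Q_def by auto
  have "norm (1 - hermitian z w) \<le> 2" using h norm_triangle_ineq4[of 1 "hermitian z w"] by simp
  then have "Q \<le> 2\<^sup>2" unfolding Q_def by (intro power_mono) auto
  then have Q4: "Q \<le> 4" by simp
  have P0: "0 < P" unfolding P_def using z3 w3 by simp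
  have "(1 - r\<^sup>2) * d \<le> (1 - (norm z)\<^sup>2) * d" using z2 by (intro mult_right_mono) (auto simp: d_def)
  also have "\<dots> \<le> Q - P" unfolding Q_def P_def d_def by (rule hyp_gap_ge)
  finally have gap: "(1 - r\<^sup>2) * d \<le> Q - P" .
  have "(1 - r\<^sup>2) * d / 4 \<le> (1 - r\<^sup>2) * d / Q" using Q0 Q4 r2 by (intro divide_left_mono) (auto simp: d_def)
  also have "\<dots> \<le> (Q - P) / Q" using gap Q0 by (intro divide_right_mono) auto
  also have "\<dots> = 1 - P / Q" using Q0 by (simp add: diff_divide_distrib)
  finally have "P / Q \<le> 1 + (- ((1 - r\<^sup>2) * d / 4))" by simp
  also have "\<dots> \<le> exp (- ((1 - r\<^sup>2) * d / 4))" by (rule exp_ge_add_one_self)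
  finally have "(P / Q) powr L \<le> exp (- ((1 - r\<^sup>2) * d / 4)) powr L"
    using L P0 Q0 by (intro powr_mono2) auto
  then have "(norm (corr L z w))\<^sup>2 \<le> exp (- ((1 - r\<^sup>2) * d / 4) * L)"
    unfolding norm_corr[OF L z1 w1] P_def Q_def by (simp add: exp_powr_real)
  also have "\<dots> = (exp (- (L * (1 - r\<^sup>2) / 8) * d))\<^sup>2"
    unfolding exp_double[symmetric] by (simp add: field_simps)
  finally show ?thesis unfolding d_def by (rule power2_le_imp_le) simp
qed

text \<open>At distances of order \<open>1 / sqrt L\<close> the correlation stays bounded below.
  Since \<open>(1 - r\<^sup>2)\<^sup>2 \<le> Q\<close>, the hypothesis on the distance gives
  \<open>1 - x \<le> P / Q\<close> with \<open>x = 1 / (2 * L)\<close>, and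
  \<open>- 2 * x \<le> ln (1 - x)\<close> for \<open>x \<le> 1 / 2\<close>, which is where
  \<open>1 \<le> L\<close> enters.\<close>

lemma norm_corr_ge:
  assumes L: "1 \<le> L" and z: "norm z \<le> r" and w: "norm w \<le> r" and r: "r < 1"
    and d: "(norm (z - w))\<^sup>2 \<le> (1 - r\<^sup>2)\<^sup>2 / (2 * L)"
  shows "exp (- 1) \<le> (norm (corr L z w))\<^sup>2"
proof -
  have r0: "0 \<le> r" using z norm_ge_zero order_trans by blast
  have z1: "norm z < 1" and w1: "norm w < 1" using z w r by auto
  have r2: "r\<^sup>2 < 1" using r r0 by (simp add: abs_square_less_1)
  define P where "P = (1 - (norm z)\<^sup>2) * (1 - (norm w)\<^sup>2)"
  define Q where "Q = (norm (1 - hermitian z w))\<^sup>2"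
  have "norm (hermitian z w) \<le> r\<^sup>2"
    using norm_hermitian_le[of z w] mult_mono[OF z w r0 norm_ge_zero] by (simp add: power2_eq_square)
  moreover have "1 - norm (hermitian z w) \<le> norm (1 - hermitian z w)" using norm_triangle_ineq2[of 1 "hermitian z w"] by simp
  ultimately have "1 - r\<^sup>2 \<le> norm (1 - hermitian z w)" by linarith
  then have Q: "(1 - r\<^sup>2)\<^sup>2 \<le> Q" unfolding Q_def using r2 by (intro power_mono) auto
  moreover have "0 < (1 - r\<^sup>2)\<^sup>2" using r2 by simp
  ultimately have Q0: "0 < Q" by linarith
  define x where "x = 1 / (2 * L)"
  have x: "0 \<le> x" "x \<le> 1 / 2" using L by (auto simp: x_def field_simps)
  have "Q - P \<le> (norm (z - w))\<^sup>2" unfolding Q_def P_def by (rule hyp_gap_le)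
  also have "\<dots> \<le> (1 - r\<^sup>2)\<^sup>2 * x" using d by (simp add: x_def)
  also have "\<dots> \<le> Q * x" using Q x by (intro mult_right_mono) auto
  finally have PQ: "1 - x \<le> P / Q" using Q0 by (simp add: field_simps)
  have "- x - 2 * x\<^sup>2 \<le> ln (1 - x)" by (rule ln_one_minus_pos_lower_bound[OF x])
  moreover have "2 * x\<^sup>2 \<le> x" using mult_left_mono[OF x(2) x(1)] by (simp add: power2_eq_square)
  ultimately have "L * (- 2 * x) \<le> L * ln (1 - x)" using L by (intro mult_left_mono) auto
  then have "- 1 \<le> L * ln (1 - x)" using L by (simp add: x_def)
  then have "exp (- 1) \<le> (1 - x) powr L" using x by (simp add: powr_def mult.commute)
  also have "\<dots> \<le> (P / Q) powr L" using PQ x L by (intro powr_mono2) auto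
  finally show ?thesis using L by (subst norm_corr[OF _ z1 w1]) (auto simp: P_def Q_def)
qed

subsection \<open>Joint characteristic functions of the series\<close>

lemma abs_summable_inner:
  fixes b b' :: "'i \<Rightarrow> complex"
  assumes b: "abs_summable b" and b': "abs_summable b'"
  shows "abs_summable (\<lambda>i. b i * cnj (b' i))"
proof (rule summable_on_comparison_test)
  show "(\<lambda>i. norm (b i) * (\<Sum>\<^sub>\<infinity>j. norm (b' j))) summable_on UNIV"
    by (rule summable_on_cmult_left[OF b])
  fix i
  have "norm (b' i) \<le> (\<Sum>\<^sub>\<infinity>j. norm (b' j))"
    using finite_sum_le_infsum[OF b', of "{i}"] by simp
  then show "norm (b i * cnj (b' i)) \<le> norm (b i) * (\<Sum>\<^sub>\<infinity>j. norm (b' j))"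
    by (simp add: norm_mult mult_left_mono)
qed simp

lemma has_sum_sum_list:
  fixes f :: "'x \<Rightarrow> 'i \<Rightarrow> complex"
  assumes "\<And>x. x \<in> set xs \<Longrightarrow> (f x has_sum s x) A"
  shows "((\<lambda>i. \<Sum>x\<leftarrow>xs. f x i) has_sum (\<Sum>x\<leftarrow>xs. s x)) A"
  using assms by (induction xs) (auto intro: has_sum_add)

lemma sum_list_product:
  "(\<Sum>p\<leftarrow>xs. f p) * (\<Sum>q\<leftarrow>ys. g q) = (\<Sum>p\<leftarrow>xs. \<Sum>q\<leftarrow>ys. f p * g q)" for f g :: "'x \<Rightarrow> complex"
  by (induction xs) (simp_all add: distrib_right sum_list_const_mult)

context gaussian_coefficients
begin

text \<open>Each of the finitely many series converges absolutely almost surely, so almost surely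
  their combination is the series of the combined coefficients. Its characteristic exponent is a
  squared norm, expanded here sesquilinearly.\<close>

lemma char_series_combination:
  fixes ts :: "(complex \<times> ('i \<Rightarrow> complex)) list"
  assumes ts: "\<And>c b. (c, b) \<in> set ts \<Longrightarrow> abs_summable b"
  shows "expectation (\<lambda>\<omega>. iexp (Re (\<Sum>(c, b)\<leftarrow>ts. c * series b \<omega>)))
    = of_real (exp (- Re (\<Sum>(c, b)\<leftarrow>ts. \<Sum>(c', b')\<leftarrow>ts. c * cnj c' * (\<Sum>\<^sub>\<infinity>i. b i * cnj (b' i))) / 4))"
proof -
  define B where "B i = (\<Sum>(c, b)\<leftarrow>ts. c * b i)" for i
  have B: "abs_summable B"
  proof (rule summable_on_comparison_test)
    show "(\<lambda>i. \<Sum>(c, b)\<leftarrow>ts. norm c * norm (b i)) summable_on UNIV"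
      using ts by (induction ts) (auto intro!: summable_on_add summable_on_cmult_right)
    show "norm (B i) \<le> (\<Sum>(c, b)\<leftarrow>ts. norm c * norm (b i))" for i
      unfolding B_def
      by (induction ts) (auto simp: norm_mult intro: order_trans[OF norm_triangle_ineq])
  qed simp
  have "AE \<omega> in M. \<forall>p\<in>set ts. abs_summable (\<lambda>i. a i \<omega> * snd p i)"
    using ts by (intro AE_finite_allI AE_abs_summable) (auto simp: prod.expand)
  then have ae: "AE \<omega> in M. series B \<omega> = (\<Sum>(c, b)\<leftarrow>ts. c * series b \<omega>)"
  proof eventually_elim
    case (elim \<omega>)
    have "((\<lambda>i. \<Sum>p\<leftarrow>ts. fst p * (a i \<omega> * snd p i)) has_sum (\<Sum>p\<leftarrow>ts. fst p * series (snd p) \<omega>)) UNIV"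
    proof (rule has_sum_sum_list)
      fix p assume "p \<in> set ts"
      then show "((\<lambda>i. fst p * (a i \<omega> * snd p i)) has_sum fst p * series (snd p) \<omega>) UNIV"
        unfolding series_def using elim by (intro has_sum_cmult_right[OF has_sum_infsum[OF abs_summable_summable]]) auto
    qed
    moreover have "(\<Sum>p\<leftarrow>ts. fst p * (a i \<omega> * snd p i)) = a i \<omega> * B i" for i
      unfolding B_def by (induction ts) (auto simp: algebra_simps)
    ultimately show ?case unfolding series_def by (auto simp: split_beta' intro: infsumI)
  qed
  have "(\<lambda>\<omega>. \<Sum>(c, b)\<leftarrow>ts. c * series b \<omega>) \<in> borel_measurable M"
    by (induction ts) (auto simp: split_beta')
  then have "expectation (\<lambda>\<omega>. iexp (Re (\<Sum>(c, b)\<leftarrow>ts. c * series b \<omega>))) = expectation (\<lambda>\<omega>. iexp (Re (series B \<omega>)))"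
    using ae by (intro integral_cong_AE) auto
  also have "\<dots> = of_real (exp (- (\<Sum>\<^sub>\<infinity>i. (norm (B i))\<^sup>2) / 4))" by (rule char_series[OF B])
  also have "(\<Sum>\<^sub>\<infinity>i. (norm (B i))\<^sup>2) = Re (\<Sum>(c, b)\<leftarrow>ts. \<Sum>(c', b')\<leftarrow>ts. c * cnj c' * (\<Sum>\<^sub>\<infinity>i. b i * cnj (b' i)))"
  proof -
    have "((\<lambda>i. \<Sum>p\<leftarrow>ts. \<Sum>q\<leftarrow>ts. fst p * cnj (fst q) * (snd p i * cnj (snd q i)))
        has_sum (\<Sum>p\<leftarrow>ts. \<Sum>q\<leftarrow>ts. fst p * cnj (fst q) * (\<Sum>\<^sub>\<infinity>i. snd p i * cnj (snd q i)))) UNIV"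
      by (intro has_sum_sum_list has_sum_cmult_right[OF has_sum_infsum[OF abs_summable_summable[OF abs_summable_inner]]])
        (auto intro: ts)
    moreover have "(\<Sum>p\<leftarrow>ts. \<Sum>q\<leftarrow>ts. fst p * cnj (fst q) * (snd p i * cnj (snd q i))) = of_real ((norm (B i))\<^sup>2)" for i
    proof -
      have 1: "cnj (\<Sum>q\<leftarrow>ts'. fst q * snd q i) = (\<Sum>q\<leftarrow>ts'. cnj (fst q * snd q i))" for ts' :: "(complex \<times> ('i \<Rightarrow> complex)) list"
        by (induction ts') auto
      have "complex_of_real ((norm (B i))\<^sup>2) = (\<Sum>p\<leftarrow>ts. fst p * snd p i) * cnj (\<Sum>q\<leftarrow>ts. fst q * snd q i)"
        unfolding complex_norm_square B_def by (simp add: split_beta')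
      then show ?thesis unfolding 1 sum_list_product by (simp add: mult_ac)
    qed
    ultimately have "((\<lambda>i. complex_of_real ((norm (B i))\<^sup>2)) has_sum
        (\<Sum>p\<leftarrow>ts. \<Sum>q\<leftarrow>ts. fst p * cnj (fst q) * (\<Sum>\<^sub>\<infinity>i. snd p i * cnj (snd q i)))) UNIV" by simp
    from has_sum_Re[OF this] show ?thesis by (simp add: split_beta' infsumI)
  qed
  finally show ?thesis .
qed

end

section \<open>Integral representation of the logarithm\<close>

text \<open>Integrable majorant, in each of the two parameters, for the covariance kernel of the
  Laplace exponentials; the exponent comes from \<open>laplace_kernel_bounds\<close>.\<close>

definition decay :: "real \<Rightarrow> real" where
  "decay t = indicator {0<..} t * (1 + t) powr (- 3 / 2)"

text \<open>A compact subinterval of the open half-line: \<open>1 / t\<close> has finite mass on it,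
  and the integral of the exponential can be separated from that of its mean
  \<open>1 / (1 + t)\<close>.\<close>

definition cutoff :: "nat \<Rightarrow> real set" where
  "cutoff j = {inverse (real (Suc j)) .. real (Suc j)}"

lemma cutoff_measurable [measurable]: "cutoff j \<in> sets borel"
  by (simp add: cutoff_def)

lemma cutoff_pos: "t \<in> cutoff j \<Longrightarrow> 0 < t"
  unfolding cutoff_def by (auto intro: less_le_trans[of 0 "inverse (real (Suc j))"])

lemma cutoff_mono: "i \<le> j \<Longrightarrow> cutoff i \<subseteq> cutoff j"
proof
  fix t assume ij: "i \<le> j" and t: "t \<in> cutoff i"
  have "inverse (real (Suc j)) \<le> inverse (real (Suc i))" using ij by (intro le_imp_inverse_le) auto
  moreover have "inverse (real (Suc i)) \<le> t" "t \<le> real (Suc j)" using t ij by (auto simp: cutoff_def)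
  ultimately show "t \<in> cutoff j" unfolding cutoff_def atLeastAtMost_iff by (metis order_trans)
qed

lemma eventually_in_cutoff: "0 < t \<Longrightarrow> \<forall>\<^sub>F j in sequentially. t \<in> cutoff j"
proof -
  assume t: "0 < t"
  obtain N :: nat where N: "max t (inverse t) \<le> real N" using real_arch_simple by blast
  have "t \<in> cutoff j" if "j \<ge> N" for j
  proof -
    have "t \<le> real (Suc j)" "inverse t \<le> real (Suc j)" using N that by auto
    then show ?thesis using t unfolding cutoff_def
      by (auto simp: inverse_eq_divide divide_le_eq mult.commute)
  qed
  then show ?thesis by (auto simp: eventually_at_top_linorder)
qed

lemma interval_subset_cutoff: "1 \<le> j \<Longrightarrow> {1..2} \<subseteq> cutoff j"
  by (auto simp: cutoff_def inverse_eq_divide intro: order_trans[of _ 1])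

lemma decay_measurable [measurable]: "decay \<in> borel_measurable borel"
  unfolding decay_def by measurable

lemma decay_nonneg: "0 \<le> decay t"
  by (simp add: decay_def)

lemma decay_integrable: "integrable lborel decay"
proof -
  have "(\<integral>\<^sup>+ t. ennreal ((1 + t) powr (- 3 / 2)) * indicator {0..} t \<partial>lborel) = ennreal (0 - (- 2 * (1 + 0) powr (- 1 / 2)))"
  proof (rule nn_integral_FTC_atLeast[where F = "\<lambda>t. - 2 * (1 + t) powr (- 1 / 2)"])
    show "((\<lambda>t::real. - 2 * (1 + t) powr (- 1 / 2)) \<longlongrightarrow> 0) at_top"
    proof -
      have "((\<lambda>t::real. (1 + t) powr (- 1 / 2)) \<longlongrightarrow> 0) at_top"
        by (rule tendsto_neg_powr) (auto intro: filterlim_tendsto_add_at_top filterlim_ident)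
      from tendsto_mult[OF tendsto_const this, of "- 2"] show ?thesis by simp
    qed
  qed (auto intro!: derivative_eq_intros)
  then have "(\<integral>\<^sup>+ t. ennreal ((1 + t) powr (- 3 / 2)) * indicator {0..} t \<partial>lborel) < \<infinity>" by simp
  moreover have "(\<integral>\<^sup>+ t. ennreal (norm (decay t)) \<partial>lborel) \<le> (\<integral>\<^sup>+ t. ennreal ((1 + t) powr (- 3 / 2)) * indicator {0..} t \<partial>lborel)"
    by (intro nn_integral_mono) (auto simp: decay_def split: split_indicator)
  ultimately show ?thesis by (intro integrableI_bounded) auto
qed

text \<open>Its square is, up to \<open>scale\<close>, the mean-square cost of the truncation in
  \<open>t\<close>; nothing in it depends on the field.\<close>

definition decay_tail :: "nat \<Rightarrow> real" where
  "decay_tail j = (\<integral>t. indicator (- cutoff j) t * decay t \<partial>lborel)"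

lemma decay_tail_tendsto: "decay_tail \<longlonglongrightarrow> 0"
proof -
  have "(\<lambda>j. \<integral>t. indicator (- cutoff j) t * decay t \<partial>lborel) \<longlonglongrightarrow> integral\<^sup>L lborel (\<lambda>t::real. 0)"
  proof (rule integral_dominated_convergence[where w = decay])
    show "AE t in lborel. (\<lambda>j. indicator (- cutoff j) t * decay t) \<longlonglongrightarrow> 0"
    proof (intro AE_I2)
      fix t :: real
      show "(\<lambda>j. indicator (- cutoff j) t * decay t) \<longlonglongrightarrow> 0"
      proof (cases "0 < t")
        case True
        show ?thesis
          by (rule tendsto_eventually) (use eventually_in_cutoff[OF True] in eventually_elim, simp)
      qed (simp add: decay_def)
    qed
  qed (auto simp: decay_integrable decay_nonneg split: split_indicator)
  then show ?thesis by (simp add: decay_tail_def[abs_def])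
qed

lemma decay_le_tail:
  assumes "S \<inter> cutoff j = {}" and [measurable]: "S \<in> sets borel"
  shows "(\<integral>t. indicator S t * decay t \<partial>lborel) \<le> decay_tail j"
  unfolding decay_tail_def
proof (rule integral_mono)
  show "integrable lborel (\<lambda>t. indicator S t * decay t)"
    by (rule Bochner_Integration.integrable_bound[OF decay_integrable]) (auto split: split_indicator)
  show "integrable lborel (\<lambda>t. indicator (- cutoff j) t * decay t)"
    by (rule Bochner_Integration.integrable_bound[OF decay_integrable]) (auto split: split_indicator)
qed (use assms decay_nonneg in \<open>auto split: split_indicator\<close>)

lemma nn_integral_exp_decay:
  assumes "0 < (y :: real)"
  shows "(\<integral>\<^sup>+ t. ennreal (exp (- t * y)) * indicator {0<..} t \<partial>lborel) = ennreal (1 / y)"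
proof -
  have "(\<integral>\<^sup>+ t. ennreal (exp (- t * y)) * indicator {0..} t \<partial>lborel) = ennreal (0 - (- exp (- 0 * y) / y))"
  proof (rule nn_integral_FTC_atLeast[where F = "\<lambda>t. - exp (- t * y) / y"])
    have "((\<lambda>t. exp (- (y * t))) \<longlongrightarrow> 0) at_top"
      using assms by (intro filterlim_compose[OF exp_at_bot] filterlim_compose[OF filterlim_uminus_at_bot_at_top]
          filterlim_tendsto_pos_mult_at_top[OF tendsto_const] filterlim_ident)
    then show "((\<lambda>t. - exp (- t * y) / y) \<longlongrightarrow> 0) at_top"
      using tendsto_divide[OF tendsto_minus[of "\<lambda>t. exp (- (y * t))" 0 at_top] tendsto_const[of y]] assms by (simp add: mult.commute)
  qed (use assms in \<open>auto intro!: derivative_eq_intros\<close>)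
  moreover have "(\<integral>\<^sup>+ t. ennreal (exp (- t * y)) * indicator {0..} t \<partial>lborel) = (\<integral>\<^sup>+ t. ennreal (exp (- t * y)) * indicator {0<..} t \<partial>lborel)"
    by (rule nn_integral_cong_AE) (use AE_lborel_singleton[of 0] in \<open>auto split: split_indicator\<close>)
  ultimately show ?thesis by simp
qed

text \<open>The quotient is the integral of \<open>exp (- t * y)\<close> over \<open>y\<close> in
  \<open>{a..b}\<close>; exchanging the two nonnegative integrals leaves that of
  \<open>1 / y\<close>.\<close>

lemma frullani_nn:
  assumes a: "0 < a" and ab: "a \<le> b"
  shows "(\<integral>\<^sup>+ t. ennreal (indicator {0<..} t * ((exp (- t * a) - exp (- t * b)) / t)) \<partial>lborel) = ennreal (ln b - ln a)"
proof -
  have 1: "ennreal (indicator {0<..} t * ((exp (- t * a) - exp (- t * b)) / t))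
      = (\<integral>\<^sup>+ y. ennreal (exp (- t * y)) * indicator {0<..} t * indicator {a..b} y \<partial>lborel)" for t
  proof (cases "0 < t")
    case True
    have "(\<integral>\<^sup>+ y. ennreal (exp (- t * y)) * indicator {a..b} y \<partial>lborel) = ennreal (- exp (- t * b) / t - (- exp (- t * a) / t))"
      using True ab by (intro nn_integral_FTC_Icc) (auto intro!: derivative_eq_intros)
    then show ?thesis using True by (simp add: diff_divide_distrib)
  qed simp
  have "(\<integral>\<^sup>+ t. ennreal (indicator {0<..} t * ((exp (- t * a) - exp (- t * b)) / t)) \<partial>lborel)
      = (\<integral>\<^sup>+ t. \<integral>\<^sup>+ y. ennreal (exp (- t * y)) * indicator {0<..} t * indicator {a..b} y \<partial>lborel \<partial>lborel)"
    by (simp only: 1)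
  also have "\<dots> = (\<integral>\<^sup>+ y. \<integral>\<^sup>+ t. ennreal (exp (- t * y)) * indicator {0<..} t * indicator {a..b} y \<partial>lborel \<partial>lborel)"
    by (rule lborel_pair.Fubini') measurable
  also have "\<dots> = (\<integral>\<^sup>+ y. ennreal (1 / y) * indicator {a..b} y \<partial>lborel)"
  proof (rule nn_integral_cong)
    fix y :: real
    show "(\<integral>\<^sup>+ t. ennreal (exp (- t * y)) * indicator {0<..} t * indicator {a..b} y \<partial>lborel) = ennreal (1 / y) * indicator {a..b} y"
      using a nn_integral_exp_decay[of y] by (subst nn_integral_multc) (auto split: split_indicator)
  qed
  also have "\<dots> = ennreal (ln b - ln a)"
    using a ab by (intro nn_integral_FTC_Icc) (auto intro!: derivative_eq_intros simp: field_simps)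
  finally show ?thesis .
qed

definition frullani :: "real \<Rightarrow> real \<Rightarrow> real" where
  "frullani v t = indicator {0<..} t * ((exp (- t) - exp (- t * v)) / t)"

text \<open>Corrects the centring: Frullani's integral uses \<open>exp (- t)\<close>, while the
  Gaussian mean of the exponential is \<open>1 / (1 + t)\<close>.\<close>

definition resolvent :: "real \<Rightarrow> real" where
  "resolvent t = indicator {0<..} t * ((1 / (1 + t) - exp (- t)) / t)"

lemma frullani_measurable [measurable]: "frullani v \<in> borel_measurable borel"
  unfolding frullani_def by measurable

lemma resolvent_measurable [measurable]: "resolvent \<in> borel_measurable borel"
  unfolding resolvent_def by measurable

lemma frullani_integral:
  assumes v: "0 < (v :: real)"
  shows "integrable lborel (frullani v)" (is "integrable _ ?f")
    and "(\<integral>t. frullani v t \<partial>lborel) = ln v"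
    and "(\<integral>t. \<bar>frullani v t\<bar> \<partial>lborel) = \<bar>ln v\<bar>"
proof -
  have m: "?f \<in> borel_measurable lborel" by measurable
  have "has_bochner_integral lborel ?f (ln v) \<and> has_bochner_integral lborel (\<lambda>t. \<bar>?f t\<bar>) \<bar>ln v\<bar>"
  proof (cases "1 \<le> v")
    case True
    have nn: "0 \<le> ?f t" for t
    proof (cases "0 < t")
      case t: True
      then have "t \<le> t * v" using True by simp
      then show ?thesis using t by (simp add: frullani_def)
    qed (simp add: frullani_def)
    have "has_bochner_integral lborel ?f (ln v)"
      using frullani_nn[of 1 v] True nn m by (intro has_bochner_integral_nn_integral) (auto simp: frullani_def)
    moreover have "(\<lambda>t. \<bar>?f t\<bar>) = ?f" using nn by (intro ext abs_of_nonneg) auto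
    ultimately show ?thesis using True by simp
  next
    case False
    define g where "g t = indicator {0<..} t * ((exp (- t * v) - exp (- t * 1)) / t)" for t :: real
    have nn: "0 \<le> g t" for t
    proof (cases "0 < t")
      case t: True
      then have "t * v \<le> t" using False by simp
      then show ?thesis using t by (simp add: g_def)
    qed (simp add: g_def)
    have [measurable]: "g \<in> borel_measurable lborel" unfolding g_def by measurable
    have "has_bochner_integral lborel g (ln 1 - ln v)"
      using frullani_nn[of v 1] False nn v unfolding g_def by (intro has_bochner_integral_nn_integral) auto
    moreover have "?f = (\<lambda>t. - g t)"
      by (auto simp: g_def frullani_def fun_eq_iff diff_divide_distrib split: split_indicator)
    moreover have "(\<lambda>t. \<bar>- g t\<bar>) = g" using nn by auto
    ultimately show ?thesis using False v has_bochner_integral_minus[of lborel g "- ln v"] by simp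
  qed
  then show "integrable lborel ?f" "integral\<^sup>L lborel ?f = ln v" "(\<integral>t. \<bar>?f t\<bar> \<partial>lborel) = \<bar>ln v\<bar>"
    by (auto simp: has_bochner_integral_iff)
qed

lemma exp_resolvent_bound:
  assumes t: "0 < (t :: real)"
  shows "0 \<le> (1 / (1 + t) - exp (- t)) / t" "(1 / (1 + t) - exp (- t)) / t \<le> 2 * decay t"
proof -
  have "exp (- t) \<le> 1 / (1 + t)"
    using exp_ge_add_one_self[of t] t by (simp add: exp_minus field_simps)
  then show "0 \<le> (1 / (1 + t) - exp (- t)) / t" using t by simp
  have "(1 / (1 + t) - exp (- t)) / t \<le> 2 / (1 + t)\<^sup>2"
  proof (cases "t \<le> 1")
    case True
    have "1 - t \<le> exp (- t)" using exp_ge_add_one_self[of "- t"] by simp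
    then have "(1 / (1 + t) - exp (- t)) / t \<le> (1 / (1 + t) - (1 - t)) / t" using t by (intro divide_right_mono) auto
    also have "\<dots> = t * (1 + t) / (1 + t)\<^sup>2"
    proof -
      have "1 / (1 + t) - (1 - t) = t * t / (1 + t)" using t by (simp add: field_simps)
      then show ?thesis using t by (simp add: power2_eq_square)
    qed
    also have "\<dots> \<le> 2 / (1 + t)\<^sup>2"
      using mult_mono[of t 1 "1 + t" 2] True t by (intro divide_right_mono) auto
    finally show ?thesis .
  next
    case False
    have "(1 / (1 + t) - exp (- t)) / t \<le> (1 / (1 + t)) / t" using t by (intro divide_right_mono) auto
    also have "\<dots> = (1 + t) / ((1 + t) * (1 + t) * t)" using t by simp
    also have "\<dots> \<le> (2 * t) / ((1 + t) * (1 + t) * t)" using t False by (intro divide_right_mono) auto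
    also have "\<dots> = 2 / (1 + t)\<^sup>2" using t by (simp add: power2_eq_square)
    finally show ?thesis .
  qed
  also have "(1 + t)\<^sup>2 = (1 + t) powr 2" using t by simp
  also have "2 / (1 + t) powr 2 = 2 * (1 + t) powr (- 2)" using t by (simp add: powr_minus_divide)
  also have "\<dots> \<le> 2 * (1 + t) powr (- 3 / 2)" using t by (intro mult_left_mono powr_mono) auto
  finally show "(1 / (1 + t) - exp (- t)) / t \<le> 2 * decay t" using t by (simp add: decay_def)
qed

text \<open>Euler's constant in integral form; for a standard complex Gaussian \<open>x\<close> it
  is minus the mean of \<open>ln ((norm x)\<^sup>2)\<close>.\<close>

definition log_const :: real where
  "log_const = (\<integral>t. resolvent t \<partial>lborel)"

lemma log_const_integrable: "integrable lborel resolvent"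
proof (rule Bochner_Integration.integrable_bound[OF integrable_mult_right[OF decay_integrable, of 2]])
  show "AE t::real in lborel. norm (resolvent t) \<le> norm (2 * decay t)"
  proof (intro AE_I2)
    fix t :: real
    show "norm (resolvent t) \<le> norm (2 * decay t)"
      using exp_resolvent_bound[of t] decay_nonneg[of t] by (cases "0 < t") (auto simp: resolvent_def)
  qed
qed measurable

text \<open>
  \<open>log_approx S x\<close> has mean zero when \<open>x\<close> is a standard complex Gaussian, since then
  \<open>exp (- t |x|\<^sup>2)\<close> has mean \<open>1 / (1 + t)\<close>.
\<close>

definition hlog :: "real set \<Rightarrow> complex \<Rightarrow> real" where
  "hlog S x = (\<integral>t. indicator S t / t * exp (- t * (norm x)\<^sup>2) \<partial>lborel)"

definition log_approx :: "real set \<Rightarrow> complex \<Rightarrow> real" where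
  "log_approx S x = (\<integral>t. indicator S t / t * (1 / (1 + t) - exp (- t * (norm x)\<^sup>2)) \<partial>lborel)"

text \<open>Both pieces are absolutely integrable over the half-line, while the two terms of
  \<open>log_approx\<close> separately are not; limit and domination can therefore be taken piece by
  piece.\<close>

lemma log_approx_split:
  assumes "x \<noteq> 0"
  shows "log_approx (cutoff j) x =
    (\<integral>t. indicator (cutoff j) t * (resolvent t) \<partial>lborel) +
    (\<integral>t. indicator (cutoff j) t * (frullani ((norm x)\<^sup>2) t) \<partial>lborel)"
proof -
  have v: "0 < (norm x)\<^sup>2" using assms by simp
  have i1: "integrable lborel (\<lambda>t. indicator (cutoff j) t * (resolvent t))"
    by (rule Bochner_Integration.integrable_bound[OF log_const_integrable]) (auto split: split_indicator)
  have i2: "integrable lborel (\<lambda>t. indicator (cutoff j) t * (frullani ((norm x)\<^sup>2) t))"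
    by (rule Bochner_Integration.integrable_bound[OF frullani_integral(1)[OF v]]) (auto split: split_indicator)
  show ?thesis
    unfolding log_approx_def
    by (subst Bochner_Integration.integral_add[OF i1 i2, symmetric], intro Bochner_Integration.integral_cong)
       (auto split: split_indicator dest: cutoff_pos simp: diff_divide_distrib resolvent_def frullani_def)
qed

lemma log_approx_tendsto:
  assumes "x \<noteq> 0"
  shows "(\<lambda>j. log_approx (cutoff j) x) \<longlonglongrightarrow> ln ((norm x)\<^sup>2) + log_const"
proof -
  have v: "0 < (norm x)\<^sup>2" using assms by simp
  have conv: "(\<lambda>j. \<integral>t. indicator (cutoff j) t * g t \<partial>lborel) \<longlonglongrightarrow> (\<integral>t. g t \<partial>lborel)"
    if int: "integrable lborel g" and g0: "\<And>t. t \<le> 0 \<Longrightarrow> g t = 0" for g :: "real \<Rightarrow> real"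
  proof (rule integral_dominated_convergence[where w = "\<lambda>t. \<bar>g t\<bar>"])
    have [measurable]: "g \<in> borel_measurable borel" using int by simp
    show "(\<lambda>t. indicator (cutoff j) t * g t) \<in> borel_measurable lborel" for j
      by measurable
    show "AE t in lborel. (\<lambda>j. indicator (cutoff j) t * g t) \<longlonglongrightarrow> g t"
    proof (intro AE_I2)
      fix t :: real
      show "(\<lambda>j. indicator (cutoff j) t * g t) \<longlonglongrightarrow> g t"
      proof (cases "0 < t")
        case True
        show ?thesis
          by (rule tendsto_eventually) (use eventually_in_cutoff[OF True] in eventually_elim, simp)
      qed (simp add: g0)
    qed
  qed (use int in \<open>auto split: split_indicator\<close>)
  have 1: "(\<lambda>j. \<integral>t. indicator (cutoff j) t * resolvent t \<partial>lborel) \<longlonglongrightarrow> log_const"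
    unfolding log_const_def by (rule conv[OF log_const_integrable]) (simp add: resolvent_def)
  have 2: "(\<lambda>j. \<integral>t. indicator (cutoff j) t * frullani ((norm x)\<^sup>2) t \<partial>lborel) \<longlonglongrightarrow> ln ((norm x)\<^sup>2)"
    unfolding frullani_integral(2)[OF v, symmetric]
    by (rule conv[OF frullani_integral(1)[OF v]]) (simp add: frullani_def)
  show ?thesis
    unfolding log_approx_split[OF assms] using tendsto_add[OF 1 2] by (simp only: add.commute)
qed

text \<open>Neither integrand changes sign on the half-line, so the integrals of their absolute
  values are \<open>\<bar>ln ((norm x)\<^sup>2)\<bar>\<close> and \<open>log_const\<close>. The
  bound does not depend on the cutoff and serves as a majorant.\<close>

lemma log_approx_le:
  assumes "x \<noteq> 0"
  shows "\<bar>log_approx (cutoff j) x\<bar> \<le> \<bar>ln ((norm x)\<^sup>2)\<bar> + log_const"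
proof -
  have v: "0 < (norm x)\<^sup>2" using assms by simp
  have le: "\<bar>\<integral>t. indicator (cutoff j) t * g t \<partial>lborel\<bar> \<le> (\<integral>t. \<bar>g t\<bar> \<partial>lborel)"
    if int: "integrable lborel g" for g :: "real \<Rightarrow> real"
  proof -
    have "\<bar>\<integral>t. indicator (cutoff j) t * g t \<partial>lborel\<bar> \<le> (\<integral>t. \<bar>indicator (cutoff j) t * g t\<bar> \<partial>lborel)"
      by (rule integral_abs_bound)
    also have "\<dots> \<le> (\<integral>t. \<bar>g t\<bar> \<partial>lborel)"
      using int by (intro integral_mono') (auto split: split_indicator)
    finally show ?thesis .
  qed
  have "(\<lambda>t. \<bar>resolvent t\<bar>) = resolvent"
  proof
    fix t show "\<bar>resolvent t\<bar> = resolvent t"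
    proof (rule abs_of_nonneg)
      show "0 \<le> resolvent t"
        using exp_resolvent_bound(1)[of t] unfolding resolvent_def by (cases "0 < t") auto
    qed
  qed
  then show ?thesis
    unfolding log_approx_split[OF assms]
    using le[OF log_const_integrable] le[OF frullani_integral(1)[OF v]]
    by (simp add: frullani_integral(3)[OF v] log_const_def)
qed

lemma indicator_div_integrable:
  assumes [measurable]: "S \<in> sets borel" and S: "S \<subseteq> cutoff j" and [measurable]: "g \<in> borel_measurable borel"
    and g: "\<And>t. t \<in> S \<Longrightarrow> \<bar>g t\<bar> \<le> B"
  shows "integrable lborel (\<lambda>t. indicator S t / t * g t :: real)"
proof (rule Bochner_Integration.integrable_bound[of _ "\<lambda>t. indicator (cutoff j) t * (real (Suc j) * B)"])
  show "integrable lborel (\<lambda>t. indicator (cutoff j) t * (real (Suc j) * B))"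
    unfolding cutoff_def by (intro integrable_mult_left integrable_real_indicator)
      (auto simp: emeasure_lborel_Icc_eq)
  show "AE t in lborel. norm (indicator S t / t * g t) \<le> norm (indicator (cutoff j) t * (real (Suc j) * B))"
  proof (intro AE_I2)
    fix t
    show "norm (indicator S t / t * g t) \<le> norm (indicator (cutoff j) t * (real (Suc j) * B))"
    proof (cases "t \<in> S")
      case True
      then have c: "t \<in> cutoff j" using S by auto
      then have t: "0 < t" by (rule cutoff_pos)
      have "inverse t \<le> real (Suc j)"
        using c le_imp_inverse_le[of "inverse (real (Suc j))" t] unfolding cutoff_def by simp
      then have "inverse t * \<bar>g t\<bar> \<le> real (Suc j) * B" using g[OF True] t by (intro mult_mono) auto
      also have "\<dots> \<le> real (Suc j) * \<bar>B\<bar>" by (intro mult_left_mono) auto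
      finally show ?thesis using True c t by (simp add: divide_inverse abs_mult del: of_nat_Suc)
    qed simp
  qed
qed measurable

lemma hlog_log_approx:
  assumes [measurable]: "S \<in> sets borel" and S: "S \<subseteq> cutoff j"
  shows "log_approx S x = (\<integral>t. indicator S t / t * (1 / (1 + t)) \<partial>lborel) - hlog S x"
proof -
  have "integrable lborel (\<lambda>t. indicator S t / t * (1 / (1 + t)))"
    by (rule indicator_div_integrable[OF _ S, where B = 1]) (use S in \<open>auto dest!: cutoff_pos subsetD\<close>)
  moreover have "integrable lborel (\<lambda>t. indicator S t / t * exp (- t * (norm x)\<^sup>2))"
    by (rule indicator_div_integrable[OF _ S, where B = 1]) (use S in \<open>auto dest!: cutoff_pos subsetD simp: zero_le_mult_iff\<close>)
  ultimately show ?thesis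
    unfolding log_approx_def hlog_def
    by (subst Bochner_Integration.integral_diff[symmetric]) (auto simp: algebra_simps)
qed

text \<open>With \<open>P = (1 + t) * (1 + s)\<close> and \<open>D = P - t * s * r\<^sup>2\<close>
  the kernel is \<open>r\<^sup>2 / (P * D)\<close>. From \<open>1 + t + s \<le> D\<close> follows
  \<open>P \<le> D\<^sup>2\<close>, so \<open>P * D\<close> is at least
  \<open>P powr (3 / 2)\<close>, the source of \<open>decay\<close>; from \<open>D \<le> P\<close>
  follows the lower bound.\<close>

lemma laplace_kernel_bounds:
  fixes r t s :: real
  assumes r: "0 \<le> r" "r \<le> 1" and t: "0 < t" and s: "0 < s"
  defines "k \<equiv> (1 / ((1 + t) * (1 + s) - t * s * r\<^sup>2) - 1 / (1 + t) * (1 / (1 + s))) / (t * s)"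
  shows "k \<le> r\<^sup>2 * (decay t * decay s)" "r\<^sup>2 * (1 / (1 + t)\<^sup>2 * (1 / (1 + s)\<^sup>2)) \<le> k" "0 \<le> k"
proof -
  define P where "P = (1 + t) * (1 + s)"
  define D where "D = P - t * s * r\<^sup>2"
  have r2: "r\<^sup>2 \<le> 1" using r by (simp add: power_le_one)
  have ts: "0 < t * s" using t s by simp
  have P1: "1 \<le> P" using t s by (simp add: P_def field_simps add_nonneg_nonneg)
  have "t * s * r\<^sup>2 \<le> t * s * 1" using r2 ts by (intro mult_left_mono) auto
  then have D1: "1 + t + s \<le> D" by (simp add: D_def P_def algebra_simps)
  have D0: "0 < D" using D1 t s by linarith
  have DP: "D \<le> P" using ts by (simp add: D_def)
  have k: "k = r\<^sup>2 / (P * D)"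
  proof -
    have "1 / D - 1 / P = (P - D) / (P * D)" using D0 P1 by (simp add: field_simps)
    also have "\<dots> = t * s * r\<^sup>2 / (P * D)" by (simp add: D_def)
    finally have "k = (t * s * r\<^sup>2 / (P * D)) / (t * s)" unfolding k_def by (simp add: D_def P_def)
    then show ?thesis using t s by (simp add: divide_simps)
  qed
  have "P \<le> D\<^sup>2"
  proof -
    have "P \<le> (1 + t + s)\<^sup>2" using t s by (simp add: P_def power2_eq_square algebra_simps)
    also have "\<dots> \<le> D\<^sup>2" using D1 t s by (intro power_mono) auto
    finally show ?thesis .
  qed
  then have "sqrt P \<le> D" using D0 by (intro real_le_lsqrt) auto
  then have "P * sqrt P \<le> P * D" using P1 by (intro mult_left_mono) auto
  then have "r\<^sup>2 / (P * D) \<le> r\<^sup>2 / (P * sqrt P)" using P1 by (intro divide_left_mono) (auto intro!: mult_pos_pos D0)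
  also have "P * sqrt P = P powr (3 / 2)"
  proof -
    have "P powr (3 / 2) = P powr (1 + 1 / 2)" by simp
    also have "\<dots> = P * sqrt P" using P1 by (simp only: powr_add powr_half_sqrt) simp
    finally show ?thesis ..
  qed
  also have "r\<^sup>2 / P powr (3 / 2) = r\<^sup>2 * (decay t * decay s)"
    using t s by (simp add: decay_def P_def powr_mult powr_minus_divide)
  finally show "k \<le> r\<^sup>2 * (decay t * decay s)" by (simp add: k)
  have "r\<^sup>2 / (P * P) \<le> r\<^sup>2 / (P * D)" using DP D0 P1 by (intro divide_left_mono mult_left_mono) auto
  then show "r\<^sup>2 * (1 / (1 + t)\<^sup>2 * (1 / (1 + s)\<^sup>2)) \<le> k"
    unfolding k by (simp add: P_def power2_eq_square mult_ac)
  show "0 \<le> k" unfolding k using P1 D0 by simp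
qed

section \<open>Covariances of integrals over a parameter\<close>

context prob_space
begin

definition cov :: "('a \<Rightarrow> real) \<Rightarrow> ('a \<Rightarrow> real) \<Rightarrow> real" where
  "cov X Y = expectation (\<lambda>\<omega>. X \<omega> * Y \<omega>) - expectation X * expectation Y"

lemma expectation_weighted_integral:
  fixes p :: "'x \<Rightarrow> real" and Y :: "'x \<Rightarrow> 'a \<Rightarrow> real"
  assumes N: "sigma_finite_measure N" and Y [measurable]: "(\<lambda>(z, \<omega>). Y z \<omega>) \<in> borel_measurable (N \<Otimes>\<^sub>M M)"
    and Y_le: "\<And>z \<omega>. \<bar>Y z \<omega>\<bar> \<le> B" and p: "integrable N p"
    and V [measurable]: "V \<in> borel_measurable M" and V_le: "\<And>\<omega>. \<bar>V \<omega>\<bar> \<le> B'"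
  shows "expectation (\<lambda>\<omega>. V \<omega> * (\<integral>z. p z * Y z \<omega> \<partial>N)) = (\<integral>z. p z * expectation (\<lambda>\<omega>. V \<omega> * Y z \<omega>) \<partial>N)"
    and "(\<lambda>\<omega>. \<integral>z. p z * Y z \<omega> \<partial>N) \<in> borel_measurable M"
    and "\<bar>\<integral>z. p z * Y z \<omega> \<partial>N\<bar> \<le> (\<integral>z. \<bar>p z\<bar> \<partial>N) * B"
    and "integrable N (\<lambda>z. p z * expectation (\<lambda>\<omega>. V \<omega> * Y z \<omega>))"
proof -
  interpret N: sigma_finite_measure N by fact
  have [measurable]: "p \<in> borel_measurable N" using p by simp
  have B: "0 \<le> B" "0 \<le> B'" using Y_le V_le abs_ge_zero order_trans by blast+
  show m: "(\<lambda>\<omega>. \<integral>z. p z * Y z \<omega> \<partial>N) \<in> borel_measurable M"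
    by (rule N.borel_measurable_lebesgue_integral) measurable
  have bd: "norm (p z * (V \<omega> * Y z \<omega>)) \<le> \<bar>p z\<bar> * (B' * B)" for z \<omega>
    unfolding real_norm_def abs_mult by (intro mult_left_mono mult_mono Y_le V_le) (auto simp: B)
  have F: "(\<integral>\<omega>. (\<integral>z. p z * (V \<omega> * Y z \<omega>) \<partial>N) \<partial>M) = (\<integral>z. (\<integral>\<omega>. p z * (V \<omega> * Y z \<omega>) \<partial>M) \<partial>N)"
    using fubini_expectation(2)[OF N, of "\<lambda>(z, \<omega>). p z * (V \<omega> * Y z \<omega>)" "\<lambda>z. \<bar>p z\<bar> * (B' * B)"] p bd by simp
  have "V \<omega> * (\<integral>z. p z * Y z \<omega> \<partial>N) = (\<integral>z. p z * (V \<omega> * Y z \<omega>) \<partial>N)" for \<omega>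
    by (subst Bochner_Integration.integral_mult_right_zero[symmetric]) (simp only: mult_ac)
  then show "expectation (\<lambda>\<omega>. V \<omega> * (\<integral>z. p z * Y z \<omega> \<partial>N)) = (\<integral>z. p z * expectation (\<lambda>\<omega>. V \<omega> * Y z \<omega>) \<partial>N)"
    using F by simp
  have "\<bar>\<integral>z. p z * Y z \<omega> \<partial>N\<bar> \<le> (\<integral>z. \<bar>p z * Y z \<omega>\<bar> \<partial>N)" by (rule integral_abs_bound)
  also have "\<dots> \<le> (\<integral>z. \<bar>p z\<bar> * B \<partial>N)"
    using p Y_le by (intro integral_mono') (auto simp: abs_mult B intro!: mult_left_mono)
  finally show "\<bar>\<integral>z. p z * Y z \<omega> \<partial>N\<bar> \<le> (\<integral>z. \<bar>p z\<bar> \<partial>N) * B" by simp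
  show "integrable N (\<lambda>z. p z * expectation (\<lambda>\<omega>. V \<omega> * Y z \<omega>))"
  proof (rule Bochner_Integration.integrable_bound[of _ "\<lambda>z. \<bar>p z\<bar> * (B' * B)"])
    show "AE z in N. norm (p z * expectation (\<lambda>\<omega>. V \<omega> * Y z \<omega>)) \<le> norm (\<bar>p z\<bar> * (B' * B))"
    proof (intro AE_I2)
      fix z
      have "\<bar>expectation (\<lambda>\<omega>. V \<omega> * Y z \<omega>)\<bar> \<le> (\<integral>\<omega>. B' * B \<partial>M)"
        by (rule order_trans[OF integral_abs_bound], rule integral_mono')
           (auto simp: abs_mult B intro!: mult_mono Y_le V_le)
      then show "norm (p z * expectation (\<lambda>\<omega>. V \<omega> * Y z \<omega>)) \<le> norm (\<bar>p z\<bar> * (B' * B))"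
        by (simp add: prob_space abs_mult B mult_left_mono)
    qed
  qed (use p in auto)
qed

text \<open>Bilinearity of the covariance under integrals: Fubini is applied first with the whole
  second integral as the bounded factor, then inside, with \<open>Y1 z\<close> as that
  factor.\<close>

lemma cov_weighted_integrals:
  fixes p1 :: "'x \<Rightarrow> real" and Y1 :: "'x \<Rightarrow> 'a \<Rightarrow> real" and p2 :: "'y \<Rightarrow> real" and Y2 :: "'y \<Rightarrow> 'a \<Rightarrow> real"
  assumes N1: "sigma_finite_measure N1" and Y1 [measurable]: "(\<lambda>(z, \<omega>). Y1 z \<omega>) \<in> borel_measurable (N1 \<Otimes>\<^sub>M M)"
    and Y1_le: "\<And>z \<omega>. \<bar>Y1 z \<omega>\<bar> \<le> B1" and p1: "integrable N1 p1"
    and N2: "sigma_finite_measure N2" and Y2 [measurable]: "(\<lambda>(z, \<omega>). Y2 z \<omega>) \<in> borel_measurable (N2 \<Otimes>\<^sub>M M)"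
    and Y2_le: "\<And>z \<omega>. \<bar>Y2 z \<omega>\<bar> \<le> B2" and p2: "integrable N2 p2"
  shows "cov (\<lambda>\<omega>. \<integral>z. p1 z * Y1 z \<omega> \<partial>N1) (\<lambda>\<omega>. \<integral>w. p2 w * Y2 w \<omega> \<partial>N2)
    = (\<integral>z. p1 z * (\<integral>w. p2 w * cov (Y1 z) (Y2 w) \<partial>N2) \<partial>N1)"
proof -
  define I2 where "I2 \<omega> = (\<integral>w. p2 w * Y2 w \<omega> \<partial>N2)" for \<omega>
  note E2 = expectation_weighted_integral[OF N2 Y2 Y2_le p2]
  have I2 [measurable]: "I2 \<in> borel_measurable M"
    unfolding I2_def by (rule E2(2)[of "\<lambda>_. 0" 0]) auto
  have I2_le: "\<bar>I2 \<omega>\<bar> \<le> (\<integral>z. \<bar>p2 z\<bar> \<partial>N2) * B2" for \<omega>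
    unfolding I2_def by (rule E2(3)[of "\<lambda>_. 0" 0]) auto
  note E1 = expectation_weighted_integral[OF N1 Y1 Y1_le p1]
  have 1: "expectation (\<lambda>\<omega>. (\<integral>z. p1 z * Y1 z \<omega> \<partial>N1) * I2 \<omega>) = (\<integral>z. p1 z * expectation (\<lambda>\<omega>. I2 \<omega> * Y1 z \<omega>) \<partial>N1)"
    using E1(1)[OF I2 I2_le] by (simp add: mult.commute)
  have 2: "expectation (\<lambda>\<omega>. \<integral>z. p1 z * Y1 z \<omega> \<partial>N1) = (\<integral>z. p1 z * expectation (Y1 z) \<partial>N1)"
    using E1(1)[of "\<lambda>_. 1" 1] by simp
  have i1: "integrable N1 (\<lambda>z. p1 z * expectation (\<lambda>\<omega>. I2 \<omega> * Y1 z \<omega>))" by (rule E1(4)[OF I2 I2_le])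
  have i2: "integrable N1 (\<lambda>z. p1 z * expectation (Y1 z))" using E1(4)[of "\<lambda>_. 1" 1] by simp
  have 3: "expectation (\<lambda>\<omega>. I2 \<omega> * Y1 z \<omega>) - expectation (Y1 z) * expectation I2
      = (\<integral>w. p2 w * cov (Y1 z) (Y2 w) \<partial>N2)" if "z \<in> space N1" for z
  proof -
    have [measurable]: "Y1 z \<in> borel_measurable M"
      using measurable_compose[OF measurable_Pair1'[OF that] Y1] by simp
    have "expectation (\<lambda>\<omega>. I2 \<omega> * Y1 z \<omega>) = (\<integral>w. p2 w * expectation (\<lambda>\<omega>. Y1 z \<omega> * Y2 w \<omega>) \<partial>N2)"
      using E2(1)[of "Y1 z" B1] Y1_le by (simp add: I2_def mult.commute)
    moreover have "expectation I2 = (\<integral>w. p2 w * expectation (Y2 w) \<partial>N2)"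
      using E2(1)[of "\<lambda>_. 1" 1] by (simp add: I2_def[abs_def])
    moreover have "integrable N2 (\<lambda>w. p2 w * expectation (\<lambda>\<omega>. Y1 z \<omega> * Y2 w \<omega>))"
      by (rule E2(4)) (use Y1_le in auto)
    moreover have "integrable N2 (\<lambda>w. p2 w * expectation (Y2 w))" using E2(4)[of "\<lambda>_. 1" 1] by simp
    moreover have "p2 w * cov (Y1 z) (Y2 w) = p2 w * expectation (\<lambda>\<omega>. Y1 z \<omega> * Y2 w \<omega>) - expectation (Y1 z) * (p2 w * expectation (Y2 w))" for w
      by (simp add: cov_def right_diff_distrib mult_ac)
    ultimately show ?thesis by simp
  qed
  have "cov (\<lambda>\<omega>. \<integral>z. p1 z * Y1 z \<omega> \<partial>N1) I2
      = (\<integral>z. p1 z * expectation (\<lambda>\<omega>. I2 \<omega> * Y1 z \<omega>) \<partial>N1) - (\<integral>z. p1 z * expectation (Y1 z) \<partial>N1) * expectation I2"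
    unfolding cov_def 1 2 ..
  also have "\<dots> = (\<integral>z. p1 z * (expectation (\<lambda>\<omega>. I2 \<omega> * Y1 z \<omega>) - expectation (Y1 z) * expectation I2) \<partial>N1)"
    using i1 i2 by (simp add: right_diff_distrib mult.assoc[symmetric])
  also have "\<dots> = (\<integral>z. p1 z * (\<integral>w. p2 w * cov (Y1 z) (Y2 w) \<partial>N2) \<partial>N1)"
    by (intro Bochner_Integration.integral_cong refl) (simp only: 3)
  finally show ?thesis unfolding I2_def .
qed

lemma cov_self: "integrable M X \<Longrightarrow> integrable M (\<lambda>\<omega>. (X \<omega>)\<^sup>2) \<Longrightarrow> cov X X = variance X" for X :: "'a \<Rightarrow> real"
  unfolding cov_def by (subst variance_eq) (auto simp: power2_eq_square)

end

section \<open>Normalised Gaussian fields\<close>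

text \<open>\<open>\<rho> z w\<close> is the complex covariance. Circular symmetry is built into
  \<open>char_F\<close>, whose exponent has only terms with \<open>c * cnj c'\<close>. Measurability
  of the sections is a separate assumption because it is used for every \<omega>, also outside the
  space of \<open>M\<close>.\<close>

locale gaussian_field = prob_space M for M :: "'w measure" +
  fixes F :: "'v :: euclidean_space \<Rightarrow> 'w \<Rightarrow> complex" and \<rho> :: "'v \<Rightarrow> 'v \<Rightarrow> complex"
  assumes F_measurable: "(\<lambda>(z, \<omega>). F z \<omega>) \<in> borel_measurable (borel \<Otimes>\<^sub>M M)"
    and F_measurable_section: "(\<lambda>z. F z \<omega>) \<in> borel_measurable borel"
    and \<rho>_measurable: "(\<lambda>(z, w). \<rho> z w) \<in> borel_measurable (borel \<Otimes>\<^sub>M borel)"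
    and \<rho>_self: "\<rho> z z = 1"
    and \<rho>_cnj: "\<rho> w z = cnj (\<rho> z w)"
    and char_F: "expectation (\<lambda>\<omega>. iexp (Re (\<Sum>(c, z)\<leftarrow>ts. c * F z \<omega>)))
      = of_real (exp (- Re (\<Sum>(c, z)\<leftarrow>ts. \<Sum>(c', z')\<leftarrow>ts. c * cnj c' * \<rho> z z') / 4))"
begin

lemma F_meas [measurable (raw)]:
  assumes "f \<in> borel_measurable K" "g \<in> measurable K M"
  shows "(\<lambda>x. F (f x) (g x)) \<in> borel_measurable K"
  using measurable_compose[OF measurable_Pair[OF assms] F_measurable] by simp

lemma \<rho>_meas [measurable (raw)]:
  assumes "f \<in> borel_measurable K" "g \<in> borel_measurable K"
  shows "(\<lambda>x. \<rho> (f x) (g x)) \<in> borel_measurable K"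
  using measurable_compose[OF measurable_Pair[OF assms] \<rho>_measurable] by simp

lemma char_two:
  "expectation (\<lambda>\<omega>. iexp (Re (c * F z \<omega>)) * iexp (Re (d * F w \<omega>)))
    = of_real (exp (- ((norm c)\<^sup>2 + (norm d)\<^sup>2 + 2 * Re (c * cnj d * \<rho> z w)) / 4))"
proof -
  have 1: "Re (c * cnj c) = (norm c)\<^sup>2" "Re (d * cnj d) = (norm d)\<^sup>2"
    unfolding cmod_power2 by (simp_all add: power2_eq_square)
  have "Re (d * cnj c * \<rho> w z) = Re (cnj (c * cnj d * \<rho> z w))"
    unfolding \<rho>_cnj[of w z] by (simp only: complex_cnj_mult complex_cnj_cnj mult_ac)
  then have 2: "Re (d * cnj c * \<rho> w z) = Re (c * cnj d * \<rho> z w)" by (simp only: cnj.sel)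
  have "expectation (\<lambda>\<omega>. iexp (Re (c * F z \<omega>)) * iexp (Re (d * F w \<omega>)))
    = expectation (\<lambda>\<omega>. iexp (Re (\<Sum>(c, z)\<leftarrow>[(c, z), (d, w)]. c * F z \<omega>)))"
    by (intro Bochner_Integration.integral_cong refl) (simp add: exp_add[symmetric] algebra_simps)
  also have "\<dots> = of_real (exp (- (Re (c * cnj c) + Re (c * cnj d * \<rho> z w) + (Re (d * cnj c * \<rho> w z) + Re (d * cnj d))) / 4))"
    by (subst char_F) (simp only: list.map sum_list.Cons sum_list.Nil prod.case \<rho>_self plus_complex.sel add_0_right mult_1_right)
  also have "\<dots> = of_real (exp (- ((norm c)\<^sup>2 + (norm d)\<^sup>2 + 2 * Re (c * cnj d * \<rho> z w)) / 4))"
    unfolding 1 2 by (simp add: algebra_simps)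
  finally show ?thesis .
qed

lemma norm_\<rho>_le_1: "norm (\<rho> z w) \<le> 1"
proof -
  \<comment> \<open>The phase for which the cross term becomes \<open>- norm (\<rho> z w)\<close>;
    the bound 1 on the characteristic function at \<open>(1, d)\<close> then forces
    \<open>norm (\<rho> z w) \<le> 1\<close>.\<close>
  define d where "d = - sgn (\<rho> z w)"
  have "norm (expectation (\<lambda>\<omega>. iexp (Re (1 * F z \<omega>)) * iexp (Re (d * F w \<omega>)))) \<le> expectation (\<lambda>\<omega>. 1)"
    by (rule order_trans[OF integral_norm_bound], rule integral_mono') (auto simp: norm_mult)
  then have "0 \<le> 1 + (norm d)\<^sup>2 + 2 * Re (cnj d * \<rho> z w)"
    unfolding char_two by (simp add: prob_space)
  moreover have "norm d \<le> 1" by (simp add: d_def norm_sgn)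
  then have "(norm d)\<^sup>2 \<le> 1" by (simp add: power_le_one)
  moreover have "cnj d * \<rho> z w = - of_real (norm (\<rho> z w))"
  proof (cases "\<rho> z w = 0")
    case False
    have "cnj (\<rho> z w) * \<rho> z w = of_real (norm (\<rho> z w) * norm (\<rho> z w))"
      using complex_norm_square[of "\<rho> z w"] by (simp add: power2_eq_square mult.commute)
    then show ?thesis using False by (simp add: d_def sgn_eq)
  qed (simp add: d_def)
  ultimately show ?thesis by simp
qed

text \<open>Each exponential is an average of \<open>iexp\<close> over a Gaussian variable, so the
  expectation over the field becomes a characteristic function, and what remains are complex
  Gaussian integrals, first in \<open>v\<close>, then in \<open>u\<close>.\<close>

lemma laplace_two:
  assumes t: "0 \<le> t" and s: "0 \<le> s"
  shows "expectation (\<lambda>\<omega>. exp (- t * (norm (F z \<omega>))\<^sup>2) * exp (- s * (norm (F w \<omega>))\<^sup>2))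
    = 1 / ((1 + t) * (1 + s) - t * s * (norm (\<rho> z w))\<^sup>2)"
proof -
  define r where "r = norm (\<rho> z w)"
  have r: "0 \<le> r" "r \<le> 1" unfolding r_def using norm_\<rho>_le_1 by auto
  have r2: "r\<^sup>2 \<le> 1" using r by (simp add: power_le_one)
  \<comment> \<open>The coefficient of \<open>- (norm u)\<^sup>2\<close> that is left once
    \<open>v\<close> has been integrated out; it is positive since \<open>r \<le> 1\<close>, and
    \<open>c * (1 + s)\<close> is the denominator of the claim.\<close>
  define c where "c = 1 + t - t * s * r\<^sup>2 / (1 + s)"
  have c: "0 < c"
  proof -
    have "t * (s * r\<^sup>2) \<le> t * (s * 1)" using r2 s t by (intro mult_left_mono) auto
    then have "t * s * r\<^sup>2 < (1 + t) * (1 + s)" using s t by (simp add: algebra_simps)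
    then show ?thesis using s by (simp add: c_def field_simps)
  qed
  have gi: "integrable lborel (\<lambda>u. complex_of_real (gauss u))"
    using gauss_has_integral by (simp add: has_bochner_integral_iff)
  have rep: "of_real (exp (- q * (norm x)\<^sup>2)) = (\<integral>u. of_real (gauss u) * iexp (Re (of_real (2 * sqrt q) * u * x)) \<partial>lborel)" if "0 \<le> q" for q x
  proof -
    have "(norm (of_real (2 * sqrt q) * x))\<^sup>2 / 4 = q * (norm x)\<^sup>2" using that by (simp add: norm_mult power_mult_distrib)
    then show ?thesis using gauss_fourier[of "of_real (2 * sqrt q) * x"]
      by (simp add: has_bochner_integral_iff mult_ac del: of_real_exp)
  qed
  have E: "expectation (\<lambda>\<omega>. V \<omega> * of_real (exp (- q * (norm (F x \<omega>))\<^sup>2)))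
      = (\<integral>u. of_real (gauss u) * expectation (\<lambda>\<omega>. V \<omega> * iexp (Re (of_real (2 * sqrt q) * u * F x \<omega>))) \<partial>lborel)"
    if q: "0 \<le> q" and V [measurable]: "V \<in> borel_measurable M" and V1: "\<And>\<omega>. norm (V \<omega>) \<le> 1" for q x and V :: "'w \<Rightarrow> complex"
  proof -
    have "expectation (\<lambda>\<omega>. V \<omega> * of_real (exp (- q * (norm (F x \<omega>))\<^sup>2)))
        = (\<integral>\<omega>. (\<integral>u. of_real (gauss u) * (V \<omega> * iexp (Re (of_real (2 * sqrt q) * u * F x \<omega>))) \<partial>lborel) \<partial>M)"
      unfolding rep[OF q]
      by (subst Bochner_Integration.integral_mult_right_zero[symmetric]) (simp only: mult_ac)
    also have "\<dots> = (\<integral>u. (\<integral>\<omega>. of_real (gauss u) * (V \<omega> * iexp (Re (of_real (2 * sqrt q) * u * F x \<omega>))) \<partial>M) \<partial>lborel)"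
    proof -
      define g where "g = (\<lambda>(u, \<omega>). complex_of_real (gauss u) * (V \<omega> * iexp (Re (of_real (2 * sqrt q) * u * F x \<omega>))))"
      have [measurable]: "g \<in> borel_measurable (lborel \<Otimes>\<^sub>M M)" unfolding g_def by measurable
      have "norm (g (u, \<omega>)) \<le> gauss u" for u \<omega>
      proof -
        have "norm (g (u, \<omega>)) = gauss u * norm (V \<omega>)"
          by (simp add: g_def norm_mult gauss_nonneg)
        also have "\<dots> \<le> gauss u" using V1 gauss_nonneg by (intro mult_left_le) auto
        finally show ?thesis .
      qed
      then have "(\<integral>\<omega>. (\<integral>u. g (u, \<omega>) \<partial>lborel) \<partial>M) = (\<integral>u. (\<integral>\<omega>. g (u, \<omega>) \<partial>M) \<partial>lborel)"
        using gauss_has_integral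
        by (intro fubini_expectation(2)[where b = gauss] lborel.sigma_finite_measure_axioms)
           (auto simp: has_bochner_integral_iff)
      then show ?thesis by (simp only: g_def prod.case)
    qed
    finally show ?thesis by simp
  qed
  have inner: "(\<integral>v. of_real (gauss v) * expectation (\<lambda>\<omega>. iexp (Re (of_real (2 * sqrt t) * u * F z \<omega>)) * iexp (Re (of_real (2 * sqrt s) * v * F w \<omega>))) \<partial>lborel)
      = of_real (exp (- t * (norm u)\<^sup>2 + t * s * r\<^sup>2 * (norm u)\<^sup>2 / (1 + s)) / (1 + s))" for u
  proof -
    define a where "a = - (sqrt t * sqrt s) * cnj (u * \<rho> z w)"
    have na: "(norm a)\<^sup>2 = t * s * r\<^sup>2 * (norm u)\<^sup>2"
      using t s by (simp add: a_def norm_mult power_mult_distrib r_def)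
    have "of_real (gauss v) * expectation (\<lambda>\<omega>. iexp (Re (of_real (2 * sqrt t) * u * F z \<omega>)) * iexp (Re (of_real (2 * sqrt s) * v * F w \<omega>)))
        = complex_of_real (exp (- t * (norm u)\<^sup>2) / pi * exp (- (1 + s) * (norm v)\<^sup>2 + 2 * Re (a * v)))" for v
    proof -
      have 1: "Re (of_real (2 * sqrt t) * u * cnj (of_real (2 * sqrt s) * v) * \<rho> z w) = - 4 * Re (a * v)"
      proof -
        have "Re (of_real (2 * sqrt t) * u * cnj (of_real (2 * sqrt s) * v) * \<rho> z w) = 4 * (sqrt t * sqrt s) * Re (cnj (cnj (u * \<rho> z w) * v))"
          by (simp add: algebra_simps)
        then show ?thesis by (simp add: a_def algebra_simps)
      qed
      have 2: "(norm (of_real (2 * sqrt t) * u))\<^sup>2 = 4 * t * (norm u)\<^sup>2" "(norm (of_real (2 * sqrt s) * v))\<^sup>2 = 4 * s * (norm v)\<^sup>2"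
        using t s by (simp_all add: norm_mult power_mult_distrib)
      have "exp (- (norm v)\<^sup>2) / pi * exp (- (4 * t * (norm u)\<^sup>2 + 4 * s * (norm v)\<^sup>2 + 2 * (- 4 * Re (a * v))) / 4)
          = exp (- t * (norm u)\<^sup>2) / pi * exp (- (1 + s) * (norm v)\<^sup>2 + 2 * Re (a * v))"
        unfolding times_divide_eq_left exp_add[symmetric] by (simp add: algebra_simps add_divide_distrib diff_divide_distrib)
      then show ?thesis unfolding char_two 1 2 gauss_def of_real_mult[symmetric] by (simp only:)
    qed
    then have "(\<integral>v. of_real (gauss v) * expectation (\<lambda>\<omega>. iexp (Re (of_real (2 * sqrt t) * u * F z \<omega>)) * iexp (Re (of_real (2 * sqrt s) * v * F w \<omega>))) \<partial>lborel)
        = of_real (\<integral>v. exp (- t * (norm u)\<^sup>2) / pi * exp (- (1 + s) * (norm v)\<^sup>2 + 2 * Re (a * v)) \<partial>lborel)"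
      by (simp only: integral_complex_of_real)
    also have "(\<integral>v. exp (- t * (norm u)\<^sup>2) / pi * exp (- (1 + s) * (norm v)\<^sup>2 + 2 * Re (a * v)) \<partial>lborel)
        = exp (- t * (norm u)\<^sup>2) / pi * (pi / (1 + s) * exp ((norm a)\<^sup>2 / (1 + s)))"
      using gaussian_integral_complex[of "1 + s" a] s by (simp only: Bochner_Integration.integral_mult_right_zero) (simp add: has_bochner_integral_iff)
    also have "\<dots> = exp (- t * (norm u)\<^sup>2 + t * s * r\<^sup>2 * (norm u)\<^sup>2 / (1 + s)) / (1 + s)"
      by (simp only: na exp_add) simp
    finally show ?thesis .
  qed
  have "of_real (expectation (\<lambda>\<omega>. exp (- t * (norm (F z \<omega>))\<^sup>2) * exp (- s * (norm (F w \<omega>))\<^sup>2)))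
      = expectation (\<lambda>\<omega>. of_real (exp (- s * (norm (F w \<omega>))\<^sup>2)) * complex_of_real (exp (- t * (norm (F z \<omega>))\<^sup>2)))"
    by (simp only: of_real_mult[symmetric] integral_complex_of_real mult.commute)
  also have "\<dots> = (\<integral>u. of_real (gauss u) * expectation (\<lambda>\<omega>. of_real (exp (- s * (norm (F w \<omega>))\<^sup>2)) * iexp (Re (of_real (2 * sqrt t) * u * F z \<omega>))) \<partial>lborel)"
    using s by (intro E t) auto
  also have "\<dots> = (\<integral>u. of_real (gauss u) * of_real (exp (- t * (norm u)\<^sup>2 + t * s * r\<^sup>2 * (norm u)\<^sup>2 / (1 + s)) / (1 + s)) \<partial>lborel)"
  proof (intro Bochner_Integration.integral_cong refl)
    fix u
    have "expectation (\<lambda>\<omega>. of_real (exp (- s * (norm (F w \<omega>))\<^sup>2)) * iexp (Re (of_real (2 * sqrt t) * u * F z \<omega>)))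
        = (\<integral>v. of_real (gauss v) * expectation (\<lambda>\<omega>. iexp (Re (of_real (2 * sqrt t) * u * F z \<omega>)) * iexp (Re (of_real (2 * sqrt s) * v * F w \<omega>))) \<partial>lborel)"
      by (subst mult.commute, rule E[OF s]) auto
    then show "of_real (gauss u) * expectation (\<lambda>\<omega>. of_real (exp (- s * (norm (F w \<omega>))\<^sup>2)) * iexp (Re (of_real (2 * sqrt t) * u * F z \<omega>)))
      = of_real (gauss u) * of_real (exp (- t * (norm u)\<^sup>2 + t * s * r\<^sup>2 * (norm u)\<^sup>2 / (1 + s)) / (1 + s))"
      by (simp only: inner)
  qed
  also have "\<dots> = of_real (\<integral>u. exp (- c * (norm u)\<^sup>2 + 2 * Re (0 * u)) * (1 / (pi * (1 + s))) \<partial>lborel)"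
    unfolding of_real_mult[symmetric] integral_complex_of_real
    by (intro arg_cong[where f = of_real] Bochner_Integration.integral_cong refl)
       (simp add: gauss_def c_def exp_add[symmetric] algebra_simps diff_divide_distrib add_divide_distrib)
  also have "(\<integral>u. exp (- c * (norm u)\<^sup>2 + 2 * Re (0 * u)) * (1 / (pi * (1 + s))) \<partial>lborel) = pi / c * (1 / (pi * (1 + s)))"
    using gaussian_integral_complex[OF c, of 0] by (simp only: Bochner_Integration.integral_mult_left_zero) (simp add: has_bochner_integral_iff)
  also have "\<dots> = 1 / ((1 + t) * (1 + s) - t * s * r\<^sup>2)"
  proof -
    have "c * (1 + s) = (1 + t) * (1 + s) - t * s * r\<^sup>2" using s by (simp add: c_def field_simps)
    then show ?thesis by (simp add: mult_ac)
  qed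
  finally show ?thesis unfolding r_def of_real_eq_iff .
qed

lemma laplace_one: "0 \<le> t \<Longrightarrow> expectation (\<lambda>\<omega>. exp (- t * (norm (F z \<omega>))\<^sup>2)) = 1 / (1 + t)"
  using laplace_two[of t 0 z z] by simp

text \<open>The indicator of the zero event is at most
  \<open>exp (- real n * (norm (F z \<omega>))\<^sup>2)\<close> for every \<open>n\<close>, and the
  mean of that tends to 0.\<close>

lemma F_nonzero: "AE \<omega> in M. F z \<omega> \<noteq> 0"
proof -
  have [measurable]: "{\<omega> \<in> space M. F z \<omega> = 0} \<in> sets M" by measurable
  have "prob {\<omega> \<in> space M. F z \<omega> = 0} \<le> 1 / (1 + real n)" for n
  proof -
    have "prob {\<omega> \<in> space M. F z \<omega> = 0} = expectation (indicator {\<omega> \<in> space M. F z \<omega> = 0})"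
      by (simp add: Int_absorb2)
    also have "\<dots> \<le> expectation (\<lambda>\<omega>. exp (- real n * (norm (F z \<omega>))\<^sup>2))"
    proof (rule integral_mono)
      show "integrable M (\<lambda>\<omega>. exp (- real n * (norm (F z \<omega>))\<^sup>2))"
        by (rule integrable_const_bound[where B = 1]) auto
      show "integrable M (indicator {\<omega> \<in> space M. F z \<omega> = 0} :: 'w \<Rightarrow> real)"
        by (rule integrable_real_indicator) (auto simp: emeasure_eq_measure)
    qed (auto split: split_indicator)
    finally show ?thesis by (simp only: laplace_one of_nat_0_le_iff)
  qed
  moreover have "(\<lambda>n. 1 / (1 + real n)) \<longlonglongrightarrow> 0"
    using LIMSEQ_inverse_real_of_nat by (simp add: inverse_eq_divide add.commute)
  ultimately have "prob {\<omega> \<in> space M. F z \<omega> = 0} \<le> 0"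
    by (intro LIMSEQ_le_const[where X = "\<lambda>n. 1 / (1 + real n)"]) auto
  then have "prob {\<omega> \<in> space M. F z \<omega> = 0} = 0" using measure_nonneg antisym by blast
  then have "{\<omega> \<in> space M. F z \<omega> = 0} \<in> null_sets M"
    by (simp add: null_sets_def emeasure_eq_measure)
  then show ?thesis by (rule AE_I') auto
qed

lemma hlog_measurable [measurable]:
  assumes [measurable]: "S \<in> sets borel"
  shows "hlog S \<in> borel_measurable borel"
  unfolding hlog_def by measurable

lemma hlog_F_measurable [measurable]:
  assumes [measurable]: "S \<in> sets borel"
  shows "(\<lambda>(z, \<omega>). hlog S (F z \<omega>)) \<in> borel_measurable (borel \<Otimes>\<^sub>M M)"
  by measurable

lemma weight_integrable:
  assumes "S \<in> sets borel" "S \<subseteq> cutoff j"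
  shows "integrable lborel (\<lambda>t. indicator S t / t :: real)"
  using indicator_div_integrable[OF assms, of "\<lambda>_. 1" 1] by simp

text \<open>The clipping \<open>max 0 t\<close> makes the integrand bounded for all \<open>t\<close>; on \<open>S\<close> it has no effect.\<close>

lemma hlog_clip:
  assumes "S \<subseteq> cutoff j"
  shows "hlog S x = (\<integral>t. indicator S t / t * exp (- max 0 t * (norm x)\<^sup>2) \<partial>lborel)"
  unfolding hlog_def
  using assms by (intro Bochner_Integration.integral_cong refl) (auto split: split_indicator dest!: cutoff_pos subsetD)

lemma expectation_hlog:
  assumes S [measurable]: "S \<in> sets borel" and Sj: "S \<subseteq> cutoff j"
  shows "expectation (\<lambda>\<omega>. hlog S (F z \<omega>)) = (\<integral>t. indicator S t / t * (1 / (1 + t)) \<partial>lborel)"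
proof -
  have "expectation (\<lambda>\<omega>. 1 * hlog S (F z \<omega>)) = (\<integral>t. indicator S t / t * expectation (\<lambda>\<omega>. 1 * exp (- max 0 t * (norm (F z \<omega>))\<^sup>2)) \<partial>lborel)"
    unfolding hlog_clip[OF Sj]
    by (rule expectation_weighted_integral(1)[where B = 1 and B' = 1])
       (auto intro: lborel.sigma_finite_measure_axioms weight_integrable[OF S Sj])
  also have "\<dots> = (\<integral>t. indicator S t / t * (1 / (1 + t)) \<partial>lborel)"
  proof (intro Bochner_Integration.integral_cong refl)
    fix t
    show "indicator S t / t * expectation (\<lambda>\<omega>. 1 * exp (- max 0 t * (norm (F z \<omega>))\<^sup>2)) = indicator S t / t * (1 / (1 + t))"
    proof (cases "t \<in> S")
      case True
      then have "0 < t" using Sj cutoff_pos by auto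
      then show ?thesis using laplace_one[of t z] by (simp add: max_def)
    qed simp
  qed
  finally show ?thesis by simp
qed

text \<open>The pointwise bounds of \<open>laplace_kernel_bounds\<close> are products in the two
  parameters, so they integrate separately. The lower bound is what makes covariances of truncated
  logarithms nonnegative.\<close>

lemma cov_hlog:
  assumes S [measurable]: "S \<in> sets borel" and Sj: "S \<subseteq> cutoff j"
    and S' [measurable]: "S' \<in> sets borel" and Sj': "S' \<subseteq> cutoff j'"
  shows "cov (\<lambda>\<omega>. hlog S (F z \<omega>)) (\<lambda>\<omega>. hlog S' (F w \<omega>))
    \<le> (norm (\<rho> z w))\<^sup>2 * ((\<integral>t. indicator S t * decay t \<partial>lborel) * (\<integral>s. indicator S' s * decay s \<partial>lborel))" (is ?up)
    and "(norm (\<rho> z w))\<^sup>2 * ((\<integral>t. indicator S t / (1 + t)\<^sup>2 \<partial>lborel) * (\<integral>s. indicator S' s / (1 + s)\<^sup>2 \<partial>lborel))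
    \<le> cov (\<lambda>\<omega>. hlog S (F z \<omega>)) (\<lambda>\<omega>. hlog S' (F w \<omega>))" (is ?low)
proof -
  define r where "r = norm (\<rho> z w)"
  have r: "0 \<le> r" "r \<le> 1" unfolding r_def using norm_\<rho>_le_1 by auto
  define e where "e x t \<omega> = exp (- max 0 t * (norm (F x \<omega>))\<^sup>2)" for x t \<omega>
  have e1: "\<bar>e x t \<omega>\<bar> \<le> 1" for x t \<omega> by (simp add: e_def)
  define k where "k t s = (1 / ((1 + t) * (1 + s) - t * s * r\<^sup>2) - 1 / (1 + t) * (1 / (1 + s))) / (t * s)" for t s
  define g where "g t s = indicator S t * (indicator S' s * k t s)" for t s :: real
  have [measurable]: "(\<lambda>(t, s). g t s) \<in> borel_measurable (lborel \<Otimes>\<^sub>M lborel)"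
    unfolding g_def k_def by measurable
  have pos: "t \<in> S \<Longrightarrow> 0 < t" "s \<in> S' \<Longrightarrow> 0 < s" for t s using Sj Sj' cutoff_pos by auto
  have g_up: "g t s \<le> r\<^sup>2 * ((indicator S t * decay t) * (indicator S' s * decay s))" for t s
    using laplace_kernel_bounds(1)[of r t s] r pos(1)[of t] pos(2)[of s] by (auto simp: g_def k_def split: split_indicator)
  have g_low: "r\<^sup>2 * ((indicator S t / (1 + t)\<^sup>2) * (indicator S' s / (1 + s)\<^sup>2)) \<le> g t s" for t s
    using laplace_kernel_bounds(2)[of r t s] r pos(1)[of t] pos(2)[of s] by (auto simp: g_def k_def split: split_indicator)
  have g0: "0 \<le> g t s" for t s
    using laplace_kernel_bounds(3)[of r t s] r pos(1)[of t] pos(2)[of s] by (auto simp: g_def k_def split: split_indicator)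
  have iS: "integrable lborel (\<lambda>t. indicator S t * decay t)" "integrable lborel (\<lambda>t. indicator S' t * decay t)"
    by (rule Bochner_Integration.integrable_bound[OF decay_integrable]; auto split: split_indicator)+
  have iS2: "integrable lborel (\<lambda>t. indicator U t / (1 + t)\<^sup>2)" if [measurable]: "U \<in> sets borel" and U: "U \<subseteq> cutoff i" for U i
  proof (rule Bochner_Integration.integrable_bound[of _ "indicator (cutoff i) :: real \<Rightarrow> real"])
    show "integrable lborel (indicator (cutoff i) :: real \<Rightarrow> real)"
      by (auto simp: cutoff_def emeasure_lborel_Icc_eq)
    show "AE t in lborel. norm (indicator U t / (1 + t)\<^sup>2) \<le> norm (indicator (cutoff i) t :: real)"
    proof (intro AE_I2)
      fix t
      show "norm (indicator U t / (1 + t)\<^sup>2) \<le> norm (indicator (cutoff i) t :: real)"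
      proof (cases "t \<in> U")
        case True
        then have "t \<in> cutoff i" "0 < t" using U cutoff_pos by auto
        then show ?thesis using True one_le_power[of "1 + t" 2] by (simp add: divide_le_eq)
      qed simp
    qed
  qed measurable
  have covk: "cov (e z t) (e w s) = k t s * (t * s)" if "0 < t" "0 < s" for t s
    using laplace_two[of t s z w] laplace_one[of t z] laplace_one[of s w] that
    by (simp add: cov_def e_def[abs_def] k_def r_def max_def)
  have "cov (\<lambda>\<omega>. hlog S (F z \<omega>)) (\<lambda>\<omega>. hlog S' (F w \<omega>))
      = (\<integral>t. indicator S t / t * (\<integral>s. indicator S' s / s * cov (e z t) (e w s) \<partial>lborel) \<partial>lborel)"
    unfolding hlog_clip[OF Sj] hlog_clip[OF Sj'] e_def
    by (rule cov_weighted_integrals[where ?B1.0 = 1 and ?B2.0 = 1])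
       (auto intro: lborel.sigma_finite_measure_axioms weight_integrable[OF S Sj] weight_integrable[OF S' Sj'])
  also have "\<dots> = (\<integral>t. (\<integral>s. g t s \<partial>lborel) \<partial>lborel)"
  proof (intro Bochner_Integration.integral_cong refl)
    fix t
    have "indicator S t / t * (indicator S' s / s * cov (e z t) (e w s)) = g t s" for s
    proof (cases "t \<in> S \<and> s \<in> S'")
      case True
      then have "0 < t" "0 < s" using pos by auto
      then show ?thesis using True by (simp add: g_def covk)
    qed (auto simp: g_def)
    then show "indicator S t / t * (\<integral>s. indicator S' s / s * cov (e z t) (e w s) \<partial>lborel) = (\<integral>s. g t s \<partial>lborel)"
      by (simp only: Bochner_Integration.integral_mult_right_zero[symmetric])
  qed
  finally have cov_eq: "cov (\<lambda>\<omega>. hlog S (F z \<omega>)) (\<lambda>\<omega>. hlog S' (F w \<omega>)) = (\<integral>t. (\<integral>s. g t s \<partial>lborel) \<partial>lborel)" .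
  have int_in: "integrable lborel (\<lambda>s. g t s)" for t
  proof (rule Bochner_Integration.integrable_bound[OF integrable_mult_right[OF iS(2), of "r\<^sup>2 * (indicator S t * decay t)"]])
    show "AE s in lborel. norm (g t s) \<le> norm (r\<^sup>2 * (indicator S t * decay t) * (indicator S' s * decay s))"
      using g_up g0 by (intro AE_I2) (simp add: mult.assoc abs_of_nonneg decay_nonneg)
  qed measurable
  define G where "G t = (\<integral>s. g t s \<partial>lborel)" for t
  have [measurable]: "G \<in> borel_measurable lborel" unfolding G_def by measurable
  have G0: "0 \<le> G t" for t unfolding G_def using g0 by simp
  have G_up: "G t \<le> r\<^sup>2 * (indicator S t * decay t) * (\<integral>s. indicator S' s * decay s \<partial>lborel)" for t
  proof -
    have "G t \<le> (\<integral>s. r\<^sup>2 * (indicator S t * decay t) * (indicator S' s * decay s) \<partial>lborel)"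
      unfolding G_def using iS(2) g_up by (intro integral_mono int_in) (auto simp: mult.assoc)
    then show ?thesis by simp
  qed
  have G_low: "r\<^sup>2 * (indicator S t / (1 + t)\<^sup>2) * (\<integral>s. indicator S' s / (1 + s)\<^sup>2 \<partial>lborel) \<le> G t" for t
  proof -
    have "(\<integral>s. r\<^sup>2 * (indicator S t / (1 + t)\<^sup>2) * (indicator S' s / (1 + s)\<^sup>2) \<partial>lborel) \<le> G t"
      unfolding G_def using g_low iS2[OF S' Sj'] by (intro integral_mono int_in integrable_mult_right) (auto simp: mult.assoc)
    then show ?thesis by (simp only: Bochner_Integration.integral_mult_right_zero)
  qed
  have iup: "integrable lborel (\<lambda>t. r\<^sup>2 * (indicator S t * decay t) * (\<integral>s. indicator S' s * decay s \<partial>lborel))"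
    using iS(1) by (intro integrable_mult_left integrable_mult_right)
  have int_out: "integrable lborel G"
    by (rule Bochner_Integration.integrable_bound[OF iup])
       (use G0 G_up in \<open>auto simp: abs_of_nonneg intro: order_trans[OF _ abs_ge_self]\<close>)
  have "(\<integral>t. G t \<partial>lborel) \<le> (\<integral>t. r\<^sup>2 * (indicator S t * decay t) * (\<integral>s. indicator S' s * decay s \<partial>lborel) \<partial>lborel)"
    by (intro integral_mono int_out iup G_up)
  then show ?up unfolding cov_eq G_def[symmetric]
    by (simp only: Bochner_Integration.integral_mult_right_zero Bochner_Integration.integral_mult_left_zero r_def[symmetric])
  have "(\<integral>t. r\<^sup>2 * (indicator S t / (1 + t)\<^sup>2) * (\<integral>s. indicator S' s / (1 + s)\<^sup>2 \<partial>lborel) \<partial>lborel) \<le> (\<integral>t. G t \<partial>lborel)"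
    using iS2[OF S Sj] by (intro integral_mono int_out G_low integrable_mult_left integrable_mult_right)
  then show ?low unfolding cov_eq G_def[symmetric]
    by (simp only: Bochner_Integration.integral_mult_right_zero Bochner_Integration.integral_mult_left_zero r_def[symmetric])
qed

end

lemma lborel_distr_uminus_euclidean: "distr lborel borel uminus = (lborel :: 'a :: euclidean_space measure)"
  using lborel_affine[of "- 1" "0 :: 'a"] by (simp add: density_1)

lemma lborel_integral_uminus:
  fixes f :: "'a :: euclidean_space \<Rightarrow> 'b :: {banach, second_countable_topology}"
  assumes [measurable]: "f \<in> borel_measurable borel"
  shows "(\<integral>x. f (- x) \<partial>lborel) = (\<integral>x. f x \<partial>lborel)"
proof -
  have "(\<integral>x. f x \<partial>lborel) = (\<integral>x. f x \<partial>distr lborel borel uminus)"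
    by (simp only: lborel_distr_uminus_euclidean)
  also have "\<dots> = (\<integral>x. f (- x) \<partial>lborel)" by (subst integral_distr) auto
  finally show ?thesis ..
qed

lemma pair_integral_product:
  fixes f :: "'a \<Rightarrow> 'c :: {real_normed_field, banach, second_countable_topology}" and g :: "'b \<Rightarrow> 'c"
  assumes M1: "sigma_finite_measure M1" and M2: "sigma_finite_measure M2" and f: "integrable M1 f" and g: "integrable M2 g"
  shows "integrable (M1 \<Otimes>\<^sub>M M2) (\<lambda>(x, y). f x * g y)"
    and "(\<integral>(x, y). f x * g y \<partial>(M1 \<Otimes>\<^sub>M M2)) = (\<integral>x. f x \<partial>M1) * (\<integral>y. g y \<partial>M2)"
proof -
  interpret M1: sigma_finite_measure M1 by fact
  interpret M2: sigma_finite_measure M2 by fact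
  interpret P: pair_sigma_finite M1 M2 ..
  have [measurable]: "f \<in> borel_measurable M1" "g \<in> borel_measurable M2" using f g by auto
  show 1: "integrable (M1 \<Otimes>\<^sub>M M2) (\<lambda>(x, y). f x * g y)"
    by (rule P.Fubini_integrable) (use f g in \<open>auto simp: norm_mult\<close>)
  show "(\<integral>(x, y). f x * g y \<partial>(M1 \<Otimes>\<^sub>M M2)) = (\<integral>x. f x \<partial>M1) * (\<integral>y. g y \<partial>M2)"
    using P.integral_fst'[OF 1] by simp
qed

text \<open>All upper bounds below see the intensity only through \<kappa>, which bounds the
  integrated correlation of a point of \<open>D\<close> with \<open>D\<close>. Neither the ball nor
  holomorphy enters.\<close>

locale gaussian_statistic = gaussian_field M F \<rho>
  for M :: "'w measure" and F :: "'v :: euclidean_space \<Rightarrow> 'w \<Rightarrow> complex" and \<rho> +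
  fixes h :: "'v \<Rightarrow> real" and D :: "'v set" and H \<kappa> :: real
  assumes h_measurable [measurable]: "h \<in> borel_measurable borel"
    and h_le: "\<bar>h z\<bar> \<le> H" and h_support: "h z \<noteq> 0 \<Longrightarrow> z \<in> D"
    and D_measurable [measurable]: "D \<in> sets borel" and D_finite: "emeasure lborel D < \<infinity>"
    and \<kappa>_nonneg: "0 \<le> \<kappa>"
    and \<rho>_integral_le: "z \<in> D \<Longrightarrow> (\<integral>w. indicator D w * norm (\<rho> z w) \<partial>lborel) \<le> \<kappa>"
begin

lemma H_nonneg: "0 \<le> H"
  using h_le[of undefined] by linarith

lemma integrable_D: "integrable lborel (indicator D :: 'v \<Rightarrow> real)"
  using D_finite by simp

lemma dominated_integrable:
  fixes p :: "'v \<Rightarrow> 'b :: {banach, second_countable_topology}"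
  assumes [measurable]: "p \<in> borel_measurable borel" and p: "\<And>z. norm (p z) \<le> P * indicator D z"
  shows "integrable lborel p"
  by (rule Bochner_Integration.integrable_bound[OF integrable_mult_right[OF integrable_D, of P]])
     (use p in \<open>auto intro: order_trans[OF _ abs_ge_self]\<close>)

lemma h_dominated: "norm (h z) \<le> H * indicator D z"
  using h_le[of z] h_support[of z] by (cases "z \<in> D") (auto intro: ccontr)

lemma h_integrable: "integrable lborel h"
  by (rule dominated_integrable[OF _ h_dominated]) measurable

lemma integral_dominated_le:
  assumes "\<And>z. norm (p z) \<le> P * indicator D z" "0 \<le> P"
  shows "(\<integral>z. norm (p z) \<partial>lborel) \<le> P * measure lborel D"
proof -
  have "(\<integral>z. norm (p z) \<partial>lborel) \<le> (\<integral>z. P * indicator D z \<partial>lborel)"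
    using assms integrable_D by (intro integral_mono') auto
  then show ?thesis by simp
qed

lemma corr_integral_dominated_le:
  assumes q: "\<And>w. \<bar>q w\<bar> \<le> Q * indicator D w" and Q: "0 \<le> Q" and z: "z \<in> D"
  shows "(\<integral>w. \<bar>q w\<bar> * norm (\<rho> z w) \<partial>lborel) \<le> Q * \<kappa>"
proof -
  have "(\<integral>w. \<bar>q w\<bar> * norm (\<rho> z w) \<partial>lborel) \<le> (\<integral>w. Q * (indicator D w * norm (\<rho> z w)) \<partial>lborel)"
  proof (rule integral_mono')
    show "integrable lborel (\<lambda>w. Q * (indicator D w * norm (\<rho> z w)))"
      by (rule integrable_mult_right, rule dominated_integrable[where P = 1])
         (use norm_\<rho>_le_1 in \<open>auto split: split_indicator\<close>)
    show "\<bar>q w\<bar> * norm (\<rho> z w) \<le> Q * (indicator D w * norm (\<rho> z w))" for w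
      using mult_right_mono[OF q norm_ge_zero, of w "\<rho> z w"] by (simp add: mult_ac)
    show "0 \<le> Q * (indicator D w * norm (\<rho> z w))" for w using Q by simp
  qed
  also have "\<dots> \<le> Q * \<kappa>" using \<rho>_integral_le[OF z] Q by (simp add: mult_left_mono)
  finally show ?thesis .
qed

text \<open>A Schur-type estimate: the inner integral costs one factor \<kappa>, uniformly on
  \<open>D\<close>, and the outer one only the measure of \<open>D\<close>.\<close>

lemma double_integral_le:
  assumes [measurable]: "p \<in> borel_measurable borel" "q \<in> borel_measurable borel"
    and p: "\<And>z. \<bar>p z\<bar> \<le> P * indicator D z" and P: "0 \<le> P"
    and q: "\<And>z. \<bar>q z\<bar> \<le> Q * indicator D z" and Q: "0 \<le> Q"
    and c: "\<And>z w. \<bar>c z w\<bar> \<le> b * norm (\<rho> z w)" and b: "0 \<le> b"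
  shows "\<bar>\<integral>z. p z * (\<integral>w. q w * c z w \<partial>lborel) \<partial>lborel\<bar> \<le> P * Q * b * measure lborel D * \<kappa>"
proof -
  have inner: "\<bar>\<integral>w. q w * c z w \<partial>lborel\<bar> \<le> b * (Q * \<kappa>)" if z: "z \<in> D" for z
  proof -
    have "\<bar>\<integral>w. q w * c z w \<partial>lborel\<bar> \<le> (\<integral>w. \<bar>q w * c z w\<bar> \<partial>lborel)" by (rule integral_abs_bound)
    also have "\<dots> \<le> (\<integral>w. b * (\<bar>q w\<bar> * norm (\<rho> z w)) \<partial>lborel)"
    proof (rule integral_mono')
      show "integrable lborel (\<lambda>w. b * (\<bar>q w\<bar> * norm (\<rho> z w)))"
        by (rule integrable_mult_right, rule dominated_integrable[where P = Q])
           (use norm_\<rho>_le_1 q in \<open>auto simp: abs_mult intro!: order_trans[OF mult_right_le_one_le q]\<close>)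
      show "\<bar>q w * c z w\<bar> \<le> b * (\<bar>q w\<bar> * norm (\<rho> z w))" for w
        using mult_left_mono[OF c abs_ge_zero, of "q w" z w] by (simp add: abs_mult mult_ac)
    qed (use b in auto)
    also have "\<dots> \<le> b * (Q * \<kappa>)" using corr_integral_dominated_le[OF q Q z] b by (simp add: mult_left_mono)
    finally show ?thesis .
  qed
  have "\<bar>\<integral>z. p z * (\<integral>w. q w * c z w \<partial>lborel) \<partial>lborel\<bar> \<le> (\<integral>z. \<bar>p z * (\<integral>w. q w * c z w \<partial>lborel)\<bar> \<partial>lborel)"
    by (rule integral_abs_bound)
  also have "\<dots> \<le> (\<integral>z. P * (b * (Q * \<kappa>)) * indicator D z \<partial>lborel)"
  proof (rule integral_mono')
    show "integrable lborel (\<lambda>z. P * (b * (Q * \<kappa>)) * indicator D z)" by (intro integrable_mult_right integrable_D)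
    fix z
    show "\<bar>p z * (\<integral>w. q w * c z w \<partial>lborel)\<bar> \<le> P * (b * (Q * \<kappa>)) * indicator D z"
    proof (cases "z \<in> D")
      case True
      then show ?thesis using p[of z] inner[OF True] P by (simp add: abs_mult mult_mono)
    next
      case False
      then have "p z = 0" using p[of z] by simp
      then show ?thesis using False by simp
    qed
    show "0 \<le> P * (b * (Q * \<kappa>)) * indicator D z" using P b Q \<kappa>_nonneg by simp
  qed
  also have "\<dots> = P * Q * b * measure lborel D * \<kappa>" by simp
  finally show ?thesis .
qed

text \<open>Density and parameter set are both left free: increments of the cutoff and the test
  variable of the variance bound are statistics of this kind.\<close>

definition lstat :: "('v \<Rightarrow> real) \<Rightarrow> real set \<Rightarrow> 'w \<Rightarrow> real" where
  "lstat p S \<omega> = (\<integral>z. p z * hlog S (F z \<omega>) \<partial>lborel)"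

lemma hlog_bounded:
  assumes S: "S \<in> sets borel" "S \<subseteq> cutoff j"
  shows "\<bar>hlog S x\<bar> \<le> (\<integral>t. indicator S t / t \<partial>lborel)"
proof -
  have "\<bar>hlog S x\<bar> \<le> (\<integral>t. \<bar>indicator S t / t * exp (- t * (norm x)\<^sup>2)\<bar> \<partial>lborel)"
    unfolding hlog_def by (rule integral_abs_bound)
  also have "\<dots> \<le> (\<integral>t. indicator S t / t \<partial>lborel)"
  proof (rule integral_mono')
    fix t
    show "\<bar>indicator S t / t * exp (- t * (norm x)\<^sup>2)\<bar> \<le> indicator S t / t"
      using S(2) cutoff_pos[of t j] by (cases "t \<in> S") (auto simp: abs_mult divide_le_cancel)
    show "0 \<le> indicator S t / t" using S(2) cutoff_pos[of t j] by (cases "t \<in> S") auto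
  qed (rule weight_integrable[OF S])
  finally show ?thesis .
qed

lemma lstat_basic:
  assumes [measurable]: "p \<in> borel_measurable borel" and p: "\<And>z. \<bar>p z\<bar> \<le> P * indicator D z"
    and S [measurable]: "S \<in> sets borel" and Sj: "S \<subseteq> cutoff j"
  shows "lstat p S \<in> borel_measurable M"
    and "\<exists>B. \<forall>\<omega>. \<bar>lstat p S \<omega>\<bar> \<le> B"
    and "expectation (lstat p S) = (\<integral>z. p z * (\<integral>t. indicator S t / t * (1 / (1 + t)) \<partial>lborel) \<partial>lborel)"
    and "integrable M (lstat p S)" "integrable M (\<lambda>\<omega>. (lstat p S \<omega>)\<^sup>2)"
proof -
  have ip: "integrable lborel p" by (rule dominated_integrable[where P = P]) (use p in auto)
  have m: "(\<lambda>(z, \<omega>). hlog S (F z \<omega>)) \<in> borel_measurable (lborel \<Otimes>\<^sub>M M)" by measurable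
  note E = expectation_weighted_integral[OF lborel.sigma_finite_measure_axioms m hlog_bounded[OF S Sj] ip]
  show meas [measurable]: "lstat p S \<in> borel_measurable M"
    using E(2)[of "\<lambda>_. 1" 1] unfolding lstat_def by simp
  show ex: "\<exists>B. \<forall>\<omega>. \<bar>lstat p S \<omega>\<bar> \<le> B"
    using E(3)[of "\<lambda>_. 1" 1] unfolding lstat_def by auto
  show "expectation (lstat p S) = (\<integral>z. p z * (\<integral>t. indicator S t / t * (1 / (1 + t)) \<partial>lborel) \<partial>lborel)"
    using E(1)[of "\<lambda>_. 1" 1] unfolding lstat_def by (simp add: expectation_hlog[OF S Sj])
  obtain B where B: "\<And>\<omega>. \<bar>lstat p S \<omega>\<bar> \<le> B" using ex by blast
  show "integrable M (lstat p S)" by (rule integrable_const_bound[where B = B]) (use B in auto)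
  show "integrable M (\<lambda>\<omega>. (lstat p S \<omega>)\<^sup>2)"
  proof (rule integrable_const_bound[where B = "B\<^sup>2"])
    show "AE \<omega> in M. norm ((lstat p S \<omega>)\<^sup>2) \<le> B\<^sup>2"
      using B by (intro AE_I2) (simp add: abs_le_square_iff[symmetric] order_trans[OF B abs_ge_self])
  qed measurable
qed

lemma cov_lstat:
  assumes [measurable]: "p \<in> borel_measurable borel" and p: "\<And>z. \<bar>p z\<bar> \<le> P * indicator D z"
    and S [measurable]: "S \<in> sets borel" and Sj: "S \<subseteq> cutoff j"
    and [measurable]: "q \<in> borel_measurable borel" and q: "\<And>z. \<bar>q z\<bar> \<le> Q * indicator D z"
    and S' [measurable]: "S' \<in> sets borel" and Sj': "S' \<subseteq> cutoff j'"
  shows "cov (lstat p S) (lstat q S')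
    = (\<integral>z. p z * (\<integral>w. q w * cov (\<lambda>\<omega>. hlog S (F z \<omega>)) (\<lambda>\<omega>. hlog S' (F w \<omega>)) \<partial>lborel) \<partial>lborel)"
proof -
  have ip: "integrable lborel p" by (rule dominated_integrable[where P = P]) (use p in auto)
  have iq: "integrable lborel q" by (rule dominated_integrable[where P = Q]) (use q in auto)
  have m: "(\<lambda>(z, \<omega>). hlog S (F z \<omega>)) \<in> borel_measurable (lborel \<Otimes>\<^sub>M M)"
    "(\<lambda>(z, \<omega>). hlog S' (F z \<omega>)) \<in> borel_measurable (lborel \<Otimes>\<^sub>M M)" by measurable
  show ?thesis
    unfolding lstat_def
    by (rule cov_weighted_integrals[OF lborel.sigma_finite_measure_axioms m(1) hlog_bounded[OF S Sj] ip
          lborel.sigma_finite_measure_axioms m(2) hlog_bounded[OF S' Sj'] iq])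
qed

definition dint :: "real set \<Rightarrow> real" where
  "dint S = (\<integral>t. indicator S t * decay t \<partial>lborel)"

lemma dint_nonneg: "0 \<le> dint S"
  unfolding dint_def using decay_nonneg by (intro integral_nonneg_AE AE_I2) auto

text \<open>Passing from the square of \<open>norm (\<rho> z w)\<close> to its first power matches
  \<kappa>, which integrates the first power.\<close>

lemma cov_hlog_bounds:
  assumes S: "S \<in> sets borel" "S \<subseteq> cutoff j" and S': "S' \<in> sets borel" "S' \<subseteq> cutoff j'"
  shows "0 \<le> cov (\<lambda>\<omega>. hlog S (F z \<omega>)) (\<lambda>\<omega>. hlog S' (F w \<omega>))"
    and "cov (\<lambda>\<omega>. hlog S (F z \<omega>)) (\<lambda>\<omega>. hlog S' (F w \<omega>)) \<le> (dint S * dint S') * (norm (\<rho> z w))\<^sup>2"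
    and "\<bar>cov (\<lambda>\<omega>. hlog S (F z \<omega>)) (\<lambda>\<omega>. hlog S' (F w \<omega>))\<bar> \<le> (dint S * dint S') * norm (\<rho> z w)"
proof -
  show 1: "0 \<le> cov (\<lambda>\<omega>. hlog S (F z \<omega>)) (\<lambda>\<omega>. hlog S' (F w \<omega>))"
    by (rule order_trans[OF _ cov_hlog(2)[OF S S']]) (auto intro!: mult_nonneg_nonneg integral_nonneg_AE)
  show 2: "cov (\<lambda>\<omega>. hlog S (F z \<omega>)) (\<lambda>\<omega>. hlog S' (F w \<omega>)) \<le> (dint S * dint S') * (norm (\<rho> z w))\<^sup>2"
    using cov_hlog(1)[OF S S', of z w] by (simp add: dint_def mult.commute)
  have "(norm (\<rho> z w))\<^sup>2 \<le> norm (\<rho> z w)"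
    using norm_\<rho>_le_1[of z w] by (simp add: power2_eq_square mult_left_le)
  then have "(dint S * dint S') * (norm (\<rho> z w))\<^sup>2 \<le> (dint S * dint S') * norm (\<rho> z w)"
    by (intro mult_left_mono) (auto simp: dint_nonneg)
  then show "\<bar>cov (\<lambda>\<omega>. hlog S (F z \<omega>)) (\<lambda>\<omega>. hlog S' (F w \<omega>))\<bar> \<le> (dint S * dint S') * norm (\<rho> z w)"
    using 1 2 by linarith
qed

text \<open>The bound is quadratic in \<open>dint S\<close> and linear in \<kappa>, so parameters of
  small \<open>decay\<close> mass contribute little on the scale \<kappa>, whatever the
  intensity.\<close>

lemma variance_lstat_le:
  assumes m [measurable]: "p \<in> borel_measurable borel" and p: "\<And>z. \<bar>p z\<bar> \<le> P * indicator D z" and P: "0 \<le> P"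
    and S: "S \<in> sets borel" "S \<subseteq> cutoff j"
  shows "variance (lstat p S) \<le> P\<^sup>2 * measure lborel D * \<kappa> * (dint S)\<^sup>2"
proof -
  have "variance (lstat p S) = cov (lstat p S) (lstat p S)"
    using lstat_basic[OF m p S] by (simp add: cov_self)
  also have "\<dots> \<le> P * P * (dint S * dint S) * measure lborel D * \<kappa>"
    unfolding cov_lstat[OF m p S m p S]
    by (rule order_trans[OF abs_ge_self], rule double_integral_le[OF m m p P p P])
       (auto simp: dint_nonneg intro: cov_hlog_bounds(3)[OF S S])
  finally show ?thesis by (simp add: power2_eq_square mult_ac)
qed

subsection \<open>The logarithm as a limit in mean square\<close>

definition scale :: real where
  "scale = H\<^sup>2 * measure lborel D * \<kappa>"

lemma scale_nonneg: "0 \<le> scale"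
  unfolding scale_def using \<kappa>_nonneg by simp

text \<open>The sign is reversed because the exponential enters the logarithm with a minus; so
  \<open>apx j\<close> approximates the centred logarithm itself.\<close>

definition apx :: "nat \<Rightarrow> 'w \<Rightarrow> real" where
  "apx j \<omega> = expectation (lstat h (cutoff j)) - lstat h (cutoff j) \<omega>"

text \<open>Adding \<open>log_const\<close> centres the logarithm of the normalised field.\<close>

definition logstat :: "'w \<Rightarrow> real" where
  "logstat \<omega> = (\<integral>z. h z * (ln ((norm (F z \<omega>))\<^sup>2) + log_const) \<partial>lborel)"

lemmas h_dom = h_dominated[unfolded real_norm_def]
lemmas apx_basic = lstat_basic[OF h_measurable h_dom cutoff_measurable order_refl]

lemma apx_measurable [measurable]: "apx j \<in> borel_measurable M"
  unfolding apx_def using apx_basic(1) by simp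

lemma apx_integrable: "integrable M (apx j)"
  unfolding apx_def using apx_basic(4) by simp

lemma apx_mean: "expectation (apx j) = 0"
  unfolding apx_def using apx_basic(4) by (simp add: prob_space)

lemma apx_square: "expectation (\<lambda>\<omega>. (apx j \<omega>)\<^sup>2) = variance (lstat h (cutoff j))"
  by (simp add: apx_def power2_commute)

lemma apx_bounded: "\<exists>B. \<forall>\<omega>. \<bar>apx j \<omega>\<bar> \<le> B"
proof -
  obtain B where B: "\<And>\<omega>. \<bar>lstat h (cutoff j) \<omega>\<bar> \<le> B" using apx_basic(2) by blast
  have "\<bar>apx j \<omega>\<bar> \<le> \<bar>expectation (lstat h (cutoff j))\<bar> + B" for \<omega>
    unfolding apx_def using B[of \<omega>] by linarith
  then show ?thesis by blast
qed

lemma apx_eq_log_approx: "apx j \<omega> = (\<integral>z. h z * log_approx (cutoff j) (F z \<omega>) \<partial>lborel)"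
proof -
  have i1: "integrable lborel (\<lambda>z. h z * hlog (cutoff j) (F z \<omega>))"
  proof (rule Bochner_Integration.integrable_bound[OF integrable_mult_left[OF h_integrable, of "\<integral>t. indicator (cutoff j) t / t \<partial>lborel"]])
    show "(\<lambda>z. h z * hlog (cutoff j) (F z \<omega>)) \<in> borel_measurable lborel"
      using F_measurable_section[of \<omega>] by measurable
    show "AE z in lborel. norm (h z * hlog (cutoff j) (F z \<omega>)) \<le> norm (h z * (\<integral>t. indicator (cutoff j) t / t \<partial>lborel))"
      unfolding real_norm_def abs_mult
      by (intro AE_I2 mult_left_mono order_trans[OF hlog_bounded[OF cutoff_measurable order_refl] abs_ge_self] abs_ge_zero)
  qed
  have i2: "integrable lborel (\<lambda>z. h z * (\<integral>t. indicator (cutoff j) t / t * (1 / (1 + t)) \<partial>lborel))"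
    by (intro integrable_mult_left h_integrable)
  show ?thesis
    unfolding apx_def apx_basic(3) lstat_def hlog_log_approx[OF cutoff_measurable order_refl]
    using i1 i2 by (simp add: right_diff_distrib)
qed

text \<open>Up to sign the difference is the centred statistic over the parameters in
  \<open>cutoff i - cutoff j\<close>, whose \<open>decay\<close> mass is at most
  \<open>decay_tail j\<close>; so the bound is uniform in \<open>i\<close>.\<close>

lemma apx_diff_square:
  assumes "j \<le> i"
  shows "expectation (\<lambda>\<omega>. (apx i \<omega> - apx j \<omega>)\<^sup>2) \<le> scale * (decay_tail j)\<^sup>2"
proof -
  define S where "S = cutoff i - cutoff j"
  have S: "S \<in> sets borel" "S \<subseteq> cutoff i" by (auto simp: S_def)
  have sub: "cutoff j \<subseteq> cutoff i" by (rule cutoff_mono[OF assms])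
  have hl: "hlog (cutoff i) x = hlog (cutoff j) x + hlog S x" for x
  proof -
    have e: "integrable lborel (\<lambda>t. indicator U t / t * exp (- t * (norm x)\<^sup>2))" if "U \<in> sets borel" "U \<subseteq> cutoff i" for U
      by (rule indicator_div_integrable[OF that, where B = 1]) (use that in \<open>auto dest!: cutoff_pos subsetD simp: zero_le_mult_iff\<close>)
    show ?thesis
      unfolding hlog_def
      by (subst Bochner_Integration.integral_add[symmetric, OF e e])
         (use S sub in \<open>auto simp: S_def intro!: Bochner_Integration.integral_cong split: split_indicator\<close>)
  qed
  have int: "integrable lborel (\<lambda>z. h z * hlog U (F z \<omega>))" if U [measurable]: "U \<in> sets borel" and "U \<subseteq> cutoff i" for U \<omega>
  proof (rule Bochner_Integration.integrable_bound[OF integrable_mult_left[OF h_integrable, of "\<integral>t. indicator U t / t \<partial>lborel"]])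
    show "(\<lambda>z. h z * hlog U (F z \<omega>)) \<in> borel_measurable lborel"
      using F_measurable_section[of \<omega>] by measurable
    show "AE z in lborel. norm (h z * hlog U (F z \<omega>)) \<le> norm (h z * (\<integral>t. indicator U t / t \<partial>lborel))"
      unfolding real_norm_def abs_mult
      by (intro AE_I2 mult_left_mono order_trans[OF hlog_bounded[OF that] abs_ge_self] abs_ge_zero)
  qed
  have ls: "lstat h (cutoff i) \<omega> = lstat h (cutoff j) \<omega> + lstat h S \<omega>" for \<omega>
    unfolding lstat_def hl distrib_left using int sub S by (intro Bochner_Integration.integral_add) auto
  have "expectation (lstat h (cutoff i)) = expectation (lstat h (cutoff j)) + expectation (lstat h S)"
    unfolding ls using lstat_basic(4)[OF h_measurable h_dom S] apx_basic(4) by (intro Bochner_Integration.integral_add)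
  then have "apx i \<omega> - apx j \<omega> = - (lstat h S \<omega> - expectation (lstat h S))" for \<omega>
    unfolding apx_def ls by simp
  then have "expectation (\<lambda>\<omega>. (apx i \<omega> - apx j \<omega>)\<^sup>2) = variance (lstat h S)"
    by (simp only: power2_minus)
  also have "\<dots> \<le> scale * (dint S)\<^sup>2"
    unfolding scale_def by (rule variance_lstat_le[OF h_measurable h_dom H_nonneg S])
  also have "\<dots> \<le> scale * (decay_tail j)\<^sup>2"
  proof -
    have "dint S \<le> decay_tail j" unfolding dint_def by (rule decay_le_tail) (auto simp: S_def)
    then show ?thesis using dint_nonneg scale_nonneg by (intro mult_left_mono power_mono) auto
  qed
  finally show ?thesis .
qed

text \<open>The moment is not computed: the truncated logarithms have variances bounded uniformly in
  \<open>j\<close>, and Fatou's lemma passes to the limit.\<close>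

lemma log_moment: "(\<integral>\<^sup>+ \<omega>. ennreal ((ln ((norm (F z \<omega>))\<^sup>2) + log_const)\<^sup>2) \<partial>M) \<le> ennreal ((integral\<^sup>L lborel decay)\<^sup>2)"
proof -
  have *: "(\<integral>\<^sup>+ \<omega>. ennreal ((log_approx (cutoff j) (F z \<omega>))\<^sup>2) \<partial>M) \<le> ennreal ((integral\<^sup>L lborel decay)\<^sup>2)" for j
  proof -
    note S = cutoff_measurable[of j] order_refl[of "cutoff j"]
    have m [measurable]: "(\<lambda>\<omega>. hlog (cutoff j) (F z \<omega>)) \<in> borel_measurable M" by measurable
    define B where "B = (\<integral>t. indicator (cutoff j) t / t \<partial>lborel)"
    have B: "\<bar>hlog (cutoff j) x\<bar> \<le> B" for x unfolding B_def by (rule hlog_bounded[OF S])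
    have i1: "integrable M (\<lambda>\<omega>. hlog (cutoff j) (F z \<omega>))" by (rule integrable_const_bound[where B = B]) (use B in auto)
    have i2: "integrable M (\<lambda>\<omega>. (hlog (cutoff j) (F z \<omega>))\<^sup>2)"
    proof (rule integrable_const_bound[where B = "B\<^sup>2"])
      show "AE \<omega> in M. norm ((hlog (cutoff j) (F z \<omega>))\<^sup>2) \<le> B\<^sup>2"
        using B by (intro AE_I2) (simp add: abs_le_square_iff[symmetric] order_trans[OF B abs_ge_self])
    qed measurable
    define e where "e = expectation (\<lambda>\<omega>. hlog (cutoff j) (F z \<omega>))"
    have la: "log_approx (cutoff j) (F z \<omega>) = e - hlog (cutoff j) (F z \<omega>)" for \<omega>
      unfolding e_def expectation_hlog[OF S] by (rule hlog_log_approx[OF S])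
    have i3: "integrable M (\<lambda>\<omega>. (e - hlog (cutoff j) (F z \<omega>))\<^sup>2)"
      using i1 i2 by (simp add: power2_diff)
    have "(\<integral>\<^sup>+ \<omega>. ennreal ((log_approx (cutoff j) (F z \<omega>))\<^sup>2) \<partial>M) = ennreal (variance (\<lambda>\<omega>. hlog (cutoff j) (F z \<omega>)))"
      unfolding la using i3 by (subst nn_integral_eq_integral) (auto simp: e_def power2_commute)
    also have "variance (\<lambda>\<omega>. hlog (cutoff j) (F z \<omega>)) \<le> (dint (cutoff j) * dint (cutoff j)) * (norm (\<rho> z z))\<^sup>2"
      using cov_hlog_bounds(2)[OF S S, of z z] cov_self[OF i1 i2] by simp
    also have "\<dots> \<le> (integral\<^sup>L lborel decay)\<^sup>2"
    proof -
      have "dint (cutoff j) \<le> integral\<^sup>L lborel decay"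
        unfolding dint_def using decay_integrable decay_nonneg
        by (intro integral_mono') (auto split: split_indicator)
      then have "dint (cutoff j) * dint (cutoff j) \<le> integral\<^sup>L lborel decay * integral\<^sup>L lborel decay"
        using dint_nonneg order_trans by (intro mult_mono) blast+
      then show ?thesis by (simp add: \<rho>_self power2_eq_square)
    qed
    finally show ?thesis by (simp add: ennreal_leI)
  qed
  have "(\<integral>\<^sup>+ \<omega>. ennreal ((ln ((norm (F z \<omega>))\<^sup>2) + log_const)\<^sup>2) \<partial>M)
      = (\<integral>\<^sup>+ \<omega>. liminf (\<lambda>j. ennreal ((log_approx (cutoff j) (F z \<omega>))\<^sup>2)) \<partial>M)"
  proof (rule nn_integral_cong_AE)
    show "AE \<omega> in M. ennreal ((ln ((norm (F z \<omega>))\<^sup>2) + log_const)\<^sup>2) = liminf (\<lambda>j. ennreal ((log_approx (cutoff j) (F z \<omega>))\<^sup>2))"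
      using F_nonzero[of z]
    proof eventually_elim
      case (elim \<omega>)
      have "(\<lambda>j. ennreal ((log_approx (cutoff j) (F z \<omega>))\<^sup>2)) \<longlonglongrightarrow> ennreal ((ln ((norm (F z \<omega>))\<^sup>2) + log_const)\<^sup>2)"
        by (rule tendsto_ennrealI[OF tendsto_power[OF log_approx_tendsto[OF elim]]])
      from lim_imp_Liminf[OF _ this] show ?case by simp
    qed
  qed
  also have "\<dots> \<le> liminf (\<lambda>j. \<integral>\<^sup>+ \<omega>. ennreal ((log_approx (cutoff j) (F z \<omega>))\<^sup>2) \<partial>M)"
    by (rule nn_integral_liminf) (simp add: hlog_log_approx[OF cutoff_measurable order_refl])
  also have "\<dots> \<le> ennreal ((integral\<^sup>L lborel decay)\<^sup>2)"
    by (rule Liminf_le) (auto simp: *)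
  finally show ?thesis .
qed

text \<open>Tonelli with the crude \<open>\<bar>x\<bar> \<le> 1 + x\<^sup>2\<close> and the uniform
  second moment. It supplies the majorant for dominated convergence along almost every path.\<close>

lemma AE_log_integrable: "AE \<omega> in M. integrable lborel (\<lambda>z. h z * ln ((norm (F z \<omega>))\<^sup>2))"
proof -
  interpret P: pair_sigma_finite lborel M ..
  define B where "B = (integral\<^sup>L lborel decay)\<^sup>2"
  define f where "f z \<omega> = h z * (ln ((norm (F z \<omega>))\<^sup>2) + log_const)" for z \<omega>
  have fm [measurable]: "(\<lambda>(z, \<omega>). f z \<omega>) \<in> borel_measurable (lborel \<Otimes>\<^sub>M M)" unfolding f_def by measurable
  have "(\<integral>\<^sup>+ \<omega>. \<integral>\<^sup>+ z. ennreal (norm (f z \<omega>)) \<partial>lborel \<partial>M) = (\<integral>\<^sup>+ z. \<integral>\<^sup>+ \<omega>. ennreal (norm (f z \<omega>)) \<partial>M \<partial>lborel)"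
    by (rule P.Fubini') measurable
  also have "\<dots> \<le> (\<integral>\<^sup>+ z. ennreal (H * indicator D z) * ennreal (1 + B) \<partial>lborel)"
  proof (rule nn_integral_mono)
    fix z
    have "(\<integral>\<^sup>+ \<omega>. ennreal (norm (f z \<omega>)) \<partial>M) \<le> (\<integral>\<^sup>+ \<omega>. ennreal (H * indicator D z) * (1 + ennreal ((ln ((norm (F z \<omega>))\<^sup>2) + log_const)\<^sup>2)) \<partial>M)"
    proof (rule nn_integral_mono)
      fix \<omega>
      define x where "x = ln ((norm (F z \<omega>))\<^sup>2) + log_const"
      have "\<bar>x\<bar> \<le> 1 + x\<^sup>2" using sum_squares_bound[of 1 "\<bar>x\<bar>"] by simp
      then have "norm (f z \<omega>) \<le> (H * indicator D z) * (1 + x\<^sup>2)"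
        unfolding f_def x_def[symmetric] real_norm_def abs_mult using h_dom[of z] by (intro mult_mono) auto
      then have "ennreal (norm (f z \<omega>)) \<le> ennreal ((H * indicator D z) * (1 + x\<^sup>2))" by (rule ennreal_leI)
      also have "\<dots> = ennreal (H * indicator D z) * ennreal (1 + x\<^sup>2)"
        using H_nonneg by (intro ennreal_mult) auto
      also have "ennreal (1 + x\<^sup>2) = 1 + ennreal (x\<^sup>2)" by (subst ennreal_plus) auto
      finally have "ennreal (norm (f z \<omega>)) \<le> ennreal (H * indicator D z) * (1 + ennreal (x\<^sup>2))" .
      then show "ennreal (norm (f z \<omega>)) \<le> ennreal (H * indicator D z) * (1 + ennreal ((ln ((norm (F z \<omega>))\<^sup>2) + log_const)\<^sup>2))"
        by (simp only: x_def)
    qed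
    also have "\<dots> = ennreal (H * indicator D z) * (1 + (\<integral>\<^sup>+ \<omega>. ennreal ((ln ((norm (F z \<omega>))\<^sup>2) + log_const)\<^sup>2) \<partial>M))"
      by (subst nn_integral_cmult) (auto simp: nn_integral_add emeasure_space_1)
    also have "\<dots> \<le> ennreal (H * indicator D z) * ennreal (1 + B)"
      using log_moment[of z] by (intro mult_left_mono) (auto simp: B_def add_left_mono)
    finally show "(\<integral>\<^sup>+ \<omega>. ennreal (norm (f z \<omega>)) \<partial>M) \<le> ennreal (H * indicator D z) * ennreal (1 + B)" .
  qed
  also have "\<dots> < \<infinity>"
  proof -
    have "(\<integral>\<^sup>+ z. ennreal (H * indicator D z) \<partial>lborel) = ennreal (H * measure lborel D)"
      using nn_integral_eq_integral[OF integrable_mult_right[OF integrable_D, of H]] H_nonneg by simp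
    then show ?thesis by (simp add: nn_integral_multc ennreal_mult_less_top)
  qed
  finally have "AE \<omega> in M. (\<integral>\<^sup>+ z. ennreal (norm (f z \<omega>)) \<partial>lborel) \<noteq> \<infinity>"
    by (intro nn_integral_PInf_AE) auto
  then show ?thesis
  proof eventually_elim
    case (elim \<omega>)
    have "(\<lambda>z. f z \<omega>) \<in> borel_measurable lborel"
      using F_measurable_section[of \<omega>] unfolding f_def by measurable
    then have "integrable lborel (\<lambda>z. f z \<omega>)" using elim by (intro integrableI_bounded) (auto simp: less_top)
    from Bochner_Integration.integrable_diff[OF this integrable_mult_left[OF h_integrable, of log_const]]
    show ?case by (simp add: f_def algebra_simps)
  qed
qed

lemma AE_F_nonzero: "AE \<omega> in M. AE z in lborel. F z \<omega> \<noteq> 0"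
proof -
  interpret P: pair_sigma_finite lborel M ..
  have "AE z in lborel. AE \<omega> in M. F z \<omega> \<noteq> 0" using F_nonzero by simp
  moreover have "{x \<in> space (lborel \<Otimes>\<^sub>M M). F (fst x) (snd x) \<noteq> 0} \<in> sets (lborel \<Otimes>\<^sub>M M)"
    by measurable
  ultimately show ?thesis using P.AE_commute[of "\<lambda>z \<omega>. F z \<omega> \<noteq> 0"] by simp
qed

lemma apx_tendsto: "AE \<omega> in M. (\<lambda>j. apx j \<omega>) \<longlonglongrightarrow> logstat \<omega>"
  using AE_log_integrable AE_F_nonzero
proof eventually_elim
  case (elim \<omega>)
  have [measurable]: "(\<lambda>z. F z \<omega>) \<in> borel_measurable borel" by (rule F_measurable_section)
  show ?case
    unfolding apx_eq_log_approx logstat_def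
  proof (rule integral_dominated_convergence[where w = "\<lambda>z. \<bar>h z * ln ((norm (F z \<omega>))\<^sup>2)\<bar> + \<bar>h z\<bar> * log_const"])
    show "integrable lborel (\<lambda>z. \<bar>h z * ln ((norm (F z \<omega>))\<^sup>2)\<bar> + \<bar>h z\<bar> * log_const)"
      using elim(1) h_integrable by auto
    show "AE z in lborel. (\<lambda>j. h z * log_approx (cutoff j) (F z \<omega>)) \<longlonglongrightarrow> h z * (ln ((norm (F z \<omega>))\<^sup>2) + log_const)"
      using elim(2) by eventually_elim (rule tendsto_mult[OF tendsto_const log_approx_tendsto])
    show "AE z in lborel. norm (h z * log_approx (cutoff j) (F z \<omega>)) \<le> \<bar>h z * ln ((norm (F z \<omega>))\<^sup>2)\<bar> + \<bar>h z\<bar> * log_const" for j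
      using elim(2)
    proof eventually_elim
      case (elim z)
      then show ?case
        using mult_left_mono[OF log_approx_le[OF elim, of j], of "\<bar>h z\<bar>"] by (simp add: abs_mult distrib_left)
    qed
    show "(\<lambda>z. h z * log_approx (cutoff j) (F z \<omega>)) \<in> borel_measurable lborel" for j
      unfolding hlog_log_approx[OF cutoff_measurable order_refl] by measurable
  qed measurable
qed

lemma logstat_measurable [measurable]: "logstat \<in> borel_measurable M"
  unfolding logstat_def by measurable

text \<open>Fatou's lemma in \<open>i\<close>, applied to \<open>apx i - apx j\<close>: the bound is
  uniform in \<open>i\<close>, and \<open>apx i\<close> converges almost surely to the logarithmic
  statistic.\<close>

lemma logstat_apx:
  shows "integrable M (\<lambda>\<omega>. (logstat \<omega> - apx j \<omega>)\<^sup>2)"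
    and "expectation (\<lambda>\<omega>. (logstat \<omega> - apx j \<omega>)\<^sup>2) \<le> scale * (decay_tail j)\<^sup>2"
proof -
  have "(\<integral>\<^sup>+ \<omega>. ennreal ((logstat \<omega> - apx j \<omega>)\<^sup>2) \<partial>M) = (\<integral>\<^sup>+ \<omega>. liminf (\<lambda>i. ennreal ((apx i \<omega> - apx j \<omega>)\<^sup>2)) \<partial>M)"
  proof (rule nn_integral_cong_AE)
    show "AE \<omega> in M. ennreal ((logstat \<omega> - apx j \<omega>)\<^sup>2) = liminf (\<lambda>i. ennreal ((apx i \<omega> - apx j \<omega>)\<^sup>2))"
      using apx_tendsto
    proof eventually_elim
      case (elim \<omega>)
      have "(\<lambda>i. ennreal ((apx i \<omega> - apx j \<omega>)\<^sup>2)) \<longlonglongrightarrow> ennreal ((logstat \<omega> - apx j \<omega>)\<^sup>2)"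
        by (rule tendsto_ennrealI[OF tendsto_power[OF tendsto_diff[OF elim tendsto_const]]])
      from lim_imp_Liminf[OF _ this] show ?case by simp
    qed
  qed
  also have "\<dots> \<le> liminf (\<lambda>i. \<integral>\<^sup>+ \<omega>. ennreal ((apx i \<omega> - apx j \<omega>)\<^sup>2) \<partial>M)"
    by (rule nn_integral_liminf) measurable
  also have "\<dots> \<le> ennreal (scale * (decay_tail j)\<^sup>2)"
  proof (rule Liminf_le)
    show "\<forall>\<^sub>F i in sequentially. (\<integral>\<^sup>+ \<omega>. ennreal ((apx i \<omega> - apx j \<omega>)\<^sup>2) \<partial>M) \<le> ennreal (scale * (decay_tail j)\<^sup>2)"
    proof (rule eventually_sequentiallyI)
      fix i assume "j \<le> i"
      obtain A where A: "\<And>\<omega>. \<bar>apx i \<omega>\<bar> \<le> A" using apx_bounded by blast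
      obtain B where B: "\<And>\<omega>. \<bar>apx j \<omega>\<bar> \<le> B" using apx_bounded by blast
      have AB: "\<bar>apx i \<omega> - apx j \<omega>\<bar> \<le> A + B" for \<omega> using A[of \<omega>] B[of \<omega>] by linarith
      have "integrable M (\<lambda>\<omega>. (apx i \<omega> - apx j \<omega>)\<^sup>2)"
      proof (rule integrable_const_bound[where B = "(A + B)\<^sup>2"])
        show "AE \<omega> in M. norm ((apx i \<omega> - apx j \<omega>)\<^sup>2) \<le> (A + B)\<^sup>2"
          using AB by (intro AE_I2) (simp add: abs_le_square_iff[symmetric] order_trans[OF AB abs_ge_self])
      qed measurable
      then show "(\<integral>\<^sup>+ \<omega>. ennreal ((apx i \<omega> - apx j \<omega>)\<^sup>2) \<partial>M) \<le> ennreal (scale * (decay_tail j)\<^sup>2)"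
        using apx_diff_square[OF \<open>j \<le> i\<close>] by (subst nn_integral_eq_integral) (auto intro: ennreal_leI)
    qed
  qed simp
  finally have le: "(\<integral>\<^sup>+ \<omega>. ennreal ((logstat \<omega> - apx j \<omega>)\<^sup>2) \<partial>M) \<le> ennreal (scale * (decay_tail j)\<^sup>2)" .
  show i: "integrable M (\<lambda>\<omega>. (logstat \<omega> - apx j \<omega>)\<^sup>2)"
    by (rule integrableI_nonneg) (use le in \<open>auto intro: le_less_trans\<close>)
  show "expectation (\<lambda>\<omega>. (logstat \<omega> - apx j \<omega>)\<^sup>2) \<le> scale * (decay_tail j)\<^sup>2"
    using le i scale_nonneg by (subst (asm) nn_integral_eq_integral) (auto simp: ennreal_le_iff)
qed

lemma logstat_integrable: "integrable M logstat" and logstat_square_integrable: "integrable M (\<lambda>\<omega>. (logstat \<omega>)\<^sup>2)"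
proof -
  obtain B where B: "\<And>\<omega>. \<bar>apx 0 \<omega>\<bar> \<le> B" using apx_bounded by blast
  have ia: "integrable M (\<lambda>\<omega>. (apx 0 \<omega>)\<^sup>2)"
  proof (rule integrable_const_bound[where B = "B\<^sup>2"])
    show "AE \<omega> in M. norm ((apx 0 \<omega>)\<^sup>2) \<le> B\<^sup>2"
      using B by (intro AE_I2) (simp add: abs_le_square_iff[symmetric] order_trans[OF B abs_ge_self])
  qed measurable
  show 2: "integrable M (\<lambda>\<omega>. (logstat \<omega>)\<^sup>2)"
  proof (rule Bochner_Integration.integrable_bound)
    show "integrable M (\<lambda>\<omega>. 2 * (logstat \<omega> - apx 0 \<omega>)\<^sup>2 + 2 * (apx 0 \<omega>)\<^sup>2)"
      using logstat_apx(1)[of 0] ia by auto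
    have "x\<^sup>2 \<le> 2 * (x - y)\<^sup>2 + 2 * y\<^sup>2" for x y :: real
      using zero_le_power2[of "x - 2 * y"] by (simp add: power2_eq_square algebra_simps)
    then show "AE \<omega> in M. norm ((logstat \<omega>)\<^sup>2) \<le> norm (2 * (logstat \<omega> - apx 0 \<omega>)\<^sup>2 + 2 * (apx 0 \<omega>)\<^sup>2)"
      by (intro AE_I2) (simp add: order_trans[OF _ abs_ge_self])
  qed measurable
  show "integrable M logstat" by (rule square_integrable_imp_integrable[OF _ 2]) measurable
qed

lemma logstat_mean: "expectation logstat = 0"
proof -
  have "\<bar>expectation logstat\<bar> \<le> sqrt (scale * (decay_tail j)\<^sup>2)" for j
  proof -
    have "\<bar>expectation logstat\<bar> = \<bar>expectation (\<lambda>\<omega>. logstat \<omega> - apx j \<omega>)\<bar>"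
      using logstat_integrable apx_integrable by (simp add: apx_mean)
    also have "\<dots> \<le> expectation (\<lambda>\<omega>. norm (logstat \<omega> - apx j \<omega>))" by (simp add: integral_abs_bound)
    also have "\<dots> \<le> sqrt (expectation (\<lambda>\<omega>. (norm (logstat \<omega> - apx j \<omega>))\<^sup>2))"
      by (rule expectation_norm_le_sqrt) (use logstat_apx(1)[of j] in auto)
    also have "\<dots> \<le> sqrt (scale * (decay_tail j)\<^sup>2)" using logstat_apx(2)[of j] by simp
    finally show ?thesis .
  qed
  moreover have "(\<lambda>j. sqrt (scale * (decay_tail j)\<^sup>2)) \<longlonglongrightarrow> sqrt (scale * 0\<^sup>2)"
    by (intro tendsto_intros decay_tail_tendsto)
  ultimately have "\<bar>expectation logstat\<bar> \<le> sqrt (scale * 0\<^sup>2)"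
    by (intro LIMSEQ_le_const) auto
  then show ?thesis by simp
qed

end

section \<open>The truncated statistic as a mixture of exponentials\<close>

definition amp :: "real \<times> complex \<Rightarrow> complex" where
  "amp = (\<lambda>(t, u). of_real (2 * sqrt t) * u)"

lemma amp_measurable [measurable]: "amp \<in> borel_measurable (lborel \<Otimes>\<^sub>M lborel)"
  unfolding amp_def by measurable

lemma Re_sum_list: "Re (\<Sum>x\<leftarrow>xs. f x) = (\<Sum>x\<leftarrow>xs. Re (f x))"
  by (induction xs) auto

context gaussian_field
begin

text \<open>A label consists of a point, a Laplace parameter \<open>t\<close> and a Fourier variable
  \<open>u\<close>; with the coefficient \<open>amp (t, u)\<close>, averaging \<open>iexp\<close>
  over \<open>u\<close> yields \<open>exp (- t * (norm (F z \<omega>))\<^sup>2)\<close>.\<close>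

definition label_X :: "'v \<times> real \<times> complex \<Rightarrow> 'w \<Rightarrow> real" where
  "label_X s \<omega> = Re (amp (snd s) * F (fst s) \<omega>)"

text \<open>The real part of a circularly symmetric complex Gaussian carries half of its second
  absolute moment, hence the division by 2.\<close>

definition label_C :: "'v \<times> real \<times> complex \<Rightarrow> 'v \<times> real \<times> complex \<Rightarrow> real" where
  "label_C s t = Re (amp (snd s) * cnj (amp (snd t)) * \<rho> (fst s) (fst t)) / 2"

lemma abs_label_C_le: "\<bar>label_C s t\<bar> \<le> norm (amp (snd s)) * norm (amp (snd t)) * norm (\<rho> (fst s) (fst t)) / 2"
  unfolding label_C_def
  using abs_Re_le_cmod[of "amp (snd s) * cnj (amp (snd t)) * \<rho> (fst s) (fst t)"] by (simp add: norm_mult)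

sublocale L: gaussian_family M "lborel \<Otimes>\<^sub>M (lborel \<Otimes>\<^sub>M lborel)" label_X label_C
proof (intro gaussian_family.intro gaussian_family_axioms.intro)
  show "prob_space M" by (rule prob_space_axioms)
  show "sigma_finite_measure (lborel \<Otimes>\<^sub>M (lborel \<Otimes>\<^sub>M lborel) :: ('v \<times> real \<times> complex) measure)"
    unfolding lborel_prod by (rule lborel.sigma_finite_measure_axioms)
  show "space (lborel \<Otimes>\<^sub>M (lborel \<Otimes>\<^sub>M lborel)) = (UNIV :: ('v \<times> real \<times> complex) set)"
    by (simp add: space_pair_measure)
  show "(\<lambda>(t, \<omega>). label_X t \<omega>) \<in> borel_measurable ((lborel \<Otimes>\<^sub>M (lborel \<Otimes>\<^sub>M lborel)) \<Otimes>\<^sub>M M)"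
    unfolding label_X_def by measurable
  show "(\<lambda>(s, t). label_C s t) \<in> borel_measurable ((lborel \<Otimes>\<^sub>M (lborel \<Otimes>\<^sub>M lborel)) \<Otimes>\<^sub>M (lborel \<Otimes>\<^sub>M (lborel \<Otimes>\<^sub>M lborel)))"
    unfolding label_C_def by measurable
  show "label_C s t = label_C t s" for s t
  proof -
    have "amp (snd t) * cnj (amp (snd s)) * \<rho> (fst t) (fst s) = cnj (amp (snd s) * cnj (amp (snd t)) * \<rho> (fst s) (fst t))"
      unfolding \<rho>_cnj[of "fst t" "fst s"] by (simp add: mult_ac)
    then show ?thesis unfolding label_C_def by (simp only: cnj.sel)
  qed
  show "expectation (\<lambda>\<omega>. iexp (\<Sum>(c, t)\<leftarrow>ts. c * label_X t \<omega>))
      = of_real (exp (- (\<Sum>(c, t)\<leftarrow>ts. \<Sum>(c', t')\<leftarrow>ts. c * c' * label_C t t') / 2))" for ts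
  proof -
    define us where "us = map (\<lambda>p. (of_real (fst p) * amp (snd (snd p)), fst (snd p))) ts"
    have 1: "(\<Sum>(c, t)\<leftarrow>ts. c * label_X t \<omega>) = Re (\<Sum>(c, z)\<leftarrow>us. c * F z \<omega>)" for \<omega>
      by (simp add: us_def comp_def split_beta' Re_sum_list label_X_def mult.assoc)
    have "Re (\<Sum>(c, z)\<leftarrow>us. \<Sum>(c', z')\<leftarrow>us. c * cnj c' * \<rho> z z')
        = (\<Sum>p\<leftarrow>ts. \<Sum>q\<leftarrow>ts. 2 * (fst p * fst q * label_C (snd p) (snd q)))"
    proof -
      have "Re (of_real c * amp k * cnj (of_real d * amp l) * r) = 2 * (c * d * (Re (amp k * cnj (amp l) * r) / 2))" for c d k l r
      proof -
        define W where "W = amp k * cnj (amp l) * r"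
        have e: "of_real c * amp k * cnj (of_real d * amp l) * r = of_real (c * d) * W"
          by (simp add: W_def mult_ac)
        show ?thesis unfolding e W_def[symmetric] by simp
      qed
      then show ?thesis
        by (simp only: us_def comp_def split_beta' Re_sum_list label_C_def list.map_comp fst_conv snd_conv)
    qed
    also have "\<dots> = 2 * (\<Sum>p\<leftarrow>ts. \<Sum>q\<leftarrow>ts. fst p * fst q * label_C (snd p) (snd q))"
      by (simp add: sum_list_const_mult)
    finally have 2: "Re (\<Sum>(c, z)\<leftarrow>us. \<Sum>(c', z')\<leftarrow>us. c * cnj c' * \<rho> z z')
        = 2 * (\<Sum>(c, t)\<leftarrow>ts. \<Sum>(c', t')\<leftarrow>ts. c * c' * label_C t t')" by (simp add: split_beta')
    show ?thesis unfolding 1 char_F 2 by simp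
  qed
qed

end

text \<open>A first moment rather than a mass, since the bound on the covariance of two labels grows
  linearly in the modulus of each \<open>u\<close>.\<close>

definition gauss_tail :: "real \<Rightarrow> real" where
  "gauss_tail R = (\<integral>u. gauss u * indicator (- cball 0 R) u * norm u \<partial>lborel)"

lemma gauss_norm_integrable: "integrable lborel (\<lambda>u. gauss u * norm u)"
proof (rule integrableI_bounded)
  have "(\<integral>\<^sup>+ u. ennreal (norm (gauss u * norm u)) \<partial>lborel) = (\<integral>\<^sup>+ u. ennreal (gauss u) * ennreal (norm u) \<partial>lborel)"
    by (intro nn_integral_cong) (simp add: ennreal_mult gauss_nonneg abs_mult)
  also have "\<dots> < \<infinity>" using nn_integral_norm_gauss by (auto intro: le_less_trans)
  finally show "(\<integral>\<^sup>+ u. ennreal (norm (gauss u * norm u)) \<partial>lborel) < \<infinity>" .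
qed measurable

lemma gauss_tail_tendsto: "(\<lambda>n. gauss_tail (real n)) \<longlonglongrightarrow> 0"
proof -
  have "(\<lambda>n. \<integral>u. gauss u * indicator (- cball 0 (real n)) u * norm u \<partial>lborel) \<longlonglongrightarrow> integral\<^sup>L lborel (\<lambda>u::complex. 0)"
  proof (rule integral_dominated_convergence[where w = "\<lambda>u. gauss u * norm u"])
    show "AE u in lborel. (\<lambda>n. gauss u * indicator (- cball 0 (real n)) u * norm u) \<longlonglongrightarrow> 0"
    proof (intro AE_I2)
      fix u :: complex
      obtain N :: nat where N: "norm u \<le> real N" using real_arch_simple by blast
      have "\<forall>\<^sub>F n in sequentially. gauss u * indicator (- cball 0 (real n)) u * norm u = 0"
        by (rule eventually_sequentiallyI[of N]) (use N in auto)
      then show "(\<lambda>n. gauss u * indicator (- cball 0 (real n)) u * norm u) \<longlonglongrightarrow> 0"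
        by (rule tendsto_eventually)
    qed
  qed (use gauss_norm_integrable gauss_nonneg in \<open>auto split: split_indicator\<close>)
  then show ?thesis by (simp add: gauss_tail_def)
qed

definition cut_mass :: "nat \<Rightarrow> real" where
  "cut_mass j = (\<integral>t. indicator (cutoff j) t / t \<partial>lborel)"

text \<open>The factor \<open>2 * sqrt t\<close> is the part of \<open>norm (amp (t, u))\<close>
  that depends on \<open>t\<close>; the other part goes into \<open>gauss_tail\<close>.\<close>

definition cut_mass_sqrt :: "nat \<Rightarrow> real" where
  "cut_mass_sqrt j = (\<integral>t. indicator (cutoff j) t / t * (2 * sqrt t) \<partial>lborel)"

text \<open>Bounds the modulus of \<open>amp (t, u)\<close> on the labels that are kept, those with
  \<open>t\<close> in \<open>cutoff j\<close> and \<open>norm u \<le> real n\<close>.\<close>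

definition amp_max :: "nat \<Rightarrow> nat \<Rightarrow> real" where
  "amp_max j n = 2 * sqrt (real (Suc j)) * real n"

lemma cut_weight_nonneg: "0 \<le> indicator (cutoff j) t / (t :: real)"
  using cutoff_pos[of t j] by (cases "t \<in> cutoff j") auto

lemma cut_mass_nonneg: "0 \<le> cut_mass j"
  unfolding cut_mass_def using cut_weight_nonneg by (intro integral_nonneg_AE AE_I2) auto

context gaussian_statistic
begin

abbreviation "labels \<equiv> (lborel :: 'v measure) \<Otimes>\<^sub>M ((lborel :: real measure) \<Otimes>\<^sub>M (lborel :: complex measure))"

lemma cut_integrable: "integrable lborel (\<lambda>t. indicator (cutoff j) t / t :: real)"
  by (rule weight_integrable[OF cutoff_measurable order_refl])

lemma cut_sqrt_integrable: "integrable lborel (\<lambda>t. indicator (cutoff j) t / t * (2 * sqrt t) :: real)"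
proof (rule indicator_div_integrable[OF cutoff_measurable order_refl, where B = "2 * sqrt (real (Suc j))"])
  fix t assume "t \<in> cutoff j"
  then show "\<bar>2 * sqrt t\<bar> \<le> 2 * sqrt (real (Suc j))" using cutoff_pos[of t j] by (auto simp: cutoff_def)
qed measurable

lemma product_integral:
  fixes f1 :: "'v \<Rightarrow> real" and f2 :: "real \<Rightarrow> real" and f3 :: "complex \<Rightarrow> real"
  assumes "integrable lborel f1" "integrable lborel f2" "integrable lborel f3"
  shows "integrable labels (\<lambda>s. f1 (fst s) * (f2 (fst (snd s)) * f3 (snd (snd s))))"
    and "(\<integral>s. f1 (fst s) * (f2 (fst (snd s)) * f3 (snd (snd s))) \<partial>labels)
      = (\<integral>z. f1 z \<partial>lborel) * ((\<integral>t. f2 t \<partial>lborel) * (\<integral>u. f3 u \<partial>lborel))"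
proof -
  note s = lborel.sigma_finite_measure_axioms
  have sf: "sigma_finite_measure ((lborel :: real measure) \<Otimes>\<^sub>M (lborel :: complex measure))"
    unfolding lborel_prod by (rule lborel.sigma_finite_measure_axioms)
  have 1: "integrable (lborel \<Otimes>\<^sub>M lborel) (\<lambda>(t, u). f2 t * f3 u)" by (rule pair_integral_product[OF s s assms(2,3)])
  show "integrable labels (\<lambda>s. f1 (fst s) * (f2 (fst (snd s)) * f3 (snd (snd s))))"
    using pair_integral_product(1)[OF s sf assms(1) 1] by (simp add: split_beta')
  show "(\<integral>s. f1 (fst s) * (f2 (fst (snd s)) * f3 (snd (snd s))) \<partial>labels)
      = (\<integral>z. f1 z \<partial>lborel) * ((\<integral>t. f2 t \<partial>lborel) * (\<integral>u. f3 u \<partial>lborel))"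
    using pair_integral_product(2)[OF s sf assms(1) 1] pair_integral_product(2)[OF s s assms(2,3)] by (simp add: split_beta')
qed

text \<open>\<open>A\<close> is the window for the Fourier variable: the whole plane gives the
  statistic without truncation in \<open>u\<close>, a ball its truncation, and the complement of the
  ball the error.\<close>

definition weight :: "nat \<Rightarrow> complex set \<Rightarrow> 'v \<times> real \<times> complex \<Rightarrow> complex" where
  "weight j A s = of_real (h (fst s) * (indicator (cutoff j) (fst (snd s)) / fst (snd s) * (gauss (snd (snd s)) * indicator A (snd (snd s)))))"

lemma weight_measurable [measurable]:
  assumes [measurable]: "A \<in> sets borel"
  shows "weight j A \<in> borel_measurable labels"
  unfolding weight_def by measurable

lemma gauss_indicator_integrable: "A \<in> sets borel \<Longrightarrow> integrable lborel (\<lambda>u. gauss u * indicator A u)"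
  using gauss_has_integral by (intro integrable_mult_indicator[where 'b = real, simplified mult.commute real_scaleR_def] ) (auto simp: has_bochner_integral_iff)

lemma gauss_indicator_le_1:
  assumes A: "A \<in> sets borel"
  shows "(\<integral>u. gauss u * indicator A u \<partial>lborel) \<le> 1"
proof -
  have "(\<integral>u. gauss u * indicator A u \<partial>lborel) \<le> (\<integral>u. gauss u \<partial>lborel)"
    using gauss_has_integral gauss_nonneg by (intro integral_mono') (auto simp: has_bochner_integral_iff split: split_indicator)
  then show ?thesis using gauss_has_integral by (simp add: has_bochner_integral_iff)
qed

lemma weight_norm: "norm (weight j A s) = \<bar>h (fst s)\<bar> * (indicator (cutoff j) (fst (snd s)) / fst (snd s) * (gauss (snd (snd s)) * indicator A (snd (snd s))))"
  unfolding weight_def using cut_weight_nonneg[of j "fst (snd s)"] gauss_nonneg[of "snd (snd s)"]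
  by (simp only: norm_of_real abs_mult abs_of_nonneg) (simp add: abs_mult)

lemma weight_integrable_labels:
  assumes A: "A \<in> sets borel"
  shows "integrable labels (weight j A)"
  unfolding weight_def
  by (intro integrable_of_real product_integral(1) h_integrable cut_integrable gauss_indicator_integrable[OF A])

lemma weight_mass:
  assumes A: "A \<in> sets borel"
  shows "(\<integral>s. norm (weight j A s) \<partial>labels) \<le> H * measure lborel D * cut_mass j"
proof -
  have "(\<integral>s. norm (weight j A s) \<partial>labels) = (\<integral>z. \<bar>h z\<bar> \<partial>lborel) * (cut_mass j * (\<integral>u. gauss u * indicator A u \<partial>lborel))"
    unfolding weight_norm cut_mass_def
    by (intro product_integral(2) integrable_abs h_integrable cut_integrable gauss_indicator_integrable[OF A])
  also have "\<dots> \<le> (H * measure lborel D) * (cut_mass j * 1)"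
    using integral_dominated_le[OF h_dominated H_nonneg] gauss_indicator_le_1[OF A] cut_mass_nonneg H_nonneg
    by (intro mult_mono mult_left_mono) (auto intro!: integral_nonneg_AE mult_nonneg_nonneg gauss_nonneg)
  finally show ?thesis by simp
qed

text \<open>Reflecting \<open>u\<close> conjugates the integrand. Reality of the mixture is what
  allows \<open>char_lin_approx\<close> to be applied to it.\<close>

lemma fourier_symmetric_real:
  assumes A [measurable]: "A \<in> sets borel" and sym: "\<And>u. u \<in> A \<longleftrightarrow> - u \<in> A"
  shows "(\<integral>u. of_real (gauss u * indicator A u) * iexp (Re (c * u)) \<partial>lborel)
    = of_real (Re (\<integral>u. of_real (gauss u * indicator A u) * iexp (Re (c * u)) \<partial>lborel))"
proof -
  define f where "f u = of_real (gauss u * indicator A u) * iexp (Re (c * u))" for u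
  have [measurable]: "f \<in> borel_measurable borel" unfolding f_def by measurable
  have "f (- u) = cnj (f u)" for u
  proof -
    have 1: "iexp (- r) = cnj (iexp r)" for r :: real by (simp add: exp_cnj)
    have "f (- u) = of_real (gauss u * indicator A u) * iexp (- Re (c * u))"
      using sym[of u] by (simp add: f_def gauss_def indicator_def)
    then show ?thesis by (simp only: f_def 1 complex_cnj_mult complex_cnj_complex_of_real)
  qed
  then have "cnj (\<integral>u. f u \<partial>lborel) = (\<integral>u. f u \<partial>lborel)"
    using lborel_integral_uminus[of f] by (simp add: Bochner_Integration.integral_cnj)
  then show ?thesis unfolding f_def[symmetric] by (simp add: complex_eq_iff)
qed

lemma lin_weight:
  assumes A [measurable]: "A \<in> sets borel"
  shows "L.lin (weight j A) \<omega> = (\<integral>z. of_real (h z) * (\<integral>t. of_real (indicator (cutoff j) t / t) *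
      (\<integral>u. of_real (gauss u * indicator A u) * iexp (Re (of_real (2 * sqrt t) * F z \<omega> * u)) \<partial>lborel) \<partial>lborel) \<partial>lborel)"
proof -
  have [measurable]: "(\<lambda>z. F z \<omega>) \<in> borel_measurable borel" by (rule F_measurable_section)
  interpret P: pair_sigma_finite "lborel :: 'v measure" "(lborel :: real measure) \<Otimes>\<^sub>M (lborel :: complex measure)" ..
  define G where "G s = weight j A s * iexp (label_X s \<omega>)" for s
  have [measurable]: "G \<in> borel_measurable labels" unfolding G_def label_X_def by measurable
  have iG: "integrable labels G"
    by (rule Bochner_Integration.integrable_bound[OF weight_integrable_labels[OF A, of j]]) (auto simp: G_def norm_mult)
  have iGz: "integrable (lborel \<Otimes>\<^sub>M lborel) (\<lambda>k. G (z, k))" for z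
  proof (rule Bochner_Integration.integrable_bound)
    show "integrable (lborel \<Otimes>\<^sub>M lborel) (\<lambda>(t, u). (\<bar>h z\<bar> * (indicator (cutoff j) t / t)) * (gauss u * indicator A u))"
      by (intro pair_integral_product(1) lborel.sigma_finite_measure_axioms integrable_mult_right cut_integrable gauss_indicator_integrable[OF A])
    show "AE k in lborel \<Otimes>\<^sub>M lborel. norm (G (z, k)) \<le> norm (case k of (t, u) \<Rightarrow> (\<bar>h z\<bar> * (indicator (cutoff j) t / t)) * (gauss u * indicator A u))"
    proof (intro AE_I2)
      fix k :: "real \<times> complex"
      have "norm (G (z, k)) = (\<bar>h z\<bar> * (indicator (cutoff j) (fst k) / fst k)) * (gauss (snd k) * indicator A (snd k))"
        by (simp add: G_def norm_mult weight_norm)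
      then show "norm (G (z, k)) \<le> norm (case k of (t, u) \<Rightarrow> (\<bar>h z\<bar> * (indicator (cutoff j) t / t)) * (gauss u * indicator A u))"
        by (simp only: split_beta' real_norm_def abs_ge_self)
    qed
  qed measurable
  have "L.lin (weight j A) \<omega> = (\<integral>z. (\<integral>k. G (z, k) \<partial>(lborel \<Otimes>\<^sub>M lborel)) \<partial>lborel)"
    unfolding L.lin_def G_def[symmetric] by (rule P.integral_fst'[OF iG, symmetric])
  also have "\<dots> = (\<integral>z. (\<integral>t. (\<integral>u. G (z, t, u) \<partial>lborel) \<partial>lborel) \<partial>lborel)"
    using lborel_pair.integral_fst'[OF iGz] by simp
  also have "\<dots> = (\<integral>z. of_real (h z) * (\<integral>t. of_real (indicator (cutoff j) t / t) *
      (\<integral>u. of_real (gauss u * indicator A u) * iexp (Re (of_real (2 * sqrt t) * F z \<omega> * u)) \<partial>lborel) \<partial>lborel) \<partial>lborel)"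
  proof (intro Bochner_Integration.integral_cong refl)
    fix z
    have "G (z, t, u) = of_real (h z) * (of_real (indicator (cutoff j) t / t) * (of_real (gauss u * indicator A u) * iexp (Re (of_real (2 * sqrt t) * F z \<omega> * u))))" for t u
    proof -
      have "label_X (z, t, u) \<omega> = Re (of_real (2 * sqrt t) * F z \<omega> * u)"
        unfolding label_X_def amp_def by (simp only: fst_conv snd_conv prod.case mult_ac)
      then show ?thesis by (simp only: G_def weight_def fst_conv snd_conv of_real_mult mult.assoc)
    qed
    then show "(\<integral>t. (\<integral>u. G (z, t, u) \<partial>lborel) \<partial>lborel) = of_real (h z) * (\<integral>t. of_real (indicator (cutoff j) t / t) *
      (\<integral>u. of_real (gauss u * indicator A u) * iexp (Re (of_real (2 * sqrt t) * F z \<omega> * u)) \<partial>lborel) \<partial>lborel)"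
      by (simp only: Bochner_Integration.integral_mult_right_zero)
  qed
  finally show ?thesis .
qed

lemma lin_weight_real:
  assumes A: "A \<in> sets borel" and sym: "\<And>u. u \<in> A \<longleftrightarrow> - u \<in> A"
  shows "L.lin (weight j A) \<omega> = of_real (Re (L.lin (weight j A) \<omega>))"
  unfolding lin_weight[OF A]
  by (subst (1 2) fourier_symmetric_real[OF A sym]) (simp only: of_real_mult[symmetric] integral_complex_of_real Re_complex_of_real)

lemma lin_weight_UNIV: "L.lin (weight j UNIV) \<omega> = of_real (lstat h (cutoff j) \<omega>)"
proof -
  have 1: "of_real (indicator (cutoff j) t / t) * (\<integral>u. of_real (gauss u * indicator UNIV u) * iexp (Re (of_real (2 * sqrt t) * x * u)) \<partial>lborel)
      = complex_of_real (indicator (cutoff j) t / t * exp (- t * (norm x)\<^sup>2))" for t x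
  proof (cases "t \<in> cutoff j")
    case True
    then have t: "0 < t" by (rule cutoff_pos)
    define c where "c = of_real (2 * sqrt t) * x"
    have "(norm c)\<^sup>2 = 4 * t * (norm x)\<^sup>2" using t by (simp add: c_def norm_mult power_mult_distrib)
    then have e: "- (norm c)\<^sup>2 / 4 = - t * (norm x)\<^sup>2" by simp
    have "(\<integral>u. of_real (gauss u) * iexp (Re (c * u)) \<partial>lborel) = complex_of_real (exp (- t * (norm x)\<^sup>2))"
      unfolding e[symmetric] by (rule has_bochner_integral_integral_eq[OF gauss_fourier])
    then show ?thesis unfolding c_def by (simp only: of_real_mult indicator_UNIV mult_1_right)
  qed simp
  show ?thesis
    unfolding lin_weight[OF sets.top[of borel, simplified space_borel]] 1 lstat_def hlog_def
    by (simp only: of_real_mult[symmetric] integral_complex_of_real)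
qed

definition trunc :: "nat \<Rightarrow> nat \<Rightarrow> 'w \<Rightarrow> real" where
  "trunc j n \<omega> = Re (L.lin (weight j (cball 0 (real n))) \<omega>)"

lemma trunc_measurable [measurable]: "trunc j n \<in> borel_measurable M"
proof -
  have "cball (0 :: complex) (real n) \<in> sets borel" by simp
  from L.lin_measurable[OF weight_measurable[OF this]]
  have "L.lin (weight j (cball 0 (real n))) \<in> borel_measurable M" .
  moreover have "Re \<in> borel_measurable borel"
    by (intro borel_measurable_continuous_onI continuous_intros)
  ultimately show ?thesis unfolding trunc_def[abs_def] by (rule measurable_compose)
qed

lemma lin_trunc: "L.lin (weight j (cball 0 (real n))) \<omega> = of_real (trunc j n \<omega>)"
  unfolding trunc_def by (rule lin_weight_real) auto

lemma trunc_bounded: "\<bar>trunc j n \<omega>\<bar> \<le> H * measure lborel D * cut_mass j"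
proof -
  have "\<bar>trunc j n \<omega>\<bar> = norm (L.lin (weight j (cball 0 (real n))) \<omega>)" unfolding lin_trunc by simp
  also have "\<dots> \<le> H * measure lborel D * cut_mass j"
    by (rule order_trans[OF L.norm_lin_le weight_mass]) (auto intro: weight_integrable_labels)
  finally show ?thesis .
qed

lemma trunc_integrable: "integrable M (trunc j n)"
  by (rule integrable_const_bound[where B = "H * measure lborel D * cut_mass j"]) (use trunc_bounded in auto)

text \<open>The removed part is itself a mixture, over labels with \<open>u\<close> outside the
  ball. Their covariances are unbounded, but \<open>lin_variance_le\<close> is linear in them, and
  up to the correlation the bound \<open>abs_label_C_le\<close> factors over the two labels.\<close>

lemma trunc_error:
  "variance (\<lambda>\<omega>. lstat h (cutoff j) \<omega> - trunc j n \<omega>) \<le> scale * (cut_mass_sqrt j * gauss_tail (real n))\<^sup>2"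
proof -
  define A where "A = - cball (0 :: complex) (real n)"
  have A [measurable]: "A \<in> sets borel" unfolding A_def by measurable
  \<comment> \<open>The modulus of the weight times that of \<open>amp\<close>, written as a product
    over the three components of the label, so that its integrals factor.\<close>
  define b where "b s = \<bar>h (fst s)\<bar> * (indicator (cutoff j) (fst (snd s)) / fst (snd s) * (2 * sqrt (fst (snd s))) * (gauss (snd (snd s)) * indicator A (snd (snd s)) * norm (snd (snd s))))"
    for s :: "'v \<times> real \<times> complex"
  have gA: "integrable lborel (\<lambda>u. gauss u * indicator A u * norm u)"
    by (rule Bochner_Integration.integrable_bound[OF gauss_norm_integrable]) (auto split: split_indicator)
  have gA': "(\<integral>u. gauss u * indicator A u * norm u \<partial>lborel) = gauss_tail (real n)" by (simp add: gauss_tail_def A_def)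
  have [measurable]: "b \<in> borel_measurable labels" unfolding b_def by measurable
  have ib: "integrable labels b"
    unfolding b_def by (intro product_integral(1) integrable_abs h_integrable cut_sqrt_integrable gA)
  have b_eq: "b s = norm (weight j A s) * norm (amp (snd s))" for s
    unfolding b_def weight_norm amp_def using cutoff_pos[of "fst (snd s)" j]
    by (cases "fst (snd s) \<in> cutoff j") (auto simp: split_beta' norm_mult)
  have b0: "0 \<le> b s" for s unfolding b_eq by simp
  have gt0: "0 \<le> gauss_tail (real n)" unfolding gauss_tail_def by (intro integral_nonneg_AE AE_I2) (auto intro!: mult_nonneg_nonneg gauss_nonneg)
  have cm0: "0 \<le> cut_mass_sqrt j" unfolding cut_mass_sqrt_def
  proof (intro integral_nonneg_AE AE_I2)
    fix t show "0 \<le> indicator (cutoff j) t / t * (2 * sqrt t)"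
      using cutoff_pos[of t j] by (cases "t \<in> cutoff j") auto
  qed
  define tau where "tau = cut_mass_sqrt j * gauss_tail (real n)"
  have tau0: "0 \<le> tau" unfolding tau_def using gt0 cm0 by simp
  have b_int: "(\<integral>s. b s \<partial>labels) \<le> H * measure lborel D * tau"
  proof -
    have "(\<integral>s. b s \<partial>labels) = (\<integral>z. \<bar>h z\<bar> \<partial>lborel) * tau"
      unfolding b_def tau_def cut_mass_sqrt_def gA'[symmetric]
      by (intro product_integral(2) integrable_abs h_integrable cut_sqrt_integrable gA)
    also have "\<dots> \<le> (H * measure lborel D) * tau"
      using integral_dominated_le[OF h_dominated H_nonneg] tau0 by (intro mult_right_mono) auto
    finally show ?thesis .
  qed
  have le: "norm (weight j A s) * norm (weight j A t) * \<bar>label_C s t\<bar> \<le> b s * (b t * norm (\<rho> (fst s) (fst t)))" for s t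
  proof -
    have "norm (weight j A s) * norm (weight j A t) * \<bar>label_C s t\<bar>
        \<le> norm (weight j A s) * norm (weight j A t) * (norm (amp (snd s)) * norm (amp (snd t)) * norm (\<rho> (fst s) (fst t)) / 2)"
      by (intro mult_left_mono abs_label_C_le) auto
    also have "\<dots> \<le> norm (weight j A s) * norm (weight j A t) * (norm (amp (snd s)) * norm (amp (snd t)) * norm (\<rho> (fst s) (fst t)))"
      by (intro mult_left_mono) auto
    finally show ?thesis by (simp add: b_eq mult_ac)
  qed
  have ibb: "integrable (labels \<Otimes>\<^sub>M labels) (\<lambda>(s, t). b s * b t)"
    by (intro pair_integral_product(1) ib L.N.sigma_finite_measure_axioms)
  have C': "integrable (labels \<Otimes>\<^sub>M labels) (\<lambda>(s, t). norm (weight j A s) * norm (weight j A t) * \<bar>label_C s t\<bar>)"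
  proof (rule Bochner_Integration.integrable_bound[OF ibb])
    show "AE p in labels \<Otimes>\<^sub>M labels. norm (case p of (s, t) \<Rightarrow> norm (weight j A s) * norm (weight j A t) * \<bar>label_C s t\<bar>) \<le> norm (case p of (s, t) \<Rightarrow> b s * b t)"
    proof (intro AE_I2)
      fix p :: "('v \<times> real \<times> complex) \<times> ('v \<times> real \<times> complex)"
      obtain s t where p: "p = (s, t)" by (cases p)
      have "b s * (b t * norm (\<rho> (fst s) (fst t))) \<le> b s * (b t * 1)"
        using b0 norm_\<rho>_le_1 by (intro mult_left_mono) auto
      with le[of s t] show "norm (case p of (s, t) \<Rightarrow> norm (weight j A s) * norm (weight j A t) * \<bar>label_C s t\<bar>) \<le> norm (case p of (s, t) \<Rightarrow> b s * b t)"
        unfolding p prod.case real_norm_def by (simp add: abs_mult b0)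
    qed
  qed measurable
  have iw: "integrable labels (weight j A)" by (rule weight_integrable_labels[OF A])
  have inner: "(\<integral>t. norm (weight j A s) * norm (weight j A t) * \<bar>label_C s t\<bar> \<partial>labels) \<le> b s * (H * \<kappa> * tau)" for s
  proof (cases "fst s \<in> D")
    case True
    define f where "f w = \<bar>h w\<bar> * norm (\<rho> (fst s) w)" for w
    have f: "integrable lborel f" unfolding f_def
      by (rule dominated_integrable[where P = H])
         (use norm_\<rho>_le_1 h_dom in \<open>auto simp: abs_mult intro!: order_trans[OF mult_right_le_one_le h_dom]\<close>)
    have e: "b s * (b t * norm (\<rho> (fst s) (fst t)))
        = b s * (f (fst t) * (indicator (cutoff j) (fst (snd t)) / fst (snd t) * (2 * sqrt (fst (snd t))) * (gauss (snd (snd t)) * indicator A (snd (snd t)) * norm (snd (snd t)))))" for t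
      by (simp add: b_def f_def mult_ac)
    have "(\<integral>t. norm (weight j A s) * norm (weight j A t) * \<bar>label_C s t\<bar> \<partial>labels) \<le> (\<integral>t. b s * (b t * norm (\<rho> (fst s) (fst t))) \<partial>labels)"
    proof (rule integral_mono')
      show "integrable labels (\<lambda>t. b s * (b t * norm (\<rho> (fst s) (fst t))))"
        unfolding e by (intro integrable_mult_right product_integral(1) f cut_sqrt_integrable gA)
    qed (use le b0 in auto)
    also have "\<dots> = b s * ((\<integral>w. f w \<partial>lborel) * tau)"
      unfolding e tau_def cut_mass_sqrt_def gA'[symmetric]
      by (subst Bochner_Integration.integral_mult_right_zero, subst product_integral(2)[OF f cut_sqrt_integrable gA]) (rule refl)
    also have "\<dots> \<le> b s * ((H * \<kappa>) * tau)"
      using corr_integral_dominated_le[OF h_dom H_nonneg True] b0 tau0 unfolding f_def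
      by (intro mult_left_mono mult_right_mono) auto
    finally show ?thesis .
  next
    case False
    then have "h (fst s) = 0" using h_support by blast
    then show ?thesis by (simp add: weight_def b_def)
  qed
  have w_eq: "weight j UNIV s - weight j (cball 0 (real n)) s = weight j A s" for s
    by (auto simp: weight_def A_def indicator_def)
  have lin_eq: "L.lin (weight j A) \<omega> = of_real (lstat h (cutoff j) \<omega> - trunc j n \<omega>)" if "\<omega> \<in> space M" for \<omega>
  proof -
    have "L.lin (weight j A) \<omega> = L.lin (weight j UNIV) \<omega> - L.lin (weight j (cball 0 (real n))) \<omega>"
      unfolding w_eq[symmetric] by (rule L.lin_diff[symmetric]) (auto intro: weight_integrable_labels that)
    then show ?thesis by (simp only: lin_weight_UNIV lin_trunc of_real_diff)
  qed
  define X where "X \<omega> = lstat h (cutoff j) \<omega> - trunc j n \<omega>" for \<omega>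
  have EX: "expectation (L.lin (weight j A)) = of_real (expectation X)"
  proof -
    have "expectation (L.lin (weight j A)) = expectation (\<lambda>\<omega>. complex_of_real (X \<omega>))"
      by (intro Bochner_Integration.integral_cong refl) (simp add: lin_eq X_def)
    then show ?thesis by (simp only: integral_complex_of_real)
  qed
  have "variance X = expectation (\<lambda>\<omega>. (norm (L.lin (weight j A) \<omega> - expectation (L.lin (weight j A))))\<^sup>2)"
    by (intro Bochner_Integration.integral_cong refl)
       (simp only: lin_eq EX X_def[symmetric] of_real_diff[symmetric] norm_of_real power2_abs)
  also have "\<dots> \<le> (\<integral>s. (\<integral>t. norm (weight j A s) * norm (weight j A t) * \<bar>label_C s t\<bar> \<partial>labels) \<partial>labels)"
    by (rule L.lin_variance_le[OF iw C'])
  also have "\<dots> \<le> (\<integral>s. b s * (H * \<kappa> * tau) \<partial>labels)"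
    using inner b0 H_nonneg \<kappa>_nonneg tau0 by (intro integral_mono' integrable_mult_left ib) auto
  also have "\<dots> = (\<integral>s. b s \<partial>labels) * (H * \<kappa> * tau)" by simp
  also have "\<dots> \<le> (H * measure lborel D * tau) * (H * \<kappa> * tau)"
    using b_int H_nonneg \<kappa>_nonneg tau0 by (intro mult_right_mono) auto
  also have "\<dots> = scale * tau\<^sup>2" by (simp add: scale_def power2_eq_square mult_ac)
  finally show ?thesis by (simp only: X_def[abs_def] tau_def)
qed

text \<open>Both truncations are used here: on the labels that are kept the covariances are at most
  \<open>(amp_max j n)\<^sup>2\<close> times the correlation, so the constants of
  \<open>char_lin_approx\<close> are explicit, and the correlations enter them only through
  \<kappa>.\<close>

lemma trunc_char:
  fixes s :: real and j n :: nat
  defines "A \<equiv> H * measure lborel D * cut_mass j"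
    and "\<kappa>' \<equiv> H * cut_mass j * (amp_max j n)\<^sup>2 * \<kappa>"
  defines "K \<equiv> exp ((amp_max j n)\<^sup>2) * \<kappa>'"
  shows "norm (expectation (\<lambda>\<omega>. iexp (s * (trunc j n \<omega> - expectation (trunc j n)))) - of_real (exp (- s\<^sup>2 * variance (trunc j n) / 2)))
    \<le> \<bar>s\<bar> * (A * s\<^sup>2 * K\<^sup>2 * exp (\<bar>s\<bar> * K) + \<bar>s\<bar> * (K * sqrt (A * \<kappa>')))"
proof -
  define B where "B = cball (0 :: complex) (real n)"
  have B [measurable]: "B \<in> sets borel" unfolding B_def by measurable
  define m where "m = weight j B"
  have im: "integrable labels m" unfolding m_def by (rule weight_integrable_labels[OF B])
  have \<kappa>'0: "0 \<le> \<kappa>'" unfolding \<kappa>'_def using H_nonneg cut_mass_nonneg \<kappa>_nonneg by simp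
  have K0: "0 \<le> K" unfolding K_def using \<kappa>'0 by simp
  have amp_le: "norm (amp (snd s)) \<le> amp_max j n" and in_D: "fst s \<in> D" if "m s \<noteq> 0" for s
  proof -
    obtain z t u where s: "s = (z, t, u)" by (cases s)
    have t: "t \<in> cutoff j" and u: "u \<in> B" and "h z \<noteq> 0"
      using that by (auto simp: m_def weight_def s indicator_def split: if_splits)
    then show "fst s \<in> D" using h_support by (simp add: s)
    have "norm (amp (snd s)) = 2 * sqrt t * norm u" using cutoff_pos[OF t] by (simp add: amp_def s norm_mult)
    also have "\<dots> \<le> 2 * sqrt (real (Suc j)) * real n"
      using t u cutoff_pos[OF t] by (intro mult_mono) (auto simp: cutoff_def B_def)
    finally show "norm (amp (snd s)) \<le> amp_max j n" by (simp add: amp_max_def)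
  qed
  have am0: "0 \<le> amp_max j n" by (simp add: amp_max_def)
  have C_le': "\<bar>label_C s t\<bar> \<le> (amp_max j n)\<^sup>2 * norm (\<rho> (fst s) (fst t))" if "m s \<noteq> 0" "m t \<noteq> 0" for s t
  proof -
    have "\<bar>label_C s t\<bar> \<le> norm (amp (snd s)) * norm (amp (snd t)) * norm (\<rho> (fst s) (fst t)) / 2" by (rule abs_label_C_le)
    also have "\<dots> \<le> norm (amp (snd s)) * norm (amp (snd t)) * norm (\<rho> (fst s) (fst t))" by simp
    also have "\<dots> \<le> amp_max j n * amp_max j n * norm (\<rho> (fst s) (fst t))"
      using amp_le[OF that(1)] amp_le[OF that(2)] am0 by (intro mult_right_mono mult_mono) auto
    finally show ?thesis by (simp add: power2_eq_square)
  qed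
  have C_le: "\<bar>label_C s t\<bar> \<le> (amp_max j n)\<^sup>2" if "m s \<noteq> 0" "m t \<noteq> 0" for s t
    using C_le'[OF that] mult_left_mono[OF norm_\<rho>_le_1, of "(amp_max j n)\<^sup>2" "fst s" "fst t"] by simp
  have \<kappa>le: "(\<integral>t. norm (m t) * \<bar>label_C s t\<bar> \<partial>labels) \<le> \<kappa>'" if s: "m s \<noteq> 0" for s
  proof -
    define f where "f w = (amp_max j n)\<^sup>2 * (\<bar>h w\<bar> * norm (\<rho> (fst s) w))" for w
    have f0: "integrable lborel (\<lambda>w. \<bar>h w\<bar> * norm (\<rho> (fst s) w))"
      by (rule dominated_integrable[where P = H])
         (use norm_\<rho>_le_1 h_dom in \<open>auto simp: abs_mult intro!: order_trans[OF mult_right_le_one_le h_dom]\<close>)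
    then have f: "integrable lborel f" unfolding f_def by (rule integrable_mult_right)
    have "(\<integral>t. norm (m t) * \<bar>label_C s t\<bar> \<partial>labels)
        \<le> (\<integral>t. f (fst t) * (indicator (cutoff j) (fst (snd t)) / fst (snd t) * (gauss (snd (snd t)) * indicator B (snd (snd t)))) \<partial>labels)"
    proof (rule integral_mono')
      show "integrable labels (\<lambda>t. f (fst t) * (indicator (cutoff j) (fst (snd t)) / fst (snd t) * (gauss (snd (snd t)) * indicator B (snd (snd t)))))"
        by (intro product_integral(1) f cut_integrable gauss_indicator_integrable[OF B])
      fix t
      have e: "f (fst t) * (indicator (cutoff j) (fst (snd t)) / fst (snd t) * (gauss (snd (snd t)) * indicator B (snd (snd t))))
          = norm (m t) * ((amp_max j n)\<^sup>2 * norm (\<rho> (fst s) (fst t)))"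
        by (simp add: f_def m_def weight_norm mult_ac)
      show "0 \<le> f (fst t) * (indicator (cutoff j) (fst (snd t)) / fst (snd t) * (gauss (snd (snd t)) * indicator B (snd (snd t))))"
        unfolding e by simp
      show "norm (m t) * \<bar>label_C s t\<bar> \<le> f (fst t) * (indicator (cutoff j) (fst (snd t)) / fst (snd t) * (gauss (snd (snd t)) * indicator B (snd (snd t))))"
        unfolding e using C_le'[OF s, of t] by (cases "m t = 0") (auto intro!: mult_left_mono)
    qed
    also have "\<dots> = (\<integral>w. f w \<partial>lborel) * (cut_mass j * (\<integral>u. gauss u * indicator B u \<partial>lborel))"
      unfolding cut_mass_def by (intro product_integral(2) f cut_integrable gauss_indicator_integrable[OF B])
    also have "\<dots> \<le> ((amp_max j n)\<^sup>2 * (H * \<kappa>)) * (cut_mass j * 1)"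
    proof (intro mult_mono mult_left_mono)
      show "(\<integral>w. f w \<partial>lborel) \<le> (amp_max j n)\<^sup>2 * (H * \<kappa>)"
        unfolding f_def using corr_integral_dominated_le[OF h_dom H_nonneg in_D[OF s]] by (simp add: mult_left_mono)
      show "0 \<le> cut_mass j * (\<integral>u. gauss u * indicator B u \<partial>lborel)"
        by (intro mult_nonneg_nonneg cut_mass_nonneg integral_nonneg_AE AE_I2 gauss_nonneg) auto
      show "0 \<le> (\<integral>u. gauss u * indicator B u \<partial>lborel)"
        by (intro integral_nonneg_AE AE_I2 mult_nonneg_nonneg gauss_nonneg) auto
    qed (use gauss_indicator_le_1[OF B] cut_mass_nonneg H_nonneg \<kappa>_nonneg in auto)
    finally show ?thesis by (simp add: \<kappa>'_def mult_ac)
  qed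
  define A' where "A' = (\<integral>t. norm (m t) \<partial>labels)"
  have A': "0 \<le> A'" "A' \<le> A" unfolding A'_def A_def m_def using weight_mass[OF B] by auto
  have "norm (expectation (\<lambda>\<omega>. iexp (s * (trunc j n \<omega> - expectation (trunc j n)))) - of_real (exp (- s\<^sup>2 * variance (trunc j n) / 2)))
    \<le> \<bar>s\<bar> * (A' * s\<^sup>2 * K\<^sup>2 * exp (\<bar>s\<bar> * K) + \<bar>s\<bar> * (K * sqrt (A' * \<kappa>')))"
    unfolding K_def A'_def
    by (rule L.char_lin_approx[OF im _ C_le \<kappa>le \<kappa>'0]) (simp_all add: m_def B_def lin_trunc)
  also have "\<dots> \<le> \<bar>s\<bar> * (A * s\<^sup>2 * K\<^sup>2 * exp (\<bar>s\<bar> * K) + \<bar>s\<bar> * (K * sqrt (A * \<kappa>')))"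
    using A' K0 \<kappa>'0 by (intro mult_left_mono add_mono mult_right_mono real_sqrt_le_mono) auto
  finally show ?thesis .
qed

subsection \<open>A lower bound for the variance\<close>

text \<open>Cauchy-Schwarz against a test variable \<open>V\<close>, the statistic whose density is
  the indicator of \<open>B\<close>. Because all covariances are nonnegative, the points of
  \<open>B2\<close>, where \<open>h\<close> has the sign \<sigma>, contribute at least
  \<open>\<eta> * lowc * \<theta>\<close>. The other points of \<open>D\<close> may have the wrong
  sign, but they are nearly uncorrelated with \<open>B\<close>, which is what \<epsilon>
  measures.\<close>

lemma variance_lower:
  assumes B [measurable]: "B \<in> sets borel" and BD: "B \<subseteq> D" and B2 [measurable]: "B2 \<in> sets borel" and B2D: "B2 \<subseteq> D"
    and \<sigma>: "\<bar>\<sigma>\<bar> = 1" and \<eta>: "0 \<le> \<eta>" "\<And>z. z \<in> B2 \<Longrightarrow> \<eta> \<le> \<sigma> * h z"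
    and \<epsilon>: "0 \<le> \<epsilon>" "\<And>z w. z \<in> B \<Longrightarrow> w \<in> D - B2 \<Longrightarrow> (norm (\<rho> z w))\<^sup>2 \<le> \<epsilon>"
    and \<theta>: "\<And>z. z \<in> B \<Longrightarrow> \<theta> \<le> (\<integral>w. indicator B2 w * (norm (\<rho> z w))\<^sup>2 \<partial>lborel)"
    and j: "1 \<le> j"
    and v: "0 < v" "measure lborel D * \<kappa> * (integral\<^sup>L lborel decay)\<^sup>2 \<le> v"
  defines "lowc \<equiv> (\<integral>t. indicator {1..2} t / (1 + t)\<^sup>2 \<partial>lborel)\<^sup>2"
  defines "\<Lambda> \<equiv> measure lborel B * (\<eta> * lowc * \<theta> - H * (integral\<^sup>L lborel decay)\<^sup>2 * \<epsilon> * measure lborel D)"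
  assumes \<Lambda>: "0 \<le> \<Lambda>"
  shows "\<Lambda>\<^sup>2 / v \<le> expectation (\<lambda>\<omega>. (apx j \<omega>)\<^sup>2)"
proof -
  define dd where "dd = integral\<^sup>L lborel decay"
  \<comment> \<open>The test variable uses a fixed parameter interval contained in every cutoff with
    \<open>1 \<le> j\<close>, so the bound does not depend on \<open>j\<close>.\<close>
  define T where "T = {1..2 :: real}"
  have T: "T \<in> sets borel" "T \<subseteq> cutoff j" using interval_subset_cutoff[OF j] by (auto simp: T_def)
  note S = cutoff_measurable[of j] order_refl[of "cutoff j"]
  define p where "p z = (indicator B z :: real)" for z :: 'v
  have [measurable]: "p \<in> borel_measurable borel" unfolding p_def by measurable
  have pd: "\<bar>p z\<bar> \<le> 1 * indicator D z" for z using BD by (auto simp: p_def split: split_indicator)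
  have dint_le: "dint U \<le> dd" if "U \<in> sets borel" for U
    unfolding dint_def dd_def using decay_integrable decay_nonneg
    by (intro integral_mono') (auto split: split_indicator)
  have dd0: "0 \<le> dd" unfolding dd_def by (intro integral_nonneg_AE AE_I2 decay_nonneg)
  define c where "c z w = cov (\<lambda>\<omega>. hlog T (F z \<omega>)) (\<lambda>\<omega>. hlog (cutoff j) (F w \<omega>))" for z w
  have [measurable]: "(\<lambda>w. c z w) \<in> borel_measurable borel" for z
    unfolding c_def cov_def using T(1) by measurable
  have c0: "0 \<le> c z w" for z w unfolding c_def by (rule cov_hlog_bounds(1)[OF T S])
  have c_up: "c z w \<le> dd\<^sup>2 * (norm (\<rho> z w))\<^sup>2" for z w
  proof -
    have "c z w \<le> (dint T * dint (cutoff j)) * (norm (\<rho> z w))\<^sup>2" unfolding c_def by (rule cov_hlog_bounds(2)[OF T S])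
    also have "\<dots> \<le> (dd * dd) * (norm (\<rho> z w))\<^sup>2"
      using dint_le[OF T(1)] dint_le[OF S(1)] dint_nonneg dd0 by (intro mult_right_mono mult_mono) auto
    finally show ?thesis by (simp add: power2_eq_square)
  qed
  have c_up': "c z w \<le> dd\<^sup>2" for z w
  proof -
    have "dd\<^sup>2 * (norm (\<rho> z w))\<^sup>2 \<le> dd\<^sup>2 * 1" using norm_\<rho>_le_1[of z w] by (intro mult_left_mono) (auto simp: power_le_one)
    then show ?thesis using c_up[of z w] by simp
  qed
  have c_low: "lowc * (norm (\<rho> z w))\<^sup>2 \<le> c z w" for z w
  proof -
    define a where "a U = (\<integral>t. indicator U t / (1 + t)\<^sup>2 \<partial>lborel)" for U :: "real set"
    have iU: "integrable lborel (\<lambda>t. indicator U t / (1 + t)\<^sup>2)" if U: "U \<in> sets borel" "U \<subseteq> cutoff j" for U :: "real set"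
    proof (rule Bochner_Integration.integrable_bound[of _ "indicator (cutoff j) :: real \<Rightarrow> real"])
      show "integrable lborel (indicator (cutoff j) :: real \<Rightarrow> real)" by (auto simp: cutoff_def emeasure_lborel_Icc_eq)
      have [measurable]: "U \<in> sets borel" by fact
      show "(\<lambda>t. indicator U t / (1 + t)\<^sup>2 :: real) \<in> borel_measurable lborel" by measurable
      show "AE t in lborel. norm (indicator U t / (1 + t)\<^sup>2) \<le> norm (indicator (cutoff j) t :: real)"
      proof (intro AE_I2)
        fix t
        show "norm (indicator U t / (1 + t)\<^sup>2) \<le> norm (indicator (cutoff j) t :: real)"
        proof (cases "t \<in> U")
          case True
          then have "t \<in> cutoff j" "0 < t" using U cutoff_pos by auto
          then show ?thesis using True one_le_power[of "1 + t" 2] by (simp add: divide_le_eq)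
        qed simp
      qed
    qed
    \<comment> \<open>The covariance pairs \<open>T\<close> with \<open>cutoff j\<close>; shrinking
      the second set to \<open>T\<close> gives the constant \<open>lowc\<close>, which is free of
      \<open>j\<close>.\<close>
    have "a T \<le> a (cutoff j)"
      unfolding a_def using T(2) iU[OF T] iU[OF S] by (intro integral_mono) (auto split: split_indicator)
    moreover have "0 \<le> a T" unfolding a_def by (intro integral_nonneg_AE AE_I2) (auto split: split_indicator)
    ultimately have "lowc \<le> a T * a (cutoff j)"
      unfolding lowc_def T_def[symmetric] a_def[symmetric] by (simp add: power2_eq_square mult_left_mono)
    then have "lowc * (norm (\<rho> z w))\<^sup>2 \<le> a T * a (cutoff j) * (norm (\<rho> z w))\<^sup>2" by (rule mult_right_mono) simp
    also have "\<dots> \<le> c z w" using cov_hlog(2)[OF T S, of z w] by (simp add: c_def a_def mult_ac)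
    finally show ?thesis .
  qed
  have lowc0: "0 \<le> lowc" unfolding lowc_def by simp
  have inner: "\<eta> * lowc * \<theta> - H * dd\<^sup>2 * \<epsilon> * measure lborel D \<le> \<sigma> * (\<integral>w. h w * c z w \<partial>lborel)" if z: "z \<in> B" for z
  proof -
    have i1: "integrable lborel (\<lambda>w. indicator B2 w * (norm (\<rho> z w))\<^sup>2)"
      by (rule dominated_integrable[where P = 1])
         (use B2D norm_\<rho>_le_1 in \<open>auto simp: power_le_one split: split_indicator\<close>)
    have i2: "integrable lborel (\<lambda>w. h w * c z w)"
    proof (rule dominated_integrable[where P = "H * dd\<^sup>2"])
      fix w show "norm (h w * c z w) \<le> H * dd\<^sup>2 * indicator D w"
        using mult_mono[OF h_dom[of w] c_up'[of z w]] c0[of z w] H_nonneg by (simp add: abs_mult mult_ac)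
    qed measurable
    have "\<eta> * lowc * \<theta> - H * dd\<^sup>2 * \<epsilon> * measure lborel D
        \<le> \<eta> * lowc * (\<integral>w. indicator B2 w * (norm (\<rho> z w))\<^sup>2 \<partial>lborel) - H * dd\<^sup>2 * \<epsilon> * (\<integral>w. indicator D w \<partial>lborel)"
      using \<theta>[OF z] \<eta>(1) lowc0 by (simp add: mult_left_mono)
    also have "\<dots> = (\<integral>w. \<eta> * lowc * (indicator B2 w * (norm (\<rho> z w))\<^sup>2) - H * dd\<^sup>2 * \<epsilon> * indicator D w \<partial>lborel)"
      by (subst Bochner_Integration.integral_diff) (auto intro!: integrable_mult_right i1 integrable_D simp del: integrable_indicator_iff)
    also have "\<dots> \<le> (\<integral>w. \<sigma> * (h w * c z w) \<partial>lborel)"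
    proof (rule integral_mono)
      show "integrable lborel (\<lambda>w. \<eta> * lowc * (indicator B2 w * (norm (\<rho> z w))\<^sup>2) - H * dd\<^sup>2 * \<epsilon> * indicator D w)"
        by (intro Bochner_Integration.integrable_diff integrable_mult_right i1 integrable_D)
      show "integrable lborel (\<lambda>w. \<sigma> * (h w * c z w))" by (intro integrable_mult_right i2)
      fix w
      show "\<eta> * lowc * (indicator B2 w * (norm (\<rho> z w))\<^sup>2) - H * dd\<^sup>2 * \<epsilon> * indicator D w \<le> \<sigma> * (h w * c z w)"
      proof (cases "w \<in> B2")
        case True
        have "\<eta> * lowc * (norm (\<rho> z w))\<^sup>2 \<le> \<eta> * c z w"
          using mult_left_mono[OF c_low \<eta>(1)] by (simp add: mult_ac)
        also have "\<dots> \<le> (\<sigma> * h w) * c z w" using \<eta>(2)[OF True] c0 by (intro mult_right_mono) auto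
        finally have "\<eta> * lowc * (norm (\<rho> z w))\<^sup>2 \<le> \<sigma> * (h w * c z w)" by (simp add: mult_ac)
        moreover have "0 \<le> H * dd\<^sup>2 * \<epsilon> * indicator D w" using H_nonneg \<epsilon>(1) by simp
        ultimately show ?thesis using True by simp
      next
        case False
        show ?thesis
        proof (cases "w \<in> D")
          case True
          have "\<bar>\<sigma> * (h w * c z w)\<bar> = \<bar>h w\<bar> * c z w" using \<sigma> c0[of z w] by (simp add: abs_mult)
          also have "\<dots> \<le> H * (dd\<^sup>2 * \<epsilon>)"
          proof (rule mult_mono)
            have "c z w \<le> dd\<^sup>2 * (norm (\<rho> z w))\<^sup>2" by (rule c_up)
            also have "\<dots> \<le> dd\<^sup>2 * \<epsilon>" using \<epsilon>(2)[OF z, of w] True False by (intro mult_left_mono) auto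
            finally show "c z w \<le> dd\<^sup>2 * \<epsilon>" .
          qed (use h_le c0 H_nonneg in auto)
          finally show ?thesis using False True by (simp add: mult_ac abs_le_iff)
        next
          case nD: False
          then have "h w = 0" using h_support by blast
          then show ?thesis using nD False by simp
        qed
      qed
    qed
    finally show ?thesis by simp
  qed
  define X where "X = lstat h (cutoff j)"
  define V where "V = lstat p T"
  have X: "integrable M X" "integrable M (\<lambda>\<omega>. (X \<omega>)\<^sup>2)" unfolding X_def using apx_basic by auto
  have V: "integrable M V" "integrable M (\<lambda>\<omega>. (V \<omega>)\<^sup>2)" "V \<in> borel_measurable M" "\<exists>b. \<forall>\<omega>. \<bar>V \<omega>\<bar> \<le> b"
    unfolding V_def using lstat_basic[OF _ pd T] by auto
  have covVX: "\<Lambda> \<le> \<sigma> * cov V X"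
  proof -
    define g where "g z = p z * (\<sigma> * (\<integral>w. h w * c z w \<partial>lborel))" for z
    have [measurable]: "(\<lambda>(z, w). c z w) \<in> borel_measurable (borel \<Otimes>\<^sub>M borel)"
      unfolding c_def cov_def using T(1) by measurable
    have [measurable]: "g \<in> borel_measurable borel" unfolding g_def by measurable
    have gb: "\<bar>g z\<bar> \<le> (H * dd\<^sup>2 * measure lborel D) * indicator D z" for z
    proof -
      have "\<bar>\<integral>w. h w * c z w \<partial>lborel\<bar> \<le> (\<integral>w. norm (h w * c z w) \<partial>lborel)" by (simp add: integral_abs_bound)
      also have "\<dots> \<le> H * dd\<^sup>2 * measure lborel D"
      proof (rule integral_dominated_le)
        fix w show "norm (h w * c z w) \<le> H * dd\<^sup>2 * indicator D w"
          using mult_mono[OF h_dom[of w] c_up'[of z w]] c0[of z w] H_nonneg by (simp add: abs_mult mult_ac)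
      qed (use H_nonneg in auto)
      finally have "\<bar>p z\<bar> * \<bar>\<integral>w. h w * c z w \<partial>lborel\<bar> \<le> (1 * indicator D z) * (H * dd\<^sup>2 * measure lborel D)"
        using pd[of z] by (intro mult_mono) auto
      then show ?thesis using \<sigma> by (simp add: g_def abs_mult mult_ac)
    qed
    have ig: "integrable lborel g" by (rule dominated_integrable[OF _ gb[folded real_norm_def]]) measurable
    have iB: "integrable lborel (indicator B :: 'v \<Rightarrow> real)"
      by (rule dominated_integrable[where P = 1]) (use BD in \<open>auto split: split_indicator\<close>)
    have "cov V X = (\<integral>z. p z * (\<integral>w. h w * c z w \<partial>lborel) \<partial>lborel)"
      unfolding V_def X_def c_def by (rule cov_lstat[OF _ pd T h_measurable h_dom S]) measurable
    then have e: "\<sigma> * cov V X = (\<integral>z. g z \<partial>lborel)"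
      unfolding g_def by (simp only: mult.left_commute[of _ \<sigma>] Bochner_Integration.integral_mult_right_zero)
    have "\<Lambda> = (\<integral>z. indicator B z * (\<eta> * lowc * \<theta> - H * dd\<^sup>2 * \<epsilon> * measure lborel D) \<partial>lborel)"
      by (simp add: \<Lambda>_def dd_def)
    also have "\<dots> \<le> (\<integral>z. g z \<partial>lborel)"
    proof (rule integral_mono[OF _ ig])
      show "integrable lborel (\<lambda>z. indicator B z * (\<eta> * lowc * \<theta> - H * dd\<^sup>2 * \<epsilon> * measure lborel D))"
        by (intro integrable_mult_left iB)
      show "indicator B z * (\<eta> * lowc * \<theta> - H * dd\<^sup>2 * \<epsilon> * measure lborel D) \<le> g z" for z
        using inner[of z] by (cases "z \<in> B") (auto simp: g_def p_def)
    qed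
    finally show ?thesis by (simp only: e)
  qed
  have varV: "cov V V \<le> v"
  proof -
    have "cov V V = variance V" by (rule cov_self[OF V(1,2)])
    also have "\<dots> \<le> 1\<^sup>2 * measure lborel D * \<kappa> * (dint T)\<^sup>2"
      unfolding V_def by (rule variance_lstat_le[OF _ pd _ T]) auto
    also have "\<dots> \<le> measure lborel D * \<kappa> * dd\<^sup>2"
      using dint_le[OF T(1)] dint_nonneg \<kappa>_nonneg by (simp add: mult_left_mono power_mono)
    finally show ?thesis using v(2) by (simp add: dd_def)
  qed
  obtain b where b: "\<And>\<omega>. \<bar>V \<omega>\<bar> \<le> b" using V(4) by blast
  have iVX: "integrable M (\<lambda>\<omega>. V \<omega> * X \<omega>)"
  proof (rule Bochner_Integration.integrable_bound[OF integrable_mult_right[OF X(1), of b]])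
    show "AE \<omega> in M. norm (V \<omega> * X \<omega>) \<le> norm (b * X \<omega>)"
      using b by (intro AE_I2) (auto simp: abs_mult intro!: mult_right_mono order_trans[OF b abs_ge_self])
  qed (use V(3) X(1) in auto)
  \<comment> \<open>A regression coefficient with the covariance and the variance of
    \<open>V\<close> replaced by their bounds \<Lambda> and \<open>v\<close>; the variance of
    \<open>X - a * V\<close> is nonnegative, and this gives the claim without dividing by the
    variance of \<open>V\<close>.\<close>
  define a where "a = \<sigma> * \<Lambda> / v"
  have "0 \<le> cov (\<lambda>\<omega>. X \<omega> - a * V \<omega>) (\<lambda>\<omega>. X \<omega> - a * V \<omega>)"
  proof -
    have i: "integrable M (\<lambda>\<omega>. X \<omega> - a * V \<omega>)" using X(1) V(1) by auto
    have e: "(X \<omega> - a * V \<omega>)\<^sup>2 = (X \<omega>)\<^sup>2 - 2 * a * (V \<omega> * X \<omega>) + a\<^sup>2 * (V \<omega>)\<^sup>2" for \<omega>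
      by (simp add: power2_eq_square algebra_simps)
    have "integrable M (\<lambda>\<omega>. (X \<omega> - a * V \<omega>)\<^sup>2)"
      unfolding e using X(2) V(2) iVX by (intro Bochner_Integration.integrable_add Bochner_Integration.integrable_diff integrable_mult_right)
    from cov_self[OF i this] show ?thesis using variance_positive[of "\<lambda>\<omega>. X \<omega> - a * V \<omega>"] by simp
  qed
  also have "cov (\<lambda>\<omega>. X \<omega> - a * V \<omega>) (\<lambda>\<omega>. X \<omega> - a * V \<omega>) = cov X X - 2 * a * cov V X + a\<^sup>2 * cov V V"
  proof -
    have e: "(X \<omega> - a * V \<omega>) * (X \<omega> - a * V \<omega>) = X \<omega> * X \<omega> - 2 * a * (V \<omega> * X \<omega>) + a\<^sup>2 * (V \<omega> * V \<omega>)" for \<omega>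
      by (simp add: power2_eq_square algebra_simps)
    have i: "integrable M (\<lambda>\<omega>. X \<omega> * X \<omega>)" "integrable M (\<lambda>\<omega>. V \<omega> * V \<omega>)"
      using X(2) V(2) by (simp_all add: power2_eq_square)
    have E1: "expectation (\<lambda>\<omega>. X \<omega> * X \<omega> - 2 * a * (V \<omega> * X \<omega>) + a\<^sup>2 * (V \<omega> * V \<omega>))
        = expectation (\<lambda>\<omega>. X \<omega> * X \<omega>) - 2 * a * expectation (\<lambda>\<omega>. V \<omega> * X \<omega>) + a\<^sup>2 * expectation (\<lambda>\<omega>. V \<omega> * V \<omega>)"
      using i iVX by simp
    have E2: "expectation (\<lambda>\<omega>. X \<omega> - a * V \<omega>) = expectation X - a * expectation V"
      using X(1) V(1) by simp
    show ?thesis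
      unfolding cov_def e E1 E2 by (simp add: power2_eq_square algebra_simps)
  qed
  finally have "2 * a * cov V X \<le> cov X X + a\<^sup>2 * cov V V" by linarith
  moreover have "2 * (\<Lambda>\<^sup>2 / v) \<le> 2 * a * cov V X"
  proof -
    have "\<Lambda> * \<Lambda> / v \<le> \<Lambda> * (\<sigma> * cov V X) / v" using covVX \<Lambda> v(1) by (intro divide_right_mono mult_left_mono) auto
    moreover have "2 * a * cov V X = 2 * (\<Lambda> * (\<sigma> * cov V X) / v)" by (simp add: a_def mult_ac)
    ultimately show ?thesis by (simp add: power2_eq_square)
  qed
  moreover have "a\<^sup>2 * cov V V \<le> \<Lambda>\<^sup>2 / v"
  proof -
    have "\<sigma>\<^sup>2 = 1" using \<sigma> by (metis one_power2 power2_abs)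
    then have "a\<^sup>2 * cov V V \<le> (\<Lambda>\<^sup>2 / v\<^sup>2) * v"
      using varV by (intro mult_mono) (auto simp: a_def power_mult_distrib power_divide cov_self[OF V(1,2)])
    then show ?thesis using v(1) by (simp add: power2_eq_square)
  qed
  ultimately have "\<Lambda>\<^sup>2 / v \<le> cov X X" by linarith
  then show ?thesis using cov_self[OF X] by (simp add: apx_square X_def)
qed

text \<open>The lower bound is uniform in \<open>j\<close>, so the limit in mean square preserves it
  up to the factor 2 of \<open>(x + y)\<^sup>2 \<le> 2 * x\<^sup>2 + 2 * y\<^sup>2\<close>.\<close>

lemma logstat_lower:
  assumes "\<And>j. 1 \<le> j \<Longrightarrow> c \<le> expectation (\<lambda>\<omega>. (apx j \<omega>)\<^sup>2)"
  shows "c / 2 \<le> expectation (\<lambda>\<omega>. (logstat \<omega>)\<^sup>2)"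
proof -
  have "c \<le> 2 * expectation (\<lambda>\<omega>. (logstat \<omega>)\<^sup>2) + 2 * (scale * (decay_tail j)\<^sup>2)" if "1 \<le> j" for j
  proof -
    have le: "y\<^sup>2 \<le> 2 * x\<^sup>2 + 2 * (x - y)\<^sup>2" for x y :: real
      using zero_le_power2[of "2 * x - y"] by (simp add: power2_eq_square algebra_simps)
    have "c \<le> expectation (\<lambda>\<omega>. (apx j \<omega>)\<^sup>2)" by (rule assms[OF that])
    also have "\<dots> \<le> expectation (\<lambda>\<omega>. 2 * (logstat \<omega>)\<^sup>2 + 2 * (logstat \<omega> - apx j \<omega>)\<^sup>2)"
      using logstat_square_integrable logstat_apx(1)[of j] le by (intro integral_mono') auto
    also have "\<dots> = 2 * expectation (\<lambda>\<omega>. (logstat \<omega>)\<^sup>2) + 2 * expectation (\<lambda>\<omega>. (logstat \<omega> - apx j \<omega>)\<^sup>2)"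
      using logstat_square_integrable logstat_apx(1)[of j] by simp
    finally show ?thesis using logstat_apx(2)[of j] by linarith
  qed
  moreover have "(\<lambda>j. 2 * expectation (\<lambda>\<omega>. (logstat \<omega>)\<^sup>2) + 2 * (scale * (decay_tail j)\<^sup>2))
      \<longlonglongrightarrow> 2 * expectation (\<lambda>\<omega>. (logstat \<omega>)\<^sup>2) + 2 * (scale * 0\<^sup>2)"
    by (intro tendsto_intros decay_tail_tendsto)
  ultimately have "c \<le> 2 * expectation (\<lambda>\<omega>. (logstat \<omega>)\<^sup>2) + 2 * (scale * 0\<^sup>2)"
    by (intro LIMSEQ_le_const[where X = "\<lambda>j. 2 * expectation (\<lambda>\<omega>. (logstat \<omega>)\<^sup>2) + 2 * (scale * (decay_tail j)\<^sup>2)"]) auto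
  then show ?thesis by simp
qed

end

section \<open>From approximants to the limit of the characteristic functions\<close>

lemma norm_iexp_diff_le: "norm (iexp x - iexp y) \<le> \<bar>x - y\<bar>"
proof -
  have "iexp x - iexp y = iexp y * (iexp (x - y) - 1)"
    by (simp add: exp_diff algebra_simps)
  then have "norm (iexp x - iexp y) = norm (iexp (x - y) - 1)"
    by (simp add: norm_mult)
  also have "\<dots> \<le> \<bar>x - y\<bar>" using iexp_approx1[of "x - y" 0] by simp
  finally show ?thesis .
qed

lemma abs_exp_neg_diff_le: "0 \<le> a \<Longrightarrow> 0 \<le> b \<Longrightarrow> \<bar>exp (- a) - exp (- b)\<bar> \<le> \<bar>a - b\<bar>" for a b :: real
proof (induction a b rule: linorder_wlog)
  case (le a b)
  have "exp (- a) - exp (- b) = exp (- a) * (1 - exp (- (b - a)))" by (simp add: algebra_simps flip: exp_add)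
  also have "\<dots> \<le> 1 * (b - a)"
  proof (rule mult_mono)
    show "1 - exp (- (b - a)) \<le> b - a" using exp_ge_add_one_self[of "- (b - a)"] by linarith
  qed (use le in auto)
  finally have "exp (- a) - exp (- b) \<le> b - a" by simp
  moreover have "exp (- b) \<le> exp (- a)" using le by simp
  ultimately show ?case using le by simp
qed (simp add: abs_minus_commute)

context prob_space
begin

text \<open>An approximant with mean-square error at most \<epsilon> relative to the standard
  deviation may replace \<open>X k\<close>: it changes the normalised characteristic function by at
  most \<open>\<bar>t\<bar> * \<epsilon>\<close> and the variance by a relative error of at most
  \<open>3 * \<epsilon>\<close>. The approximants may depend on \<epsilon>, since \<open>k\<close>
  tends to infinity for fixed \<epsilon>.\<close>

lemma clt_criterion:
  fixes X :: "nat \<Rightarrow> 'a \<Rightarrow> real"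
  defines "s \<equiv> \<lambda>k. sqrt (expectation (\<lambda>\<omega>. (X k \<omega>)\<^sup>2))"
  assumes X [measurable]: "\<And>k. X k \<in> borel_measurable M" and X2: "\<And>k. integrable M (\<lambda>\<omega>. (X k \<omega>)\<^sup>2)"
    and pos: "\<forall>\<^sub>F k in sequentially. 0 < s k"
    and approx: "\<And>\<epsilon>. 0 < \<epsilon> \<Longrightarrow> \<exists>Z. (\<forall>k. Z k \<in> borel_measurable M \<and> integrable M (\<lambda>\<omega>. (Z k \<omega>)\<^sup>2)) \<and>
      (\<forall>\<^sub>F k in sequentially. integrable M (\<lambda>\<omega>. (X k \<omega> - Z k \<omega>)\<^sup>2) \<and> expectation (\<lambda>\<omega>. (X k \<omega> - Z k \<omega>)\<^sup>2) \<le> \<epsilon>\<^sup>2 * (s k)\<^sup>2) \<and>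
      (\<lambda>k. expectation (\<lambda>\<omega>. iexp (t / s k * Z k \<omega>)) - of_real (exp (- (t / s k)\<^sup>2 * expectation (\<lambda>\<omega>. (Z k \<omega>)\<^sup>2) / 2))) \<longlonglongrightarrow> 0"
  shows "(\<lambda>k. expectation (\<lambda>\<omega>. iexp (t / s k * X k \<omega>))) \<longlonglongrightarrow> of_real (exp (- t\<^sup>2 / 2))"
proof (rule LIMSEQ_I)
  fix \<delta> :: real assume \<delta>: "0 < \<delta>"
  \<comment> \<open>Collects the two errors proportional to \<epsilon>, from the characteristic
    function and from the variance; \<epsilon> is then chosen with
    \<open>\<epsilon> * c < \<delta> / 2\<close>.\<close>
  define c where "c = \<bar>t\<bar> + 3 * t\<^sup>2"
  have c: "0 \<le> c" by (simp add: c_def)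
  define \<epsilon> where "\<epsilon> = min 1 (\<delta> / (2 * (c + 1)))"
  have \<epsilon>: "0 < \<epsilon>" "\<epsilon> \<le> 1" using \<delta> c by (auto simp: \<epsilon>_def)
  have "\<epsilon> * c \<le> \<delta> / (2 * (c + 1)) * c" using c by (intro mult_right_mono) (auto simp: \<epsilon>_def)
  also have "\<dots> < \<delta> / 2" using c \<delta> by (simp add: field_simps)
  finally have \<epsilon>c: "\<epsilon> * c < \<delta> / 2" .
  obtain Z where Z: "\<And>k. Z k \<in> borel_measurable M" and Z2: "\<And>k. integrable M (\<lambda>\<omega>. (Z k \<omega>)\<^sup>2)"
    and XZ: "\<forall>\<^sub>F k in sequentially. integrable M (\<lambda>\<omega>. (X k \<omega> - Z k \<omega>)\<^sup>2) \<and> expectation (\<lambda>\<omega>. (X k \<omega> - Z k \<omega>)\<^sup>2) \<le> \<epsilon>\<^sup>2 * (s k)\<^sup>2"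
    and lim: "(\<lambda>k. expectation (\<lambda>\<omega>. iexp (t / s k * Z k \<omega>)) - of_real (exp (- (t / s k)\<^sup>2 * expectation (\<lambda>\<omega>. (Z k \<omega>)\<^sup>2) / 2))) \<longlonglongrightarrow> 0"
    using approx[OF \<epsilon>(1)] by blast
  have "\<forall>\<^sub>F k in sequentially. norm (expectation (\<lambda>\<omega>. iexp (t / s k * Z k \<omega>)) - of_real (exp (- (t / s k)\<^sup>2 * expectation (\<lambda>\<omega>. (Z k \<omega>)\<^sup>2) / 2))) < \<delta> / 2"
    using tendstoD[OF lim, of "\<delta> / 2"] \<delta> by (simp add: dist_norm)
  with XZ pos have "\<forall>\<^sub>F k in sequentially. norm (expectation (\<lambda>\<omega>. iexp (t / s k * X k \<omega>)) - of_real (exp (- t\<^sup>2 / 2))) < \<delta>"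
  proof eventually_elim
    case (elim k)
    define d where "d \<omega> = X k \<omega> - Z k \<omega>" for \<omega>
    note [measurable] = Z
    have [measurable]: "d \<in> borel_measurable M" unfolding d_def by measurable
    have d2: "integrable M (\<lambda>\<omega>. (d \<omega>)\<^sup>2)" "expectation (\<lambda>\<omega>. (d \<omega>)\<^sup>2) \<le> \<epsilon>\<^sup>2 * (s k)\<^sup>2" using elim by (auto simp: d_def)
    have sk: "0 < s k" by fact
    have s2: "expectation (\<lambda>\<omega>. (X k \<omega>)\<^sup>2) = (s k)\<^sup>2" by (simp add: s_def)
    have id: "integrable M d" by (rule square_integrable_imp_integrable[OF _ d2(1)]) measurable
    have i: "integrable M (\<lambda>\<omega>. iexp (t / s k * X k \<omega>))" "integrable M (\<lambda>\<omega>. iexp (t / s k * Z k \<omega>))"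
      by (rule integrable_const_bound[where B = 1]; auto)+
    have 1: "norm (expectation (\<lambda>\<omega>. iexp (t / s k * X k \<omega>)) - expectation (\<lambda>\<omega>. iexp (t / s k * Z k \<omega>))) \<le> \<bar>t\<bar> * \<epsilon>"
    proof -
      have "norm (expectation (\<lambda>\<omega>. iexp (t / s k * X k \<omega>)) - expectation (\<lambda>\<omega>. iexp (t / s k * Z k \<omega>)))
          = norm (expectation (\<lambda>\<omega>. iexp (t / s k * X k \<omega>) - iexp (t / s k * Z k \<omega>)))"
        using i by simp
      also have "\<dots> \<le> expectation (\<lambda>\<omega>. \<bar>t\<bar> / s k * norm (d \<omega>))"
      proof (rule order_trans[OF integral_norm_bound], rule integral_mono')
        fix \<omega>
        have "norm (iexp (t / s k * X k \<omega>) - iexp (t / s k * Z k \<omega>)) \<le> \<bar>t / s k * X k \<omega> - t / s k * Z k \<omega>\<bar>"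
          by (rule norm_iexp_diff_le)
        also have "\<dots> = \<bar>t\<bar> / s k * norm (d \<omega>)"
          using sk unfolding d_def right_diff_distrib[symmetric] by (simp add: abs_mult)
        finally show "norm (iexp (t / s k * X k \<omega>) - iexp (t / s k * Z k \<omega>)) \<le> \<bar>t\<bar> / s k * norm (d \<omega>)" .
      qed (use id sk in auto)
      also have "\<dots> = \<bar>t\<bar> / s k * expectation (\<lambda>\<omega>. norm (d \<omega>))" by simp
      also have "\<dots> \<le> \<bar>t\<bar> / s k * (\<epsilon> * s k)"
      proof (rule mult_left_mono)
        have "expectation (\<lambda>\<omega>. norm (d \<omega>)) \<le> sqrt (expectation (\<lambda>\<omega>. (norm (d \<omega>))\<^sup>2))"
          by (rule expectation_norm_le_sqrt) (use d2 in auto)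
        also have "\<dots> \<le> sqrt ((\<epsilon> * s k)\<^sup>2)" using d2(2) by (intro real_sqrt_le_mono) (simp add: power_mult_distrib)
        also have "\<dots> = \<epsilon> * s k" using \<epsilon> sk by (subst real_sqrt_abs) simp
        finally show "expectation (\<lambda>\<omega>. norm (d \<omega>)) \<le> \<epsilon> * s k" .
      qed (use sk in auto)
      also have "\<dots> = \<bar>t\<bar> * \<epsilon>" using sk by simp
      finally show ?thesis .
    qed
    have 2: "\<bar>expectation (\<lambda>\<omega>. (Z k \<omega>)\<^sup>2) - (s k)\<^sup>2\<bar> \<le> 3 * \<epsilon> * (s k)\<^sup>2"
    proof -
      have "\<bar>expectation (\<lambda>\<omega>. (Z k \<omega>)\<^sup>2) - (s k)\<^sup>2\<bar> = \<bar>expectation (\<lambda>\<omega>. (Z k \<omega>)\<^sup>2 - (X k \<omega>)\<^sup>2)\<bar>"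
        using Z2 X2 by (simp add: s2)
      also have "\<dots> \<le> expectation (\<lambda>\<omega>. (d \<omega>)\<^sup>2 + \<epsilon> * (X k \<omega>)\<^sup>2 + (d \<omega>)\<^sup>2 / \<epsilon>)"
      proof (rule order_trans[OF integral_abs_bound], rule integral_mono')
        show "integrable M (\<lambda>\<omega>. (d \<omega>)\<^sup>2 + \<epsilon> * (X k \<omega>)\<^sup>2 + (d \<omega>)\<^sup>2 / \<epsilon>)" using X2 d2(1) by auto
        fix \<omega>
        define x where "x = X k \<omega>"
        define y where "y = d \<omega>"
        \<comment> \<open>Young's inequality with weight \<epsilon>; the division by \<epsilon> is
          harmless, because the second moment of \<open>d\<close> is of order \<epsilon>
          squared.\<close>
        have "0 \<le> (\<epsilon> * \<bar>x\<bar> - \<bar>y\<bar>)\<^sup>2 / \<epsilon>" using \<epsilon> by simp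
        also have "\<dots> = \<epsilon> * x\<^sup>2 + y\<^sup>2 / \<epsilon> - 2 * (\<bar>x\<bar> * \<bar>y\<bar>)"
          using \<epsilon> by (simp add: power2_eq_square field_simps flip: abs_mult)
        finally have "2 * (\<bar>x\<bar> * \<bar>y\<bar>) \<le> \<epsilon> * x\<^sup>2 + y\<^sup>2 / \<epsilon>" by simp
        moreover have "(Z k \<omega>)\<^sup>2 - (X k \<omega>)\<^sup>2 = y\<^sup>2 - 2 * (x * y)"
          by (simp add: x_def y_def d_def power2_eq_square algebra_simps)
        then have "\<bar>(Z k \<omega>)\<^sup>2 - (X k \<omega>)\<^sup>2\<bar> \<le> y\<^sup>2 + 2 * (\<bar>x\<bar> * \<bar>y\<bar>)"
          using abs_triangle_ineq4[of "y\<^sup>2" "2 * (x * y)"] by (simp add: abs_mult)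
        ultimately show "\<bar>(Z k \<omega>)\<^sup>2 - (X k \<omega>)\<^sup>2\<bar> \<le> (d \<omega>)\<^sup>2 + \<epsilon> * (X k \<omega>)\<^sup>2 + (d \<omega>)\<^sup>2 / \<epsilon>"
          unfolding x_def y_def by linarith
        show "0 \<le> (d \<omega>)\<^sup>2 + \<epsilon> * (X k \<omega>)\<^sup>2 + (d \<omega>)\<^sup>2 / \<epsilon>" using \<epsilon> by simp
      qed
      also have "\<dots> = expectation (\<lambda>\<omega>. (d \<omega>)\<^sup>2) + \<epsilon> * (s k)\<^sup>2 + expectation (\<lambda>\<omega>. (d \<omega>)\<^sup>2) / \<epsilon>"
        using X2 d2(1) by (simp add: s2)
      also have "\<dots> \<le> \<epsilon>\<^sup>2 * (s k)\<^sup>2 + \<epsilon> * (s k)\<^sup>2 + (\<epsilon>\<^sup>2 * (s k)\<^sup>2) / \<epsilon>"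
        using d2(2) \<epsilon> by (intro add_mono divide_right_mono) auto
      also have "\<dots> \<le> 3 * \<epsilon> * (s k)\<^sup>2"
      proof -
        have "\<epsilon>\<^sup>2 * (s k)\<^sup>2 \<le> \<epsilon> * (s k)\<^sup>2"
          using \<epsilon> by (intro mult_right_mono) (auto simp: power2_eq_square mult_left_le)
        moreover have "(\<epsilon>\<^sup>2 * (s k)\<^sup>2) / \<epsilon> = \<epsilon> * (s k)\<^sup>2" using \<epsilon> by (simp add: power2_eq_square)
        ultimately show ?thesis by linarith
      qed
      finally show ?thesis .
    qed
    have 3: "norm (complex_of_real (exp (- (t / s k)\<^sup>2 * expectation (\<lambda>\<omega>. (Z k \<omega>)\<^sup>2) / 2)) - of_real (exp (- t\<^sup>2 / 2))) \<le> 3 * t\<^sup>2 * \<epsilon>"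
    proof -
      define z where "z = expectation (\<lambda>\<omega>. (Z k \<omega>)\<^sup>2)"
      have z0: "0 \<le> z" unfolding z_def by simp
      have "norm (complex_of_real (exp (- (t / s k)\<^sup>2 * z / 2)) - of_real (exp (- t\<^sup>2 / 2)))
          = \<bar>exp (- ((t / s k)\<^sup>2 * z / 2)) - exp (- (t\<^sup>2 / 2))\<bar>"
        unfolding of_real_diff[symmetric] norm_of_real by simp
      also have "\<dots> \<le> \<bar>(t / s k)\<^sup>2 * z / 2 - t\<^sup>2 / 2\<bar>" using z0 by (intro abs_exp_neg_diff_le) auto
      also have "\<dots> = t\<^sup>2 / (2 * (s k)\<^sup>2) * \<bar>z - (s k)\<^sup>2\<bar>"
      proof -
        have "(t / s k)\<^sup>2 * z / 2 - t\<^sup>2 / 2 = t\<^sup>2 / (2 * (s k)\<^sup>2) * (z - (s k)\<^sup>2)"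
          using sk by (simp add: power_divide field_simps)
        then show ?thesis by (simp add: abs_mult)
      qed
      also have "\<dots> \<le> t\<^sup>2 / (2 * (s k)\<^sup>2) * (3 * \<epsilon> * (s k)\<^sup>2)"
        using 2 by (intro mult_left_mono) (auto simp: z_def)
      also have "\<dots> = 3 * t\<^sup>2 * \<epsilon> / 2" using sk by simp
      also have "\<dots> \<le> 3 * t\<^sup>2 * \<epsilon>" using \<epsilon> by simp
      finally show ?thesis by (simp only: z_def)
    qed
    define e1 where "e1 = expectation (\<lambda>\<omega>. iexp (t / s k * X k \<omega>))"
    define e2 where "e2 = expectation (\<lambda>\<omega>. iexp (t / s k * Z k \<omega>))"
    define e3 where "e3 = complex_of_real (exp (- (t / s k)\<^sup>2 * expectation (\<lambda>\<omega>. (Z k \<omega>)\<^sup>2) / 2))"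
    define e4 where "e4 = complex_of_real (exp (- t\<^sup>2 / 2))"
    have "norm (e1 - e4) \<le> norm (e1 - e2) + norm (e2 - e3) + norm (e3 - e4)"
      using norm_triangle_ineq[of "e1 - e2" "e2 - e4"] norm_triangle_ineq[of "e2 - e3" "e3 - e4"] by simp
    also have "\<dots> < \<bar>t\<bar> * \<epsilon> + \<delta> / 2 + 3 * t\<^sup>2 * \<epsilon>"
      using 1 3 elim unfolding e1_def e2_def e3_def e4_def by linarith
    also have "\<dots> = \<epsilon> * c + \<delta> / 2" by (simp add: c_def algebra_simps)
    also have "\<dots> < \<delta>" using \<epsilon>c by simp
    finally show ?case by (simp only: e1_def e4_def)
  qed
  then show "\<exists>no. \<forall>n\<ge>no. norm (expectation (\<lambda>\<omega>. iexp (t / s n * X n \<omega>)) - of_real (exp (- t\<^sup>2 / 2))) < \<delta>"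
    by (simp add: eventually_sequentially)
qed

end

text \<open>The right side of \<open>trunc_char\<close> as a function of \<kappa> and
  \<open>s\<close>, the two quantities that vary with the intensity.\<close>

definition char_error :: "nat \<Rightarrow> nat \<Rightarrow> real \<Rightarrow> real \<Rightarrow> real \<Rightarrow> real \<Rightarrow> real" where
  "char_error j n H mD \<kappa> s =
    (let A = H * mD * cut_mass j; \<kappa>' = H * cut_mass j * (amp_max j n)\<^sup>2 * \<kappa>; K = exp ((amp_max j n)\<^sup>2) * \<kappa>'
     in \<bar>s\<bar> * (A * s\<^sup>2 * K\<^sup>2 * exp (\<bar>s\<bar> * K) + \<bar>s\<bar> * (K * sqrt (A * \<kappa>'))))"

text \<open>With \<kappa> proportional to \<open>q\<close> and \<open>s\<close> at most of order
  \<open>1 / sqrt q\<close>, the constant \<open>K\<close> is of order \<open>q\<close>. Then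
  \<open>\<bar>s\<bar> ^ 3 * K\<^sup>2\<close> and \<open>s\<^sup>2 * K * sqrt \<kappa>\<close> are
  both at most of order \<open>sqrt q\<close>, while \<open>\<bar>s\<bar> * K\<close> in the
  exponential tends to 0.\<close>

lemma char_error_tendsto:
  assumes H: "0 \<le> H" and mD: "0 \<le> mD" and \<kappa>0: "0 \<le> \<kappa>0" and c: "0 < c"
    and q: "\<And>k. 0 < q k" "q \<longlonglongrightarrow> 0"
    and s: "\<forall>\<^sub>F k in sequentially. \<bar>s k\<bar> \<le> c / sqrt (q k)"
  shows "(\<lambda>k. char_error j n H mD (\<kappa>0 * q k) (s k)) \<longlonglongrightarrow> 0"
proof -
  define A where "A = H * mD * cut_mass j"
  define \<kappa>1 where "\<kappa>1 = H * cut_mass j * (amp_max j n)\<^sup>2 * \<kappa>0"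
  define K1 where "K1 = exp ((amp_max j n)\<^sup>2) * \<kappa>1"
  have A: "0 \<le> A" "0 \<le> \<kappa>1" "0 \<le> K1" using H mD \<kappa>0 cut_mass_nonneg[of j] by (auto simp: A_def \<kappa>1_def K1_def)
  define y where "y k = sqrt (q k)" for k
  have y: "0 < y k" "y k * y k = q k" for k using q(1)[of k] by (auto simp: y_def)
  have y0: "y \<longlonglongrightarrow> 0" unfolding y_def using tendsto_real_sqrt[OF q(2)] by simp
  define E where "E k = A * c ^ 3 * K1\<^sup>2 * y k * exp (c * K1 * y k) + c\<^sup>2 * K1 * sqrt (A * \<kappa>1) * y k" for k
  have "E \<longlonglongrightarrow> A * c ^ 3 * K1\<^sup>2 * 0 * exp (c * K1 * 0) + c\<^sup>2 * K1 * sqrt (A * \<kappa>1) * 0"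
    unfolding E_def by (intro tendsto_intros y0)
  then have E0: "E \<longlonglongrightarrow> 0" by simp
  show ?thesis
  proof (rule Lim_null_comparison[OF _ E0])
    show "\<forall>\<^sub>F k in sequentially. norm (char_error j n H mD (\<kappa>0 * q k) (s k)) \<le> E k"
      using s
    proof eventually_elim
      case (elim k)
      define Y where "Y = y k"
      have Y: "0 < Y" "q k = Y * Y" using y[of k] by (auto simp: Y_def)
      have sk: "\<bar>s k\<bar> \<le> c / Y" using elim by (simp add: Y_def y_def)
      have eq: "char_error j n H mD (\<kappa>0 * q k) (s k)
          = \<bar>s k\<bar> * (A * (s k)\<^sup>2 * (K1 * (Y * Y))\<^sup>2 * exp (\<bar>s k\<bar> * (K1 * (Y * Y))) + \<bar>s k\<bar> * (K1 * (Y * Y) * sqrt (A * (\<kappa>1 * (Y * Y)))))"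
        unfolding char_error_def Let_def A_def K1_def \<kappa>1_def Y(2) by (simp add: mult_ac)
      have nn: "0 \<le> char_error j n H mD (\<kappa>0 * q k) (s k)" unfolding eq using A Y by (auto intro!: mult_nonneg_nonneg add_nonneg_nonneg)
      have mono: "x * (A * x\<^sup>2 * k\<^sup>2 * exp (x * k) + x * (k * v)) \<le> X * (A * X\<^sup>2 * k\<^sup>2 * exp (X * k) + X * (k * v))"
        if "0 \<le> x" "x \<le> X" "0 \<le> k" "0 \<le> v" for x X k v
      proof -
        have "x\<^sup>2 \<le> X\<^sup>2" using that by (intro power_mono) auto
        moreover have "exp (x * k) \<le> exp (X * k)" using that by (simp add: mult_right_mono)
        ultimately have "A * x\<^sup>2 * k\<^sup>2 * exp (x * k) \<le> A * X\<^sup>2 * k\<^sup>2 * exp (X * k)"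
          using A by (intro mult_mono mult_left_mono mult_right_mono) auto
        moreover have "x * (k * v) \<le> X * (k * v)" using that by (intro mult_right_mono) auto
        ultimately show ?thesis using that A by (intro mult_mono[OF _ add_mono]) (auto intro!: add_nonneg_nonneg mult_nonneg_nonneg)
      qed
      have K: "0 \<le> K1 * (Y * Y)" using A Y by simp
      have "char_error j n H mD (\<kappa>0 * q k) (s k)
          \<le> (c / Y) * (A * (c / Y)\<^sup>2 * (K1 * (Y * Y))\<^sup>2 * exp ((c / Y) * (K1 * (Y * Y))) + (c / Y) * (K1 * (Y * Y) * sqrt (A * (\<kappa>1 * (Y * Y)))))"
        unfolding eq using mono[OF abs_ge_zero sk K, of "sqrt (A * (\<kappa>1 * (Y * Y)))"] A Y by simp
      also have "\<dots> = E k"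
      proof -
        have "sqrt (A * (\<kappa>1 * (Y * Y))) = sqrt (A * \<kappa>1) * Y" using Y by (simp add: real_sqrt_mult mult_ac)
        moreover have "(c / Y) * (K1 * (Y * Y)) = c * K1 * Y" using Y by simp
        moreover have "(c / Y) * (A * (c / Y)\<^sup>2 * (K1 * (Y * Y))\<^sup>2) = A * c ^ 3 * K1\<^sup>2 * Y"
          using Y by (simp add: power2_eq_square power3_eq_cube field_simps)
        moreover have "(c / Y) * ((c / Y) * (K1 * (Y * Y) * (sqrt (A * \<kappa>1) * Y))) = c\<^sup>2 * K1 * sqrt (A * \<kappa>1) * Y"
          using Y by (simp add: power2_eq_square field_simps)
        ultimately show ?thesis
          unfolding E_def Y_def[symmetric] by (simp only: distrib_left mult.assoc[symmetric])
      qed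
      finally show ?case using nn by simp
    qed
  qed
qed

context gaussian_statistic
begin

lemma approximant:
  "\<exists>Z. Z \<in> borel_measurable M \<and> integrable M (\<lambda>\<omega>. (Z \<omega>)\<^sup>2) \<and>
    integrable M (\<lambda>\<omega>. (logstat \<omega> - Z \<omega>)\<^sup>2) \<and>
    expectation (\<lambda>\<omega>. (logstat \<omega> - Z \<omega>)\<^sup>2)
      \<le> 2 * (H\<^sup>2 * measure lborel D * \<kappa>) * ((decay_tail j)\<^sup>2 + (cut_mass_sqrt j * gauss_tail (real n))\<^sup>2) \<and>
    (\<forall>s. norm (expectation (\<lambda>\<omega>. iexp (s * Z \<omega>)) - of_real (exp (- s\<^sup>2 * expectation (\<lambda>\<omega>. (Z \<omega>)\<^sup>2) / 2)))
      \<le> char_error j n H (measure lborel D) \<kappa> s)"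
proof -
  \<comment> \<open>The minus sign is that of \<open>apx\<close>; the Gaussian exponent is even, so
    below it only replaces \<open>s\<close> by \<open>- s\<close>.\<close>
  define Z where "Z \<omega> = - (trunc j n \<omega> - expectation (trunc j n))" for \<omega>
  have Zm [measurable]: "Z \<in> borel_measurable M" unfolding Z_def by measurable
  obtain bT where bT: "\<And>\<omega>. \<bar>trunc j n \<omega>\<bar> \<le> bT" using trunc_bounded by blast
  obtain bX where bX: "\<And>\<omega>. \<bar>lstat h (cutoff j) \<omega>\<bar> \<le> bX" using apx_basic(2) by blast
  have sq: "integrable M (\<lambda>\<omega>. (g \<omega>)\<^sup>2)" if [measurable]: "g \<in> borel_measurable M" and g: "\<And>\<omega>. \<bar>g \<omega>\<bar> \<le> b" for g :: "'w \<Rightarrow> real" and b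
  proof (rule integrable_const_bound[where B = "b\<^sup>2"])
    show "AE \<omega> in M. norm ((g \<omega>)\<^sup>2) \<le> b\<^sup>2"
      using g by (intro AE_I2) (simp add: abs_le_square_iff[symmetric] order_trans[OF g abs_ge_self])
  qed measurable
  have Z2: "integrable M (\<lambda>\<omega>. (Z \<omega>)\<^sup>2)"
  proof (rule sq)
    show "\<bar>Z \<omega>\<bar> \<le> bT + \<bar>expectation (trunc j n)\<bar>" for \<omega> unfolding Z_def using bT[of \<omega>] by linarith
  qed measurable
  have EZ: "expectation (\<lambda>\<omega>. (Z \<omega>)\<^sup>2) = variance (trunc j n)" by (simp only: Z_def power2_minus)
  define e where "e \<omega> = (lstat h (cutoff j) \<omega> - trunc j n \<omega>) - expectation (\<lambda>\<omega>. lstat h (cutoff j) \<omega> - trunc j n \<omega>)" for \<omega>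
  have [measurable]: "lstat h (cutoff j) \<in> borel_measurable M" by (rule apx_basic(1))
  have [measurable]: "e \<in> borel_measurable M" unfolding e_def by measurable
  have e2: "integrable M (\<lambda>\<omega>. (e \<omega>)\<^sup>2)"
  proof (rule sq)
    show "\<bar>e \<omega>\<bar> \<le> bX + bT + \<bar>expectation (\<lambda>\<omega>. lstat h (cutoff j) \<omega> - trunc j n \<omega>)\<bar>" for \<omega>
      unfolding e_def using bT[of \<omega>] bX[of \<omega>] by linarith
  qed measurable
  have dec: "logstat \<omega> - Z \<omega> = (logstat \<omega> - apx j \<omega>) - e \<omega>" for \<omega>
    using apx_basic(4) trunc_integrable by (simp add: Z_def e_def apx_def)
  have le: "(x - y)\<^sup>2 \<le> 2 * x\<^sup>2 + 2 * y\<^sup>2" for x y :: real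
    using zero_le_power2[of "x + y"] by (simp add: power2_eq_square algebra_simps)
  have i: "integrable M (\<lambda>\<omega>. 2 * (logstat \<omega> - apx j \<omega>)\<^sup>2 + 2 * (e \<omega>)\<^sup>2)"
    using logstat_apx(1)[of j] e2 by auto
  have LZ: "integrable M (\<lambda>\<omega>. (logstat \<omega> - Z \<omega>)\<^sup>2)"
    by (rule Bochner_Integration.integrable_bound[OF i])
       (use le in \<open>auto simp: dec intro: order_trans[OF _ abs_ge_self]\<close>)
  have "expectation (\<lambda>\<omega>. (logstat \<omega> - Z \<omega>)\<^sup>2) \<le> expectation (\<lambda>\<omega>. 2 * (logstat \<omega> - apx j \<omega>)\<^sup>2 + 2 * (e \<omega>)\<^sup>2)"
    using LZ i le by (intro integral_mono) (auto simp: dec)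
  also have "\<dots> = 2 * expectation (\<lambda>\<omega>. (logstat \<omega> - apx j \<omega>)\<^sup>2) + 2 * expectation (\<lambda>\<omega>. (e \<omega>)\<^sup>2)"
    using logstat_apx(1)[of j] e2 by simp
  also have "\<dots> \<le> 2 * (scale * (decay_tail j)\<^sup>2) + 2 * (scale * (cut_mass_sqrt j * gauss_tail (real n))\<^sup>2)"
    using logstat_apx(2)[of j] trunc_error[of j n] unfolding e_def by linarith
  finally have 1: "expectation (\<lambda>\<omega>. (logstat \<omega> - Z \<omega>)\<^sup>2)
      \<le> 2 * (H\<^sup>2 * measure lborel D * \<kappa>) * ((decay_tail j)\<^sup>2 + (cut_mass_sqrt j * gauss_tail (real n))\<^sup>2)"
    by (simp add: scale_def algebra_simps)
  have 2: "norm (expectation (\<lambda>\<omega>. iexp (s * Z \<omega>)) - of_real (exp (- s\<^sup>2 * expectation (\<lambda>\<omega>. (Z \<omega>)\<^sup>2) / 2)))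
      \<le> char_error j n H (measure lborel D) \<kappa> s" for s
  proof -
    have "s * Z \<omega> = (- s) * (trunc j n \<omega> - expectation (trunc j n))" for \<omega> by (simp add: Z_def algebra_simps)
    then have f: "(\<lambda>\<omega>. iexp (s * Z \<omega>)) = (\<lambda>\<omega>. iexp ((- s) * (trunc j n \<omega> - expectation (trunc j n))))"
      by (simp only:)
    show ?thesis
      using trunc_char[of "- s" j n] unfolding f EZ char_error_def Let_def power2_minus abs_minus_cancel .
  qed
  show ?thesis by (intro exI[of _ Z] conjI allI Zm Z2 LZ 1 2)
qed

end

section \<open>Asymptotics in the intensity\<close>

lemma nn_integral_gaussian_shift:
  fixes z :: "'v :: euclidean_space"
  assumes c: "0 < c"
  shows "(\<integral>\<^sup>+ w. ennreal (exp (- c * (norm (z - w))\<^sup>2)) \<partial>lborel) = ennreal (sqrt (pi / c) ^ DIM('v))"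
proof -
  have 1: "has_bochner_integral lborel (\<lambda>x. exp (- c * (x - m)\<^sup>2)) (sqrt (pi / c))" for m :: real
  proof -
    have "has_bochner_integral lborel (\<lambda>x. exp (- c * x\<^sup>2 + 2 * (c * m) * x) * exp (- c * m\<^sup>2))
        (sqrt (pi / c) * exp ((c * m)\<^sup>2 / c) * exp (- c * m\<^sup>2))"
      using gaussian_integral_real[OF c, of "c * m"] by (rule has_bochner_integral_mult_left)
    moreover have "exp (- c * x\<^sup>2 + 2 * (c * m) * x) * exp (- c * m\<^sup>2) = exp (- c * (x - m)\<^sup>2)" for x
      unfolding exp_add[symmetric] by (simp add: power2_eq_square algebra_simps)
    moreover have "exp ((c * m)\<^sup>2 / c) * exp (- c * m\<^sup>2) = 1"
      unfolding exp_add[symmetric] using c by (simp add: power2_eq_square)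
    ultimately show ?thesis by (simp add: mult.assoc)
  qed
  have "exp (- c * (norm (z - w))\<^sup>2) = (\<Prod>b\<in>Basis. exp (- c * (w \<bullet> b - z \<bullet> b)\<^sup>2))" for w
  proof -
    have "(norm (z - w))\<^sup>2 = (\<Sum>b\<in>Basis. (w \<bullet> b - z \<bullet> b)\<^sup>2)"
      unfolding norm_minus_commute[of z w] power2_norm_eq_inner euclidean_inner[of "w - z" "w - z"]
      by (simp add: inner_diff_left power2_eq_square)
    then show ?thesis by (simp add: exp_sum sum_distrib_left)
  qed
  then have "(\<integral>\<^sup>+ w. ennreal (exp (- c * (norm (z - w))\<^sup>2)) \<partial>lborel) = (\<integral>\<^sup>+ w. (\<Prod>b\<in>Basis. ennreal (exp (- c * (w \<bullet> b - z \<bullet> b)\<^sup>2))) \<partial>lborel)"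
    by (simp add: prod_ennreal)
  also have "\<dots> = (\<Prod>b\<in>Basis. (\<integral>\<^sup>+ x. ennreal (exp (- c * (x - z \<bullet> b)\<^sup>2)) \<partial>lborel))"
    by (rule nn_integral_lborel_prod) auto
  also have "\<dots> = (\<Prod>b\<in>(Basis :: 'v set). ennreal (sqrt (pi / c)))"
    using 1 by (intro prod.cong refl) (subst nn_integral_eq_integral, auto simp: has_bochner_integral_iff)
  also have "\<dots> = ennreal (sqrt (pi / c) ^ DIM('v))"
    using c by (simp add: ennreal_power)
  finally show ?thesis .
qed

lemma ball_proj_measurable: "(ball_proj :: complex ^ 'n :: finite \<Rightarrow> complex ^ 'n) \<in> borel_measurable borel"
  unfolding ball_proj_def[abs_def] by (rule measurable_If) (auto intro!: borel_measurable_const)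

lemma ball_proj_nth_measurable: "(\<lambda>z. (ball_proj z :: complex ^ 'n :: finite) $ j) \<in> borel_measurable borel"
  by (rule measurable_compose[OF ball_proj_measurable]) (intro borel_measurable_continuous_onI continuous_intros)

locale hyperbolic_field = gaussian_coefficients M a for M :: "'w measure" and a :: "('n :: finite \<Rightarrow> nat) \<Rightarrow> 'w \<Rightarrow> complex"
begin

definition nfield :: "real \<Rightarrow> complex ^ 'n \<Rightarrow> 'w \<Rightarrow> complex" where
  "nfield L z \<omega> = series (evec L z) \<omega>"

lemma evec_measurable [measurable]: "(\<lambda>z. evec L z \<alpha>) \<in> borel_measurable borel"
proof -
  note [measurable] = ball_proj_measurable ball_proj_nth_measurable
  show ?thesis unfolding evec_def by measurable
qed

lemma nfield_gaussian_field:
  assumes L: "0 < L"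
  shows "gaussian_field M (nfield L) (corr L)"
proof (intro gaussian_field.intro gaussian_field_axioms.intro)
  show "prob_space M" by (rule prob_space_axioms)
  show "(\<lambda>(z, \<omega>). nfield L z \<omega>) \<in> borel_measurable (borel \<Otimes>\<^sub>M M)"
    unfolding nfield_def series_def split_beta'
    by (rule borel_measurable_infsum_complex) measurable
  show "(\<lambda>z. nfield L z \<omega>) \<in> borel_measurable borel" for \<omega>
    unfolding nfield_def series_def
    by (rule borel_measurable_infsum_complex) measurable
  show "(\<lambda>(z, w). corr L z w :: complex) \<in> borel_measurable (borel \<Otimes>\<^sub>M borel)"
    unfolding corr_def split_beta'
    by (rule borel_measurable_infsum_complex) measurable
  show "corr L z z = 1" for z :: "complex ^ 'n" by (rule corr_self[OF L])
  show "corr L w z = cnj (corr L z w)" for z w :: "complex ^ 'n"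
    unfolding corr_def by (simp add: mult.commute flip: infsum_cnj)
  show "expectation (\<lambda>\<omega>. iexp (Re (\<Sum>(c, z)\<leftarrow>ts. c * nfield L z \<omega>)))
      = of_real (exp (- Re (\<Sum>(c, z)\<leftarrow>ts. \<Sum>(c', z')\<leftarrow>ts. c * cnj c' * corr L z z') / 4))" for ts
    using char_series_combination[of "map (\<lambda>(c, z). (c, evec L z)) ts"] evec_abs_summable[OF L]
    by (auto simp: comp_def split_beta' nfield_def corr_def)
qed

text \<open>The correlation is dominated by a Gaussian of rate
  \<open>L * (1 - r\<^sup>2) / 8\<close>, whose integral over the whole space is explicit. The
  exponent is the real dimension, twice the complex one.\<close>

lemma corr_integral_le:
  fixes z :: "complex ^ 'n"
  assumes L: "0 < L" and r: "0 \<le> r" "r < 1" and z: "norm z \<le> r"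
  shows "(\<integral>w. indicator (cball 0 r) w * norm (corr L z w) \<partial>lborel)
    \<le> sqrt (8 * pi / (1 - r\<^sup>2)) ^ DIM(complex ^ 'n) * (1 / sqrt L) ^ DIM(complex ^ 'n)"
proof -
  interpret gaussian_field M "nfield L" "corr L" by (rule nfield_gaussian_field[OF L])
  define c where "c = L * (1 - r\<^sup>2) / 8"
  have r2: "r\<^sup>2 < 1" using r by (simp add: abs_square_less_1)
  have c: "0 < c" using L r2 by (simp add: c_def)
  have "integrable lborel (\<lambda>w. indicator (cball 0 r) w * norm (corr L z w))"
  proof (rule Bochner_Integration.integrable_bound[of _ "indicator (cball 0 r) :: complex ^ 'n \<Rightarrow> real"])
    show "integrable lborel (indicator (cball 0 r) :: complex ^ 'n \<Rightarrow> real)"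
      by (intro integrable_real_indicator emeasure_bounded_finite) auto
    show "(\<lambda>w. indicator (cball 0 r) w * norm (corr L z w)) \<in> borel_measurable lborel"
      by (intro borel_measurable_times borel_measurable_indicator borel_measurable_norm) (auto intro: \<rho>_meas)
  qed (use norm_\<rho>_le_1 in \<open>auto split: split_indicator\<close>)
  then have "ennreal (\<integral>w. indicator (cball 0 r) w * norm (corr L z w) \<partial>lborel)
      = (\<integral>\<^sup>+ w. ennreal (indicator (cball 0 r) w * norm (corr L z w)) \<partial>lborel)"
    by (subst nn_integral_eq_integral) auto
  also have "\<dots> \<le> (\<integral>\<^sup>+ w. ennreal (exp (- c * (norm (z - w))\<^sup>2)) \<partial>lborel)"
    using norm_corr_le[OF L z _ r(2)] by (intro nn_integral_mono) (auto simp: c_def intro!: ennreal_leI split: split_indicator)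
  also have "\<dots> = ennreal (sqrt (pi / c) ^ DIM(complex ^ 'n))" by (rule nn_integral_gaussian_shift[OF c])
  finally have "(\<integral>w. indicator (cball 0 r) w * norm (corr L z w) \<partial>lborel) \<le> sqrt (pi / c) ^ DIM(complex ^ 'n)"
    using c by (subst (asm) ennreal_le_iff) auto
  also have "pi / c = (8 * pi / (1 - r\<^sup>2)) * (1 / L)" using L r2 by (simp add: c_def field_simps)
  also have "sqrt \<dots> = sqrt (8 * pi / (1 - r\<^sup>2)) * (1 / sqrt L)" by (simp add: real_sqrt_mult real_sqrt_divide)
  finally show ?thesis by (simp only: power_mult_distrib)
qed

text \<open>Only a ball of radius of order \<open>1 / sqrt L\<close> around \<open>z\<close> is
  used: on it the squared correlation is at least \<open>exp (- 1)\<close>, and its volume has the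
  order of the upper bound in \<open>corr_integral_le\<close>.\<close>

lemma corr_integral_ge:
  fixes z :: "complex ^ 'n"
  assumes L: "1 \<le> L" and r: "0 \<le> r" "r < 1" and B2 [measurable]: "B2 \<in> sets borel" and B2r: "B2 \<subseteq> cball 0 r" and z: "norm z \<le> r"
    and ball: "ball z ((1 - r\<^sup>2) / sqrt 2 * (1 / sqrt L)) \<subseteq> B2"
  shows "exp (- 1) * (unit_ball_vol (DIM(complex ^ 'n)) * ((1 - r\<^sup>2) / sqrt 2) ^ DIM(complex ^ 'n)) * (1 / sqrt L) ^ DIM(complex ^ 'n)
    \<le> (\<integral>w. indicator B2 w * (norm (corr L z w))\<^sup>2 \<partial>lborel)"
proof -
  have L0: "0 < L" using L by simp
  interpret gaussian_field M "nfield L" "corr L" by (rule nfield_gaussian_field[OF L0])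
  define R where "R = (1 - r\<^sup>2) / sqrt 2 * (1 / sqrt L)"
  have r2: "r\<^sup>2 < 1" using r by (simp add: abs_square_less_1)
  have R: "0 \<le> R" using r2 L by (simp add: R_def)
  have fin: "integrable lborel (indicator (cball 0 r) :: complex ^ 'n \<Rightarrow> real)"
    by (intro integrable_real_indicator emeasure_bounded_finite) auto
  have "exp (- 1) * (unit_ball_vol (DIM(complex ^ 'n)) * R ^ DIM(complex ^ 'n)) = (\<integral>w. exp (- 1) * indicator (ball z R) w \<partial>lborel)"
    using content_ball[OF R, of z] by simp
  also have "\<dots> \<le> (\<integral>w. indicator B2 w * (norm (corr L z w))\<^sup>2 \<partial>lborel)"
  proof (rule integral_mono)
    show "integrable lborel (\<lambda>w. exp (- 1) * indicator (ball z R) w :: real)"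
      by (intro integrable_mult_right integrable_real_indicator emeasure_bounded_finite) auto
    show "integrable lborel (\<lambda>w. indicator B2 w * (norm (corr L z w))\<^sup>2)"
    proof (rule Bochner_Integration.integrable_bound[OF fin])
      show "(\<lambda>w. indicator B2 w * (norm (corr L z w))\<^sup>2) \<in> borel_measurable lborel"
        by (intro borel_measurable_times borel_measurable_indicator borel_measurable_power borel_measurable_norm) (auto intro: \<rho>_meas)
      show "AE w in lborel. norm (indicator B2 w * (norm (corr L z w))\<^sup>2) \<le> norm (indicator (cball 0 r) w :: real)"
      proof (intro AE_I2)
        fix w
        show "norm (indicator B2 w * (norm (corr L z w))\<^sup>2) \<le> norm (indicator (cball 0 r) w :: real)"
          using B2r norm_\<rho>_le_1[of z w] by (cases "w \<in> B2") (auto simp: power_le_one)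
      qed
    qed
    fix w
    show "exp (- 1) * indicator (ball z R) w \<le> indicator B2 w * (norm (corr L z w))\<^sup>2"
    proof (cases "w \<in> ball z R")
      case True
      then have wB: "w \<in> B2" using ball by (auto simp: R_def)
      have "(norm (z - w))\<^sup>2 \<le> R\<^sup>2" using True by (intro power_mono) (auto simp: dist_norm)
      also have "\<dots> = (1 - r\<^sup>2)\<^sup>2 / (2 * L)" using L by (simp add: R_def power_mult_distrib power_divide)
      finally have "exp (- 1) \<le> (norm (corr L z w))\<^sup>2"
        using wB B2r by (intro norm_corr_ge[OF L z _ r(2)]) auto
      then show ?thesis using True wB by simp
    qed simp
  qed
  finally show ?thesis by (simp only: R_def power_mult_distrib mult.assoc)
qed

end

lemma power_times_exp_tendsto_0:
  fixes e :: real
  assumes e: "0 < e"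
  shows "((\<lambda>x. x ^ k * exp (- (e * x))) \<longlongrightarrow> 0) at_top"
proof -
  have "((\<lambda>x. (e * x) ^ k / exp (e * x)) \<longlongrightarrow> 0) at_top"
    by (rule filterlim_compose[OF tendsto_power_div_exp_0 filterlim_tendsto_pos_mult_at_top[OF tendsto_const e filterlim_ident]])
  then have "((\<lambda>x. (1 / e ^ k) * ((e * x) ^ k / exp (e * x))) \<longlongrightarrow> (1 / e ^ k) * 0) at_top"
    by (intro tendsto_mult tendsto_const)
  moreover have "(1 / e ^ k) * ((e * x) ^ k / exp (e * x)) = x ^ k * exp (- (e * x))" for x
    using e by (simp add: power_mult_distrib exp_minus divide_inverse)
  ultimately show ?thesis by simp
qed

lemma low_constant_pos: "0 < (\<integral>t. indicator {1..2 :: real} t / (1 + t)\<^sup>2 \<partial>lborel)\<^sup>2"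
proof -
  have "(1 / 9 :: real) = (\<integral>t. indicator {1..2 :: real} t * (1 / 9) \<partial>lborel)" by simp
  also have "\<dots> \<le> (\<integral>t. indicator {1..2 :: real} t / (1 + t)\<^sup>2 \<partial>lborel)"
  proof (rule integral_mono)
    show i: "integrable lborel (\<lambda>t. indicator {1..2 :: real} t * (1 / 9) :: real)" by simp
    have 1: "indicator {1..2 :: real} t / (1 + t)\<^sup>2 \<le> (1 :: real)" for t
      by (auto split: split_indicator simp: divide_le_eq)
    show "integrable lborel (\<lambda>t. indicator {1..2 :: real} t / (1 + t)\<^sup>2)"
    proof (rule Bochner_Integration.integrable_bound[of _ "indicator {1..2 :: real} :: real \<Rightarrow> real"])
      show "AE t in lborel. norm (indicator {1..2 :: real} t / (1 + t)\<^sup>2) \<le> norm (indicator {1..2 :: real} t :: real)"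
        using 1 by (intro AE_I2) (auto split: split_indicator simp: divide_le_eq)
    qed auto
    fix t :: real
    show "indicator {1..2 :: real} t * (1 / 9) \<le> indicator {1..2 :: real} t / (1 + t)\<^sup>2"
    proof (cases "t \<in> {1..2}")
      case True
      then have "(1 + t)\<^sup>2 \<le> 3\<^sup>2" by (intro power_mono) auto
      then show ?thesis using True by (simp add: field_simps)
    qed simp
  qed
  finally show ?thesis by (intro zero_less_power) linarith
qed

context hyperbolic_field
begin

text \<open>As the real dimension is \<open>2 * CARD('n)\<close>, this is \<open>L\<close> to the
  power \<open>- CARD('n)\<close> for positive \<open>L\<close>, the order of the variance.\<close>

definition rate :: "real \<Rightarrow> real" where
  "rate L = (1 / sqrt L) ^ DIM(complex ^ 'n)"

definition rate_factor :: "real \<Rightarrow> real" where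
  "rate_factor r = sqrt (8 * pi / (1 - r\<^sup>2)) ^ DIM(complex ^ 'n)"

lemma rate_pos: "0 < L \<Longrightarrow> 0 < rate L" by (simp add: rate_def)

lemma rate_tendsto: "(rate \<longlongrightarrow> 0) at_top"
proof -
  have "((\<lambda>L. inverse (sqrt L)) \<longlongrightarrow> 0) at_top"
    by (rule filterlim_compose[OF tendsto_inverse_0_at_top sqrt_at_top]) (rule filterlim_ident)
  then have "((\<lambda>L. inverse (sqrt L) ^ DIM(complex ^ 'n)) \<longlongrightarrow> 0 ^ DIM(complex ^ 'n)) at_top" by (rule tendsto_power)
  moreover have "(0 :: real) ^ DIM(complex ^ 'n) = 0" by (simp add: zero_power DIM_positive)
  ultimately show ?thesis by (simp only: rate_def[abs_def] inverse_eq_divide)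
qed

lemma rate_factor_nonneg: "0 \<le> r \<Longrightarrow> r < 1 \<Longrightarrow> 0 \<le> rate_factor r"
  unfolding rate_factor_def by (intro zero_le_power real_sqrt_ge_zero divide_nonneg_nonneg) (auto simp: abs_square_le_1)

lemma statistic:
  fixes h :: "complex ^ 'n \<Rightarrow> real"
  assumes L: "0 < L" and r: "0 \<le> r" "r < 1" and h: "h \<in> borel_measurable borel" "\<And>z. \<bar>h z\<bar> \<le> H" "\<And>z. h z \<noteq> 0 \<Longrightarrow> norm z \<le> r"
  shows "gaussian_statistic M (nfield L) (corr L) h (cball 0 r) H (rate_factor r * rate L)"
proof (intro gaussian_statistic.intro gaussian_statistic_axioms.intro nfield_gaussian_field[OF L])
  show "emeasure lborel (cball 0 r :: (complex ^ 'n) set) < \<infinity>" by (intro emeasure_bounded_finite) auto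
  show "0 \<le> rate_factor r * rate L" using rate_factor_nonneg[OF r] rate_pos[OF L] by simp
  show "(\<integral>w. indicator (cball 0 r) w * norm (corr L z w) \<partial>lborel) \<le> rate_factor r * rate L" if "z \<in> cball 0 r" for z :: "complex ^ 'n"
    using corr_integral_le[OF L r] that by (simp add: rate_def rate_factor_def)
qed (use h in auto)

text \<open>Two concentric balls on which \<open>h\<close> keeps its sign: points of the inner one
  have distance at least \<delta> from the complement of the outer one, so the unwanted covariances
  are exponentially small in \<open>L\<close> and lose against the contribution of order
  \<open>rate L\<close> from the outer ball.\<close>

lemma variance_rate:
  fixes h :: "complex ^ 'n \<Rightarrow> real"
  assumes r: "0 \<le> r" "r < 1" and h: "h \<in> borel_measurable borel" "\<And>z. \<bar>h z\<bar> \<le> H" "\<And>z. h z \<noteq> 0 \<Longrightarrow> norm z \<le> r"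
    and \<delta>: "0 < \<delta>" "ball z0 (2 * \<delta>) \<subseteq> cball 0 r"
    and \<eta>: "0 < \<eta>" and \<sigma>: "\<bar>\<sigma>\<bar> = 1" "\<And>z. z \<in> ball z0 (2 * \<delta>) \<Longrightarrow> \<eta> \<le> \<sigma> * h z"
  shows "\<exists>c>0. \<forall>\<^sub>F L in at_top. c * rate L
    \<le> expectation (\<lambda>\<omega>. (\<integral>z. h z * (ln ((norm (nfield L z \<omega>))\<^sup>2) + log_const) \<partial>lborel)\<^sup>2)"
proof -
  let ?N = "DIM(complex ^ 'n)"
  define dd where "dd = (integral\<^sup>L lborel decay)\<^sup>2"
  define lowc where "lowc = (\<integral>t. indicator {1..2 :: real} t / (1 + t)\<^sup>2 \<partial>lborel)\<^sup>2"
  define mD where "mD = measure lborel (cball 0 r :: (complex ^ 'n) set)"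
  define mB where "mB = measure lborel (ball z0 \<delta> :: (complex ^ 'n) set)"
  define \<theta>0 where "\<theta>0 = exp (- 1) * (unit_ball_vol ?N * ((1 - r\<^sup>2) / sqrt 2) ^ ?N)"
  define e where "e = (1 - r\<^sup>2) / 8 * \<delta>\<^sup>2"
  define c1 where "c1 = mB * (\<eta> * lowc * \<theta>0 / 2)"
  \<comment> \<open>\<open>V * rate L\<close> bounds the variance of the test variable; the summand
    1 keeps \<open>V\<close> positive.\<close>
  define V where "V = mD * rate_factor r * dd + 1"
  have r2: "r\<^sup>2 < 1" using r by (simp add: abs_square_less_1)
  have mB: "0 < mB" unfolding mB_def using content_ball_pos[OF \<delta>(1), of z0] by simp
  have \<theta>0: "0 < \<theta>0" unfolding \<theta>0_def using r2 by (intro mult_pos_pos zero_less_power unit_ball_vol_pos) auto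
  have lowc: "0 < lowc" unfolding lowc_def by (rule low_constant_pos)
  have e: "0 < e" unfolding e_def using r2 \<delta> by (intro mult_pos_pos) auto
  have c1: "0 < c1" unfolding c1_def using mB \<eta> lowc \<theta>0 by (intro mult_pos_pos) auto
  have dd: "0 \<le> dd" by (simp add: dd_def)
  have mD: "0 \<le> mD" by (simp add: mD_def)
  have V: "0 < V" unfolding V_def using mD rate_factor_nonneg[OF r] dd by (intro add_nonneg_pos mult_nonneg_nonneg) auto
  have H: "0 \<le> H" using h(2)[of undefined] by linarith
  have "((\<lambda>L. H * dd * mD * (L ^ ?N * exp (- (e * L)))) \<longlongrightarrow> H * dd * mD * 0) at_top"
    by (intro tendsto_mult[OF tendsto_const] power_times_exp_tendsto_0[OF e])
  then have ev1: "\<forall>\<^sub>F L in at_top. H * dd * mD * (L ^ ?N * exp (- (e * L))) < \<eta> * lowc * \<theta>0 / 2"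
    using \<eta> lowc \<theta>0 by (intro order_tendstoD(2)[where a = "\<eta> * lowc * \<theta>0 / 2"]) auto
  have ev2: "\<forall>\<^sub>F L in at_top. (1 :: real) \<le> L" by (rule eventually_ge_at_top)
  have "((\<lambda>L. inverse (sqrt L)) \<longlongrightarrow> 0) at_top"
    by (rule filterlim_compose[OF tendsto_inverse_0_at_top sqrt_at_top]) (rule filterlim_ident)
  then have "((\<lambda>L. (1 - r\<^sup>2) / sqrt 2 * inverse (sqrt L)) \<longlongrightarrow> (1 - r\<^sup>2) / sqrt 2 * 0) at_top"
    by (intro tendsto_mult[OF tendsto_const])
  then have ev3: "\<forall>\<^sub>F L in at_top. (1 - r\<^sup>2) / sqrt 2 * inverse (sqrt L) < \<delta>"
    using \<delta> by (intro order_tendstoD(2)[where a = \<delta>]) auto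
  have "\<forall>\<^sub>F L in at_top. c1\<^sup>2 / V / 2 * rate L
    \<le> expectation (\<lambda>\<omega>. (\<integral>z. h z * (ln ((norm (nfield L z \<omega>))\<^sup>2) + log_const) \<partial>lborel)\<^sup>2)"
    using ev1 ev2 ev3
  proof eventually_elim
    case (elim L)
    then have L1: "1 \<le> L" and L: "0 < L" by auto
    have small: "(1 - r\<^sup>2) / sqrt 2 * (1 / sqrt L) < \<delta>" using elim(3) by (simp add: inverse_eq_divide)
    interpret gaussian_statistic M "nfield L" "corr L" h "cball 0 r" H "rate_factor r * rate L"
      by (rule statistic[OF L r h])
    have q: "0 < rate L" by (rule rate_pos[OF L])
    \<comment> \<open>The eventual bound \<open>ev1\<close> carries the factor
      \<open>L ^ ?N\<close>; multiplying it by \<open>rate L\<close> and using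
      \<open>1 \<le> sqrt L\<close> turns it into a bound relative to \<open>rate L\<close>.\<close>
    have qL: "1 \<le> L ^ ?N * rate L"
    proof -
      have "1 \<le> L * (1 / sqrt L)" using L1 by (simp add: real_div_sqrt)
      then have "1 \<le> (L * (1 / sqrt L)) ^ ?N" by (rule one_le_power)
      then show ?thesis by (simp only: rate_def power_mult_distrib)
    qed
    define \<Lambda> where "\<Lambda> = mB * (\<eta> * lowc * (\<theta>0 * rate L) - H * dd * exp (- (e * L)) * mD)"
    have "H * dd * mD * exp (- (e * L)) * 1 \<le> H * dd * mD * exp (- (e * L)) * (L ^ ?N * rate L)"
      using H dd mD by (intro mult_left_mono[OF qL]) auto
    also have "\<dots> \<le> \<eta> * lowc * \<theta>0 / 2 * rate L"
      using mult_right_mono[OF less_imp_le[OF elim(1)] less_imp_le[OF q]] by (simp add: mult_ac)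
    finally have "H * dd * exp (- (e * L)) * mD \<le> \<eta> * lowc * \<theta>0 / 2 * rate L" by (simp add: mult_ac)
    then have "mB * (\<eta> * lowc * \<theta>0 / 2 * rate L) \<le> \<Lambda>"
      unfolding \<Lambda>_def using mB by (intro mult_left_mono) (auto simp: algebra_simps)
    then have \<Lambda>: "c1 * rate L \<le> \<Lambda>" by (simp add: c1_def mult_ac)
    have c1q: "0 \<le> c1 * rate L" using c1 q by simp
    have low: "\<Lambda>\<^sup>2 / (V * rate L) \<le> expectation (\<lambda>\<omega>. (apx j \<omega>)\<^sup>2)" if j: "1 \<le> j" for j
      unfolding \<Lambda>_def mB_def mD_def dd_def lowc_def
    proof (rule variance_lower[where ?B2.0 = "ball z0 (2 * \<delta>)" and \<sigma> = \<sigma>])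
      have "ball z0 \<delta> \<subseteq> ball z0 (2 * \<delta>)" using \<delta>(1) by (intro subset_ball) auto
      then show BD: "ball z0 \<delta> \<subseteq> cball 0 r" using \<delta>(2) by blast
      show "(norm (corr L z w))\<^sup>2 \<le> exp (- (e * L))" if z: "z \<in> ball z0 \<delta>" and w: "w \<in> cball 0 r - ball z0 (2 * \<delta>)" for z w
      proof -
        have "2 * \<delta> \<le> dist z0 w" "dist z0 z < \<delta>" using z w by auto
        then have "\<delta> \<le> norm (z - w)" using dist_triangle[of z0 w z] by (simp add: dist_norm)
        then have d: "\<delta>\<^sup>2 \<le> (norm (z - w))\<^sup>2" using \<delta> by (intro power_mono) auto
        have "norm (corr L z w) \<le> exp (- (L * (1 - r\<^sup>2) / 8) * (norm (z - w))\<^sup>2)"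
          using z w BD by (intro norm_corr_le[OF L _ _ r(2)]) auto
        also have "\<dots> \<le> exp (- (e * L))"
        proof -
          have "L * (1 - r\<^sup>2) / 8 * \<delta>\<^sup>2 \<le> L * (1 - r\<^sup>2) / 8 * (norm (z - w))\<^sup>2"
            using L r2 by (intro mult_left_mono[OF d]) auto
          then show ?thesis by (simp add: e_def mult_ac)
        qed
        finally have "norm (corr L z w) \<le> exp (- (e * L))" .
        moreover have "(norm (corr L z w))\<^sup>2 \<le> norm (corr L z w)"
          using norm_\<rho>_le_1[of z w] by (simp add: power2_eq_square mult_left_le)
        ultimately show ?thesis by linarith
      qed
      show "\<theta>0 * rate L \<le> (\<integral>w. indicator (ball z0 (2 * \<delta>)) w * (norm (corr L z w))\<^sup>2 \<partial>lborel)" if z: "z \<in> ball z0 \<delta>" for z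
        unfolding \<theta>0_def rate_def
      proof (rule corr_integral_ge[OF L1 r _ \<delta>(2)])
        show "norm z \<le> r" using z BD by auto
        have "w \<in> ball z0 (2 * \<delta>)" if "dist z w < (1 - r\<^sup>2) / sqrt 2 * (1 / sqrt L)" for w
          using that z small dist_triangle[of z0 w z] by auto
        then show "ball z ((1 - r\<^sup>2) / sqrt 2 * (1 / sqrt L)) \<subseteq> ball z0 (2 * \<delta>)" by auto
      qed simp
      show "measure lborel (cball 0 r :: (complex ^ 'n) set) * (rate_factor r * rate L) * (integral\<^sup>L lborel decay)\<^sup>2 \<le> V * rate L"
        using q unfolding V_def mD_def dd_def by (simp add: algebra_simps)
      show "0 \<le> measure lborel (ball z0 \<delta>) * (\<eta> * (\<integral>t. indicator {1..2 :: real} t / (1 + t)\<^sup>2 \<partial>lborel)\<^sup>2 * (\<theta>0 * rate L)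
          - H * (integral\<^sup>L lborel decay)\<^sup>2 * exp (- (e * L)) * measure lborel (cball 0 r :: (complex ^ 'n) set))"
        using \<Lambda> c1q unfolding \<Lambda>_def mB_def mD_def dd_def lowc_def by linarith
    qed (use \<delta> \<sigma> \<eta> j V q in auto)
    have "c1\<^sup>2 / V * rate L = (c1 * rate L)\<^sup>2 / (V * rate L)" using q by (simp add: power2_eq_square)
    also have "\<dots> \<le> \<Lambda>\<^sup>2 / (V * rate L)"
      using \<Lambda> c1q V q by (intro divide_right_mono power_mono) auto
    finally have "c1\<^sup>2 / V * rate L / 2 \<le> expectation (\<lambda>\<omega>. (logstat \<omega>)\<^sup>2)"
      using low by (intro logstat_lower) (blast intro: order_trans)
    then show ?case unfolding logstat_def by simp
  qed
  moreover have "0 < c1\<^sup>2 / V / 2" using c1 V by simp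
  ultimately show ?thesis by blast
qed

text \<open>The bounds for the approximation errors and the lower bound for the variance are
  multiples of the same \<open>rate (L k)\<close>, so the relative error of an approximant is
  controlled by the truncation alone. That dictates the order of choices: \<epsilon>, then
  \<open>j\<close>, then \<open>n\<close>, then \<open>k\<close>.\<close>

theorem logstat_clt:
  fixes h :: "complex ^ 'n \<Rightarrow> real" and L :: "nat \<Rightarrow> real"
  assumes h: "continuous_on UNIV h" and r0: "r0 < 1" and supp: "\<And>z. h z \<noteq> 0 \<Longrightarrow> norm z \<le> r0" and nz: "h z0 \<noteq> 0"
    and L: "\<And>k. 0 < L k" "filterlim L at_top sequentially"
  defines "X \<equiv> \<lambda>k \<omega>. \<integral>z. h z * (ln ((norm (nfield (L k) z \<omega>))\<^sup>2) + log_const) \<partial>lborel"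
  shows "(\<lambda>k. expectation (\<lambda>\<omega>. iexp (t / sqrt (expectation (\<lambda>\<omega>. (X k \<omega>)\<^sup>2)) * X k \<omega>))) \<longlonglongrightarrow> of_real (exp (- t\<^sup>2 / 2))"
    and "\<And>k. \<exists>r H \<kappa>. gaussian_statistic M (nfield (L k)) (corr (L k)) h (cball 0 r) H \<kappa>"
proof -
  have r0_nonneg: "0 \<le> r0" using supp[OF nz] norm_ge_zero[of z0] by linarith
  \<comment> \<open>A radius strictly between \<open>r0\<close> and 1 leaves room for a ball around
    \<open>z0\<close> inside \<open>cball 0 r\<close>, even when
    \<open>norm z0 = r0\<close>.\<close>
  define r where "r = (r0 + 1) / 2"
  have r: "0 \<le> r" "r < 1" "r0 < r" using r0 r0_nonneg by (auto simp: r_def)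
  have hm: "h \<in> borel_measurable borel" by (rule borel_measurable_continuous_onI[OF h])
  have suppr: "norm z \<le> r" if "h z \<noteq> 0" for z using supp[OF that] r by linarith
  have "compact (h ` cball 0 r)" by (intro compact_continuous_image continuous_on_subset[OF h] compact_cball) auto
  then obtain H where H: "\<And>z. z \<in> cball 0 r \<Longrightarrow> \<bar>h z\<bar> \<le> H"
    using compact_imp_bounded[of "h ` cball 0 r"] unfolding bounded_iff by fastforce
  have "\<bar>h 0\<bar> \<le> H" using r by (intro H) auto
  then have H0: "0 \<le> H" by linarith
  have H: "\<bar>h z\<bar> \<le> H" for z using H[of z] suppr[of z] H0 by (cases "h z = 0") auto
  have st: "gaussian_statistic M (nfield (L k)) (corr (L k)) h (cball 0 r) H (rate_factor r * rate (L k))" for k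
    by (rule statistic[OF L(1) r(1,2) hm H suppr])
  show "\<exists>r H \<kappa>. gaussian_statistic M (nfield (L k)) (corr (L k)) h (cball 0 r) H \<kappa>" for k
    using st by blast
  have "isCont h z0" using h by (simp add: continuous_on_eq_continuous_at)
  then obtain d where d: "0 < d" "\<And>z. dist z z0 < d \<Longrightarrow> dist (h z) (h z0) < \<bar>h z0\<bar> / 2"
    using nz unfolding continuous_at_eps_delta by (metis half_gt_zero zero_less_abs_iff)
  \<comment> \<open>\<open>2 * \<delta> \<le> d\<close> keeps the sign of \<open>h\<close> and a
    size of at least half of \<open>\<bar>h z0\<bar>\<close>;
    \<open>2 * \<delta> \<le> r - r0\<close> keeps the ball inside \<open>cball 0 r\<close>.\<close>
  define \<delta> where "\<delta> = min d (r - r0) / 2"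
  have \<delta>: "0 < \<delta>" "2 * \<delta> \<le> d" "2 * \<delta> \<le> r - r0" using d r by (auto simp: \<delta>_def)
  obtain c3 where c3: "0 < c3" and low: "\<forall>\<^sub>F L in at_top. c3 * rate L
    \<le> expectation (\<lambda>\<omega>. (\<integral>z. h z * (ln ((norm (nfield L z \<omega>))\<^sup>2) + log_const) \<partial>lborel)\<^sup>2)"
  proof -
    have "\<exists>c>0. \<forall>\<^sub>F L in at_top. c * rate L
      \<le> expectation (\<lambda>\<omega>. (\<integral>z. h z * (ln ((norm (nfield L z \<omega>))\<^sup>2) + log_const) \<partial>lborel)\<^sup>2)"
    proof (rule variance_rate[OF r(1,2) hm H suppr \<delta>(1), where \<eta> = "\<bar>h z0\<bar> / 2" and \<sigma> = "sgn (h z0)" and ?z0.0 = z0])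
      have "norm z \<le> r" if "dist z0 z < 2 * \<delta>" for z
        using that \<delta>(3) supp[OF nz] norm_triangle_ineq4[of z0 "z0 - z"] by (simp add: dist_norm)
      then show "ball z0 (2 * \<delta>) \<subseteq> cball 0 r" by auto
      show "\<bar>h z0\<bar> / 2 \<le> sgn (h z0) * h z" if "z \<in> ball z0 (2 * \<delta>)" for z
      proof -
        have "\<bar>h z - h z0\<bar> < \<bar>h z0\<bar> / 2" using d(2)[of z] that \<delta>(2) by (auto simp: dist_commute[of z] dist_real_def)
        then show ?thesis using nz by (auto simp: sgn_real_def abs_if split: if_splits)
      qed
    qed (use nz in \<open>auto simp: sgn_real_def\<close>)
    then show ?thesis using that by blast
  qed
  define q where "q k = rate (L k)" for k
  have q: "0 < q k" for k using rate_pos[OF L(1)] by (simp add: q_def)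
  have q0: "q \<longlonglongrightarrow> 0" unfolding q_def by (rule filterlim_compose[OF rate_tendsto L(2)])
  have lowk: "\<forall>\<^sub>F k in sequentially. c3 * q k \<le> expectation (\<lambda>\<omega>. (X k \<omega>)\<^sup>2)"
    using filterlim_iff[THEN iffD1, OF L(2), rule_format, OF low] unfolding q_def X_def .
  have X: "X k = gaussian_statistic.logstat (nfield (L k)) h" for k
    unfolding X_def by (intro ext) (rule gaussian_statistic.logstat_def[OF st[of k], symmetric])
  have Xm: "X k \<in> borel_measurable M" "integrable M (\<lambda>\<omega>. (X k \<omega>)\<^sup>2)" for k
    unfolding X by (rule gaussian_statistic.logstat_measurable[OF st] gaussian_statistic.logstat_square_integrable[OF st])+
  define mD where "mD = measure lborel (cball 0 r :: (complex ^ 'n) set)"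
  \<comment> \<open>The ratio of the upper error constant to the lower variance constant; the common
    factor \<open>q k\<close> has cancelled.\<close>
  define C where "C = 2 * (H\<^sup>2 * mD * rate_factor r) / c3"
  have C: "0 \<le> C" unfolding C_def mD_def using c3 rate_factor_nonneg[OF r(1,2)] by (intro divide_nonneg_pos mult_nonneg_nonneg) auto
  show "(\<lambda>k. expectation (\<lambda>\<omega>. iexp (t / sqrt (expectation (\<lambda>\<omega>. (X k \<omega>)\<^sup>2)) * X k \<omega>))) \<longlonglongrightarrow> of_real (exp (- t\<^sup>2 / 2))"
  proof (rule clt_criterion)
    show "\<forall>\<^sub>F k in sequentially. 0 < sqrt (expectation (\<lambda>\<omega>. (X k \<omega>)\<^sup>2))"
      using lowk by eventually_elim (use q c3 in \<open>auto intro: less_le_trans[OF mult_pos_pos]\<close>)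
    fix \<epsilon> :: real assume \<epsilon>: "0 < \<epsilon>"
    have "(\<lambda>j. C * (decay_tail j)\<^sup>2) \<longlonglongrightarrow> C * 0\<^sup>2"
      by (intro tendsto_mult[OF tendsto_const] tendsto_power decay_tail_tendsto)
    then have "\<forall>\<^sub>F j in sequentially. C * (decay_tail j)\<^sup>2 < \<epsilon>\<^sup>2 / 2"
      using \<epsilon> by (intro order_tendstoD(2)[where a = "\<epsilon>\<^sup>2 / 2"]) auto
    then obtain j where j: "C * (decay_tail j)\<^sup>2 < \<epsilon>\<^sup>2 / 2" by (auto simp: eventually_sequentially)
    \<comment> \<open>\<open>cut_mass_sqrt j\<close> grows without bound in \<open>j\<close>, so
      \<open>n\<close> has to be chosen depending on \<open>j\<close>.\<close>
    have "(\<lambda>n. C * (cut_mass_sqrt j * gauss_tail (real n))\<^sup>2) \<longlonglongrightarrow> C * (cut_mass_sqrt j * 0)\<^sup>2"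
      by (intro tendsto_mult[OF tendsto_const] tendsto_power gauss_tail_tendsto)
    then have "\<forall>\<^sub>F n in sequentially. C * (cut_mass_sqrt j * gauss_tail (real n))\<^sup>2 < \<epsilon>\<^sup>2 / 2"
      using \<epsilon> by (intro order_tendstoD(2)[where a = "\<epsilon>\<^sup>2 / 2"]) auto
    then obtain n where n: "C * (cut_mass_sqrt j * gauss_tail (real n))\<^sup>2 < \<epsilon>\<^sup>2 / 2" by (auto simp: eventually_sequentially)
    have "\<exists>Z. \<forall>k. Z k \<in> borel_measurable M \<and> integrable M (\<lambda>\<omega>. (Z k \<omega>)\<^sup>2) \<and>
      integrable M (\<lambda>\<omega>. (X k \<omega> - Z k \<omega>)\<^sup>2) \<and>
      expectation (\<lambda>\<omega>. (X k \<omega> - Z k \<omega>)\<^sup>2)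
        \<le> 2 * (H\<^sup>2 * mD * (rate_factor r * q k)) * ((decay_tail j)\<^sup>2 + (cut_mass_sqrt j * gauss_tail (real n))\<^sup>2) \<and>
      (\<forall>s. norm (expectation (\<lambda>\<omega>. iexp (s * Z k \<omega>)) - of_real (exp (- s\<^sup>2 * expectation (\<lambda>\<omega>. (Z k \<omega>)\<^sup>2) / 2)))
        \<le> char_error j n H mD (rate_factor r * q k) s)"
      unfolding X mD_def q_def using gaussian_statistic.approximant[OF st] by (intro choice allI)
    then obtain Z where Z: "\<And>k. Z k \<in> borel_measurable M" "\<And>k. integrable M (\<lambda>\<omega>. (Z k \<omega>)\<^sup>2)"
      "\<And>k. integrable M (\<lambda>\<omega>. (X k \<omega> - Z k \<omega>)\<^sup>2)"
      "\<And>k. expectation (\<lambda>\<omega>. (X k \<omega> - Z k \<omega>)\<^sup>2)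
        \<le> 2 * (H\<^sup>2 * mD * (rate_factor r * q k)) * ((decay_tail j)\<^sup>2 + (cut_mass_sqrt j * gauss_tail (real n))\<^sup>2)"
      "\<And>k s. norm (expectation (\<lambda>\<omega>. iexp (s * Z k \<omega>)) - of_real (exp (- s\<^sup>2 * expectation (\<lambda>\<omega>. (Z k \<omega>)\<^sup>2) / 2)))
        \<le> char_error j n H mD (rate_factor r * q k) s"
      by blast
    define s where "s k = sqrt (expectation (\<lambda>\<omega>. (X k \<omega>)\<^sup>2))" for k
    have s2: "(s k)\<^sup>2 = expectation (\<lambda>\<omega>. (X k \<omega>)\<^sup>2)" for k by (simp add: s_def)
    have close: "\<forall>\<^sub>F k in sequentially. integrable M (\<lambda>\<omega>. (X k \<omega> - Z k \<omega>)\<^sup>2) \<and> expectation (\<lambda>\<omega>. (X k \<omega> - Z k \<omega>)\<^sup>2) \<le> \<epsilon>\<^sup>2 * (s k)\<^sup>2"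
      using lowk
    proof eventually_elim
      case (elim k)
      have "expectation (\<lambda>\<omega>. (X k \<omega> - Z k \<omega>)\<^sup>2) \<le> c3 * q k * (C * (decay_tail j)\<^sup>2 + C * (cut_mass_sqrt j * gauss_tail (real n))\<^sup>2)"
      proof -
        have "2 * (H\<^sup>2 * mD * (rate_factor r * q k)) * (x + y) = c3 * q k * (C * x + C * y)" for x y
          using c3 by (simp add: C_def field_simps)
        then show ?thesis using Z(4)[of k] by (simp only:)
      qed
      also have "\<dots> \<le> c3 * q k * \<epsilon>\<^sup>2"
        using j n c3 q[of k] by (intro mult_left_mono) auto
      also have "\<dots> \<le> \<epsilon>\<^sup>2 * (s k)\<^sup>2" using mult_left_mono[OF elim zero_le_power2[of \<epsilon>]] by (simp add: s2 mult.commute)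
      finally show ?case using Z(3) by blast
    qed
    have "(\<lambda>k. char_error j n H mD (rate_factor r * q k) (t / s k)) \<longlonglongrightarrow> 0"
    proof (rule char_error_tendsto[where c = "(\<bar>t\<bar> + 1) / sqrt c3"])
      show "\<forall>\<^sub>F k in sequentially. \<bar>t / s k\<bar> \<le> (\<bar>t\<bar> + 1) / sqrt c3 / sqrt (q k)"
        using lowk
      proof eventually_elim
        case (elim k)
        have "sqrt c3 * sqrt (q k) \<le> s k" unfolding s_def real_sqrt_mult[symmetric] using elim by simp
        moreover have "0 < sqrt c3 * sqrt (q k)" using c3 q by simp
        ultimately have "\<bar>t\<bar> / s k \<le> (\<bar>t\<bar> + 1) / (sqrt c3 * sqrt (q k))" and "0 < s k" by (auto intro!: frac_le)
        then show ?case by simp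
      qed
    qed (use H0 rate_factor_nonneg[OF r(1,2)] c3 q q0 in \<open>auto simp: mD_def\<close>)
    then have lim: "(\<lambda>k. expectation (\<lambda>\<omega>. iexp (t / s k * Z k \<omega>)) - of_real (exp (- (t / s k)\<^sup>2 * expectation (\<lambda>\<omega>. (Z k \<omega>)\<^sup>2) / 2))) \<longlonglongrightarrow> 0"
      by (rule Lim_null_comparison[rotated]) (rule always_eventually[OF allI[OF Z(5)]])
    show "\<exists>Z. (\<forall>k. Z k \<in> borel_measurable M \<and> integrable M (\<lambda>\<omega>. (Z k \<omega>)\<^sup>2)) \<and>
      (\<forall>\<^sub>F k in sequentially. integrable M (\<lambda>\<omega>. (X k \<omega> - Z k \<omega>)\<^sup>2) \<and> expectation (\<lambda>\<omega>. (X k \<omega> - Z k \<omega>)\<^sup>2)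
        \<le> \<epsilon>\<^sup>2 * (sqrt (expectation (\<lambda>\<omega>. (X k \<omega>)\<^sup>2)))\<^sup>2) \<and>
      (\<lambda>k. expectation (\<lambda>\<omega>. iexp (t / sqrt (expectation (\<lambda>\<omega>. (X k \<omega>)\<^sup>2)) * Z k \<omega>))
        - of_real (exp (- (t / sqrt (expectation (\<lambda>\<omega>. (X k \<omega>)\<^sup>2)))\<^sup>2 * expectation (\<lambda>\<omega>. (Z k \<omega>)\<^sup>2) / 2))) \<longlonglongrightarrow> 0"
      using Z(1,2) close lim unfolding s_def by (intro exI[of _ Z] conjI allI)
  qed (use Xm in auto)
qed

end

section \<open>Smooth forms\<close>

lemma directional_derivative_shift:
  fixes f :: "'a :: real_normed_vector \<Rightarrow> real"
  assumes "\<And>x. ((\<lambda>s. f (x + s *\<^sub>R u)) has_real_derivative f' x) (at 0)"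
  shows "((\<lambda>s. f (x + s *\<^sub>R u)) has_real_derivative f' (x + s *\<^sub>R u)) (at s)"
proof -
  have "((\<lambda>t. f ((x + s *\<^sub>R u) + t *\<^sub>R u)) has_real_derivative f' (x + s *\<^sub>R u)) (at 0)" by (rule assms)
  then have "((\<lambda>t. f (x + (t + s) *\<^sub>R u)) has_real_derivative f' (x + s *\<^sub>R u)) (at 0)"
    by (simp add: scaleR_add_left add_ac)
  then show ?thesis using DERIV_shift[of "\<lambda>s. f (x + s *\<^sub>R u)" _ 0 s] by simp
qed

text \<open>The mean value theorem twice, first along \<open>u\<close> for the difference of two
  translates, then along \<open>v\<close>. The second difference on the left is symmetric in the two
  directions, which is what the comparison of the mixed derivatives exploits.\<close>

lemma second_difference:
  fixes f :: "'a :: real_normed_vector \<Rightarrow> real"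
  assumes u: "\<And>x. ((\<lambda>s. f (x + s *\<^sub>R u)) has_real_derivative fu x) (at 0)"
    and uv: "\<And>x. ((\<lambda>s. fu (x + s *\<^sub>R v)) has_real_derivative fuv x) (at 0)"
    and t: "0 < t"
  shows "\<exists>\<xi> \<eta>. 0 < \<xi> \<and> \<xi> < t \<and> 0 < \<eta> \<and> \<eta> < t \<and>
    f (x + t *\<^sub>R u + t *\<^sub>R v) - f (x + t *\<^sub>R u) - f (x + t *\<^sub>R v) + f x = t * t * fuv (x + \<xi> *\<^sub>R u + \<eta> *\<^sub>R v)"
proof -
  have "((\<lambda>s. f (x + t *\<^sub>R v + s *\<^sub>R u) - f (x + s *\<^sub>R u)) has_real_derivative fu (x + t *\<^sub>R v + s *\<^sub>R u) - fu (x + s *\<^sub>R u)) (at s)" for s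
    by (intro DERIV_diff directional_derivative_shift[OF u])
  from MVT2[OF t this] obtain \<xi> where \<xi>: "0 < \<xi>" "\<xi> < t"
    "f (x + t *\<^sub>R v + t *\<^sub>R u) - f (x + t *\<^sub>R u) - (f (x + t *\<^sub>R v) - f x) = t * (fu (x + t *\<^sub>R v + \<xi> *\<^sub>R u) - fu (x + \<xi> *\<^sub>R u))"
    by auto
  have "((\<lambda>s. fu (x + \<xi> *\<^sub>R u + s *\<^sub>R v)) has_real_derivative fuv (x + \<xi> *\<^sub>R u + s *\<^sub>R v)) (at s)" for s
    by (rule directional_derivative_shift[OF uv])
  from MVT2[OF t this] obtain \<eta> where \<eta>: "0 < \<eta>" "\<eta> < t"
    "fu (x + \<xi> *\<^sub>R u + t *\<^sub>R v) - fu (x + \<xi> *\<^sub>R u) = t * fuv (x + \<xi> *\<^sub>R u + \<eta> *\<^sub>R v)"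
    by auto
  have "x + t *\<^sub>R v + \<xi> *\<^sub>R u = x + \<xi> *\<^sub>R u + t *\<^sub>R v" "x + t *\<^sub>R v + t *\<^sub>R u = x + t *\<^sub>R u + t *\<^sub>R v"
    by (simp_all add: add_ac)
  then have "f (x + t *\<^sub>R u + t *\<^sub>R v) - f (x + t *\<^sub>R u) - f (x + t *\<^sub>R v) + f x = t * t * fuv (x + \<xi> *\<^sub>R u + \<eta> *\<^sub>R v)"
    using \<xi>(3) \<eta>(3) by (simp only: mult.assoc)
  then show ?thesis using \<xi> \<eta> by blast
qed

text \<open>Schwarz's theorem: divided by \<open>t * t\<close>, the same second difference tends to
  either mixed derivative, by continuity at \<open>x\<close>. The hypotheses are directional because
  \<open>smooth\<close> is an iteration of directional derivatives.\<close>

lemma mixed_derivatives_commute_real: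
  fixes f :: "'a :: real_normed_vector \<Rightarrow> real"
  assumes u: "\<And>x. ((\<lambda>s. f (x + s *\<^sub>R u)) has_real_derivative fu x) (at 0)"
    and v: "\<And>x. ((\<lambda>s. f (x + s *\<^sub>R v)) has_real_derivative fv x) (at 0)"
    and uv: "\<And>x. ((\<lambda>s. fu (x + s *\<^sub>R v)) has_real_derivative fuv x) (at 0)"
    and vu: "\<And>x. ((\<lambda>s. fv (x + s *\<^sub>R u)) has_real_derivative fvu x) (at 0)"
    and cont: "isCont fuv x" "isCont fvu x"
  shows "fuv x = fvu x"
proof -
  define t where "t k = inverse (real (Suc k))" for k
  have t: "0 < t k" for k by (simp add: t_def)
  have t0: "t \<longlonglongrightarrow> 0" unfolding t_def by (rule LIMSEQ_inverse_real_of_nat)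
  have "\<exists>\<xi> \<eta> \<xi>' \<eta>'. 0 < \<xi> \<and> \<xi> < t k \<and> 0 < \<eta> \<and> \<eta> < t k \<and> 0 < \<xi>' \<and> \<xi>' < t k \<and> 0 < \<eta>' \<and> \<eta>' < t k \<and>
    fuv (x + \<xi> *\<^sub>R u + \<eta> *\<^sub>R v) = fvu (x + \<xi>' *\<^sub>R v + \<eta>' *\<^sub>R u)" for k
  proof -
    obtain \<xi> \<eta> where 1: "0 < \<xi>" "\<xi> < t k" "0 < \<eta>" "\<eta> < t k"
      "f (x + t k *\<^sub>R u + t k *\<^sub>R v) - f (x + t k *\<^sub>R u) - f (x + t k *\<^sub>R v) + f x = t k * t k * fuv (x + \<xi> *\<^sub>R u + \<eta> *\<^sub>R v)"
      using second_difference[OF u uv t] by blast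
    obtain \<xi>' \<eta>' where 2: "0 < \<xi>'" "\<xi>' < t k" "0 < \<eta>'" "\<eta>' < t k"
      "f (x + t k *\<^sub>R v + t k *\<^sub>R u) - f (x + t k *\<^sub>R v) - f (x + t k *\<^sub>R u) + f x = t k * t k * fvu (x + \<xi>' *\<^sub>R v + \<eta>' *\<^sub>R u)"
      using second_difference[OF v vu t] by blast
    have e: "x + t k *\<^sub>R v + t k *\<^sub>R u = x + t k *\<^sub>R u + t k *\<^sub>R v" by (simp add: add_ac)
    have "t k * t k * fuv (x + \<xi> *\<^sub>R u + \<eta> *\<^sub>R v) = t k * t k * fvu (x + \<xi>' *\<^sub>R v + \<eta>' *\<^sub>R u)"
      using 1(5) 2(5) unfolding e by linarith
    then have "fuv (x + \<xi> *\<^sub>R u + \<eta> *\<^sub>R v) = fvu (x + \<xi>' *\<^sub>R v + \<eta>' *\<^sub>R u)" using t[of k] by simp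
    then show ?thesis using 1 2 by blast
  qed
  then obtain \<xi> \<eta> \<xi>' \<eta>' where p: "\<And>k. 0 < \<xi> k \<and> \<xi> k < t k \<and> 0 < \<eta> k \<and> \<eta> k < t k \<and> 0 < \<xi>' k \<and> \<xi>' k < t k \<and> 0 < \<eta>' k \<and> \<eta>' k < t k \<and>
    fuv (x + \<xi> k *\<^sub>R u + \<eta> k *\<^sub>R v) = fvu (x + \<xi>' k *\<^sub>R v + \<eta>' k *\<^sub>R u)" by metis
  have lim: "p \<longlonglongrightarrow> 0" if "\<And>k. 0 < p k \<and> p k < t k" for p :: "nat \<Rightarrow> real"
    by (rule real_tendsto_sandwich[OF _ _ tendsto_const t0]) (use that in \<open>auto intro!: always_eventually less_imp_le\<close>)
  have "(\<lambda>k. x + \<xi> k *\<^sub>R u + \<eta> k *\<^sub>R v) \<longlonglongrightarrow> x + 0 *\<^sub>R u + 0 *\<^sub>R v"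
    by (intro tendsto_add tendsto_scaleR tendsto_const lim) (use p in blast)+
  then have 1: "(\<lambda>k. fuv (x + \<xi> k *\<^sub>R u + \<eta> k *\<^sub>R v)) \<longlonglongrightarrow> fuv x" using cont(1) isCont_tendsto_compose by fastforce
  have "(\<lambda>k. x + \<xi>' k *\<^sub>R v + \<eta>' k *\<^sub>R u) \<longlonglongrightarrow> x + 0 *\<^sub>R v + 0 *\<^sub>R u"
    by (intro tendsto_add tendsto_scaleR tendsto_const lim) (use p in blast)+
  then have 2: "(\<lambda>k. fvu (x + \<xi>' k *\<^sub>R v + \<eta>' k *\<^sub>R u)) \<longlonglongrightarrow> fvu x" using cont(2) isCont_tendsto_compose by fastforce
  show ?thesis using 1 2 p LIMSEQ_unique by auto
qed

lemma smooth_differentiable: "smooth f \<Longrightarrow> f differentiable (at x)"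
  using times_cont_diff.simps(2)[of 0 f] unfolding smooth_def by blast

lemma smooth_continuous: "smooth f \<Longrightarrow> continuous_on UNIV f"
  using times_cont_diff.simps(1)[of f] unfolding smooth_def by blast

lemma smooth_directional: "smooth f \<Longrightarrow> smooth (\<lambda>x. frechet_derivative f (at x) v)"
  unfolding smooth_def using times_cont_diff.simps(2) by blast

lemma smooth_has_derivative: "smooth f \<Longrightarrow> (f has_derivative frechet_derivative f (at x)) (at x)"
  using smooth_differentiable frechet_derivative_works by blast

lemma smooth_directional_has_derivative:
  assumes "smooth f"
  shows "((\<lambda>s. f (x + s *\<^sub>R u)) has_vector_derivative frechet_derivative f (at x) u) (at 0)"
proof -
  have "((\<lambda>s :: real. x + s *\<^sub>R u) has_derivative (\<lambda>s. s *\<^sub>R u)) (at 0)"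
    by (auto intro!: derivative_eq_intros)
  moreover have "(f has_derivative frechet_derivative f (at x)) (at (x + 0 *\<^sub>R u))"
    using smooth_has_derivative[OF assms] by simp
  ultimately have "((\<lambda>s. f (x + s *\<^sub>R u)) has_derivative (\<lambda>s. frechet_derivative f (at x) (s *\<^sub>R u))) (at 0)"
    by (rule has_derivative_compose)
  moreover have "frechet_derivative f (at x) (s *\<^sub>R u) = s *\<^sub>R frechet_derivative f (at x) u" for s
    by (rule linear_scale[OF linear_frechet_derivative[OF smooth_differentiable[OF assms]]])
  ultimately show ?thesis by (simp add: has_vector_derivative_def)
qed

lemma smooth_mixed_commute:
  fixes f :: "'a :: real_normed_vector \<Rightarrow> complex"
  assumes f: "smooth f"
  shows "frechet_derivative (\<lambda>y. frechet_derivative f (at y) u) (at x) v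
    = frechet_derivative (\<lambda>y. frechet_derivative f (at y) v) (at x) u"
proof -
  let ?d = "\<lambda>g w x. frechet_derivative g (at x) w"
  note s = f smooth_directional[OF f, of u] smooth_directional[OF f, of v]
  have c: "isCont (?d (?d f u) v) x" "isCont (?d (?d f v) u) x"
    using smooth_continuous[OF smooth_directional[OF s(2), of v]] smooth_continuous[OF smooth_directional[OF s(3), of u]]
    by (auto simp: continuous_on_eq_continuous_at)
  have "Re (?d (?d f u) v x) = Re (?d (?d f v) u x)"
    by (rule mixed_derivatives_commute_real[where f = "\<lambda>y. Re (f y)" and fu = "\<lambda>y. Re (?d f u y)" and fv = "\<lambda>y. Re (?d f v y)" and u = u and v = v])
       (intro has_field_derivative_Re smooth_directional_has_derivative s isCont_Re c)+
  moreover have "Im (?d (?d f u) v x) = Im (?d (?d f v) u x)"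
    by (rule mixed_derivatives_commute_real[where f = "\<lambda>y. Im (f y)" and fu = "\<lambda>y. Im (?d f u y)" and fv = "\<lambda>y. Im (?d f v y)" and u = u and v = v])
       (intro has_field_derivative_Im smooth_directional_has_derivative s isCont_Im c)+
  ultimately show ?thesis by (rule complex_eqI)
qed

lemma wirtinger_sum:
  assumes "\<And>i. i \<in> I \<Longrightarrow> f i differentiable (at z)"
  shows "wirtinger_d j (\<lambda>z. \<Sum>i\<in>I. c i * f i z) z = (\<Sum>i\<in>I. c i * wirtinger_d j (f i) z)"
    and "wirtinger_dbar j (\<lambda>z. \<Sum>i\<in>I. c i * f i z) z = (\<Sum>i\<in>I. c i * wirtinger_dbar j (f i) z)"
proof -
  have "((\<lambda>z. \<Sum>i\<in>I. c i * f i z) has_derivative (\<lambda>v. \<Sum>i\<in>I. c i * frechet_derivative (f i) (at z) v)) (at z)"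
    using assms frechet_derivative_works by (intro has_derivative_sum has_derivative_mult_right) blast
  note 1 = frechet_derivative_at[OF this, symmetric]
  show "wirtinger_d j (\<lambda>z. \<Sum>i\<in>I. c i * f i z) z = (\<Sum>i\<in>I. c i * wirtinger_d j (f i) z)"
    and "wirtinger_dbar j (\<lambda>z. \<Sum>i\<in>I. c i * f i z) z = (\<Sum>i\<in>I. c i * wirtinger_dbar j (f i) z)"
    unfolding wirtinger_d_def wirtinger_dbar_def 1
    by (simp_all add: sum_divide_distrib sum_distrib_left sum_subtractf sum.distrib diff_divide_distrib add_divide_distrib
        right_diff_distrib distrib_left mult.left_commute)
qed

lemma wirtinger_cnj:
  assumes "f differentiable (at z)"
  shows "cnj (wirtinger_d j f z) = wirtinger_dbar j (\<lambda>z. cnj (f z)) z"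
    and "cnj (wirtinger_dbar j f z) = wirtinger_d j (\<lambda>z. cnj (f z)) z"
proof -
  have "((\<lambda>z. cnj (f z)) has_derivative (\<lambda>v. cnj (frechet_derivative f (at z) v))) (at z)"
    using assms frechet_derivative_works by (intro bounded_linear.has_derivative[OF bounded_linear_cnj]) blast
  note 1 = frechet_derivative_at[OF this, symmetric]
  show "cnj (wirtinger_d j f z) = wirtinger_dbar j (\<lambda>z. cnj (f z)) z"
    and "cnj (wirtinger_dbar j f z) = wirtinger_d j (\<lambda>z. cnj (f z)) z"
    unfolding wirtinger_d_def wirtinger_dbar_def 1 by simp_all
qed

lemma wirtinger_derivative_at:
  assumes "smooth f"
  shows "frechet_derivative (wirtinger_d j f) (at z) v = (frechet_derivative (\<lambda>z. frechet_derivative f (at z) (axis j 1)) (at z) v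
      - \<i> * frechet_derivative (\<lambda>z. frechet_derivative f (at z) (axis j \<i>)) (at z) v) / 2"
    and "frechet_derivative (wirtinger_dbar j f) (at z) v = (frechet_derivative (\<lambda>z. frechet_derivative f (at z) (axis j 1)) (at z) v
      + \<i> * frechet_derivative (\<lambda>z. frechet_derivative f (at z) (axis j \<i>)) (at z) v) / 2"
    and "wirtinger_d j f differentiable (at z)" and "wirtinger_dbar j f differentiable (at z)"
proof -
  let ?D = "\<lambda>e. frechet_derivative (\<lambda>z. frechet_derivative f (at z) (axis j e)) (at z)"
  have d: "((\<lambda>z. frechet_derivative f (at z) (axis j e)) has_derivative ?D e) (at z)" for e
    by (rule smooth_has_derivative[OF smooth_directional[OF assms]])
  have "(wirtinger_d j f has_derivative (\<lambda>v. (?D 1 v - \<i> * ?D \<i> v) / 2)) (at z)"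
    unfolding wirtinger_d_def[abs_def] by (intro bounded_linear.has_derivative[OF bounded_linear_divide] has_derivative_diff has_derivative_mult_right d)
  note 1 = this
  have "(wirtinger_dbar j f has_derivative (\<lambda>v. (?D 1 v + \<i> * ?D \<i> v) / 2)) (at z)"
    unfolding wirtinger_dbar_def[abs_def] by (intro bounded_linear.has_derivative[OF bounded_linear_divide] has_derivative_add has_derivative_mult_right d)
  note 2 = this
  show "frechet_derivative (wirtinger_d j f) (at z) v = (?D 1 v - \<i> * ?D \<i> v) / 2"
    by (simp add: frechet_derivative_at[OF 1, symmetric])
  show "frechet_derivative (wirtinger_dbar j f) (at z) v = (?D 1 v + \<i> * ?D \<i> v) / 2"
    by (simp add: frechet_derivative_at[OF 2, symmetric])
  show "wirtinger_d j f differentiable (at z)" "wirtinger_dbar j f differentiable (at z)"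
    using 1 2 unfolding differentiable_def by blast+
qed

lemma wirtinger_commute:
  assumes "smooth f"
  shows "wirtinger_dbar k (wirtinger_d j f) z = wirtinger_d j (wirtinger_dbar k f) z"
  unfolding wirtinger_dbar_def[of k "wirtinger_d j f"] wirtinger_d_def[of j "wirtinger_dbar k f"] wirtinger_derivative_at[OF assms]
  by (simp add: smooth_mixed_commute[OF assms, of "axis j _" z "axis k _"] algebra_simps add_divide_distrib diff_divide_distrib)

lemma wirtinger_second_continuous:
  assumes "smooth f"
  shows "continuous_on UNIV (wirtinger_dbar k (wirtinger_d j f))"
  unfolding wirtinger_dbar_def[of k "wirtinger_d j f", abs_def] wirtinger_derivative_at[OF assms]
  by (intro continuous_intros smooth_continuous smooth_directional assms) simp_all

lemma wirtinger_second_zero: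
  assumes U: "open U" "z \<in> U" "\<And>w. w \<in> U \<Longrightarrow> f w = 0"
  shows "wirtinger_dbar k (wirtinger_d j f) z = 0"
proof -
  have fd: "frechet_derivative g (at w) = (\<lambda>v. 0)" if "w \<in> U" "\<And>w. w \<in> U \<Longrightarrow> g w = 0" for g :: "complex ^ 'a \<Rightarrow> complex" and w
    using frechet_derivative_transform_within_open[OF differentiable_const U(1) that(1), of 0 g] that(2) by simp
  have "wirtinger_d j f w = 0" if "w \<in> U" for w
    unfolding wirtinger_d_def using fd[OF that U(3)] by simp
  then show ?thesis unfolding wirtinger_dbar_def using fd[OF U(2)] by simp
qed

text \<open>The top coefficient is the only one that \<open>form_integral\<close> sees. The order,
  \<open>form_delbar\<close> after \<open>form_del\<close>, comes from moving both derivatives of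
  the current onto the test form.\<close>

definition ddbar_density :: "('n :: {finite, linorder}) form \<Rightarrow> complex ^ ('n :: {finite, linorder}) \<Rightarrow> complex" where
  "ddbar_density \<phi> = form_delbar (form_del \<phi>) UNIV UNIV"

lemma ddbar_density_eq:
  fixes \<phi> :: "('n :: {finite, linorder}) form"
  assumes "smooth_form \<phi>"
  shows "ddbar_density \<phi> z = (\<Sum>k\<in>UNIV. \<Sum>j\<in>UNIV. (-1) ^ CARD('n) * insert_sign k UNIV * insert_sign j UNIV
      * wirtinger_dbar k (wirtinger_d j (\<phi> (UNIV - {j}) (UNIV - {k}))) z)"
proof -
  have s: "smooth (\<phi> J K)" for J K using assms by (simp add: smooth_form_def)
  show ?thesis
    unfolding ddbar_density_def form_delbar_def form_del_def
    by (subst wirtinger_sum(2)) (auto intro!: wirtinger_derivative_at s simp: sum_distrib_left mult_ac)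
qed

lemma form_del_delbar_eq:
  fixes \<phi> :: "('n :: {finite, linorder}) form"
  assumes "smooth_form \<phi>"
  shows "form_del (form_delbar \<phi>) J K z = (\<Sum>j\<in>J. \<Sum>k\<in>K. (-1) ^ card (J - {j}) * insert_sign k K * insert_sign j J
      * wirtinger_d j (wirtinger_dbar k (\<phi> (J - {j}) (K - {k}))) z)"
proof -
  have s: "smooth (\<phi> J K)" for J K using assms by (simp add: smooth_form_def)
  show ?thesis
    unfolding form_delbar_def form_del_def
    by (subst wirtinger_sum(1)) (auto intro!: wirtinger_derivative_at s simp: sum_distrib_left mult_ac)
qed

text \<open>In the coefficient of full degree the antiholomorphic differential passes
  \<open>n\<close> holomorphic ones in one order of differentiation and \<open>n - 1\<close> in the
  other; since the derivatives commute, only this sign remains.\<close>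

lemma form_del_delbar_top:
  fixes \<phi> :: "('n :: {finite, linorder}) form"
  assumes "smooth_form \<phi>"
  shows "form_del (form_delbar \<phi>) UNIV UNIV z = - ddbar_density \<phi> z"
proof -
  have s: "smooth (\<phi> J K)" for J K using assms by (simp add: smooth_form_def)
  have "(-1 :: complex) ^ card (UNIV - {j :: 'n}) = - ((-1) ^ CARD('n))" for j
    using zero_less_card_finite[where 'a = 'n] by (cases "CARD('n)") (auto simp: card_Diff_singleton)
  then show ?thesis
    unfolding form_del_delbar_eq[OF assms] ddbar_density_eq[OF assms] wirtinger_commute[OF s]
    by (subst sum.swap) (simp add: sum_negf)
qed

text \<open>The coefficient at \<open>(J, K)\<close> of the derived form involves only the
  coefficients of \<phi> at \<open>(J - {j}, K - {k})\<close>, so the bidegree leaves only full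
  \<open>J\<close> and \<open>K\<close>. There the two orders of differentiation agree up to
  sign.\<close>

lemma ddbar_density_nonzero:
  fixes \<phi> :: "('n :: {finite, linorder}) form"
  assumes \<phi>: "smooth_form \<phi>" and deg: "bidegree (CARD('n) - 1) (CARD('n) - 1) \<phi>"
    and nz: "form_del (form_delbar \<phi>) \<noteq> (\<lambda>_ _ _. 0)"
  shows "\<exists>z. ddbar_density \<phi> z \<noteq> 0"
proof -
  obtain J K z where z: "form_del (form_delbar \<phi>) J K z \<noteq> 0" using nz by (auto simp: fun_eq_iff)
  have zero: "wirtinger_d j (wirtinger_dbar k (\<lambda>_. 0)) z = 0" for j k :: 'n and z
  proof -
    have "wirtinger_dbar k (\<lambda>_. 0) = (\<lambda>_. 0)" by (simp add: fun_eq_iff wirtinger_dbar_def)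
    then show ?thesis by (simp add: wirtinger_d_def)
  qed
  have full: "A = UNIV" if "j \<in> A" "card (A - {j}) = CARD('n) - 1" for A and j :: 'n
  proof -
    have "card A = CARD('n)" using that card_Suc_Diff1[of A j] by (simp add: card_gt_0_iff)
    then show ?thesis using card_subset_eq[of UNIV A] by simp
  qed
  have "J = UNIV \<and> K = UNIV"
  proof (rule ccontr)
    assume n: "\<not> (J = UNIV \<and> K = UNIV)"
    have "\<phi> (J - {j}) (K - {k}) = (\<lambda>_. 0)" if "j \<in> J" "k \<in> K" for j k
      using deg full[OF that(1)] full[OF that(2)] n unfolding bidegree_def by blast
    then have "form_del (form_delbar \<phi>) J K z = 0"
      unfolding form_del_delbar_eq[OF \<phi>] by (intro sum.neutral ballI) (simp add: zero)
    with z show False by simp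
  qed
  then show ?thesis using z form_del_delbar_top[OF \<phi>] by auto
qed

lemma ddbar_density_support:
  assumes \<phi>: "smooth_form \<phi>" and nz: "ddbar_density \<phi> z \<noteq> 0"
  shows "z \<in> form_support \<phi>"
proof (rule ccontr)
  assume z: "z \<notin> form_support \<phi>"
  have vanish: "\<phi> J K w = 0" if "w \<in> - form_support \<phi>" for J K w
    using that closure_subset[of "{z. \<exists>J K. \<phi> J K z \<noteq> 0}"] unfolding form_support_def by blast
  have "wirtinger_dbar k (wirtinger_d j (\<phi> J K)) z = 0" for j k J K
  proof (rule wirtinger_second_zero[OF _ _ vanish])
    show "open (- form_support \<phi>)" unfolding form_support_def by (intro open_Compl closed_closure)
  qed (use z in auto)
  then show False using nz unfolding ddbar_density_eq[OF \<phi>] by simp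
qed

lemma ddbar_density_continuous:
  assumes "smooth_form \<phi>"
  shows "continuous_on UNIV (ddbar_density \<phi>)"
  unfolding fun_eq_iff[THEN iffD2, OF allI, OF ddbar_density_eq[OF assms]]
  using assms by (intro continuous_on_sum continuous_on_mult continuous_on_const wirtinger_second_continuous) (simp add: smooth_form_def)

text \<open>Conjugation exchanges the two kinds of derivative and, by reality of \<phi>, the two
  index sets. The remaining sign is the one in \<open>cnj_stat_factor\<close>, so the product with
  \<open>stat_factor\<close> is real.\<close>

lemma ddbar_density_cnj:
  fixes \<phi> :: "('n :: {finite, linorder}) form"
  assumes \<phi>: "smooth_form \<phi>" and real: "real_form \<phi>"
  shows "cnj (ddbar_density \<phi> z) = (-1) ^ (CARD('n) + 1) * ddbar_density \<phi> z"
proof -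
  have s: "smooth (\<phi> J K)" for J K using \<phi> by (simp add: smooth_form_def)
  have sgn: "cnj (insert_sign k (UNIV :: 'n set)) = insert_sign k UNIV" for k by (simp add: insert_sign_def)
  \<comment> \<open>The sum over a single index puts the constant sign into the form from which
    \<open>wirtinger_sum\<close> can pull it out.\<close>
  have cj: "(\<lambda>z. cnj (\<phi> (UNIV - {j}) (UNIV - {k}) z)) = (\<lambda>z. \<Sum>i\<in>{()}. (-1) ^ (CARD('n) + 1) * \<phi> (UNIV - {k}) (UNIV - {j}) z)" for j k
  proof
    fix z
    have c: "card (UNIV - {i :: 'n}) = CARD('n) - 1" for i by (simp add: card_Diff_singleton)
    have "\<phi> (UNIV - {k}) (UNIV - {j}) z = (-1) ^ ((CARD('n) - 1) * (CARD('n) - 1)) * cnj (\<phi> (UNIV - {j}) (UNIV - {k}) z)"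
      using fun_cong[OF fun_cong[OF fun_cong[OF real[unfolded real_form_def], of "UNIV - {k}"], of "UNIV - {j}"], of z]
      by (simp add: form_cnj_def c)
    \<comment> \<open>The parities agree: \<open>(n - 1)\<^sup>2\<close> and \<open>n + 1\<close>
      differ by \<open>n * (n - 3)\<close>, which is even.\<close>
    moreover have "(-1 :: complex) ^ ((CARD('n) - 1) * (CARD('n) - 1)) = (-1) ^ (CARD('n) + 1)"
      using zero_less_card_finite[where 'a = 'n] by (cases "CARD('n)") (auto simp: minus_one_power_iff)
    ultimately show "cnj (\<phi> (UNIV - {j}) (UNIV - {k}) z) = (\<Sum>i\<in>{()}. (-1) ^ (CARD('n) + 1) * \<phi> (UNIV - {k}) (UNIV - {j}) z)"
      by (simp add: minus_one_power_iff)
  qed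
  have "cnj (wirtinger_dbar k (wirtinger_d j (\<phi> (UNIV - {j}) (UNIV - {k}))) z)
      = (-1) ^ (CARD('n) + 1) * wirtinger_dbar j (wirtinger_d k (\<phi> (UNIV - {k}) (UNIV - {j}))) z" for j k
  proof -
    have "cnj (wirtinger_dbar k (wirtinger_d j (\<phi> (UNIV - {j}) (UNIV - {k}))) z)
        = wirtinger_d k (\<lambda>z. wirtinger_dbar j (\<lambda>z. cnj (\<phi> (UNIV - {j}) (UNIV - {k}) z)) z) z"
      by (subst wirtinger_cnj(2)[OF wirtinger_derivative_at(3)[OF s]]) (simp add: wirtinger_cnj(1)[OF smooth_differentiable[OF s]])
    also have "\<dots> = wirtinger_d k (\<lambda>z. \<Sum>i\<in>{()}. (-1) ^ (CARD('n) + 1) * wirtinger_dbar j (\<phi> (UNIV - {k}) (UNIV - {j})) z) z"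
      unfolding cj by (subst wirtinger_sum(2)) (auto intro: smooth_differentiable[OF s])
    also have "\<dots> = (-1) ^ (CARD('n) + 1) * wirtinger_d k (wirtinger_dbar j (\<phi> (UNIV - {k}) (UNIV - {j}))) z"
      by (subst wirtinger_sum(1)) (auto intro: wirtinger_derivative_at s)
    finally show ?thesis by (simp add: wirtinger_commute[OF s])
  qed
  then have "cnj (ddbar_density \<phi> z) = (\<Sum>k\<in>UNIV. \<Sum>j\<in>UNIV. (-1) ^ CARD('n) * insert_sign k UNIV * insert_sign j UNIV
      * ((-1) ^ (CARD('n) + 1) * wirtinger_dbar j (wirtinger_d k (\<phi> (UNIV - {k}) (UNIV - {j}))) z))"
    unfolding ddbar_density_eq[OF \<phi>] by (simp add: sgn)
  also have "\<dots> = (-1) ^ (CARD('n) + 1) * ddbar_density \<phi> z"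
    unfolding ddbar_density_eq[OF \<phi>] sum_distrib_left by (subst sum.swap) (simp add: mult_ac)
  finally show ?thesis .
qed

section \<open>The linear statistic\<close>

text \<open>Combines the factor of the current, the sign from moving the two derivatives onto the
  form, where only the step in degree 0 contributes a minus, and the orientation constant of
  \<open>form_integral\<close>.\<close>

definition stat_factor :: "nat \<Rightarrow> complex" where
  "stat_factor n = - \<i> / (2 * of_real pi) * ((-1) ^ (n * (n - 1) div 2) * (-2 * \<i>) ^ n)"

text \<open>The density \<open>h\<close> of the overview; for a real form the product is real
  already, and \<open>Re\<close> only changes the type.\<close>

definition stat_density :: "('n :: {finite, linorder}) form \<Rightarrow> complex ^ ('n :: {finite, linorder}) \<Rightarrow> real" where
  "stat_density \<phi> z = Re (stat_factor CARD('n) * ddbar_density \<phi> z)"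

lemma stat_factor_nonzero: "stat_factor n \<noteq> 0"
  by (simp add: stat_factor_def)

lemma cnj_stat_factor: "cnj (stat_factor n) = (-1) ^ (n + 1) * stat_factor n"
  by (simp add: stat_factor_def power_minus[of "2 * \<i>" n] minus_one_power_iff)

lemma of_real_stat_density:
  fixes \<phi> :: "('n :: {finite, linorder}) form"
  assumes "smooth_form \<phi>" "real_form \<phi>"
  shows "of_real (stat_density \<phi> z) = stat_factor CARD('n) * ddbar_density \<phi> z"
proof -
  have "cnj (stat_factor CARD('n) * ddbar_density \<phi> z)
      = ((-1) ^ (CARD('n) + 1) * (-1) ^ (CARD('n) + 1)) * (stat_factor CARD('n) * ddbar_density \<phi> z)"
    by (simp only: complex_cnj_mult cnj_stat_factor ddbar_density_cnj[OF assms] mult_ac)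
  also have "(-1 :: complex) ^ (CARD('n) + 1) * (-1) ^ (CARD('n) + 1) = 1" by (simp flip: power_mult_distrib)
  finally have "stat_factor CARD('n) * ddbar_density \<phi> z \<in> \<real>" by (simp add: Reals_cnj_iff)
  then show ?thesis unfolding stat_density_def by (rule of_real_Re)
qed

text \<open>The support condition absorbs the restriction to the ball, and the statistic becomes an
  integral over the whole space against a fixed density.\<close>

lemma zero_integral_eq:
  fixes \<phi> :: "('n :: {finite, linorder}) form"
  assumes "smooth_form \<phi>" "real_form \<phi>" and supp: "form_support \<phi> \<subseteq> ball 0 1"
  shows "zero_integral a \<phi> L \<omega> = (\<integral>z. stat_density \<phi> z * ln ((norm (hyp_gaf a L \<omega> z))\<^sup>2) \<partial>lborel)"
proof -
  let ?l = "\<lambda>z. ln ((norm (hyp_gaf a L \<omega> z))\<^sup>2)"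
  have "zero_current (hyp_gaf a L \<omega>) \<phi>
      = stat_factor CARD('n) * (\<integral>z. indicator (ball 0 1) z *\<^sub>R (of_real (?l z) * ddbar_density \<phi> z) \<partial>lborel)"
    by (simp add: zero_current_def current_del_def current_delbar_def fun_current_def form_integral_def stat_factor_def
        ddbar_density_def set_lebesgue_integral_def)
  also have "\<dots> = (\<integral>z. stat_factor CARD('n) * (indicator (ball 0 1) z *\<^sub>R (of_real (?l z) * ddbar_density \<phi> z)) \<partial>lborel)"
    by (rule integral_mult_right_zero[symmetric])
  also have "\<dots> = (\<integral>z. of_real (stat_density \<phi> z * ?l z) \<partial>lborel)"
  proof (intro Bochner_Integration.integral_cong refl)
    fix z
    show "stat_factor CARD('n) * (indicator (ball 0 1) z *\<^sub>R (of_real (?l z) * ddbar_density \<phi> z)) = of_real (stat_density \<phi> z * ?l z)"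
    proof (cases "z \<in> ball 0 1")
      case True
      then show ?thesis unfolding of_real_mult of_real_stat_density[OF assms(1,2)] by (simp add: mult_ac)
    next
      case False
      then have "ddbar_density \<phi> z = 0" using ddbar_density_support[OF assms(1)] supp by blast
      then show ?thesis by (simp add: stat_density_def)
    qed
  qed
  finally show ?thesis unfolding zero_integral_def integral_complex_of_real by simp
qed

context hyperbolic_field
begin

lemma nfield_hyp_gaf:
  assumes "norm z < 1"
  shows "nfield L z \<omega> = of_real ((1 - (norm z)\<^sup>2) powr (L / 2)) * hyp_gaf a L \<omega> z"
proof -
  have "nfield L z \<omega> = (\<Sum>\<^sub>\<infinity>\<alpha>. of_real ((1 - (norm z)\<^sup>2) powr (L / 2)) * (a \<alpha> \<omega> * of_real (hyp_coeff L \<alpha>) * (\<Prod>j\<in>UNIV. (z $ j) ^ \<alpha> j)))"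
    using assms by (simp add: nfield_def series_def evec_def ball_proj_def mult_ac)
  also have "\<dots> = of_real ((1 - (norm z)\<^sup>2) powr (L / 2)) * hyp_gaf a L \<omega> z"
    unfolding hyp_gaf_def by (rule infsum_cmult_right')
  finally show ?thesis .
qed

lemma ln_nfield:
  assumes z: "norm z < 1" and nz: "nfield L z \<omega> \<noteq> 0"
  shows "ln ((norm (hyp_gaf a L \<omega> z))\<^sup>2) = ln ((norm (nfield L z \<omega>))\<^sup>2) - L * ln (1 - (norm z)\<^sup>2)"
proof -
  have p: "0 < 1 - (norm z)\<^sup>2" using z by (simp add: abs_square_less_1)
  have "hyp_gaf a L \<omega> z \<noteq> 0" using nz nfield_hyp_gaf[OF z] by auto
  then have "ln ((norm (nfield L z \<omega>))\<^sup>2) = ln (((1 - (norm z)\<^sup>2) powr (L / 2))\<^sup>2) + ln ((norm (hyp_gaf a L \<omega> z))\<^sup>2)"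
    unfolding nfield_hyp_gaf[OF z] using p by (simp add: norm_mult power_mult_distrib ln_mult)
  moreover have "ln (((1 - (norm z)\<^sup>2) powr (L / 2))\<^sup>2) = L * ln (1 - (norm z)\<^sup>2)"
    using p by (simp add: ln_realpow ln_powr)
  ultimately show ?thesis by simp
qed

lemma log_integral_measurable:
  assumes [measurable]: "h \<in> borel_measurable borel"
  shows "(\<lambda>\<omega>. \<integral>z. h z * ln ((norm (hyp_gaf a L \<omega> z))\<^sup>2) \<partial>lborel) \<in> borel_measurable M"
proof -
  have [measurable]: "(\<lambda>z :: complex ^ 'n. z $ j) \<in> borel_measurable borel" for j
    by (intro borel_measurable_continuous_onI continuous_intros)
  have "(\<lambda>x. \<Sum>\<^sub>\<infinity>\<alpha>. a \<alpha> (fst x) * of_real (hyp_coeff L \<alpha>) * (\<Prod>j\<in>UNIV. (snd x $ j) ^ \<alpha> j)) \<in> borel_measurable (M \<Otimes>\<^sub>M lborel)"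
    by (rule borel_measurable_infsum_complex) measurable
  then have [measurable]: "(\<lambda>(\<omega>, z). hyp_gaf a L \<omega> z) \<in> borel_measurable (M \<Otimes>\<^sub>M lborel)"
    unfolding hyp_gaf_def split_beta' .
  show ?thesis by (rule lborel.borel_measurable_lebesgue_integral) measurable
qed

text \<open>Normalising the field and centring the logarithm adds, almost surely, the deterministic
  number that is the integral of \<open>h z * (L * ln (1 - (norm z)\<^sup>2) + log_const)\<close>.
  The integrand is dominated by a multiple of \<open>h\<close> because the support stays away from
  the unit sphere.\<close>

lemma AE_log_integral:
  fixes h :: "complex ^ 'n \<Rightarrow> real"
  assumes st: "gaussian_statistic M (nfield L) (corr L) h (cball 0 r) H \<kappa>"
    and r0: "r0 < 1" and supp: "\<And>z. h z \<noteq> 0 \<Longrightarrow> norm z \<le> r0" and L: "0 < L"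
  shows "\<exists>d. AE \<omega> in M. (\<integral>z. h z * ln ((norm (hyp_gaf a L \<omega> z))\<^sup>2) \<partial>lborel)
    = (\<integral>z. h z * (ln ((norm (nfield L z \<omega>))\<^sup>2) + log_const) \<partial>lborel) - d"
proof -
  interpret gaussian_statistic M "nfield L" "corr L" h "cball 0 r" H \<kappa> by (rule st)
  define g where "g z = h z * (L * ln (1 - (norm z)\<^sup>2) + log_const)" for z
  have g: "integrable lborel g"
  proof (rule Bochner_Integration.integrable_bound[OF integrable_mult_left[OF h_integrable, of "L * \<bar>ln (1 - r0\<^sup>2)\<bar> + \<bar>log_const\<bar>"]])
    show "g \<in> borel_measurable lborel" unfolding g_def by measurable
    show "AE z in lborel. norm (g z) \<le> norm (h z * (L * \<bar>ln (1 - r0\<^sup>2)\<bar> + \<bar>log_const\<bar>))"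
    proof (intro AE_I2)
      fix z
      show "norm (g z) \<le> norm (h z * (L * \<bar>ln (1 - r0\<^sup>2)\<bar> + \<bar>log_const\<bar>))"
      proof (cases "h z = 0")
        case False
        then have "norm z \<le> r0" by (rule supp)
        then have "(norm z)\<^sup>2 \<le> r0\<^sup>2" "0 \<le> r0" using norm_ge_zero[of z] by (auto intro!: power_mono intro: order_trans simp del: norm_ge_zero)
        then have "(norm z)\<^sup>2 \<le> r0\<^sup>2" "r0\<^sup>2 < 1" using r0 by (auto simp: abs_square_less_1)
        then have "\<bar>ln (1 - (norm z)\<^sup>2)\<bar> \<le> \<bar>ln (1 - r0\<^sup>2)\<bar>" by (subst (1 2) abs_of_nonpos) auto
        then have "L * \<bar>ln (1 - (norm z)\<^sup>2)\<bar> \<le> L * \<bar>ln (1 - r0\<^sup>2)\<bar>" using L by (intro mult_left_mono) auto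
        then have "\<bar>L * ln (1 - (norm z)\<^sup>2) + log_const\<bar> \<le> L * \<bar>ln (1 - r0\<^sup>2)\<bar> + \<bar>log_const\<bar>"
          using abs_triangle_ineq[of "L * ln (1 - (norm z)\<^sup>2)" log_const] unfolding abs_mult abs_of_pos[OF L] by linarith
        then show ?thesis unfolding g_def real_norm_def abs_mult by (intro mult_left_mono) auto
      qed (simp add: g_def)
    qed
  qed
  have "AE \<omega> in M. (\<integral>z. h z * ln ((norm (hyp_gaf a L \<omega> z))\<^sup>2) \<partial>lborel)
    = (\<integral>z. h z * (ln ((norm (nfield L z \<omega>))\<^sup>2) + log_const) \<partial>lborel) - integral\<^sup>L lborel g"
    using AE_log_integrable AE_F_nonzero
  proof eventually_elim
    case (elim \<omega>)
    have i: "integrable lborel (\<lambda>z. h z * (ln ((norm (nfield L z \<omega>))\<^sup>2) + log_const))"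
      using elim(1) h_integrable by (simp add: distrib_left)
    have "(\<integral>z. h z * ln ((norm (hyp_gaf a L \<omega> z))\<^sup>2) \<partial>lborel)
        = (\<integral>z. h z * (ln ((norm (nfield L z \<omega>))\<^sup>2) + log_const) - g z \<partial>lborel)"
    proof (rule integral_cong_AE)
      show "AE z in lborel. h z * ln ((norm (hyp_gaf a L \<omega> z))\<^sup>2) = h z * (ln ((norm (nfield L z \<omega>))\<^sup>2) + log_const) - g z"
        using elim(2)
      proof eventually_elim
        case (elim z)
        show ?case
        proof (cases "h z = 0")
          case False
          then have z: "norm z < 1" using supp[of z] r0 by linarith
          show ?thesis unfolding g_def ln_nfield[OF z elim] by (simp add: algebra_simps)
        qed (simp add: g_def)
      qed
      have [measurable]: "(\<lambda>z :: complex ^ 'n. z $ j) \<in> borel_measurable borel" for j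
        by (intro borel_measurable_continuous_onI continuous_intros)
      have "(\<lambda>z. \<Sum>\<^sub>\<infinity>\<alpha>. a \<alpha> \<omega> * of_real (hyp_coeff L \<alpha>) * (\<Prod>j\<in>UNIV. (z $ j) ^ \<alpha> j)) \<in> borel_measurable borel"
        by (rule borel_measurable_infsum_complex) measurable
      then have [measurable]: "hyp_gaf a L \<omega> \<in> borel_measurable borel" unfolding hyp_gaf_def[abs_def] .
      show "(\<lambda>z. h z * ln ((norm (hyp_gaf a L \<omega> z))\<^sup>2)) \<in> borel_measurable lborel" by measurable
      show "(\<lambda>z. h z * (ln ((norm (nfield L z \<omega>))\<^sup>2) + log_const) - g z) \<in> borel_measurable lborel"
        using i g by (intro borel_measurable_diff borel_measurable_integrable)
    qed
    also have "\<dots> = (\<integral>z. h z * (ln ((norm (nfield L z \<omega>))\<^sup>2) + log_const) \<partial>lborel) - integral\<^sup>L lborel g"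
      by (rule Bochner_Integration.integral_diff[OF i g])
    finally show ?case .
  qed
  then show ?thesis by blast
qed

end

text \<open>A deterministic shift disappears in the standardised variable, so Levy's continuity
  theorem can be applied through the centred \<open>X k\<close>.\<close>

lemma (in prob_space) weak_conv_standardised:
  fixes Y X :: "nat \<Rightarrow> 'a \<Rightarrow> real"
  assumes Y [measurable]: "\<And>k. Y k \<in> borel_measurable M" and X [measurable]: "\<And>k. X k \<in> borel_measurable M"
    and XY: "\<And>k. AE \<omega> in M. Y k \<omega> = X k \<omega> - d k"
    and X1: "\<And>k. integrable M (X k)" "\<And>k. expectation (X k) = 0"
    and char_lim: "\<And>t. (\<lambda>k. expectation (\<lambda>\<omega>. iexp (t / sqrt (expectation (\<lambda>\<omega>. (X k \<omega>)\<^sup>2)) * X k \<omega>))) \<longlonglongrightarrow> of_real (exp (- t\<^sup>2 / 2))"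
  shows "weak_conv_m (\<lambda>k. distr M borel (\<lambda>\<omega>. (Y k \<omega> - expectation (Y k)) / sqrt (variance (Y k)))) std_normal_distribution"
proof (rule levy_continuity)
  have E: "expectation (Y k) = - d k" for k
  proof -
    have "expectation (Y k) = expectation (\<lambda>\<omega>. X k \<omega> - d k)" using XY by (intro integral_cong_AE) auto
    then show ?thesis using X1 by (simp add: prob_space)
  qed
  have V: "variance (Y k) = expectation (\<lambda>\<omega>. (X k \<omega>)\<^sup>2)" for k
    unfolding E using XY[of k] by (intro integral_cong_AE) (auto elim!: eventually_mono)
  show "real_distribution (distr M borel (\<lambda>\<omega>. (Y k \<omega> - expectation (Y k)) / sqrt (variance (Y k))))" for k
    by (rule real_distribution_distr) measurable
  show "real_distribution std_normal_distribution" by (rule real_dist_normal_dist)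
  show "(\<lambda>k. char (distr M borel (\<lambda>\<omega>. (Y k \<omega> - expectation (Y k)) / sqrt (variance (Y k)))) t) \<longlonglongrightarrow> char std_normal_distribution t" for t
  proof -
    have "char (distr M borel (\<lambda>\<omega>. (Y k \<omega> - expectation (Y k)) / sqrt (variance (Y k)))) t
        = expectation (\<lambda>\<omega>. iexp (t / sqrt (expectation (\<lambda>\<omega>. (X k \<omega>)\<^sup>2)) * X k \<omega>))" for k
    proof -
      have "char (distr M borel (\<lambda>\<omega>. (Y k \<omega> - expectation (Y k)) / sqrt (variance (Y k)))) t
          = expectation (\<lambda>\<omega>. iexp (t * ((Y k \<omega> - expectation (Y k)) / sqrt (variance (Y k)))))"
        unfolding char_def by (subst integral_distr) auto
      also have "\<dots> = expectation (\<lambda>\<omega>. iexp (t / sqrt (expectation (\<lambda>\<omega>. (X k \<omega>)\<^sup>2)) * X k \<omega>))"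
        unfolding V unfolding E using XY[of k] by (intro integral_cong_AE) (auto elim!: eventually_mono)
      finally show ?thesis .
    qed
    then show ?thesis using char_lim[of t] by (simp add: char_std_normal_distribution)
  qed
qed

text \<open>Nonvanishing of the second derivative of \<phi> excludes the degenerate case in which
  the statistic is identically 0: its variance is then 0, and so, by the convention for division, is
  the quotient. Reality of \<phi> makes the statistic a real random variable. The limit in the
  intensity is taken along arbitrary positive sequences that tend to infinity.\<close>

theorem corollary5:
  fixes M :: "'w measure"
    and a :: "('n :: {finite, linorder} \<Rightarrow> nat) \<Rightarrow> 'w \<Rightarrow> complex"
    and \<phi> :: "'n form"
    and L :: "nat \<Rightarrow> real"
  assumes "prob_space M"
    and "prob_space.indep_vars M (\<lambda>_. borel) a UNIV"
    and "\<And>\<alpha>. std_complex_gaussian M (a \<alpha>)"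
    and "bidegree (CARD('n) - 1) (CARD('n) - 1) \<phi>"
    and "smooth_form \<phi>"
    and "compact (form_support \<phi>)" and "form_support \<phi> \<subseteq> ball 0 1"
    and "real_form \<phi>"
    and "form_del (form_delbar \<phi>) \<noteq> (\<lambda>_ _ _. 0)"
    and "\<And>k. 0 < L k" and "filterlim L at_top sequentially"
  shows "weak_conv_m
    (\<lambda>k. distr M borel (\<lambda>\<omega>.
        (zero_integral a \<phi> (L k) \<omega> - prob_space.expectation M (zero_integral a \<phi> (L k))) /
        sqrt (prob_space.variance M (zero_integral a \<phi> (L k)))))
    std_normal_distribution"
proof -
  interpret hyperbolic_field M a
    using assms(1-3) by (intro hyperbolic_field.intro gaussian_coefficients.intro gaussian_coefficients_axioms.intro)
  define h where "h = stat_density \<phi>"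
  have h: "continuous_on UNIV h"
    unfolding h_def stat_density_def[abs_def]
    by (intro continuous_on_Re continuous_on_mult continuous_on_const ddbar_density_continuous assms)
  obtain z0 where "ddbar_density \<phi> z0 \<noteq> 0" using ddbar_density_nonzero[OF assms(5,4,9)] ..
  then have "complex_of_real (h z0) \<noteq> 0"
    unfolding h_def of_real_stat_density[OF assms(5,8)] by (simp add: stat_factor_nonzero)
  then have z0: "h z0 \<noteq> 0" by simp
  have supp: "z \<in> form_support \<phi>" if "h z \<noteq> 0" for z
    using that by (intro ddbar_density_support[OF assms(5)]) (auto simp: h_def stat_density_def)
  \<comment> \<open>A support point of maximal norm; the support is not empty because it contains
    \<open>z0\<close>. The norm of \<open>m\<close> is a radius below 1 that encloses the whole
    support.\<close>
  obtain m where m: "m \<in> form_support \<phi>" "\<And>z. z \<in> form_support \<phi> \<Longrightarrow> norm z \<le> norm m"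
    using continuous_attains_sup[OF assms(6), of norm] supp[OF z0] by (auto intro: continuous_intros)
  have r0: "norm m < 1" using m(1) assms(7) by auto
  have suppr: "norm z \<le> norm m" if "h z \<noteq> 0" for z using m(2)[OF supp[OF that]] .
  define X where "X k \<omega> = (\<integral>z. h z * (ln ((norm (nfield (L k) z \<omega>))\<^sup>2) + log_const) \<partial>lborel)" for k \<omega>
  note clt = logstat_clt[OF h r0 suppr z0 assms(10,11)]
  have zi: "zero_integral a \<phi> (L k) = (\<lambda>\<omega>. \<integral>z. h z * ln ((norm (hyp_gaf a (L k) \<omega> z))\<^sup>2) \<partial>lborel)" for k
    unfolding h_def by (intro ext zero_integral_eq assms)
  have X: "X k \<in> borel_measurable M \<and> integrable M (X k) \<and> expectation (X k) = 0 \<and>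
      (\<exists>d. AE \<omega> in M. zero_integral a \<phi> (L k) \<omega> = X k \<omega> - d)" for k
  proof -
    obtain r H \<kappa> where st: "gaussian_statistic M (nfield (L k)) (corr (L k)) h (cball 0 r) H \<kappa>" using clt(2)[of k] by blast
    have "X k = gaussian_statistic.logstat (nfield (L k)) h"
      unfolding X_def by (intro ext) (rule gaussian_statistic.logstat_def[OF st, symmetric])
    then show ?thesis
      using gaussian_statistic.logstat_measurable[OF st] gaussian_statistic.logstat_integrable[OF st]
        gaussian_statistic.logstat_mean[OF st] AE_log_integral[OF st r0 suppr assms(10)]
      unfolding zi X_def by simp
  qed
  then obtain d where d: "\<And>k. AE \<omega> in M. zero_integral a \<phi> (L k) \<omega> = X k \<omega> - d k" by metis
  show ?thesis
  proof (rule weak_conv_standardised[OF _ _ d])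
    show "zero_integral a \<phi> (L k) \<in> borel_measurable M" for k
      unfolding zi by (rule log_integral_measurable[OF borel_measurable_continuous_onI[OF h]])
    show "(\<lambda>k. expectation (\<lambda>\<omega>. iexp (t / sqrt (expectation (\<lambda>\<omega>. (X k \<omega>)\<^sup>2)) * X k \<omega>))) \<longlonglongrightarrow> of_real (exp (- t\<^sup>2 / 2))" for t
      unfolding X_def by (rule clt(1))
  qed (use X in auto)
qed

end
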